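(* The strong Dixmier-Moeglin equivalence is strictly stronger than the Dixmier-Moeglin equivalence: every noetherian $\mathbb{K}$-algebra satisfying the strong Dixmier-Moeglin equivalence satisfies the Dixmier-Moeglin equivalence, whereas the universal enveloping algebra $U(\mathfrak{sl}_2(\mathbb{C}))$ (over $\mathbb{K}=\mathbb{C}$) satisfies the Dixmier-Moeglin equivalence but does not satisfy the strong Dixmier-Moeglin equivalence.
   Context: $\mathbb{K}$ is an infinite field; all algebras are unital associative $\mathbb{K}$-algebras and ideals are two-sided. Let $R$ be a noetherian $\mathbb{K}$-algebra and $P$ a prime ideal of $R$. $\mathrm{Frac}$ denotes the Goldie quotient ring, $\mathcal{Z}$ the centre, $\mathrm{ht}$ the height of a prime ideal. A primitive ideal is the annihilator of a simple module. $P$ is locally closed if $\{P\}$ is locally closed in $\mathrm{Spec}\,R$ with the Zariski topology (equivalently, $P$ is strictly contained in the intersection of all primes strictly containing $P$); $P$ is rational if $\mathcal{Z}(\mathrm{Frac}(R/P))$ is algebraic over $\mathbb{K}$. $R$ satisfies the Dixmier-Moeglin equivalence if for every prime ideal of $R$ the properties of being primitive, locally closed, and rational are equivalent. Degrees: - $\mathrm{prim.deg}\,P:=\inf\{\mathrm{ht}\,Q\mid Q \text{ a primitive ideal of } R/P\}$ (heights taken in $R/P$). - $\mathrm{rat.deg}\,P$ is the transcendence degree over $\mathbb{K}$ of $\mathcal{Z}(\mathrm{Frac}(R/P))$. - $\mathrm{loc.deg}\,P$ is the smallest nonnegative integer $d$ such that the intersection of all prime ideals of $R/P$ of height strictly greater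 than $d$ is nonzero (an empty intersection is the whole ring $R/P$). $R$ satisfies the strong Dixmier-Moeglin equivalence if every prime ideal $P$ of $R$ satisfies $\mathrm{loc.deg}\,P=\mathrm{prim.deg}\,P=\mathrm{rat.deg}\,P$. *)

theory Defs
  imports
    "HOL-Analysis.Analysis"
    "HOL-Algebra.Algebra"
    "HOL-Algebra.Algebraic_Closure_Type"
    "HOL-Library.Extended_Nat"
begin

section \<open>Noncommutative algebras over a field\<close>

text \<open>
  The library's locale \<open>algebra\<close> is about commutative algebras. Here a \<open>K\<close>-algebra is a ring
  \<open>R\<close> together with its structure map, a unital ring homomorphism from \<open>K\<close> into the centre of \<open>R\<close>.
\<close>

definition center :: "'a ring \<Rightarrow> 'a set" where
  "center R = {z \<in> carrier R. \<forall>x\<in>carrier R. z \<otimes>\<^bsub>R\<^esub> x = x \<otimes>\<^bsub>R\<^esub> z}"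

definition center_ring :: "'a ring \<Rightarrow> 'a ring" where
  "center_ring R = R\<lparr>carrier := center R\<rparr>"

definition k_algebra :: "'k ring \<Rightarrow> 'a ring \<Rightarrow> ('k \<Rightarrow> 'a) \<Rightarrow> bool" where
  "k_algebra K R \<eta> \<longleftrightarrow> field K \<and> ring R \<and> \<eta> \<in> ring_hom K R \<and> \<eta> ` carrier K \<subseteq> center R"

definition left_ideal :: "'a ring \<Rightarrow> 'a set \<Rightarrow> bool" where
  "left_ideal R I \<longleftrightarrow> additive_subgroup I R \<and> (\<forall>r\<in>carrier R. \<forall>a\<in>I. r \<otimes>\<^bsub>R\<^esub> a \<in> I)"

definition right_ideal :: "'a ring \<Rightarrow> 'a set \<Rightarrow> bool" where
  "right_ideal R I \<longleftrightarrow> additive_subgroup I R \<and> (\<forall>r\<in>carrier R. \<forall>a\<in>I. a \<otimes>\<^bsub>R\<^esub> r \<in> I)"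

text \<open>
  Ascending chain conditions on one-sided ideals; the library's \<open>noetherian_ring\<close> only
  constrains two-sided ideals.
\<close>

definition noetherian :: "'a ring \<Rightarrow> bool" where
  "noetherian R \<longleftrightarrow>
     (\<forall>I :: nat \<Rightarrow> 'a set. (\<forall>n. left_ideal R (I n) \<and> I n \<subseteq> I (Suc n)) \<longrightarrow>
        (\<exists>N. \<forall>n\<ge>N. I n = I N)) \<and>
     (\<forall>I :: nat \<Rightarrow> 'a set. (\<forall>n. right_ideal R (I n) \<and> I n \<subseteq> I (Suc n)) \<longrightarrow>
        (\<exists>N. \<forall>n\<ge>N. I n = I N))"


section \<open>Prime spectrum, heights, locally closed primes\<close>

text \<open>The library's \<open>primeideal\<close> is the commutative (completely prime) notion.\<close>

definition prime_ideal :: "'a ring \<Rightarrow> 'a set \<Rightarrow> bool" where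
  "prime_ideal R P \<longleftrightarrow> ideal P R \<and> P \<noteq> carrier R \<and>
     (\<forall>I J. ideal I R \<and> ideal J R \<and> I \<cdot>\<^bsub>R\<^esub> J \<subseteq> P \<longrightarrow> I \<subseteq> P \<or> J \<subseteq> P)"

definition spec :: "'a ring \<Rightarrow> 'a set set" where
  "spec R = {P. prime_ideal R P}"

definition height :: "'a ring \<Rightarrow> 'a set \<Rightarrow> enat" where
  "height R P = Sup {enat n | n. \<exists>C :: nat \<Rightarrow> 'a set.
     (\<forall>i\<le>n. C i \<in> spec R) \<and> (\<forall>i<n. C i \<subset> C (Suc i)) \<and> C n = P}"

definition zariski_topology :: "'a ring \<Rightarrow> 'a set topology" where
  "zariski_topology R = topology (\<lambda>U. \<exists>I. ideal I R \<and> U = {P \<in> spec R. \<not> I \<subseteq> P})"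

lemma openin_zariski_topology:
  assumes "ring R"
  shows "openin (zariski_topology R) U \<longleftrightarrow> (\<exists>I. ideal I R \<and> U = {P \<in> spec R. \<not> I \<subseteq> P})"
proof -
  interpret ring R by fact
  let ?D = "\<lambda>I. {P \<in> spec R. \<not> I \<subseteq> P}"
  have inter: "?D I \<inter> ?D J = ?D (I \<cdot>\<^bsub>R\<^esub> J)" if I: "ideal I R" and J: "ideal J R" for I J
  proof -
    have "I \<cdot>\<^bsub>R\<^esub> J \<subseteq> I" "I \<cdot>\<^bsub>R\<^esub> J \<subseteq> J" using ideal_prod_inter[OF I J] by auto
    moreover have "I \<subseteq> P \<or> J \<subseteq> P" if "P \<in> spec R" "I \<cdot>\<^bsub>R\<^esub> J \<subseteq> P" for P
      using that I J by (simp add: spec_def prime_ideal_def)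
    ultimately show ?thesis by (auto 4 3)
  qed
  have union: "\<exists>I. ideal I R \<and> \<Union>\<U> = ?D I"
    if U: "\<And>V. V \<in> \<U> \<Longrightarrow> \<exists>I. ideal I R \<and> V = ?D I" for \<U>
  proof -
    define S where "S = \<Union>{I. ideal I R \<and> ?D I \<in> \<U>}"
    have S: "S \<subseteq> carrier R" unfolding S_def using ideal.Icarr by fastforce
    have "Idl\<^bsub>R\<^esub> S \<subseteq> P \<longleftrightarrow> S \<subseteq> P" if "P \<in> spec R" for P
    proof
      show "S \<subseteq> P" if "Idl\<^bsub>R\<^esub> S \<subseteq> P" using that genideal_self[OF S] by simp
      show "Idl\<^bsub>R\<^esub> S \<subseteq> P" if "S \<subseteq> P"
        using that \<open>P \<in> spec R\<close> by (intro genideal_minimal) (auto simp: spec_def prime_ideal_def)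
    qed
    moreover have "\<Union>\<U> = ?D S"
    proof
      show "\<Union>\<U> \<subseteq> ?D S"
      proof
        fix P assume "P \<in> \<Union>\<U>"
        then obtain V where V: "V \<in> \<U>" "P \<in> V" by blast
        obtain I where I: "ideal I R" "V = ?D I" using U[OF V(1)] by blast
        then have "I \<subseteq> S" using V(1) unfolding S_def by auto
        then show "P \<in> ?D S" using V(2) I(2) by auto
      qed
      show "?D S \<subseteq> \<Union>\<U>"
      proof
        fix P assume P: "P \<in> ?D S"
        then obtain x where x: "x \<in> S" "x \<notin> P" by auto
        then obtain I where "?D I \<in> \<U>" "x \<in> I" unfolding S_def by auto
        moreover have "P \<in> ?D I" using P x \<open>x \<in> I\<close> by auto
        ultimately show "P \<in> \<Union>\<U>" by (intro UnionI)
      qed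
    qed
    ultimately have "\<Union>\<U> = ?D (Idl\<^bsub>R\<^esub> S)" by auto
    then show ?thesis using genideal_ideal[OF S] by auto
  qed
  have "istopology (\<lambda>U. \<exists>I. ideal I R \<and> U = ?D I)"
    unfolding istopology_def
  proof (intro conjI allI impI)
    fix V W assume "\<exists>I. ideal I R \<and> V = ?D I" "\<exists>I. ideal I R \<and> W = ?D I"
    then obtain I J where "ideal I R" "V = ?D I" "ideal J R" "W = ?D J" by auto
    then show "\<exists>I. ideal I R \<and> V \<inter> W = ?D I"
      using inter[of I J] ideal_prod_is_ideal[of I J] by auto
  next
    fix \<U> assume "\<forall>V\<in>\<U>. \<exists>I. ideal I R \<and> V = ?D I"
    then show "\<exists>I. ideal I R \<and> \<Union>\<U> = ?D I" by (intro union) auto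
  qed
  then show ?thesis unfolding zariski_topology_def by (simp add: topology_inverse')
qed

definition locally_closed_prime :: "'a ring \<Rightarrow> 'a set \<Rightarrow> bool" where
  "locally_closed_prime R P \<longleftrightarrow>
     (\<exists>U C. openin (zariski_topology R) U \<and> closedin (zariski_topology R) C \<and> {P} = U \<inter> C)"

text \<open>
  If no \<open>d\<close> has the required property, the infimum of the empty set gives \<open>\<infinity>\<close>.
  Intersecting with the carrier makes the empty intersection the whole ring.
\<close>

definition loc_deg :: "'a ring \<Rightarrow> 'a set \<Rightarrow> enat" where
  "loc_deg R P = (let A = R Quot P in
     Inf {enat d | d. carrier A \<inter> \<Inter>{Q \<in> spec A. enat d < height A Q} \<noteq> {\<zero>\<^bsub>A\<^esub>}})"


section \<open>Primitive ideals\<close>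

text \<open>The library's locale \<open>module\<close> requires a commutative ring of scalars.\<close>

definition left_module :: "'a ring \<Rightarrow> ('a, 'm) module \<Rightarrow> bool" where
  "left_module R M \<longleftrightarrow> ring R \<and> abelian_group M \<and>
     (\<forall>a\<in>carrier R. \<forall>x\<in>carrier M. a \<odot>\<^bsub>M\<^esub> x \<in> carrier M) \<and>
     (\<forall>a\<in>carrier R. \<forall>b\<in>carrier R. \<forall>x\<in>carrier M.
        (a \<oplus>\<^bsub>R\<^esub> b) \<odot>\<^bsub>M\<^esub> x = a \<odot>\<^bsub>M\<^esub> x \<oplus>\<^bsub>M\<^esub> b \<odot>\<^bsub>M\<^esub> x) \<and>
     (\<forall>a\<in>carrier R. \<forall>x\<in>carrier M. \<forall>y\<in>carrier M.
        a \<odot>\<^bsub>M\<^esub> (x \<oplus>\<^bsub>M\<^esub> y) = a \<odot>\<^bsub>M\<^esub> x \<oplus>\<^bsub>M\<^esub> a \<odot>\<^bsub>M\<^esub> y) \<and>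
     (\<forall>a\<in>carrier R. \<forall>b\<in>carrier R. \<forall>x\<in>carrier M.
        (a \<otimes>\<^bsub>R\<^esub> b) \<odot>\<^bsub>M\<^esub> x = a \<odot>\<^bsub>M\<^esub> (b \<odot>\<^bsub>M\<^esub> x)) \<and>
     (\<forall>x\<in>carrier M. \<one>\<^bsub>R\<^esub> \<odot>\<^bsub>M\<^esub> x = x)"

definition simple_left_module :: "'a ring \<Rightarrow> ('a, 'm) module \<Rightarrow> bool" where
  "simple_left_module R M \<longleftrightarrow> left_module R M \<and> carrier M \<noteq> {\<zero>\<^bsub>M\<^esub>} \<and>
     (\<forall>N. submodule N R M \<longrightarrow> N = {\<zero>\<^bsub>M\<^esub>} \<or> N = carrier M)"

definition left_annihilator :: "'a ring \<Rightarrow> ('a, 'm) module \<Rightarrow> 'a set" where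
  "left_annihilator R M = {r \<in> carrier R. \<forall>x\<in>carrier M. r \<odot>\<^bsub>M\<^esub> x = \<zero>\<^bsub>M\<^esub>}"

text \<open>
  The restriction to modules with elements of type \<^typ>\<open>'a set\<close> loses nothing: a simple module is
  isomorphic to the set of cosets of a maximal left ideal of \<open>R\<close>.
\<close>

definition primitive_ideal :: "'a ring \<Rightarrow> 'a set \<Rightarrow> bool" where
  "primitive_ideal R P \<longleftrightarrow>
     (\<exists>M :: ('a, 'a set) module. simple_left_module R M \<and> P = left_annihilator R M)"

definition prim_deg :: "'a ring \<Rightarrow> 'a set \<Rightarrow> enat" where
  "prim_deg R P = Inf {height (R Quot P) Q | Q. primitive_ideal (R Quot P) Q}"


section \<open>Goldie quotient rings\<close>

definition regular_elements :: "'a ring \<Rightarrow> 'a set" where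
  "regular_elements A = {s \<in> carrier A. \<forall>x\<in>carrier A.
     (s \<otimes>\<^bsub>A\<^esub> x = \<zero>\<^bsub>A\<^esub> \<longrightarrow> x = \<zero>\<^bsub>A\<^esub>) \<and> (x \<otimes>\<^bsub>A\<^esub> s = \<zero>\<^bsub>A\<^esub> \<longrightarrow> x = \<zero>\<^bsub>A\<^esub>)}"

definition goldie_quotient_ring :: "'a ring \<Rightarrow> 'q ring \<Rightarrow> ('a \<Rightarrow> 'q) \<Rightarrow> bool" where
  "goldie_quotient_ring A Q \<iota> \<longleftrightarrow> ring A \<and> ring Q \<and> \<iota> \<in> ring_hom A Q \<and> inj_on \<iota> (carrier A) \<and>
     \<iota> ` regular_elements A \<subseteq> Units Q \<and>
     (\<forall>q\<in>carrier Q.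
        (\<exists>a\<in>carrier A. \<exists>s\<in>regular_elements A. q = \<iota> a \<otimes>\<^bsub>Q\<^esub> inv\<^bsub>Q\<^esub> (\<iota> s)) \<and>
        (\<exists>a\<in>carrier A. \<exists>s\<in>regular_elements A. q = inv\<^bsub>Q\<^esub> (\<iota> s) \<otimes>\<^bsub>Q\<^esub> \<iota> a))"

text \<open>
  By Goldie's theorem a noetherian prime ring \<open>A\<close> has a Goldie quotient ring, and it is unique up to
  an isomorphism over \<open>A\<close>. Its elements may be taken to be equivalence classes of
  fractions, i.e. sets of pairs of elements of \<open>A\<close>. Below, \<open>Q\<close> ranges over these isomorphic
  copies of \<open>Frac (R/P)\<close>, so the existential quantifier in \<open>rational_prime\<close> and the infimum in
  \<open>rat_deg\<close> make no choice.
\<close>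

text \<open>The image in \<open>Q\<close> of the base field, along \<open>K \<rightarrow> R \<rightarrow> R/P \<rightarrow> Q\<close>.\<close>

definition scalars_in_quotient ::
    "'k ring \<Rightarrow> 'a ring \<Rightarrow> ('k \<Rightarrow> 'a) \<Rightarrow> 'a set \<Rightarrow> ('a set \<Rightarrow> 'q) \<Rightarrow> 'q set" where
  "scalars_in_quotient K R \<eta> P \<iota> = (\<lambda>c. \<iota> (P +>\<^bsub>R\<^esub> \<eta> c)) ` carrier K"

definition rational_prime :: "'k ring \<Rightarrow> 'a ring \<Rightarrow> ('k \<Rightarrow> 'a) \<Rightarrow> 'a set \<Rightarrow> bool" where
  "rational_prime K R \<eta> P \<longleftrightarrow>
     (\<exists>(Q :: ('a set \<times> 'a set) set ring) \<iota>. goldie_quotient_ring (R Quot P) Q \<iota> \<and>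
        (\<forall>z\<in>center Q. ring.algebraic (center_ring Q) (scalars_in_quotient K R \<eta> P \<iota>) z))"

text \<open>
  \<open>F\<close> is a subfield of the commutative ring \<open>Z\<close>. A polynomial in the indeterminates \<open>S\<close> is given by
  a finite set \<open>E\<close> of exponent vectors and its coefficients \<open>c\<close>.
\<close>

definition algebraically_independent :: "'a ring \<Rightarrow> 'a set \<Rightarrow> 'a set \<Rightarrow> bool" where
  "algebraically_independent Z F S \<longleftrightarrow> S \<subseteq> carrier Z \<and> finite S \<and>
     (\<forall>(E :: ('a \<Rightarrow> nat) set) c. finite E \<and> (\<forall>e\<in>E. \<forall>x. x \<notin> S \<longrightarrow> e x = 0) \<and> c \<in> E \<rightarrow> F \<and>
        (\<Oplus>\<^bsub>Z\<^esub>e\<in>E. c e \<otimes>\<^bsub>Z\<^esub> (\<Otimes>\<^bsub>Z\<^esub>x\<in>S. x [^]\<^bsub>Z\<^esub> e x)) = \<zero>\<^bsub>Z\<^esub> \<longrightarrow>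
        (\<forall>e\<in>E. c e = \<zero>\<^bsub>Z\<^esub>))"

text \<open>All infinite transcendence degrees are identified with \<open>\<infinity>\<close>.\<close>

definition transcendence_degree :: "'a ring \<Rightarrow> 'a set \<Rightarrow> enat" where
  "transcendence_degree Z F = Sup {enat (card S) | S. algebraically_independent Z F S}"

definition rat_deg :: "'k ring \<Rightarrow> 'a ring \<Rightarrow> ('k \<Rightarrow> 'a) \<Rightarrow> 'a set \<Rightarrow> enat" where
  "rat_deg K R \<eta> P =
     Inf {transcendence_degree (center_ring Q) (scalars_in_quotient K R \<eta> P \<iota>) |
       (Q :: ('a set \<times> 'a set) set ring) \<iota>. goldie_quotient_ring (R Quot P) Q \<iota>}"


section \<open>The two equivalences\<close>

definition dixmier_moeglin :: "'k ring \<Rightarrow> 'a ring \<Rightarrow> ('k \<Rightarrow> 'a) \<Rightarrow> bool" where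
  "dixmier_moeglin K R \<eta> \<longleftrightarrow> (\<forall>P\<in>spec R.
     (primitive_ideal R P \<longleftrightarrow> locally_closed_prime R P) \<and>
     (locally_closed_prime R P \<longleftrightarrow> rational_prime K R \<eta> P))"

definition strong_dixmier_moeglin :: "'k ring \<Rightarrow> 'a ring \<Rightarrow> ('k \<Rightarrow> 'a) \<Rightarrow> bool" where
  "strong_dixmier_moeglin K R \<eta> \<longleftrightarrow> (\<forall>P\<in>spec R.
     loc_deg R P = prim_deg R P \<and> prim_deg R P = rat_deg K R \<eta> P)"


section \<open>Universal enveloping algebras\<close>

text \<open>
  The free unital associative algebra on \<open>S\<close>: finitely supported functions on words over \<open>S\<close>,
  with the product given by concatenation of words.
\<close>

definition free_algebra :: "'x set \<Rightarrow> ('x list \<Rightarrow> 'k::Fields.field) ring" where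
  "free_algebra S = \<lparr>
     carrier = {f. finite {w. f w \<noteq> 0} \<and> (\<forall>w. f w \<noteq> 0 \<longrightarrow> set w \<subseteq> S)},
     monoid.mult = (\<lambda>f g w. \<Sum>i\<le>length w. f (take i w) * g (drop i w)),
     one = (\<lambda>w. if w = [] then 1 else 0),
     ring.zero = (\<lambda>w. 0),
     add = (\<lambda>f g w. f w + g w)\<rparr>"

definition word :: "'x list \<Rightarrow> 'x list \<Rightarrow> 'k::Fields.field" where
  "word u = (\<lambda>w. if w = u then 1 else 0)"

text \<open>
  For a Lie algebra \<open>L\<close> with scalar multiplication \<open>smul\<close> and bracket \<open>br\<close>. The first two families of
  relations cut the free algebra on the set \<open>L\<close> down to the tensor algebra of the vector space \<open>L\<close>.
\<close>

definition enveloping_relations ::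
    "'v::ab_group_add set \<Rightarrow> ('k::Fields.field \<Rightarrow> 'v \<Rightarrow> 'v) \<Rightarrow> ('v \<Rightarrow> 'v \<Rightarrow> 'v) \<Rightarrow> ('v list \<Rightarrow> 'k) set" where
  "enveloping_relations L smul br =
     {(\<lambda>w. word [x + y] w - word [x] w - word [y] w) | x y. x \<in> L \<and> y \<in> L} \<union>
     {(\<lambda>w. word [smul c x] w - c * word [x] w) | c x. x \<in> L} \<union>
     {(\<lambda>w. word [x, y] w - word [y, x] w - word [br x y] w) | x y. x \<in> L \<and> y \<in> L}"

definition enveloping_ideal ::
    "'v::ab_group_add set \<Rightarrow> ('k::Fields.field \<Rightarrow> 'v \<Rightarrow> 'v) \<Rightarrow> ('v \<Rightarrow> 'v \<Rightarrow> 'v) \<Rightarrow> ('v list \<Rightarrow> 'k) set" where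
  "enveloping_ideal L smul br = Idl\<^bsub>free_algebra L\<^esub> (enveloping_relations L smul br)"

definition enveloping_algebra ::
    "'v::ab_group_add set \<Rightarrow> ('k::Fields.field \<Rightarrow> 'v \<Rightarrow> 'v) \<Rightarrow> ('v \<Rightarrow> 'v \<Rightarrow> 'v) \<Rightarrow> ('v list \<Rightarrow> 'k) set ring" where
  "enveloping_algebra L smul br = free_algebra L Quot enveloping_ideal L smul br"

definition enveloping_scalar ::
    "'v::ab_group_add set \<Rightarrow> ('k::Fields.field \<Rightarrow> 'v \<Rightarrow> 'v) \<Rightarrow> ('v \<Rightarrow> 'v \<Rightarrow> 'v) \<Rightarrow> 'k \<Rightarrow> ('v list \<Rightarrow> 'k) set" where
  "enveloping_scalar L smul br c =
     enveloping_ideal L smul br +>\<^bsub>free_algebra L\<^esub> (\<lambda>w. c * word [] w)"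

definition sl2 :: "(complex^2^2) set" where
  "sl2 = {A. trace A = 0}"

definition sl2_scale :: "complex \<Rightarrow> complex^2^2 \<Rightarrow> complex^2^2" where
  "sl2_scale c A = (\<chi> i j. c * A $ i $ j)"

definition sl2_bracket :: "complex^2^2 \<Rightarrow> complex^2^2 \<Rightarrow> complex^2^2" where
  "sl2_bracket A B = A ** B - B ** A"

definition U_sl2 :: "((complex^2^2) list \<Rightarrow> complex) set ring" where
  "U_sl2 = enveloping_algebra sl2 sl2_scale sl2_bracket"

definition U_sl2_scalar :: "complex \<Rightarrow> ((complex^2^2) list \<Rightarrow> complex) set" where
  "U_sl2_scalar = enveloping_scalar sl2 sl2_scale sl2_bracket"

abbreviation complex_field :: "complex ring" where
  "complex_field \<equiv> ring_of_type_algebra"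

end

(*
Part 1: for each prime P of R, loc.deg P = 0, prim.deg P = 0 and rat.deg P = 0 say that P is locally
closed, primitive and rational, respectively.

Part 2: with T = H/2, W the Casimir element and f(i) = W - (T + i)(T + i + 1), U = U(sl2) acts faithfully on
the functions from the integers to C[w][t]: E as a shift, F as the inverse shift weighted by the values of f,
T as multiplication by t + i. Every element of U is a sum of terms E^k p(T, W) and F^k p(T, W).
Lowering degrees by commutators with E shows that a nonzero ideal contains some E^m q(W) with q nonzero.
From this the primes are found to be: 0; the ideals (W - c)U; and, for each n, the annihilator of the
irreducible module of dimension n + 1, which lies over c = n(n + 2)/4. All nonzero primes are primitive, locally
closed and rational, and 0 is none of the three (it is not primitive because the field C is uncountable
whereas U has countable dimension). At P = 0 the primitive ideal W U has height 1, so prim.deg 0 is at most 1;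
the finite-codimensional primes have height 2 and intersect in 0, so loc.deg 0 is at least 2.
*)
theory Submission
  imports Defs
begin

section \<open>Ideals, primes and primitive ideals\<close>

text \<open>The variables t and w of the representation stay indeterminate, so one computation
  serves several ends. The values on the delta function at 0 show that the terms spanning U are
  independent. The specialization w = c with a suitable non-real t gives a simple module with
  annihilator (W - c)U, and c = n(n + 2)/4 with t in -n/2 + Z gives the irreducible module of
  dimension n + 1. The hard part of rationality is that the centre of Frac(U/(W - c)U) consists of
  scalars. For z in the centre, the x in U with zx in the image of U form an ideal strictly above (W
  - c)U, so it contains some E^m. As z commutes with T and E, zE^m is a scalar multiple of E^m. For
  this Frac must exist, which is Ore localization of a noetherian domain; U is noetherian by leading
  exponents and Dickson's lemma. Modulo a prime of finite codimension every element is algebraic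
  over C, so regular elements are units and the factor ring is its own Goldie quotient ring.\<close>

lemma additive_subgroupI':
  fixes R :: "'a ring" (structure)
  assumes "ring R" "I \<subseteq> carrier R" "\<zero>\<^bsub>R\<^esub> \<in> I"
    and "\<And>x y. x \<in> I \<Longrightarrow> y \<in> I \<Longrightarrow> x \<oplus>\<^bsub>R\<^esub> y \<in> I"
    and "\<And>x. x \<in> I \<Longrightarrow> \<ominus>\<^bsub>R\<^esub> x \<in> I"
  shows "additive_subgroup I R"
  using assms by (intro additive_subgroupI subgroup.intro) (auto simp: a_inv_def)

lemma left_idealI:
  fixes R :: "'a ring" (structure)
  assumes R: "ring R" "I \<subseteq> carrier R" "\<zero>\<^bsub>R\<^esub> \<in> I"
    and "\<And>x y. x \<in> I \<Longrightarrow> y \<in> I \<Longrightarrow> x \<oplus>\<^bsub>R\<^esub> y \<in> I"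
    and l: "\<And>r x. r \<in> carrier R \<Longrightarrow> x \<in> I \<Longrightarrow> r \<otimes>\<^bsub>R\<^esub> x \<in> I"
  shows "left_ideal R I"
proof -
  interpret ring R by fact
  have "\<ominus> x \<in> I" if "x \<in> I" for x
    using l[of "\<ominus> \<one>" x] that R(2) by (auto simp: l_minus subset_iff)
  then show ?thesis unfolding left_ideal_def using assms by (auto intro!: additive_subgroupI')
qed

lemma right_idealI:
  fixes R :: "'a ring" (structure)
  assumes R: "ring R" "I \<subseteq> carrier R" "\<zero>\<^bsub>R\<^esub> \<in> I"
    and "\<And>x y. x \<in> I \<Longrightarrow> y \<in> I \<Longrightarrow> x \<oplus>\<^bsub>R\<^esub> y \<in> I"
    and r: "\<And>r x. r \<in> carrier R \<Longrightarrow> x \<in> I \<Longrightarrow> x \<otimes>\<^bsub>R\<^esub> r \<in> I"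
  shows "right_ideal R I"
proof -
  interpret ring R by fact
  have "\<ominus> x \<in> I" if "x \<in> I" for x
    using r[of "\<ominus> \<one>" x] that R(2) by (auto simp: r_minus subset_iff)
  then show ?thesis unfolding right_ideal_def using assms by (auto intro!: additive_subgroupI')
qed

lemma ideal_iff_left_right: "ring R \<Longrightarrow> ideal I R \<longleftrightarrow> left_ideal R I \<and> right_ideal R I"
  unfolding left_ideal_def right_ideal_def ideal_def ideal_axioms_def by auto

lemma idealI':
  fixes R :: "'a ring" (structure)
  assumes "ring R" "I \<subseteq> carrier R" "\<zero>\<^bsub>R\<^esub> \<in> I"
    and "\<And>x y. x \<in> I \<Longrightarrow> y \<in> I \<Longrightarrow> x \<oplus>\<^bsub>R\<^esub> y \<in> I"
    and "\<And>r x. r \<in> carrier R \<Longrightarrow> x \<in> I \<Longrightarrow> r \<otimes>\<^bsub>R\<^esub> x \<in> I"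
    and "\<And>r x. r \<in> carrier R \<Longrightarrow> x \<in> I \<Longrightarrow> x \<otimes>\<^bsub>R\<^esub> r \<in> I"
  shows "ideal I R"
  using left_idealI[of R I] right_idealI[of R I] assms by (simp add: ideal_iff_left_right)

lemma left_idealD:
  assumes "left_ideal R L"
  shows "L \<subseteq> carrier R" "\<zero>\<^bsub>R\<^esub> \<in> L" "\<And>x y. x \<in> L \<Longrightarrow> y \<in> L \<Longrightarrow> x \<oplus>\<^bsub>R\<^esub> y \<in> L"
    "\<And>r x. r \<in> carrier R \<Longrightarrow> x \<in> L \<Longrightarrow> r \<otimes>\<^bsub>R\<^esub> x \<in> L"
  using assms unfolding left_ideal_def
  by (auto dest: additive_subgroup.a_subset additive_subgroup.zero_closed additive_subgroup.a_closed)

lemma right_idealD: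
  assumes "right_ideal R L"
  shows "L \<subseteq> carrier R" "\<zero>\<^bsub>R\<^esub> \<in> L" "\<And>x y. x \<in> L \<Longrightarrow> y \<in> L \<Longrightarrow> x \<oplus>\<^bsub>R\<^esub> y \<in> L"
    "\<And>r x. r \<in> carrier R \<Longrightarrow> x \<in> L \<Longrightarrow> x \<otimes>\<^bsub>R\<^esub> r \<in> L"
  using assms unfolding right_ideal_def
  by (auto dest: additive_subgroup.a_subset additive_subgroup.zero_closed additive_subgroup.a_closed)

text \<open>Quantifying over elements instead of ideals makes primeness easy to carry along
  surjections and to a type of ring elements. Given aRb inside P, the pair is enlarged to ideals: I
  collects the x with xRb inside P, and J the y with Iy inside P.\<close>

lemma prime_ideal_iff:
  fixes R :: "'a ring" (structure)
  assumes "ring R"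
  shows "prime_ideal R P \<longleftrightarrow> ideal P R \<and> P \<noteq> carrier R \<and>
     (\<forall>a\<in>carrier R. \<forall>b\<in>carrier R. (\<forall>x\<in>carrier R. a \<otimes> x \<otimes> b \<in> P) \<longrightarrow> a \<in> P \<or> b \<in> P)"
    (is "_ \<longleftrightarrow> _ \<and> _ \<and> ?E")
proof -
  interpret ring R by fact
  have E: ?E if P: "prime_ideal R P"
  proof (intro ballI impI)
    fix a b assume ab: "a \<in> carrier R" "b \<in> carrier R" and *: "\<forall>x\<in>carrier R. a \<otimes> x \<otimes> b \<in> P"
    interpret P: ideal P R using P by (simp add: prime_ideal_def)
    define I where "I = {x \<in> carrier R. \<forall>r\<in>carrier R. x \<otimes> r \<otimes> b \<in> P}"
    define J where "J = {y \<in> carrier R. \<forall>x\<in>I. x \<otimes> y \<in> P}"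
    have I: "ideal I R"
    proof (rule idealI')
      show "x \<otimes> r \<in> I" if "r \<in> carrier R" "x \<in> I" for r x
      proof -
        have "x \<otimes> r \<otimes> s \<otimes> b \<in> P" if "s \<in> carrier R" for s
          using \<open>x \<in> I\<close> \<open>r \<in> carrier R\<close> that m_closed[of r s] unfolding I_def by (auto simp: m_assoc)
        then show ?thesis using that by (auto simp: I_def)
      qed
    qed (use ab in \<open>auto simp: I_def ring_axioms l_distr m_assoc P.I_l_closed\<close>)
    have Ic: "x \<in> carrier R" if "x \<in> I" for x using that by (simp add: I_def)
    have J: "ideal J R"
    proof (rule idealI')
      fix r y assume r: "r \<in> carrier R" and y: "y \<in> J"
      have "x \<otimes> (r \<otimes> y) \<in> P" if x: "x \<in> I" for x
        using ideal.I_r_closed[OF I x r] y x r Ic by (auto simp: J_def m_assoc)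
      then show "r \<otimes> y \<in> J" using r y by (simp add: J_def)
      have "x \<otimes> (y \<otimes> r) \<in> P" if x: "x \<in> I" for x
        using r y x Ic P.I_r_closed[of "x \<otimes> y" r] by (auto simp: J_def m_assoc)
      then show "y \<otimes> r \<in> J" using r y by (simp add: J_def)
    qed (auto simp: J_def ring_axioms Ic r_distr)
    have "I \<cdot>\<^bsub>R\<^esub> J \<subseteq> P"
    proof
      fix x assume "x \<in> I \<cdot>\<^bsub>R\<^esub> J"
      then show "x \<in> P" by (induction rule: ideal_prod.induct) (auto simp: J_def)
    qed
    then have "I \<subseteq> P \<or> J \<subseteq> P" using P I J by (simp add: prime_ideal_def)
    moreover have "a \<in> I" using ab * by (simp add: I_def)
    moreover have "x \<otimes> b \<in> P" if "x \<in> I" for x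
      using that ab unfolding I_def by (metis (no_types, lifting) mem_Collect_eq one_closed r_one)
    then have "b \<in> J" using ab by (simp add: J_def)
    ultimately show "a \<in> P \<or> b \<in> P" by auto
  qed
  have "I \<subseteq> P \<or> J \<subseteq> P" if E: ?E and IJ: "ideal I R" "ideal J R" "I \<cdot>\<^bsub>R\<^esub> J \<subseteq> P" for I J
  proof (rule ccontr)
    assume "\<not> (I \<subseteq> P \<or> J \<subseteq> P)"
    then obtain a b where a: "a \<in> I" "a \<notin> P" and b: "b \<in> J" "b \<notin> P" by auto
    have "a \<otimes> x \<otimes> b \<in> P" if "x \<in> carrier R" for x
      using ideal.I_r_closed[OF IJ(1) a(1) that] b IJ(3) by (auto intro: ideal_prod.prod)
    then show False using E a b ideal.Icarr[OF IJ(1)] ideal.Icarr[OF IJ(2)] by blast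
  qed
  with E show ?thesis unfolding prime_ideal_def by blast
qed

definition maximal_left_ideal :: "'a ring \<Rightarrow> 'a set \<Rightarrow> bool" where
  "maximal_left_ideal R L \<longleftrightarrow> left_ideal R L \<and> L \<noteq> carrier R \<and>
     (\<forall>L'. left_ideal R L' \<and> L \<subseteq> L' \<longrightarrow> L' = L \<or> L' = carrier R)"

text \<open>For a left ideal L this is the annihilator of R/L, the largest two-sided ideal inside
  L.\<close>

definition bound_of :: "'a ring \<Rightarrow> 'a set \<Rightarrow> 'a set" where
  "bound_of R L = {r \<in> carrier R. \<forall>x\<in>carrier R. r \<otimes>\<^bsub>R\<^esub> x \<in> L}"

text \<open>The module R/L. Scalars act through a representative chosen by \<open>SOME\<close>; for
  a left ideal L the result does not depend on it. The record of modules extends that of rings,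
  whence the two undefined fields.\<close>

definition coset_module :: "'a ring \<Rightarrow> 'a set \<Rightarrow> ('a, 'a set) module" where
  "coset_module R L = \<lparr>carrier = a_rcosets\<^bsub>R\<^esub> L, monoid.mult = undefined, one = undefined,
     ring.zero = L, add = set_add R,
     smult = (\<lambda>r C. L +>\<^bsub>R\<^esub> (r \<otimes>\<^bsub>R\<^esub> (SOME x. x \<in> carrier R \<and> C = L +>\<^bsub>R\<^esub> x)))\<rparr>"

text \<open>Submodules of R/L come from left ideals between L and R, so maximality of L makes R/L
  simple. Its elements are sets of ring elements, as \<open>primitive_ideal\<close>
  prescribes.\<close>

lemma primitive_bound_of:
  fixes R :: "'a ring" (structure)
  assumes "ring R" and L: "maximal_left_ideal R L"
  shows "primitive_ideal R (bound_of R L)"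
proof -
  interpret ring R by fact
  have Ll: "left_ideal R L" "L \<noteq> carrier R" using L by (auto simp: maximal_left_ideal_def)
  interpret L: additive_subgroup L R using Ll by (simp add: left_ideal_def)
  interpret L: abelian_subgroup L R
    by (intro abelian_subgroupI3 abelian_group_axioms L.additive_subgroup_axioms)
  let ?M = "coset_module R L"
  have carr: "carrier ?M = {L +> x |x. x \<in> carrier R}"
    by (auto simp: coset_module_def A_RCOSETS_def')
  have eq: "L +> x = L +> y \<longleftrightarrow> x \<ominus> y \<in> L" if "x \<in> carrier R" "y \<in> carrier R" for x y
    using L.a_rcos_module_minus[OF ring_axioms that(2,1)] L.a_rcos_self[OF that(1)]
      L.a_repr_independence'[of x y] that(2) by auto
  have add: "(L +> x) \<oplus>\<^bsub>?M\<^esub> (L +> y) = L +> (x \<oplus> y)" if "x \<in> carrier R" "y \<in> carrier R" for x y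
    using that by (simp add: coset_module_def L.a_rcos_sum)
  have zero: "\<zero>\<^bsub>?M\<^esub> = L +> \<zero>" using a_coset_add_zero[OF L.a_subset] by (simp add: coset_module_def)
  have sm: "r \<odot>\<^bsub>?M\<^esub> (L +> x) = L +> (r \<otimes> x)" if "r \<in> carrier R" "x \<in> carrier R" for r x
  proof -
    define y where "y = (SOME y. y \<in> carrier R \<and> L +> x = L +> y)"
    have y: "y \<in> carrier R" "L +> y = L +> x"
      unfolding y_def by (rule someI2[of _ x]; use that in simp)+
    then have "y \<ominus> x \<in> L" using eq[of y x] that(2) by simp
    then have "r \<otimes> (y \<ominus> x) \<in> L" using left_idealD(4)[OF Ll(1) that(1)] by simp
    then have "r \<otimes> y \<ominus> r \<otimes> x \<in> L" using y that by (simp add: a_minus_def r_distr r_minus)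
    then have "L +> (r \<otimes> y) = L +> (r \<otimes> x)" using eq[of "r \<otimes> y" "r \<otimes> x"] that y by simp
    then show ?thesis by (simp add: coset_module_def y_def)
  qed
  have M: "abelian_group ?M"
  proof (rule abelian_groupI)
    fix C assume "C \<in> carrier ?M"
    then obtain x where "C = L +> x" "x \<in> carrier R" by (auto simp: carr)
    then show "\<exists>D\<in>carrier ?M. D \<oplus>\<^bsub>?M\<^esub> C = \<zero>\<^bsub>?M\<^esub>"
      by (intro bexI[of _ "L +> (\<ominus> x)"]) (auto simp: carr add zero l_neg)
  next
    show "C \<oplus>\<^bsub>?M\<^esub> D \<in> carrier ?M" if "C \<in> carrier ?M" "D \<in> carrier ?M" for C D
      using that unfolding carr by (auto simp: add)
    show "\<zero>\<^bsub>?M\<^esub> \<in> carrier ?M" unfolding carr zero by auto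
    show "C \<oplus>\<^bsub>?M\<^esub> D \<oplus>\<^bsub>?M\<^esub> B = C \<oplus>\<^bsub>?M\<^esub> (D \<oplus>\<^bsub>?M\<^esub> B)"
      if "C \<in> carrier ?M" "D \<in> carrier ?M" "B \<in> carrier ?M" for C D B
      using that unfolding carr by (auto simp: add a_assoc)
    show "C \<oplus>\<^bsub>?M\<^esub> D = D \<oplus>\<^bsub>?M\<^esub> C" if "C \<in> carrier ?M" "D \<in> carrier ?M" for C D
      using that unfolding carr by (auto simp: add a_comm)
    show "\<zero>\<^bsub>?M\<^esub> \<oplus>\<^bsub>?M\<^esub> C = C" if "C \<in> carrier ?M" for C
      using that unfolding carr zero by (auto simp: add)
  qed
  have lm: "left_module R ?M"
  proof -
    have 1: "a \<odot>\<^bsub>?M\<^esub> C \<in> carrier ?M" if "a \<in> carrier R" "C \<in> carrier ?M" for a C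
      using that sm unfolding carr by auto
    have 2: "(a \<oplus> b) \<odot>\<^bsub>?M\<^esub> C = a \<odot>\<^bsub>?M\<^esub> C \<oplus>\<^bsub>?M\<^esub> b \<odot>\<^bsub>?M\<^esub> C"
      "(a \<otimes> b) \<odot>\<^bsub>?M\<^esub> C = a \<odot>\<^bsub>?M\<^esub> (b \<odot>\<^bsub>?M\<^esub> C)"
      if "a \<in> carrier R" "b \<in> carrier R" "C \<in> carrier ?M" for a b C
      using that unfolding carr by (auto simp: sm add l_distr m_assoc)
    have 3: "a \<odot>\<^bsub>?M\<^esub> (C \<oplus>\<^bsub>?M\<^esub> D) = a \<odot>\<^bsub>?M\<^esub> C \<oplus>\<^bsub>?M\<^esub> a \<odot>\<^bsub>?M\<^esub> D"
      if "a \<in> carrier R" "C \<in> carrier ?M" "D \<in> carrier ?M" for a C D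
      using that unfolding carr by (auto simp: sm add r_distr)
    have 4: "\<one> \<odot>\<^bsub>?M\<^esub> C = C" if "C \<in> carrier ?M" for C
      using that unfolding carr by (auto simp: sm)
    show ?thesis unfolding left_module_def by (intro conjI ballI ring_axioms M 1 2 3 4)
  qed
  have nz: "L +> x = \<zero>\<^bsub>?M\<^esub> \<longleftrightarrow> x \<in> L" if "x \<in> carrier R" for x
    using eq[OF that, of \<zero>] that by (simp add: zero a_minus_def)
  have "simple_left_module R ?M"
    unfolding simple_left_module_def
  proof (intro conjI allI impI)
    show "carrier ?M \<noteq> {\<zero>\<^bsub>?M\<^esub>}" using nz Ll left_idealD(1)[OF Ll(1)] by (auto simp: carr)
    fix N assume N: "submodule N R ?M"
    define L' where "L' = {x \<in> carrier R. L +> x \<in> N}"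
    interpret M: abelian_group ?M by fact
    have Ns: "N \<subseteq> carrier ?M" "\<zero>\<^bsub>?M\<^esub> \<in> N"
      "\<And>x y. x \<in> N \<Longrightarrow> y \<in> N \<Longrightarrow> x \<oplus>\<^bsub>?M\<^esub> y \<in> N"
      "\<And>r x. r \<in> carrier R \<Longrightarrow> x \<in> N \<Longrightarrow> r \<odot>\<^bsub>?M\<^esub> x \<in> N"
      using N unfolding submodule_def submodule_axioms_def subgroup_def by auto
    have "left_ideal R L'"
    proof (rule left_idealI)
      show "\<zero> \<in> L'" using Ns(2) by (simp add: L'_def zero)
      show "x \<oplus> y \<in> L'" if "x \<in> L'" "y \<in> L'" for x y
        using that Ns(3)[of "L +> x" "L +> y"] by (simp add: L'_def add)
      show "r \<otimes> x \<in> L'" if "r \<in> carrier R" "x \<in> L'" for r x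
        using that Ns(4)[of r "L +> x"] by (simp add: L'_def sm)
    qed (auto simp: L'_def ring_axioms)
    moreover have "L \<subseteq> L'"
    proof
      fix x assume "x \<in> L"
      then have "x \<in> carrier R" "L +> x = \<zero>\<^bsub>?M\<^esub>" using nz by auto
      then show "x \<in> L'" using Ns(2) by (simp add: L'_def)
    qed
    ultimately have "L' = L \<or> L' = carrier R" using L by (auto simp: maximal_left_ideal_def)
    moreover have N': "N = (\<lambda>x. L +> x) ` L'" using Ns(1) by (auto simp: L'_def carr)
    moreover have "(\<lambda>x. L +> x) ` L = (\<lambda>_. \<zero>\<^bsub>?M\<^esub>) ` L" by (rule image_cong) (use nz in auto)
    then have "(\<lambda>x. L +> x) ` L = {\<zero>\<^bsub>?M\<^esub>}" using L.zero_closed by (auto simp only: image_constant)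
    ultimately show "N = {\<zero>\<^bsub>?M\<^esub>} \<or> N = carrier ?M" by (auto simp: carr)
  qed (rule lm)
  moreover have "(\<forall>C\<in>carrier ?M. r \<odot>\<^bsub>?M\<^esub> C = \<zero>\<^bsub>?M\<^esub>) \<longleftrightarrow> (\<forall>x\<in>carrier R. r \<otimes> x \<in> L)"
    if "r \<in> carrier R" for r
  proof -
    have "carrier ?M = (\<lambda>x. L +> x) ` carrier R" using carr by auto
    then show ?thesis using that by (simp add: sm nz)
  qed
  then have "bound_of R L = left_annihilator R ?M"
    unfolding bound_of_def left_annihilator_def by blast
  ultimately show ?thesis unfolding primitive_ideal_def by blast
qed

text \<open>A simple module is Rm for any nonzero m, hence isomorphic to R/L with L the annihilator
  of m. This form of primitivity mentions no modules, so it passes to quotient rings through the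
  left ideals alone.\<close>

lemma primitive_ideal_iff:
  fixes R :: "'a ring" (structure)
  assumes "ring R"
  shows "primitive_ideal R P \<longleftrightarrow> (\<exists>L. maximal_left_ideal R L \<and> P = bound_of R L)"
proof
  assume "primitive_ideal R P"
  then obtain M :: "('a, 'a set) module"
    where M: "simple_left_module R M" "P = left_annihilator R M" unfolding primitive_ideal_def by auto
  interpret ring R by fact
  have lm: "left_module R M" and nz: "carrier M \<noteq> {\<zero>\<^bsub>M\<^esub>}"
    and simp: "\<And>N. submodule N R M \<Longrightarrow> N = {\<zero>\<^bsub>M\<^esub>} \<or> N = carrier M"
    using M by (auto simp: simple_left_module_def)
  interpret M: abelian_group M using lm by (simp add: left_module_def)
  have sc: "a \<odot>\<^bsub>M\<^esub> x \<in> carrier M" and sl: "(a \<oplus> b) \<odot>\<^bsub>M\<^esub> x = a \<odot>\<^bsub>M\<^esub> x \<oplus>\<^bsub>M\<^esub> b \<odot>\<^bsub>M\<^esub> x"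
    and sr: "a \<odot>\<^bsub>M\<^esub> (x \<oplus>\<^bsub>M\<^esub> y) = a \<odot>\<^bsub>M\<^esub> x \<oplus>\<^bsub>M\<^esub> a \<odot>\<^bsub>M\<^esub> y"
    and sm: "(a \<otimes> b) \<odot>\<^bsub>M\<^esub> x = a \<odot>\<^bsub>M\<^esub> (b \<odot>\<^bsub>M\<^esub> x)" and s1: "\<one> \<odot>\<^bsub>M\<^esub> x = x"
    if "a \<in> carrier R" "b \<in> carrier R" "x \<in> carrier M" "y \<in> carrier M" for a b x y
    using that lm unfolding left_module_def by auto
  have s0: "a \<odot>\<^bsub>M\<^esub> \<zero>\<^bsub>M\<^esub> = \<zero>\<^bsub>M\<^esub>" if "a \<in> carrier R" for a
    using sr[of a a "\<zero>\<^bsub>M\<^esub>" "\<zero>\<^bsub>M\<^esub>"] that sc[of a a "\<zero>\<^bsub>M\<^esub>" "\<zero>\<^bsub>M\<^esub>"] by simp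
  have s0': "\<zero> \<odot>\<^bsub>M\<^esub> x = \<zero>\<^bsub>M\<^esub>" if "x \<in> carrier M" for x
    using sl[of \<zero> \<zero> x x] that sc[of \<zero> \<zero> x x] by simp
  obtain m where m: "m \<in> carrier M" "m \<noteq> \<zero>\<^bsub>M\<^esub>" using nz M.zero_closed by auto
  define L where "L = {r \<in> carrier R. r \<odot>\<^bsub>M\<^esub> m = \<zero>\<^bsub>M\<^esub>}"
  have Ll: "left_ideal R L"
  proof (rule left_idealI)
    show "x \<oplus> y \<in> L" if "x \<in> L" "y \<in> L" for x y using that sl[of x y m m] m by (auto simp: L_def)
    show "r \<otimes> x \<in> L" if "r \<in> carrier R" "x \<in> L" for r x
      using that sm[of r x m m] m s0 by (auto simp: L_def)
  qed (use m s0' ring_axioms in \<open>auto simp: L_def\<close>)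
  \<comment> \<open>For a left ideal I, the image Im is a submodule. Its dichotomy yields both the
    maximality of L and M = Rm.\<close>
  have im: "(\<lambda>r. r \<odot>\<^bsub>M\<^esub> m) ` I = {\<zero>\<^bsub>M\<^esub>} \<or> (\<lambda>r. r \<odot>\<^bsub>M\<^esub> m) ` I = carrier M" if I: "left_ideal R I" for I
  proof (rule simp)
    note D = left_idealD[OF I]
    let ?N = "(\<lambda>r. r \<odot>\<^bsub>M\<^esub> m) ` I"
    have smc: "a \<odot>\<^bsub>M\<^esub> x \<in> ?N" if ax: "a \<in> carrier R" "x \<in> ?N" for a x
    proof -
      obtain r where r: "r \<in> I" "x = r \<odot>\<^bsub>M\<^esub> m" using ax(2) by auto
      then show ?thesis using sm[of a r m m] D ax(1) m
        by (intro image_eqI[of _ _ "a \<otimes> r"]) (auto simp: subset_iff)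
    qed
    have add: "x \<oplus>\<^bsub>M\<^esub> y \<in> ?N" if xy: "x \<in> ?N" "y \<in> ?N" for x y
    proof -
      obtain r s where "r \<in> I" "s \<in> I" "x = r \<odot>\<^bsub>M\<^esub> m" "y = s \<odot>\<^bsub>M\<^esub> m" using xy by auto
      then show ?thesis using D m sl[of r s m m]
        by (intro image_eqI[of _ _ "r \<oplus> s"]) (auto simp: subset_iff)
    qed
    have sub: "?N \<subseteq> carrier M" using D m sc by auto
    have neg: "\<ominus>\<^bsub>M\<^esub> x \<in> ?N" if x: "x \<in> ?N" for x
    proof -
      have xM: "x \<in> carrier M" using x sub by auto
      have "(\<ominus> \<one>) \<odot>\<^bsub>M\<^esub> x \<oplus>\<^bsub>M\<^esub> x = \<zero>\<^bsub>M\<^esub>"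
        using sl[of "\<ominus> \<one>" \<one> x x] xM s0'[OF xM] s1[of \<one> \<one> x x] by (simp add: l_neg)
      then have "(\<ominus> \<one>) \<odot>\<^bsub>M\<^esub> x = \<ominus>\<^bsub>M\<^esub> x" using xM sc[of "\<ominus> \<one>" \<one> x x]
        by (metis M.minus_equality add.inv_closed one_closed)
      then show ?thesis using smc[of "\<ominus> \<one>" x] x by simp
    qed
    show "submodule ?N R M"
      unfolding submodule_def submodule_axioms_def subgroup_def
      using smc add sub neg image_eqI[of "\<zero>\<^bsub>M\<^esub>" "\<lambda>r. r \<odot>\<^bsub>M\<^esub> m" \<zero> I] D(2) s0'[OF m(1)]
      by (auto simp: a_inv_def[symmetric])
  qed
  have Lc: "\<one> \<notin> L" using m s1[of \<one> \<one> m m] by (auto simp: L_def)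
  then have Lc: "L \<noteq> carrier R" by auto
  have "L' = L \<or> L' = carrier R" if L': "left_ideal R L'" "L \<subseteq> L'" for L'
  proof (cases "(\<lambda>r. r \<odot>\<^bsub>M\<^esub> m) ` L' = {\<zero>\<^bsub>M\<^esub>}")
    case True
    then have "L' \<subseteq> L" using left_idealD[OF L'(1)] by (auto simp: L_def)
    then show ?thesis using L' by auto
  next
    case False
    then have eq: "(\<lambda>r. r \<odot>\<^bsub>M\<^esub> m) ` L' = carrier M" using im[OF L'(1)] by simp
    have "r \<in> L'" if r: "r \<in> carrier R" for r
    proof -
      have "r \<odot>\<^bsub>M\<^esub> m \<in> (\<lambda>r. r \<odot>\<^bsub>M\<^esub> m) ` L'" unfolding eq using sc[OF r r m(1) m(1)] .
      then obtain s where s: "s \<in> L'" "r \<odot>\<^bsub>M\<^esub> m = s \<odot>\<^bsub>M\<^esub> m" by auto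
      have sR: "s \<in> carrier R" using s left_idealD[OF L'(1)] by auto
      have "(\<ominus> s) \<odot>\<^bsub>M\<^esub> m \<oplus>\<^bsub>M\<^esub> s \<odot>\<^bsub>M\<^esub> m = \<zero>\<^bsub>M\<^esub>" using sl[of "\<ominus> s" s m m] sR m s0' by (simp add: l_neg)
      then have "\<ominus> s \<oplus> r \<in> L" using sl[of "\<ominus> s" r m m] s sR r m by (simp add: L_def)
      then have "s \<oplus> (\<ominus> s \<oplus> r) \<in> L'" using L' s left_idealD(3)[OF L'(1)] by auto
      then show ?thesis using sR r by (simp add: r_neg2)
    qed
    then show ?thesis using left_idealD[OF L'(1)] by auto
  qed
  then have mx: "maximal_left_ideal R L" using Ll Lc by (auto simp: maximal_left_ideal_def)
  have "(\<lambda>r. r \<odot>\<^bsub>M\<^esub> m) ` carrier R = carrier M"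
  proof -
    have l: "left_ideal R (carrier R)" by (rule left_idealI) (auto simp: ring_axioms)
    have "m \<in> (\<lambda>r. r \<odot>\<^bsub>M\<^esub> m) ` carrier R" using s1[of \<one> \<one> m m] m by (intro image_eqI[of _ _ \<one>]) auto
    then show ?thesis using im[OF l] m by auto
  qed
  then have cm: "carrier M = (\<lambda>r. r \<odot>\<^bsub>M\<^esub> m) ` carrier R" ..
  have "r \<otimes> x \<in> L \<longleftrightarrow> r \<odot>\<^bsub>M\<^esub> (x \<odot>\<^bsub>M\<^esub> m) = \<zero>\<^bsub>M\<^esub>" if "r \<in> carrier R" "x \<in> carrier R" for r x
    using that sm[of r x m m] m by (simp add: L_def)
  then have "P = bound_of R L"
    unfolding M(2) bound_of_def left_annihilator_def cm by auto
  then show "\<exists>L. maximal_left_ideal R L \<and> P = bound_of R L" using mx by blast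
qed (auto intro: primitive_bound_of assms)

lemma specD:
  assumes "Q \<in> spec R"
  shows "prime_ideal R Q" "ideal Q R" "Q \<noteq> carrier R" "Q \<subseteq> carrier R" "\<zero>\<^bsub>R\<^esub> \<in> Q"
proof -
  show *: "prime_ideal R Q" "ideal Q R" "Q \<noteq> carrier R"
    using assms by (auto simp: spec_def prime_ideal_def)
  show "Q \<subseteq> carrier R" "\<zero>\<^bsub>R\<^esub> \<in> Q"
    using additive_subgroup.a_subset[OF ideal.axioms(1)[OF *(2)]]
      additive_subgroup.zero_closed[OF ideal.axioms(1)[OF *(2)]] by auto
qed

section \<open>Transfer along surjective homomorphisms\<close>

locale surj_ring_hom = ring_hom_ring R S h
  for R :: "'a ring" (structure) and S :: "'b ring" and h +
  assumes surj: "h ` carrier R = carrier S"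
begin

text \<open>The lemmas of this locale are the correspondence theorem: preimages match the ideals of
  S (left, right, two-sided, prime, primitive) with those of R that contain the kernel.\<close>

definition pre :: "'b set \<Rightarrow> 'a set" where "pre Q = {r \<in> carrier R. h r \<in> Q}"

lemma ball_S: "(\<forall>y\<in>carrier S. P y) \<longleftrightarrow> (\<forall>x\<in>carrier R. P (h x))"
  using surj by (metis (no_types, lifting) image_iff)

lemma obtain_pre: "y \<in> carrier S \<Longrightarrow> \<exists>x\<in>carrier R. y = h x"
  using surj by (metis imageE)

lemma img_pre: "Q \<subseteq> carrier S \<Longrightarrow> h ` pre Q = Q"
  using obtain_pre by (auto simp: pre_def)

lemma pre_subset_iff: "Q \<subseteq> carrier S \<Longrightarrow> pre Q \<subseteq> pre Q' \<longleftrightarrow> Q \<subseteq> Q'"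
  using obtain_pre unfolding pre_def by (smt (verit) mem_Collect_eq subset_iff)

lemma pre_eq_iff: "Q \<subseteq> carrier S \<Longrightarrow> Q' \<subseteq> carrier S \<Longrightarrow> pre Q = pre Q' \<longleftrightarrow> Q = Q'"
  using pre_subset_iff[of Q Q'] pre_subset_iff[of Q' Q] by auto

lemma pre_psubset_iff: "Q \<subseteq> carrier S \<Longrightarrow> Q' \<subseteq> carrier S \<Longrightarrow> pre Q \<subset> pre Q' \<longleftrightarrow> Q \<subset> Q'"
  by (simp add: psubset_eq pre_subset_iff pre_eq_iff)

lemma pre_left_ideal:
  assumes "left_ideal S L" shows "left_ideal R (pre L)"
  by (rule left_idealI) (use left_idealD(2-4)[OF assms] in \<open>auto simp: pre_def R.ring_axioms\<close>)

lemma pre_right_ideal: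
  assumes "right_ideal S L" shows "right_ideal R (pre L)"
  by (rule right_idealI) (use right_idealD(2-4)[OF assms] in \<open>auto simp: pre_def R.ring_axioms\<close>)

lemma img_left_ideal:
  assumes "left_ideal R L" shows "left_ideal S (h ` L)"
proof (rule left_idealI)
  note D = left_idealD[OF assms]
  show "h ` L \<subseteq> carrier S" using D(1) by auto
  show "\<zero>\<^bsub>S\<^esub> \<in> h ` L" using D(2) by (metis hom_zero image_eqI)
  show "x \<oplus>\<^bsub>S\<^esub> y \<in> h ` L" if xy: "x \<in> h ` L" "y \<in> h ` L" for x y
  proof -
    obtain a b where "a \<in> L" "b \<in> L" "x = h a" "y = h b" using xy by auto
    then show ?thesis using D(1) D(3)[of a b] by (intro image_eqI[of _ _ "a \<oplus> b"]) (auto simp: subset_iff)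
  qed
  show "r \<otimes>\<^bsub>S\<^esub> x \<in> h ` L" if rx: "r \<in> carrier S" "x \<in> h ` L" for r x
  proof -
    obtain a b where "a \<in> carrier R" "b \<in> L" "r = h a" "x = h b" using rx obtain_pre[OF rx(1)] by blast
    then show ?thesis using D(1) D(4)[of a b] by (intro image_eqI[of _ _ "a \<otimes> b"]) (auto simp: subset_iff)
  qed
qed (rule S.ring_axioms)

lemma img_right_ideal:
  assumes "right_ideal R L" shows "right_ideal S (h ` L)"
proof (rule right_idealI)
  note D = right_idealD[OF assms]
  show "h ` L \<subseteq> carrier S" using D(1) by auto
  show "\<zero>\<^bsub>S\<^esub> \<in> h ` L" using D(2) by (metis hom_zero image_eqI)
  show "x \<oplus>\<^bsub>S\<^esub> y \<in> h ` L" if xy: "x \<in> h ` L" "y \<in> h ` L" for x y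
  proof -
    obtain a b where "a \<in> L" "b \<in> L" "x = h a" "y = h b" using xy by auto
    then show ?thesis using D(1) D(3)[of a b] by (intro image_eqI[of _ _ "a \<oplus> b"]) (auto simp: subset_iff)
  qed
  show "x \<otimes>\<^bsub>S\<^esub> r \<in> h ` L" if rx: "r \<in> carrier S" "x \<in> h ` L" for r x
  proof -
    obtain a b where "a \<in> carrier R" "b \<in> L" "r = h a" "x = h b" using rx obtain_pre[OF rx(1)] by blast
    then show ?thesis using D(1) D(4)[of a b] by (intro image_eqI[of _ _ "b \<otimes> a"]) (auto simp: subset_iff)
  qed
qed (rule S.ring_axioms)

lemma pre_img:
  assumes L: "additive_subgroup L R" and K: "pre {\<zero>\<^bsub>S\<^esub>} \<subseteq> L"
  shows "pre (h ` L) = L"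
proof
  interpret L: additive_subgroup L R by fact
  show "L \<subseteq> pre (h ` L)" using L.a_subset by (auto simp: pre_def)
  show "pre (h ` L) \<subseteq> L"
  proof
    fix x assume "x \<in> pre (h ` L)"
    then obtain y where y: "y \<in> L" "h x = h y" and x: "x \<in> carrier R" by (auto simp: pre_def)
    then have "h (x \<ominus> y) = \<zero>\<^bsub>S\<^esub>" using L.a_Hcarr by (simp add: a_minus_def S.r_neg)
    then have "x \<ominus> y \<in> L" using K x y L.a_Hcarr by (auto simp: pre_def)
    then have "x \<ominus> y \<oplus> y \<in> L" using y by auto
    then show "x \<in> L" using x y L.a_Hcarr by (simp add: a_minus_def R.add.m_assoc R.l_neg)
  qed
qed

lemma pre_ideal_iff: "Q \<subseteq> carrier S \<Longrightarrow> ideal (pre Q) R \<longleftrightarrow> ideal Q S"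
  using img_left_ideal[of "pre Q"] img_right_ideal[of "pre Q"] pre_left_ideal[of Q] pre_right_ideal[of Q]
  by (auto simp: ideal_iff_left_right R.ring_axioms S.ring_axioms img_pre)

lemma pre_carrier: "pre (carrier S) = carrier R"
  by (auto simp: pre_def)

lemma prime_pre_iff:
  assumes Q: "Q \<subseteq> carrier S"
  shows "prime_ideal R (pre Q) \<longleftrightarrow> prime_ideal S Q"
proof -
  have "pre Q \<noteq> carrier R \<longleftrightarrow> Q \<noteq> carrier S"
    using pre_eq_iff[OF Q, of "carrier S"] by (simp add: pre_carrier)
  moreover have "x \<in> pre Q \<longleftrightarrow> h x \<in> Q" if "x \<in> carrier R" for x using that by (simp add: pre_def)
  ultimately show ?thesis
    by (simp add: prime_ideal_iff R.ring_axioms S.ring_axioms ball_S pre_ideal_iff[OF Q])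
qed

lemma spec_pre_iff: "Q \<subseteq> carrier S \<Longrightarrow> pre Q \<in> spec R \<longleftrightarrow> Q \<in> spec S"
  by (simp add: spec_def prime_pre_iff)

lemma zero_in_left_ideal: "left_ideal S L \<Longrightarrow> {\<zero>\<^bsub>S\<^esub>} \<subseteq> L"
  by (auto dest: left_idealD)

lemma maximal_left_pre_iff:
  assumes L: "L \<subseteq> carrier S"
  shows "maximal_left_ideal R (pre L) \<longleftrightarrow> maximal_left_ideal S L"
proof -
  have l: "left_ideal R (pre L') \<longleftrightarrow> left_ideal S L'" if "L' \<subseteq> carrier S" for L'
    using pre_left_ideal[of L'] img_left_ideal[of "pre L'"] img_pre[OF that] by auto
  have "pre L \<noteq> carrier R \<longleftrightarrow> L \<noteq> carrier S"
    using pre_eq_iff[OF L, of "carrier S"] by (simp add: pre_carrier)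
  moreover have "(\<forall>M. left_ideal R M \<and> pre L \<subseteq> M \<longrightarrow> M = pre L \<or> M = carrier R) \<longleftrightarrow>
     (\<forall>L'. left_ideal S L' \<and> L \<subseteq> L' \<longrightarrow> L' = L \<or> L' = carrier S)" (is "?a = ?b") if ll: "left_ideal S L"
  proof
    assume a: ?a
    show ?b
    proof (intro allI impI)
      fix L' assume L': "left_ideal S L' \<and> L \<subseteq> L'"
      then have "L' \<subseteq> carrier S" by (auto dest: left_idealD)
      moreover have "pre L' = pre L \<or> pre L' = carrier R"
        using a[rule_format, of "pre L'"] L' l[OF calculation] by (auto simp: pre_def)
      ultimately show "L' = L \<or> L' = carrier S"
        using pre_eq_iff[of L' L] pre_eq_iff[of L' "carrier S"] L by (simp add: pre_carrier)
    qed
  next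
    assume b: ?b
    show ?a
    proof (intro allI impI)
      fix M assume M: "left_ideal R M \<and> pre L \<subseteq> M"
      have "pre {\<zero>\<^bsub>S\<^esub>} \<subseteq> pre L" using zero_in_left_ideal[OF ll] by (auto simp: pre_def)
      then have pM: "pre (h ` M) = M" using M by (intro pre_img) (auto simp: left_ideal_def)
      have lM: "left_ideal S (h ` M)" using M img_left_ideal by auto
      have "L \<subseteq> h ` M" using M img_pre[OF L] by auto
      then have "h ` M = L \<or> h ` M = carrier S" using b lM by auto
      then show "M = pre L \<or> M = carrier R" using pM pre_carrier by auto
    qed
  qed
  ultimately show ?thesis using l[OF L] by (auto simp: maximal_left_ideal_def)
qed

lemma bound_of_pre: "bound_of R (pre L) = pre (bound_of S L)"
  unfolding bound_of_def ball_S by (auto simp: pre_def)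

text \<open>Bounds commute with preimages by \<open>bound_of_pre\<close>. Conversely, a maximal left
  ideal with bound \<open>pre Q\<close> contains its bound and hence the kernel, so it is itself a
  preimage.\<close>

lemma primitive_pre_iff:
  assumes Q: "Q \<subseteq> carrier S"
  shows "primitive_ideal R (pre Q) \<longleftrightarrow> primitive_ideal S Q"
proof
  assume "primitive_ideal S Q"
  then obtain L where L: "maximal_left_ideal S L" "Q = bound_of S L"
    by (auto simp: primitive_ideal_iff S.ring_axioms)
  then have "maximal_left_ideal R (pre L)"
    using left_idealD(1)[of S L] by (intro maximal_left_pre_iff[THEN iffD2]) (auto simp: maximal_left_ideal_def)
  then show "primitive_ideal R (pre Q)"
    using L by (auto simp: primitive_ideal_iff R.ring_axioms bound_of_pre[symmetric])
next
  assume "primitive_ideal R (pre Q)"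
  then obtain M where M: "maximal_left_ideal R M" "pre Q = bound_of R M"
    by (auto simp: primitive_ideal_iff R.ring_axioms)
  have lM: "left_ideal R M" using M by (simp add: maximal_left_ideal_def)
  have "bound_of R M \<subseteq> M" unfolding bound_of_def using R.one_closed R.r_one by fastforce
  moreover have "\<zero>\<^bsub>S\<^esub> \<in> Q"
  proof -
    have "\<zero> \<in> bound_of R M" using left_idealD(2)[OF lM] by (simp add: bound_of_def)
    then show ?thesis unfolding M(2)[symmetric] by (simp add: pre_def)
  qed
  ultimately have "pre {\<zero>\<^bsub>S\<^esub>} \<subseteq> M" using M(2) by (auto simp: pre_def)
  then have pM: "pre (h ` M) = M" using lM by (intro pre_img) (auto simp: left_ideal_def)
  have sub: "h ` M \<subseteq> carrier S" using left_idealD(1)[OF lM] by auto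
  have "maximal_left_ideal S (h ` M)" using maximal_left_pre_iff[OF sub] pM M by simp
  moreover have "pre Q = pre (bound_of S (h ` M))" using M pM bound_of_pre[of "h ` M"] by simp
  then have "Q = bound_of S (h ` M)" using pre_eq_iff[OF Q] by (auto simp: bound_of_def)
  ultimately show "primitive_ideal S Q" by (auto simp: primitive_ideal_iff S.ring_axioms)
qed

lemma noetherian_image:
  assumes "noetherian R" shows "noetherian S"
  unfolding noetherian_def
proof (intro conjI allI impI)
  fix I :: "nat \<Rightarrow> 'b set" assume I: "\<forall>n. left_ideal S (I n) \<and> I n \<subseteq> I (Suc n)"
  have "\<forall>n. left_ideal R (pre (I n)) \<and> pre (I n) \<subseteq> pre (I (Suc n))"
    using I pre_left_ideal by (auto simp: pre_def)
  then obtain N where "\<forall>n\<ge>N. pre (I n) = pre (I N)"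
    using assms unfolding noetherian_def by (elim conjE allE[of _ "\<lambda>n. pre (I n)"]) auto
  moreover have "I n \<subseteq> carrier S" for n using I left_idealD(1)[of S "I n"] by simp
  ultimately show "\<exists>N. \<forall>n\<ge>N. I n = I N" using pre_eq_iff by auto
next
  fix I :: "nat \<Rightarrow> 'b set" assume I: "\<forall>n. right_ideal S (I n) \<and> I n \<subseteq> I (Suc n)"
  have "\<forall>n. right_ideal R (pre (I n)) \<and> pre (I n) \<subseteq> pre (I (Suc n))"
    using I pre_right_ideal by (auto simp: pre_def)
  then obtain N where "\<forall>n\<ge>N. pre (I n) = pre (I N)"
    using assms unfolding noetherian_def by (elim conjE) (erule allE[of _ "\<lambda>n. pre (I n)"], erule allE[of _ "\<lambda>n. pre (I n)"], auto)
  moreover have "I n \<subseteq> carrier S" for n using I right_idealD(1)[of S "I n"] by simp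
  ultimately show "\<exists>N. \<forall>n\<ge>N. I n = I N" using pre_eq_iff by auto
qed

end

lemma surj_ring_hom_quot:
  assumes "ideal P R" shows "surj_ring_hom R (R Quot P) (a_r_coset R P)"
proof -
  interpret ideal P R by fact
  show ?thesis
    by (intro surj_ring_hom.intro rcos_ring_hom_ring surj_ring_hom_axioms.intro)
      (auto simp: FactRing_def A_RCOSETS_def')
qed

lemma (in ideal) rcos_eq_self_iff:
  assumes "x \<in> carrier R" shows "I +> x = I \<longleftrightarrow> x \<in> I"
proof
  assume "I +> x = I"
  with a_rcos_self[OF assms] show "x \<in> I" by (rule back_subst)
qed (rule a_rcos_const)

lemma pre_zero_quot:
  assumes P: "ideal P R" shows "surj_ring_hom.pre R (a_r_coset R P) {\<zero>\<^bsub>R Quot P\<^esub>} = P"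
proof -
  have zero: "\<zero>\<^bsub>R Quot P\<^esub> = P" unfolding FactRing_def ring.select_convs ..
  have "surj_ring_hom.pre R (a_r_coset R P) {\<zero>\<^bsub>R Quot P\<^esub>} = {x \<in> carrier R. P +>\<^bsub>R\<^esub> x = P}"
    unfolding surj_ring_hom.pre_def[OF surj_ring_hom_quot[OF P]] zero singleton_iff ..
  also have "\<dots> = {x \<in> carrier R. x \<in> P}" using ideal.rcos_eq_self_iff[OF P] by (intro Collect_cong conj_cong) auto
  also have "\<dots> = P" using additive_subgroup.a_subset[OF ideal.axioms(1)[OF P]] by auto
  finally show ?thesis .
qed

lemma prime_quot_zero:
  assumes "prime_ideal R P" shows "prime_ideal (R Quot P) {\<zero>\<^bsub>R Quot P\<^esub>}"
proof -
  have i: "ideal P R" using assms by (simp add: prime_ideal_def)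
  interpret surj_ring_hom R "R Quot P" "a_r_coset R P" by (rule surj_ring_hom_quot) fact
  show ?thesis using prime_pre_iff[of "{\<zero>\<^bsub>R Quot P\<^esub>}"] assms pre_zero_quot[OF i] by simp
qed

section \<open>The strong equivalence implies the equivalence\<close>

text \<open>The closure of {P} consists of the primes containing P, and P must be isolated there by
  an open set. An element outside P of the ideal defining that open set lies in all the other primes
  of the closure; conversely the ideal generated by such an x defines an open set that
  works.\<close>

lemma locally_closed_prime_iff:
  fixes R :: "'a ring" (structure)
  assumes R: "ring R" and P: "P \<in> spec R"
  shows "locally_closed_prime R P \<longleftrightarrow> (\<exists>x\<in>carrier R. x \<notin> P \<and> (\<forall>Q\<in>spec R. P \<subset> Q \<longrightarrow> x \<in> Q))"
proof -
  interpret ring R by fact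
  note op = openin_zariski_topology[OF R]
  have sp: "ideal Q R" "Q \<noteq> carrier R" "Q \<subseteq> carrier R" if "Q \<in> spec R" for Q
    using specD[OF that] by auto
  have proper: "\<not> carrier R \<subseteq> Q" if "Q \<in> spec R" for Q using sp[OF that] by auto
  have "openin (zariski_topology R) (spec R)"
    unfolding op using proper oneideal by (intro exI[of _ "carrier R"]) auto
  then have ts: "topspace (zariski_topology R) = spec R"
  proof (intro subset_antisym openin_subset)
    have "openin (zariski_topology R) (topspace (zariski_topology R))" by simp
    then show "topspace (zariski_topology R) \<subseteq> spec R" unfolding op by auto
  qed
  show ?thesis
  proof
    assume "locally_closed_prime R P"
    then obtain U C where U: "openin (zariski_topology R) U" and C: "closedin (zariski_topology R) C"
      and PUC: "{P} = U \<inter> C" by (auto simp: locally_closed_prime_def)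
    obtain I where I: "ideal I R" "U = {Q \<in> spec R. \<not> I \<subseteq> Q}" using U op by auto
    obtain J where J: "spec R - C = {Q \<in> spec R. \<not> J \<subseteq> Q}" using C op ts by (auto simp: closedin_def)
    have "P \<in> U" "P \<in> C" using PUC by auto
    then obtain x where x: "x \<in> I" "x \<notin> P" and JP: "J \<subseteq> P" using I J P by auto
    have "x \<in> Q" if Q: "Q \<in> spec R" "P \<subset> Q" for Q
    proof -
      have "Q \<in> C" using Q JP J by auto
      then have "Q \<notin> U" using PUC Q by auto
      then show ?thesis using I Q x by auto
    qed
    then show "\<exists>x\<in>carrier R. x \<notin> P \<and> (\<forall>Q\<in>spec R. P \<subset> Q \<longrightarrow> x \<in> Q)"
      using x ideal.Icarr[OF I(1)] by auto
  next
    assume "\<exists>x\<in>carrier R. x \<notin> P \<and> (\<forall>Q\<in>spec R. P \<subset> Q \<longrightarrow> x \<in> Q)"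
    then obtain x where x: "x \<in> carrier R" "x \<notin> P" "\<And>Q. Q \<in> spec R \<Longrightarrow> P \<subset> Q \<Longrightarrow> x \<in> Q" by auto
    have I: "ideal (Idl {x}) R" using x by (intro genideal_ideal) auto
    define U where "U = {Q \<in> spec R. \<not> Idl {x} \<subseteq> Q}"
    define C where "C = {Q \<in> spec R. P \<subseteq> Q}"
    have "openin (zariski_topology R) U" unfolding op U_def using I by auto
    moreover have "closedin (zariski_topology R) C"
      unfolding closedin_def ts op C_def using sp[OF P] by (auto intro!: exI[of _ P])
    moreover have "{P} = U \<inter> C"
    proof -
      have "x \<in> Idl {x}" using genideal_self'[OF x(1)] .
      moreover have "Idl {x} \<subseteq> Q" if "Q \<in> spec R" "P \<subset> Q" for Q
        using x(3)[OF that] sp[OF that(1)] by (intro genideal_minimal) auto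
      ultimately show ?thesis using P x(2) by (auto simp: U_def C_def)
    qed
    ultimately show "locally_closed_prime R P" unfolding locally_closed_prime_def by blast
  qed
qed

text \<open>A supremum in \<open>enat\<close> exceeds d only if a member does, so a single chain
  witnesses a lower bound even when the height is infinite.\<close>

lemma enat_less_height_iff:
  "enat d < height R P \<longleftrightarrow> (\<exists>n>d. \<exists>C. (\<forall>i\<le>n. C i \<in> spec R) \<and> (\<forall>i<n. C i \<subset> C (Suc i)) \<and> C n = P)"
  unfolding height_def less_Sup_iff
proof (intro iffI; elim bexE exE conjE)
  fix a assume "a \<in> {enat n |n. \<exists>C. (\<forall>i\<le>n. C i \<in> spec R) \<and> (\<forall>i<n. C i \<subset> C (Suc i)) \<and> C n = P}" "enat d < a"
  then obtain n where "a = enat n"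
    "\<exists>C. (\<forall>i\<le>n. C i \<in> spec R) \<and> (\<forall>i<n. C i \<subset> C (Suc i)) \<and> C n = P" by auto
  then show "\<exists>n>d. \<exists>C. (\<forall>i\<le>n. C i \<in> spec R) \<and> (\<forall>i<n. C i \<subset> C (Suc i)) \<and> C n = P"
    using \<open>enat d < a\<close> by (intro exI[of _ n]) simp
next
  fix n C assume "d < n" "\<forall>i\<le>n. C i \<in> spec R" "\<forall>i<n. C i \<subset> C (Suc i)" "C n = P"
  then show "\<exists>a\<in>{enat n |n. \<exists>C. (\<forall>i\<le>n. C i \<in> spec R) \<and> (\<forall>i<n. C i \<subset> C (Suc i)) \<and> C n = P}. enat d < a"
    by (intro bexI[of _ "enat n"] CollectI exI[of _ n]) auto
qed

lemma height_eq_0_iff: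
  fixes A :: "'a ring" (structure)
  assumes A: "prime_ideal A {\<zero>}" and Q: "Q \<in> spec A"
  shows "height A Q = 0 \<longleftrightarrow> Q = {\<zero>}"
proof
  assume 0: "height A Q = 0"
  show "Q = {\<zero>}"
  proof (rule ccontr)
    assume "Q \<noteq> {\<zero>}"
    moreover have "\<zero> \<in> Q" using Q additive_subgroup.zero_closed
      by (auto simp: spec_def prime_ideal_def ideal_def)
    ultimately have "{\<zero>} \<subset> Q" by auto
    then have "enat 0 < height A Q" unfolding enat_less_height_iff using A Q
      by (intro exI[of _ 1] conjI exI[of _ "\<lambda>i. if i = 0 then {\<zero>} else Q"]) (auto simp: spec_def)
    then show False using 0 by (simp add: zero_enat_def)
  qed
next
  assume Q0: "Q = {\<zero>}"
  have "\<not> enat 0 < height A Q"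
  proof
    assume "enat 0 < height A Q"
    then obtain n C where C: "n > 0" "\<And>i. i \<le> n \<Longrightarrow> C i \<in> spec A" "\<And>i. i < n \<Longrightarrow> C i \<subset> C (Suc i)" "C n = Q"
      unfolding enat_less_height_iff by auto
    obtain m where m: "n = Suc m" using C(1) by (cases n) auto
    have "C m \<subset> {\<zero>}" using C(3)[of m] C(4) m Q0 by auto
    moreover have "\<zero> \<in> C m" using C(2)[of m] m additive_subgroup.zero_closed
      by (auto simp: spec_def prime_ideal_def ideal_def)
    ultimately show False by auto
  qed
  then show "height A Q = 0" by (simp add: zero_enat_def[symmetric])
qed

text \<open>Nonempty infima in \<open>enat\<close> are attained by well-ordering. The empty infimum
  is \<infinity>, so both sides fail for the empty set.\<close>

lemma Inf_enat_eq_0_iff: "Inf (S :: enat set) = 0 \<longleftrightarrow> 0 \<in> S"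
proof
  assume "Inf S = 0"
  then show "0 \<in> S" by (auto simp: Inf_enat_def split: if_splits intro: LeastI) (metis LeastI)
qed (use Inf_lower[of 0 S] in simp)

text \<open>In the prime ring R/P the primes of positive height are the nonzero ones, and they
  correspond to the primes of R strictly above P. So the condition for d = 0 is the criterion of
  \<open>locally_closed_prime_iff\<close>.\<close>

lemma loc_deg_eq_0_iff:
  fixes R :: "'a ring" (structure)
  assumes R: "ring R" and P: "P \<in> spec R"
  shows "loc_deg R P = 0 \<longleftrightarrow> locally_closed_prime R P"
proof -
  have pP: "prime_ideal R P" and i: "ideal P R" using P by (auto simp: spec_def prime_ideal_def)
  interpret surj_ring_hom R "R Quot P" "a_r_coset R P" by (rule surj_ring_hom_quot) fact
  let ?A = "R Quot P"
  note p0 = pre_zero_quot[OF i] and pz = prime_quot_zero[OF pP]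
  define M where "M = carrier ?A \<inter> \<Inter>{Q \<in> spec ?A. 0 < height ?A Q}"
  have sub: "Q \<subseteq> carrier ?A" "\<zero>\<^bsub>?A\<^esub> \<in> Q" if "Q \<in> spec ?A" for Q
    using specD[OF that] by auto
  have ht: "0 < height ?A Q \<longleftrightarrow> P \<subset> pre Q" if "Q \<in> spec ?A" for Q
  proof -
    have "0 < height ?A Q \<longleftrightarrow> {\<zero>\<^bsub>?A\<^esub>} \<subset> Q" using height_eq_0_iff[OF pz that] sub[OF that] by auto
    also have "\<dots> \<longleftrightarrow> P \<subset> pre Q" using pre_psubset_iff[of "{\<zero>\<^bsub>?A\<^esub>}" Q] sub[OF that] p0 by simp
    finally show ?thesis .
  qed
  have "loc_deg R P = 0 \<longleftrightarrow> M \<noteq> {\<zero>\<^bsub>?A\<^esub>}"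
  proof -
    have *: "(\<exists>d. 0 = enat d \<and> F d) \<longleftrightarrow> F 0" for F by (auto simp: zero_enat_def)
    show ?thesis
      unfolding loc_deg_def Let_def Inf_enat_eq_0_iff mem_Collect_eq * unfolding M_def zero_enat_def ..
  qed
  also have "\<dots> \<longleftrightarrow> (\<exists>x\<in>carrier R. x \<notin> P \<and> (\<forall>Q\<in>spec R. P \<subset> Q \<longrightarrow> x \<in> Q))"
  proof -
    have "\<zero>\<^bsub>?A\<^esub> \<in> M" using sub by (auto simp: M_def)
    then have "M \<noteq> {\<zero>\<^bsub>?A\<^esub>} \<longleftrightarrow> (\<exists>y\<in>carrier ?A. y \<noteq> \<zero>\<^bsub>?A\<^esub> \<and> y \<in> M)" by (auto simp: M_def)
    also have "\<dots> \<longleftrightarrow> (\<exists>x\<in>carrier R. P +> x \<noteq> \<zero>\<^bsub>?A\<^esub> \<and> P +> x \<in> M)"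
      using ball_S[of "\<lambda>y. \<not> (y \<noteq> \<zero>\<^bsub>?A\<^esub> \<and> y \<in> M)"] by blast
    also have "\<dots> \<longleftrightarrow> (\<exists>x\<in>carrier R. x \<notin> P \<and> (\<forall>Q\<in>spec R. P \<subset> Q \<longrightarrow> x \<in> Q))"
    proof (intro bex_cong refl conj_cong)
      fix x assume x: "x \<in> carrier R"
      show "P +> x \<noteq> \<zero>\<^bsub>?A\<^esub> \<longleftrightarrow> x \<notin> P" using p0 x by (auto simp: pre_def)
      show "P +> x \<in> M \<longleftrightarrow> (\<forall>Q\<in>spec R. P \<subset> Q \<longrightarrow> x \<in> Q)"
      proof
        assume xM: "P +> x \<in> M"
        show "\<forall>Q\<in>spec R. P \<subset> Q \<longrightarrow> x \<in> Q"
        proof (intro ballI impI)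
          fix Q assume Q: "Q \<in> spec R" "P \<subset> Q"
          then have iQ: "ideal Q R" by (simp add: spec_def prime_ideal_def)
          then have pQ: "pre (a_r_coset R P ` Q) = Q"
            using p0 Q by (intro pre_img) (auto simp: ideal_def)
          have s: "a_r_coset R P ` Q \<subseteq> carrier ?A" using ideal.Icarr[OF iQ] by auto
          have "a_r_coset R P ` Q \<in> spec ?A" using spec_pre_iff[OF s] pQ Q by simp
          then have "P +> x \<in> a_r_coset R P ` Q" using ht pQ Q xM by (auto simp: M_def)
          then show "x \<in> Q" using pQ x by (auto simp: pre_def)
        qed
      next
        assume a: "\<forall>Q\<in>spec R. P \<subset> Q \<longrightarrow> x \<in> Q"
        have "P +> x \<in> Q" if "Q \<in> spec ?A" "0 < height ?A Q" for Q
          using a spec_pre_iff[OF sub(1)[OF that(1)]] ht[OF that(1)] that by (auto simp: pre_def)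
        then show "P +> x \<in> M" using x by (auto simp: M_def)
      qed
    qed
    finally show ?thesis .
  qed
  also have "\<dots> \<longleftrightarrow> locally_closed_prime R P" using locally_closed_prime_iff[OF R P] by simp
  finally show ?thesis .
qed

text \<open>Let P be the bound of L and aRb inside P with b outside P. Some bx lies outside L, so L
  + Rbx = R by maximality; multiplying by a on the left gives aR inside L.\<close>

lemma primitive_imp_prime:
  fixes R :: "'a ring" (structure)
  assumes R: "ring R" and P: "primitive_ideal R P" shows "prime_ideal R P"
proof -
  interpret ring R by fact
  obtain L where L: "maximal_left_ideal R L" and PL: "P = bound_of R L"
    using P by (auto simp: primitive_ideal_iff[OF R])
  have l: "left_ideal R L" using L by (simp add: maximal_left_ideal_def)
  note D = left_idealD[OF l]
  have "\<one> \<notin> L" using D(1) D(4)[of _ \<one>] L by (auto simp: maximal_left_ideal_def)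
  then have "\<one> \<notin> P" by (auto simp: PL bound_of_def)
  then have ne: "P \<noteq> carrier R" by auto
  have iP: "ideal P R"
  proof (rule idealI')
    show "r \<otimes> x \<in> P" "x \<otimes> r \<in> P" if "r \<in> carrier R" "x \<in> P" for r x
      using that D by (auto simp: PL bound_of_def m_assoc)
  qed (use R D in \<open>auto simp: PL bound_of_def l_distr\<close>)
  have "a \<in> P \<or> b \<in> P"
    if ab: "a \<in> carrier R" "b \<in> carrier R" "\<forall>x\<in>carrier R. a \<otimes> x \<otimes> b \<in> P" for a b
  proof (cases "b \<in> P")
    case False
    then obtain x where x: "x \<in> carrier R" "b \<otimes> x \<notin> L" using ab by (auto simp: PL bound_of_def)
    define L' where "L' = {l \<oplus> s \<otimes> (b \<otimes> x) |l s. l \<in> L \<and> s \<in> carrier R}"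
    have "left_ideal R L'"
    proof (rule left_idealI)
      show "L' \<subseteq> carrier R" using D(1) ab x by (auto simp: L'_def)
      have "\<zero> = \<zero> \<oplus> \<zero> \<otimes> (b \<otimes> x)" using ab x by simp
      then show "\<zero> \<in> L'" unfolding L'_def using D(2) by blast
      show "y \<oplus> z \<in> L'" if yz: "y \<in> L'" "z \<in> L'" for y z
      proof -
        obtain l s l' s' where *: "l \<in> L" "s \<in> carrier R" "l' \<in> L" "s' \<in> carrier R"
          "y = l \<oplus> s \<otimes> (b \<otimes> x)" "z = l' \<oplus> s' \<otimes> (b \<otimes> x)" using yz by (auto simp: L'_def)
        have lc: "l \<in> carrier R" "l' \<in> carrier R" using * D(1) by auto
        have "y \<oplus> z = (l \<oplus> l') \<oplus> (s \<oplus> s') \<otimes> (b \<otimes> x)"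
          unfolding *(5,6) using *(2,4) lc ab x by (simp add: l_distr a_ac)
        then show ?thesis unfolding L'_def using * D(3) by blast
      qed
      show "r \<otimes> y \<in> L'" if ry: "r \<in> carrier R" "y \<in> L'" for r y
      proof -
        obtain l s where *: "l \<in> L" "s \<in> carrier R" "y = l \<oplus> s \<otimes> (b \<otimes> x)" using ry by (auto simp: L'_def)
        have lc: "l \<in> carrier R" using * D(1) by auto
        have "r \<otimes> y = r \<otimes> l \<oplus> (r \<otimes> s) \<otimes> (b \<otimes> x)"
          unfolding *(3) using *(2) lc ab x ry by (simp add: r_distr m_assoc)
        then show ?thesis unfolding L'_def using * D(4)[OF ry(1)] ry(1) by blast
      qed
    qed (rule R)
    moreover have "L \<subseteq> L'"
    proof
      fix l assume "l \<in> L"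
      moreover have "l = l \<oplus> \<zero> \<otimes> (b \<otimes> x)" using ab x calculation D(1) by auto
      ultimately show "l \<in> L'" unfolding L'_def by blast
    qed
    moreover have "b \<otimes> x \<in> L'"
    proof -
      have "b \<otimes> x = \<zero> \<oplus> \<one> \<otimes> (b \<otimes> x)" using ab x by simp
      then show ?thesis unfolding L'_def using D(2) by blast
    qed
    moreover have "L' = L \<or> L' = carrier R"
      using L calculation(1,2) by (simp add: maximal_left_ideal_def)
    ultimately have L': "L' = carrier R" using x by auto
    have "a \<otimes> r \<in> L" if "r \<in> carrier R" for r
    proof -
      have "r \<in> L'" using that L' by simp
      then obtain l s where *: "l \<in> L" "s \<in> carrier R" "r = l \<oplus> s \<otimes> (b \<otimes> x)" by (auto simp: L'_def)
      have lc: "l \<in> carrier R" using * D(1) by auto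
      have "a \<otimes> r = a \<otimes> l \<oplus> (a \<otimes> s \<otimes> b) \<otimes> x"
        unfolding *(3) using *(2) lc ab x by (simp add: r_distr m_assoc)
      moreover have "(a \<otimes> s \<otimes> b) \<otimes> x \<in> L" using ab(3) *(2) x by (auto simp: PL bound_of_def)
      ultimately show ?thesis using D(3) D(4)[OF ab(1) *(1)] by simp
    qed
    then show ?thesis using ab by (simp add: PL bound_of_def)
  qed auto
  then show ?thesis using iP ne by (auto simp: prime_ideal_iff[OF R])
qed

text \<open>The infimum is 0 only if a primitive ideal of height 0 occurs, and in the prime ring R/P
  only the zero ideal has height 0 among the primes.\<close>

lemma prim_deg_eq_0_iff:
  fixes R :: "'a ring" (structure)
  assumes R: "ring R" and P: "P \<in> spec R"
  shows "prim_deg R P = 0 \<longleftrightarrow> primitive_ideal R P"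
proof -
  have pP: "prime_ideal R P" and i: "ideal P R" using P by (auto simp: spec_def prime_ideal_def)
  interpret surj_ring_hom R "R Quot P" "a_r_coset R P" by (rule surj_ring_hom_quot) fact
  let ?A = "R Quot P"
  note p0 = pre_zero_quot[OF i] and pz = prime_quot_zero[OF pP]
  have "prim_deg R P = 0 \<longleftrightarrow> (\<exists>Q. primitive_ideal ?A Q \<and> height ?A Q = 0)"
    unfolding prim_deg_def Inf_enat_eq_0_iff mem_Collect_eq by metis
  also have "\<dots> \<longleftrightarrow> primitive_ideal ?A {\<zero>\<^bsub>?A\<^esub>}"
    using height_eq_0_iff[OF pz] primitive_imp_prime[OF S.ring_axioms] pz by (auto simp: spec_def)
  also have "\<dots> \<longleftrightarrow> primitive_ideal R P" using primitive_pre_iff[of "{\<zero>\<^bsub>?A\<^esub>}"] p0 by simp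
  finally show ?thesis .
qed

section \<open>Algebraic elements and transcendence degree zero\<close>

lemma (in ring) eval_rev:
  assumes "set cs \<subseteq> carrier R" "z \<in> carrier R"
  shows "eval (rev cs) z = (\<Oplus>i\<in>{..<length cs}. cs ! i \<otimes> z [^] i)"
  using assms(1)
proof (induction cs rule: rev_induct)
  case (snoc c cs)
  have cl: "cs ! i \<in> carrier R" if "i < length cs" for i using snoc.prems that nth_mem by fastforce
  have "(\<Oplus>i\<in>{..<length (cs @ [c])}. (cs @ [c]) ! i \<otimes> z [^] i)
      = c \<otimes> z [^] length cs \<oplus> (\<Oplus>i\<in>{..<length cs}. (cs @ [c]) ! i \<otimes> z [^] i)"
    using snoc.prems assms(2) cl
    by (simp add: lessThan_Suc nth_append Pi_def)
  also have "(\<Oplus>i\<in>{..<length cs}. (cs @ [c]) ! i \<otimes> z [^] i) = eval (rev cs) z"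
    using snoc cl assms(2) by (auto simp: nth_append intro!: finsum_cong')
  finally show ?case by simp
qed simp

text \<open>This bridges two encodings: library polynomials are coefficient lists headed by a
  nonzero leading coefficient, whereas \<open>algebraically_independent\<close> speaks of sums over
  a finite set of exponents.\<close>

lemma (in domain) algebraic_iff:
  assumes F: "subring F R" and z: "z \<in> carrier R"
  shows "algebraic F z \<longleftrightarrow> (\<exists>I :: nat set. \<exists>c. finite I \<and> c \<in> I \<rightarrow> F \<and> (\<exists>i\<in>I. c i \<noteq> \<zero>) \<and>
           (\<Oplus>i\<in>I. c i \<otimes> z [^] i) = \<zero>)"
proof
  note Fc = subringE(1)[OF F]
  assume "algebraic F z"
  then obtain p where p: "p \<in> carrier (F [X])" "p \<noteq> []" "eval p z = \<zero>"
    using algebraicE[OF F z] by (auto simp: over_def)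
  then have pF: "set p \<subseteq> F" "hd p \<noteq> \<zero>" by (auto simp: univ_poly_def polynomial_def)
  define cs where "cs = rev p"
  have "(\<Oplus>i\<in>{..<length cs}. cs ! i \<otimes> z [^] i) = \<zero>"
    using eval_rev[of cs z] p pF Fc z by (auto simp: cs_def)
  moreover have "cs ! (length cs - 1) \<noteq> \<zero>" "length cs > 0"
    using pF p(2) by (auto simp: cs_def rev_nth hd_conv_nth)
  moreover have "cs ! i \<in> F" if "i < length cs" for i
    using pF that nth_mem[of i cs] by (auto simp: cs_def)
  ultimately show "\<exists>I :: nat set. \<exists>c. finite I \<and> c \<in> I \<rightarrow> F \<and> (\<exists>i\<in>I. c i \<noteq> \<zero>) \<and> (\<Oplus>i\<in>I. c i \<otimes> z [^] i) = \<zero>"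
    by (intro exI[of _ "{..<length cs}"] exI[of _ "\<lambda>i. cs ! i"]) (auto intro!: bexI[of _ "length cs - 1"])
next
  note Fc = subringE(1)[OF F]
  assume "\<exists>I :: nat set. \<exists>c. finite I \<and> c \<in> I \<rightarrow> F \<and> (\<exists>i\<in>I. c i \<noteq> \<zero>) \<and> (\<Oplus>i\<in>I. c i \<otimes> z [^] i) = \<zero>"
  then obtain I :: "nat set" and c where I: "finite I" "\<And>i. i \<in> I \<Longrightarrow> c i \<in> F" "\<exists>i\<in>I. c i \<noteq> \<zero>"
    and sum: "(\<Oplus>i\<in>I. c i \<otimes> z [^] i) = \<zero>" by (auto simp: Pi_def)
  \<comment> \<open>Restricting to the indices with nonzero coefficient ensures that the coefficient
    at the maximum n may head a polynomial list.\<close>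
  define J where "J = {i \<in> I. c i \<noteq> \<zero>}"
  have J: "finite J" "J \<noteq> {}" using I by (auto simp: J_def)
  define n where "n = Max J"
  have nJ: "n \<in> J" using J by (simp add: n_def)
  have nmax: "i \<le> n" if "i \<in> J" for i using J that by (simp add: n_def)
  define d where "d = (\<lambda>i. if i \<in> J then c i else \<zero>)"
  define cs where "cs = map d [0..<Suc n]"
  have dF: "d i \<in> F" for i using I subringE(2)[OF F] by (auto simp: d_def J_def)
  have dn: "d n \<noteq> \<zero>" using nJ by (simp add: d_def J_def)
  have dc: "d i \<in> carrier R" for i using dF Fc by auto
  have cc: "c i \<in> carrier R" if "i \<in> I" for i using I Fc that by auto
  have "eval (rev cs) z = (\<Oplus>i\<in>{..<length cs}. cs ! i \<otimes> z [^] i)"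
    using dc by (intro eval_rev z) (auto simp: cs_def)
  also have "\<dots> = (\<Oplus>i\<in>{..<Suc n}. d i \<otimes> z [^] i)"
    using dc z by (intro finsum_cong') (auto simp: cs_def simp del: upt_Suc)
  also have "\<dots> = (\<Oplus>i\<in>J. d i \<otimes> z [^] i)"
    using nmax dc z by (intro add.finprod_mono_neutral_cong_left[symmetric]) (auto simp: d_def less_Suc_eq_le)
  also have "\<dots> = (\<Oplus>i\<in>I. c i \<otimes> z [^] i)"
    using I z dc cc by (intro add.finprod_mono_neutral_cong_left) (auto simp: d_def J_def)
  finally have "eval (rev cs) z = \<zero>" using sum by simp
  moreover have "rev cs = d n # rev (map d [0..<n])" by (simp add: cs_def)
  then have "rev cs \<in> carrier (F [X])" "rev cs \<noteq> []"
    using dF dn by (auto simp: univ_poly_def polynomial_def)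
  ultimately have "(algebraic over F) z" by (intro algebraicI)
  then show "algebraic F z" by (simp add: over_def)
qed

text \<open>For a singleton {z}, exponent vectors are plain exponents, so dependence of {z} is
  algebraicity of z. Larger sets reduce to this, because a relation satisfied by one member is a
  relation for the whole set.\<close>

lemma transcendence_degree_eq_0_iff:
  fixes Z :: "'a ring" (structure)
  assumes Z: "domain Z" and F: "subring F Z"
  shows "transcendence_degree Z F = 0 \<longleftrightarrow> (\<forall>z\<in>carrier Z. ring.algebraic Z F z)"
proof -
  interpret domain Z by fact
  note Fc = subringE(1)[OF F]
  have "transcendence_degree Z F = 0 \<longleftrightarrow> (\<forall>S. algebraically_independent Z F S \<longrightarrow> card S = 0)"
    unfolding transcendence_degree_def using Sup_bot_conv(1)[where 'a = enat]
    by (auto simp: bot_enat_def zero_enat_def)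
  also have "\<dots> \<longleftrightarrow> (\<forall>z\<in>carrier Z. algebraic F z)"
  proof (intro iffI ballI allI impI)
    fix z assume no: "\<forall>S. algebraically_independent Z F S \<longrightarrow> card S = 0" and z: "z \<in> carrier Z"
    have "\<not> algebraically_independent Z F {z}" using no by fastforce
    then obtain E :: "('a \<Rightarrow> nat) set" and c e0 where E: "finite E" "\<And>e x. e \<in> E \<Longrightarrow> x \<noteq> z \<Longrightarrow> e x = 0"
      "c \<in> E \<rightarrow> F" and s: "(\<Oplus>e\<in>E. c e \<otimes> (\<Otimes>x\<in>{z}. x [^] e x)) = \<zero>" and e0: "e0 \<in> E" "c e0 \<noteq> \<zero>"
      using z unfolding algebraically_independent_def by auto
    \<comment> \<open>The exponent vector supported at z; it inverts evaluation at z on the vectors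
      that vanish elsewhere.\<close>
    define m where "m = (\<lambda>i x. if x = z then i else (0::nat))"
    have me: "m (e z) = e" if "e \<in> E" for e using E(2)[OF that] by (auto simp: m_def)
    have inj: "inj_on (\<lambda>e. e z) E" by (rule inj_on_inverseI[of _ m]) (rule me)
    have cc: "c e \<in> carrier Z" if "e \<in> E" for e using E(3) Fc that by auto
    have "(\<Oplus>i\<in>(\<lambda>e. e z) ` E. c (m i) \<otimes> z [^] i) = (\<Oplus>e\<in>E. c (m (e z)) \<otimes> z [^] (e z))"
      using z cc me by (intro add.finprod_reindex inj) auto
    also have "\<dots> = (\<Oplus>e\<in>E. c e \<otimes> (\<Otimes>x\<in>{z}. x [^] e x))"
      using z cc me by (intro finsum_cong') auto
    finally have "(\<Oplus>i\<in>(\<lambda>e. e z) ` E. c (m i) \<otimes> z [^] i) = \<zero>" using s by simp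
    moreover have "(\<lambda>i. c (m i)) \<in> (\<lambda>e. e z) ` E \<rightarrow> F" using E(3) me by auto
    moreover have "\<exists>i\<in>(\<lambda>e. e z) ` E. c (m i) \<noteq> \<zero>" using e0 me by (auto intro!: bexI[of _ e0])
    ultimately show "algebraic F z" unfolding algebraic_iff[OF F z] using E(1)
      by (intro exI[of _ "(\<lambda>e. e z) ` E"] exI[of _ "\<lambda>i. c (m i)"]) auto
  next
    fix S assume alg: "\<forall>z\<in>carrier Z. algebraic F z" and S: "algebraically_independent Z F S"
    have Sf: "S \<subseteq> carrier Z" "finite S" using S by (auto simp: algebraically_independent_def)
    show "card S = 0"
    proof (rule ccontr)
      assume "card S \<noteq> 0"
      then obtain z where zS: "z \<in> S" by fastforce
      then have z: "z \<in> carrier Z" using Sf by auto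
      obtain I :: "nat set" and c where I: "finite I" "\<And>i. i \<in> I \<Longrightarrow> c i \<in> F" "\<exists>i\<in>I. c i \<noteq> \<zero>"
        and s: "(\<Oplus>i\<in>I. c i \<otimes> z [^] i) = \<zero>" using alg z algebraic_iff[OF F z] by (auto simp: Pi_def)
      have cc: "c i \<in> carrier Z" if "i \<in> I" for i using I Fc that by auto
      define m where "m = (\<lambda>i x. if x = z then i else (0::nat))"
      have mz: "m i z = i" for i by (simp add: m_def)
      have inj: "inj_on m I" by (rule inj_on_inverseI[of _ "\<lambda>e. e z"]) (rule mz)
      have pr: "(\<Otimes>x\<in>S. x [^] m i x) = z [^] i" for i
      proof -
        have "(\<Otimes>x\<in>S. x [^] m i x) = (\<Otimes>x\<in>S. if z = x then x [^] i else \<one>)"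
          using Sf by (intro finprod_cong') (auto simp: m_def)
        also have "\<dots> = z [^] i" using Sf zS by (intro finprod_singleton) auto
        finally show ?thesis .
      qed
      have "(\<Oplus>e\<in>m ` I. c (e z) \<otimes> (\<Otimes>x\<in>S. x [^] e x)) = (\<Oplus>i\<in>I. c (m i z) \<otimes> (\<Otimes>x\<in>S. x [^] m i x))"
        using cc z mz pr by (intro add.finprod_reindex inj) auto
      also have "\<dots> = \<zero>" using s by (simp add: pr mz)
      finally have f4: "(\<Oplus>e\<in>m ` I. c (e z) \<otimes> (\<Otimes>x\<in>S. x [^] e x)) = \<zero>" .
      have f2: "\<forall>e\<in>m ` I. \<forall>x. x \<notin> S \<longrightarrow> e x = 0" using zS by (auto simp: m_def)
      have f3: "(\<lambda>e. c (e z)) \<in> m ` I \<rightarrow> F" using I mz by auto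
      have f1: "finite (m ` I)" using I(1) by simp
      have imp: "finite E \<and> (\<forall>e\<in>E. \<forall>x. x \<notin> S \<longrightarrow> e x = 0) \<and> d \<in> E \<rightarrow> F \<and>
        (\<Oplus>e\<in>E. d e \<otimes> (\<Otimes>x\<in>S. x [^] e x)) = \<zero> \<longrightarrow> (\<forall>e\<in>E. d e = \<zero>)" for E :: "('a \<Rightarrow> nat) set" and d
        using S unfolding algebraically_independent_def by (elim conjE) (drule spec[of _ E], drule spec[of _ d])
      have "\<forall>e\<in>m ` I. c (e z) = \<zero>"
        by (rule imp[THEN mp, OF conjI[OF f1 conjI[OF f2 conjI[OF f3 f4]]]])
      then show False using I(3) mz by auto
    qed
  qed
  finally show ?thesis .
qed

section \<open>The centre of a Goldie quotient ring\<close>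

lemma regular_carrier: "regular_elements A \<subseteq> carrier A"
  unfolding regular_elements_def by blast

lemma goldie_unit:
  assumes G: "goldie_quotient_ring A Q \<iota>" and s: "s \<in> regular_elements A"
  shows "\<iota> s \<in> carrier Q" "\<iota> s \<in> Units Q" "inv\<^bsub>Q\<^esub> (\<iota> s) \<in> carrier Q"
    "inv\<^bsub>Q\<^esub> (\<iota> s) \<otimes>\<^bsub>Q\<^esub> \<iota> s = \<one>\<^bsub>Q\<^esub>" "\<iota> s \<otimes>\<^bsub>Q\<^esub> inv\<^bsub>Q\<^esub> (\<iota> s) = \<one>\<^bsub>Q\<^esub>"
proof -
  interpret Q: ring Q using G by (simp add: goldie_quotient_ring_def)
  show u: "\<iota> s \<in> Units Q" using G s by (auto simp: goldie_quotient_ring_def)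
  show "\<iota> s \<in> carrier Q" "inv\<^bsub>Q\<^esub> (\<iota> s) \<in> carrier Q"
    "inv\<^bsub>Q\<^esub> (\<iota> s) \<otimes>\<^bsub>Q\<^esub> \<iota> s = \<one>\<^bsub>Q\<^esub>" "\<iota> s \<otimes>\<^bsub>Q\<^esub> inv\<^bsub>Q\<^esub> (\<iota> s) = \<one>\<^bsub>Q\<^esub>"
    using u by auto
qed

lemma goldie_hom:
  assumes G: "goldie_quotient_ring A Q \<iota>"
  shows "ring_hom_ring A Q \<iota>"
  using G by (auto simp: goldie_quotient_ring_def intro!: ring_hom_ringI2)

lemma goldie_right_fraction:
  assumes G: "goldie_quotient_ring A Q \<iota>" and q: "q \<in> carrier Q"
  obtains a s where "a \<in> carrier A" "s \<in> regular_elements A" "q \<otimes>\<^bsub>Q\<^esub> \<iota> s = \<iota> a" "q = \<iota> a \<otimes>\<^bsub>Q\<^esub> inv\<^bsub>Q\<^esub> (\<iota> s)"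
proof -
  have "\<exists>a\<in>carrier A. \<exists>s\<in>regular_elements A. q = \<iota> a \<otimes>\<^bsub>Q\<^esub> inv\<^bsub>Q\<^esub> (\<iota> s)"
    using G q by (simp add: goldie_quotient_ring_def)
  then obtain a s where as: "a \<in> carrier A" "s \<in> regular_elements A" "q = \<iota> a \<otimes>\<^bsub>Q\<^esub> inv\<^bsub>Q\<^esub> (\<iota> s)"
    by (elim bexE)
  interpret ring_hom_ring A Q \<iota> by (rule goldie_hom) fact
  have "q \<otimes>\<^bsub>Q\<^esub> \<iota> s = \<iota> a" unfolding as(3) using as(1) goldie_unit[OF G as(2)] by (simp add: S.m_assoc)
  then show ?thesis using that as by blast
qed

lemma center_subring:
  fixes Q :: "'q ring" (structure)
  assumes "ring Q" shows "subring (center Q) Q"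
proof -
  interpret ring Q by fact
  show ?thesis
  proof (rule subringI)
    show "\<ominus> h \<in> center Q" if "h \<in> center Q" for h
      using that by (auto simp: center_def l_minus r_minus)
    show "h \<otimes> k \<in> center Q" if h: "h \<in> center Q" and k: "k \<in> center Q" for h k
    proof -
      have hc: "h \<in> carrier Q" "k \<in> carrier Q" using h k by (simp_all add: center_def)
      have hx: "h \<otimes> y = y \<otimes> h" "k \<otimes> y = y \<otimes> k" if "y \<in> carrier Q" for y
        using h k that unfolding center_def by blast+
      have "h \<otimes> k \<otimes> x = x \<otimes> (h \<otimes> k)" if "x \<in> carrier Q" for x
      proof -
        have "h \<otimes> k \<otimes> x = h \<otimes> (k \<otimes> x)" using hc that by (simp add: m_assoc)
        also have "\<dots> = h \<otimes> x \<otimes> k" unfolding hx(2)[OF that] using hc that by (simp add: m_assoc)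
        also have "\<dots> = x \<otimes> (h \<otimes> k)" unfolding hx(1)[OF that] using hc that by (simp add: m_assoc)
        finally show ?thesis .
      qed
      then show ?thesis using m_closed[OF hc] unfolding center_def by blast
    qed
  qed (auto simp: center_def l_distr r_distr)
qed

text \<open>Let z = a s^-1 and w = b t^-1 be central with zw = 0. For every x in A, a x b = z s x w
  t = z w s x t = 0, so a or b is 0 because A is prime.\<close>

lemma center_ring_domain:
  assumes G: "goldie_quotient_ring A Q \<iota>" and A: "prime_ideal A {\<zero>\<^bsub>A\<^esub>}"
  shows "domain (center_ring Q)"
proof -
  interpret ring_hom_ring A Q \<iota> by (rule goldie_hom) fact
  have inj: "inj_on \<iota> (carrier A)" using G by (simp add: goldie_quotient_ring_def)
  have sub: "subring (center Q) Q" by (rule center_subring) (rule S.ring_axioms)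
  have zz: "z \<otimes>\<^bsub>Q\<^esub> x = x \<otimes>\<^bsub>Q\<^esub> z" "z \<in> carrier Q" if "z \<in> center Q" "x \<in> carrier Q" for z x
    using that by (auto simp: center_def)
  interpret Z: ring "center_ring Q" unfolding center_ring_def by (rule S.subring_is_ring[OF sub])
  have "cring (center_ring Q)"
  proof (intro cring.intro Z.ring_axioms comm_monoid.intro comm_monoid_axioms.intro)
    show "Group.monoid (center_ring Q)" by unfold_locales
    show "x \<otimes>\<^bsub>center_ring Q\<^esub> y = y \<otimes>\<^bsub>center_ring Q\<^esub> x"
      if "x \<in> carrier (center_ring Q)" "y \<in> carrier (center_ring Q)" for x y
      using that zz(1)[of x y] zz(2)[of y y] zz(2)[of y "\<one>\<^bsub>Q\<^esub>"] by (simp add: center_ring_def)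
  qed
  moreover have "\<one>\<^bsub>Q\<^esub> \<noteq> \<zero>\<^bsub>Q\<^esub>"
  proof
    assume "\<one>\<^bsub>Q\<^esub> = \<zero>\<^bsub>Q\<^esub>"
    then have "\<iota> \<one>\<^bsub>A\<^esub> = \<iota> \<zero>\<^bsub>A\<^esub>" by simp
    then have 10: "\<one>\<^bsub>A\<^esub> = \<zero>\<^bsub>A\<^esub>" using inj by (simp add: inj_on_def)
    have "x = \<zero>\<^bsub>A\<^esub>" if "x \<in> carrier A" for x
      using R.r_one[OF that] R.r_null[OF that] by (simp add: 10)
    then have "carrier A = {\<zero>\<^bsub>A\<^esub>}" using R.zero_closed by auto
    then show False using A by (simp add: prime_ideal_def)
  qed
  moreover have "z = \<zero>\<^bsub>Q\<^esub> \<or> w = \<zero>\<^bsub>Q\<^esub>"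
    if z: "z \<in> center Q" and w: "w \<in> center Q" and 0: "z \<otimes>\<^bsub>Q\<^esub> w = \<zero>\<^bsub>Q\<^esub>" for z w
  proof -
    have zc: "z \<in> carrier Q" "w \<in> carrier Q" using z w by (auto simp: center_def)
    obtain a s where as: "a \<in> carrier A" "s \<in> regular_elements A" "z \<otimes>\<^bsub>Q\<^esub> \<iota> s = \<iota> a"
      "z = \<iota> a \<otimes>\<^bsub>Q\<^esub> inv\<^bsub>Q\<^esub> (\<iota> s)"
      using goldie_right_fraction[OF G zc(1)] by metis
    obtain b t where bt: "b \<in> carrier A" "t \<in> regular_elements A" "w \<otimes>\<^bsub>Q\<^esub> \<iota> t = \<iota> b"
      "w = \<iota> b \<otimes>\<^bsub>Q\<^esub> inv\<^bsub>Q\<^esub> (\<iota> t)"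
      using goldie_right_fraction[OF G zc(2)] by metis
    have st: "s \<in> carrier A" "t \<in> carrier A" using as(2) bt(2) regular_carrier[of A] by auto
    have "a \<otimes>\<^bsub>A\<^esub> x \<otimes>\<^bsub>A\<^esub> b = \<zero>\<^bsub>A\<^esub>" if x: "x \<in> carrier A" for x
    proof -
      let ?y = "\<iota> s \<otimes>\<^bsub>Q\<^esub> \<iota> x"
      have "\<iota> (a \<otimes>\<^bsub>A\<^esub> x \<otimes>\<^bsub>A\<^esub> b) = z \<otimes>\<^bsub>Q\<^esub> \<iota> s \<otimes>\<^bsub>Q\<^esub> \<iota> x \<otimes>\<^bsub>Q\<^esub> (w \<otimes>\<^bsub>Q\<^esub> \<iota> t)"
        unfolding as(3) bt(3) using as(1) bt(1) x by simp
      also have "\<dots> = z \<otimes>\<^bsub>Q\<^esub> ?y \<otimes>\<^bsub>Q\<^esub> (w \<otimes>\<^bsub>Q\<^esub> \<iota> t)" using x st zc by (simp add: S.m_assoc)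
      also have "\<dots> = z \<otimes>\<^bsub>Q\<^esub> (?y \<otimes>\<^bsub>Q\<^esub> w) \<otimes>\<^bsub>Q\<^esub> \<iota> t" using x st zc by (simp add: S.m_assoc)
      also have "?y \<otimes>\<^bsub>Q\<^esub> w = w \<otimes>\<^bsub>Q\<^esub> ?y" using zz(1)[OF w, of ?y] x st by simp
      also have "z \<otimes>\<^bsub>Q\<^esub> (w \<otimes>\<^bsub>Q\<^esub> ?y) \<otimes>\<^bsub>Q\<^esub> \<iota> t = z \<otimes>\<^bsub>Q\<^esub> w \<otimes>\<^bsub>Q\<^esub> (?y \<otimes>\<^bsub>Q\<^esub> \<iota> t)"
        using x st zc by (simp add: S.m_assoc)
      also have "\<dots> = \<iota> \<zero>\<^bsub>A\<^esub>" using 0 x st by simp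
      finally show ?thesis using inj as(1) bt(1) x by (simp add: inj_on_def)
    qed
    then have "a = \<zero>\<^bsub>A\<^esub> \<or> b = \<zero>\<^bsub>A\<^esub>"
      using A as(1) bt(1) by (auto simp: prime_ideal_iff[OF R.ring_axioms])
    then show ?thesis using as(4) bt(4) goldie_unit(3)[OF G as(2)] goldie_unit(3)[OF G bt(2)] by auto
  qed
  ultimately show ?thesis
    unfolding domain_def domain_axioms_def by (auto simp: center_ring_def)
qed

text \<open>An element that commutes with b and s commutes with the fraction b s^-1, as the unit s
  can be cancelled.\<close>

lemma goldie_center:
  assumes G: "goldie_quotient_ring A Q \<iota>" and a: "a \<in> center A"
  shows "\<iota> a \<in> center Q"
proof -
  interpret ring_hom_ring A Q \<iota> by (rule goldie_hom) fact
  have ac: "a \<in> carrier A" using a by (simp add: center_def)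
  have com: "\<iota> a \<otimes>\<^bsub>Q\<^esub> \<iota> b = \<iota> b \<otimes>\<^bsub>Q\<^esub> \<iota> a" if "b \<in> carrier A" for b
    using that a ac hom_mult[of a b] hom_mult[of b a] by (simp add: center_def)
  have "\<iota> a \<otimes>\<^bsub>Q\<^esub> q = q \<otimes>\<^bsub>Q\<^esub> \<iota> a" if q: "q \<in> carrier Q" for q
  proof -
    obtain b s where bs: "b \<in> carrier A" "s \<in> regular_elements A" "q \<otimes>\<^bsub>Q\<^esub> \<iota> s = \<iota> b"
      "q = \<iota> b \<otimes>\<^bsub>Q\<^esub> inv\<^bsub>Q\<^esub> (\<iota> s)"
      using goldie_right_fraction[OF G q] by metis
    have sc: "s \<in> carrier A" using bs(2) regular_carrier[of A] by auto
    note u = goldie_unit[OF G bs(2)]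
    have "\<iota> a \<otimes>\<^bsub>Q\<^esub> q \<otimes>\<^bsub>Q\<^esub> \<iota> s = q \<otimes>\<^bsub>Q\<^esub> (\<iota> s \<otimes>\<^bsub>Q\<^esub> \<iota> a)"
      using com[OF bs(1)] bs(3) that ac u by (simp add: S.m_assoc[symmetric]) (simp add: S.m_assoc)
    also have "\<dots> = q \<otimes>\<^bsub>Q\<^esub> \<iota> a \<otimes>\<^bsub>Q\<^esub> \<iota> s" using com[OF sc] that ac u by (simp add: S.m_assoc)
    finally have "\<iota> a \<otimes>\<^bsub>Q\<^esub> q \<otimes>\<^bsub>Q\<^esub> (\<iota> s \<otimes>\<^bsub>Q\<^esub> inv\<^bsub>Q\<^esub> (\<iota> s)) = q \<otimes>\<^bsub>Q\<^esub> \<iota> a \<otimes>\<^bsub>Q\<^esub> (\<iota> s \<otimes>\<^bsub>Q\<^esub> inv\<^bsub>Q\<^esub> (\<iota> s))"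
      using that ac u(1,3) by (simp add: S.m_assoc[symmetric])
    then show ?thesis using that ac u(5) by simp
  qed
  then show ?thesis using ac by (simp add: center_def)
qed

lemma scalars_subring:
  assumes kR: "k_algebra K R \<eta>" and P: "ideal P R" and G: "goldie_quotient_ring (R Quot P) Q \<iota>"
  shows "subring (scalars_in_quotient K R \<eta> P \<iota>) (center_ring Q)"
proof -
  interpret K: field K using kR by (simp add: k_algebra_def)
  interpret surj_ring_hom R "R Quot P" "a_r_coset R P" by (rule surj_ring_hom_quot) fact
  interpret i: ring_hom_ring "R Quot P" Q \<iota> by (rule goldie_hom) fact
  have sub: "subring (center Q) Q" by (rule center_subring) (rule i.S.ring_axioms)
  have \<eta>: "\<eta> \<in> ring_hom K R" "\<eta> ` carrier K \<subseteq> center R" using kR by (auto simp: k_algebra_def)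
  let ?g = "\<lambda>c. \<iota> (P +>\<^bsub>R\<^esub> \<eta> c)"
  have c: "?g c \<in> center Q" if "c \<in> carrier K" for c
  proof (rule goldie_center[OF G])
    have "\<eta> c \<in> center R" using \<eta> that by auto
    then show "P +>\<^bsub>R\<^esub> \<eta> c \<in> center (R Quot P)"
      by (simp add: center_def ball_S) (metis hom_mult)
  qed
  have "?g \<in> ring_hom K (center_ring Q)"
    using c \<eta>(1) by (intro ring_hom_memI) (auto simp: center_ring_def ring_hom_def Pi_def)
  then interpret g: ring_hom_ring K "center_ring Q" ?g
    using i.S.subring_is_ring[OF sub] by (intro ring_hom_ringI2 K.ring_axioms) (auto simp: center_ring_def)
  show ?thesis unfolding scalars_in_quotient_def
    by (rule g.img_is_subring) (rule K.carrier_is_subring)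
qed

text \<open>The infimum is attained, so value 0 means that some copy of the quotient ring has
  transcendence degree 0; for each copy this is algebraicity of its centre.\<close>

lemma rat_deg_eq_0_iff:
  fixes K :: "'k ring" and R :: "'a ring"
  assumes kR: "k_algebra K R \<eta>" and P: "P \<in> spec R"
  shows "rat_deg K R \<eta> P = 0 \<longleftrightarrow> rational_prime K R \<eta> P"
proof -
  have *: "transcendence_degree (center_ring Q) (scalars_in_quotient K R \<eta> P \<iota>) = 0 \<longleftrightarrow>
      (\<forall>z\<in>center Q. ring.algebraic (center_ring Q) (scalars_in_quotient K R \<eta> P \<iota>) z)"
    if "goldie_quotient_ring (R Quot P) Q \<iota>" for Q :: "('a set \<times> 'a set) set ring" and \<iota>
    using transcendence_degree_eq_0_iff[OF center_ring_domain[OF that prime_quot_zero[OF specD(1)[OF P]]]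
        scalars_subring[OF kR specD(2)[OF P] that]] by (simp add: center_ring_def)
  have **: "(0 = transcendence_degree (center_ring Q) (scalars_in_quotient K R \<eta> P \<iota>) \<and>
      goldie_quotient_ring (R Quot P) Q \<iota>) \<longleftrightarrow> (goldie_quotient_ring (R Quot P) Q \<iota> \<and>
      (\<forall>z\<in>center Q. ring.algebraic (center_ring Q) (scalars_in_quotient K R \<eta> P \<iota>) z))"
    for Q :: "('a set \<times> 'a set) set ring" and \<iota>
    using *[of Q \<iota>] by (intro iffI; elim conjE) simp_all
  show ?thesis
    unfolding rat_deg_def rational_prime_def Inf_enat_eq_0_iff mem_Collect_eq by (simp only: **)
qed

lemma strong_imp_dixmier_moeglin:
  assumes "k_algebra K R \<eta>" "strong_dixmier_moeglin K R \<eta>"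
  shows "dixmier_moeglin K R \<eta>"
proof -
  have "ring R" using assms by (simp add: k_algebra_def)
  then show ?thesis
    using assms loc_deg_eq_0_iff prim_deg_eq_0_iff rat_deg_eq_0_iff
    unfolding dixmier_moeglin_def strong_dixmier_moeglin_def by metis
qed

section \<open>Ore localization of noetherian domains\<close>

text \<open>The opposite ring, through which the left Ore condition is read off from the right
  one.\<close>

definition opp :: "'a ring \<Rightarrow> 'a ring" where
  "opp R = R\<lparr>monoid.mult := \<lambda>x y. y \<otimes>\<^bsub>R\<^esub> x\<rparr>"

lemma opp_simps [simp]:
  "carrier (opp R) = carrier R" "\<zero>\<^bsub>opp R\<^esub> = \<zero>\<^bsub>R\<^esub>" "\<one>\<^bsub>opp R\<^esub> = \<one>\<^bsub>R\<^esub>"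
  "x \<oplus>\<^bsub>opp R\<^esub> y = x \<oplus>\<^bsub>R\<^esub> y" "x \<otimes>\<^bsub>opp R\<^esub> y = y \<otimes>\<^bsub>R\<^esub> x"
  by (simp_all add: opp_def)

lemma ring_opp:
  fixes R :: "'a ring" (structure)
  assumes "ring R" shows "ring (opp R)"
proof -
  interpret ring R by fact
  have "\<exists>y\<in>carrier R. y \<oplus> x = \<zero>" if "x \<in> carrier R" for x
    using that by (intro bexI[of _ "\<ominus> x"]) (auto simp: l_neg)
  then show ?thesis
    by (intro ringI abelian_groupI monoidI) (simp_all add: a_ac m_assoc l_distr r_distr)
qed

lemma noetherian_opp:
  fixes R :: "'a ring" (structure)
  assumes R: "ring R" and N: "noetherian R"
  shows "noetherian (opp R)"
proof -
  have a: "additive_subgroup I (opp R) \<longleftrightarrow> additive_subgroup I R" for I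
    by (simp add: additive_subgroup_def opp_def)
  have "left_ideal (opp R) I \<longleftrightarrow> right_ideal R I" "right_ideal (opp R) I \<longleftrightarrow> left_ideal R I" for I
    by (simp_all add: left_ideal_def right_ideal_def a)
  then show ?thesis using N by (simp add: noetherian_def)
qed

definition ring_without_zero_divisors :: "'a ring \<Rightarrow> bool" where
  "ring_without_zero_divisors A \<longleftrightarrow> ring A \<and> \<one>\<^bsub>A\<^esub> \<noteq> \<zero>\<^bsub>A\<^esub> \<and>
     (\<forall>a\<in>carrier A. \<forall>b\<in>carrier A. a \<otimes>\<^bsub>A\<^esub> b = \<zero>\<^bsub>A\<^esub> \<longrightarrow> a = \<zero>\<^bsub>A\<^esub> \<or> b = \<zero>\<^bsub>A\<^esub>)"

text \<open>If a r = s b forced r = 0, the right ideals sA, asA, aasA, ... would be independent, and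
  the sums I n of the first n + 1 of them would form a strictly ascending chain.\<close>

lemma noetherian_right_ore:
  fixes A :: "'a ring" (structure)
  assumes A: "ring_without_zero_divisors A" and N: "noetherian A"
    and a: "a \<in> carrier A" and s: "s \<in> carrier A" "s \<noteq> \<zero>"
  shows "\<exists>b\<in>carrier A. \<exists>r\<in>carrier A. r \<noteq> \<zero> \<and> a \<otimes> r = s \<otimes> b"
proof (rule ccontr)
  assume "\<not> ?thesis"
  then have no: "r = \<zero>" if "b \<in> carrier A" "r \<in> carrier A" "a \<otimes> r = s \<otimes> b" for b r using that by auto
  interpret ring A using A by (simp add: ring_without_zero_divisors_def)
  have one: "\<one> \<noteq> \<zero>" and integral: "x = \<zero> \<or> y = \<zero>"
    if "x \<in> carrier A" "y \<in> carrier A" "x \<otimes> y = \<zero>" for x y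
    using A that by (auto simp: ring_without_zero_divisors_def)
  have "a \<noteq> \<zero>" using no[of \<zero> \<one>] one[of \<zero> \<zero>] s by auto
  define I where "I = rec_nat {s \<otimes> x |x. x \<in> carrier A} (\<lambda>n J. {s \<otimes> x \<oplus> a \<otimes> y |x y. x \<in> carrier A \<and> y \<in> J})"
  have I0: "I 0 = {s \<otimes> x |x. x \<in> carrier A}"
    and IS: "I (Suc n) = {s \<otimes> x \<oplus> a \<otimes> y |x y. x \<in> carrier A \<and> y \<in> I n}" for n by (simp_all add: I_def)
  have Ir: "right_ideal A (I n)" for n
  proof (induction n)
    case 0
    show ?case
    proof (rule right_idealI)
      show "\<zero> \<in> I 0" unfolding I0 using s by (auto intro!: exI[of _ \<zero>])
      show "x \<oplus> y \<in> I 0" if xy: "x \<in> I 0" "y \<in> I 0" for x y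
      proof -
        obtain x' y' where "x = s \<otimes> x'" "y = s \<otimes> y'" "x' \<in> carrier A" "y' \<in> carrier A" using xy by (auto simp: I0)
        then show ?thesis unfolding I0 using s by (auto simp: r_distr intro!: exI[of _ "x' \<oplus> y'"])
      qed
      show "x \<otimes> r \<in> I 0" if xr: "r \<in> carrier A" "x \<in> I 0" for x r
      proof -
        obtain x' where "x = s \<otimes> x'" "x' \<in> carrier A" using xr by (auto simp: I0)
        then show ?thesis unfolding I0 using s xr by (auto simp: m_assoc intro!: exI[of _ "x' \<otimes> r"])
      qed
    qed (use s in \<open>auto simp: I0 ring_axioms\<close>)
  next
    case (Suc n)
    note D = right_idealD[OF Suc]
    show ?case
    proof (rule right_idealI)
      show "I (Suc n) \<subseteq> carrier A" unfolding IS using s a D(1) by auto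
      have "\<zero> = s \<otimes> \<zero> \<oplus> a \<otimes> \<zero>" using s a by simp
      then show "\<zero> \<in> I (Suc n)" unfolding IS using D(2) by blast
      show "x \<oplus> y \<in> I (Suc n)" if xy: "x \<in> I (Suc n)" "y \<in> I (Suc n)" for x y
      proof -
        obtain x1 x2 y1 y2 where *: "x = s \<otimes> x1 \<oplus> a \<otimes> x2" "y = s \<otimes> y1 \<oplus> a \<otimes> y2"
          "x1 \<in> carrier A" "y1 \<in> carrier A" "x2 \<in> I n" "y2 \<in> I n" using xy by (auto simp: IS)
        have "x2 \<in> carrier A" "y2 \<in> carrier A" using * D(1) by auto
        then have "x \<oplus> y = s \<otimes> (x1 \<oplus> y1) \<oplus> a \<otimes> (x2 \<oplus> y2)" unfolding *(1,2) using *(3,4) s a by (simp add: r_distr a_ac)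
        then show ?thesis unfolding IS using * D(3) by blast
      qed
      show "x \<otimes> r \<in> I (Suc n)" if xr: "r \<in> carrier A" "x \<in> I (Suc n)" for x r
      proof -
        obtain x1 x2 where *: "x = s \<otimes> x1 \<oplus> a \<otimes> x2" "x1 \<in> carrier A" "x2 \<in> I n" using xr by (auto simp: IS)
        have "x2 \<in> carrier A" using * D(1) by auto
        then have "x \<otimes> r = s \<otimes> (x1 \<otimes> r) \<oplus> a \<otimes> (x2 \<otimes> r)" unfolding *(1) using *(2) s a xr(1) by (simp add: l_distr m_assoc)
        then show ?thesis unfolding IS using * D(4)[OF xr(1)] xr(1) by blast
      qed
    qed (rule ring_axioms)
  qed
  note D = right_idealD[OF Ir]
  have mono: "I n \<subseteq> I (Suc n)" for n
  proof (induction n)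
    case 0
    show ?case
    proof
      fix x assume "x \<in> I 0"
      then obtain y where y: "y \<in> carrier A" "x = s \<otimes> y" by (auto simp: I0)
      then have "x = s \<otimes> y \<oplus> a \<otimes> \<zero>" using a s by simp
      then show "x \<in> I (Suc 0)" unfolding IS using y(1) D(2) by blast
    qed
  next
    case (Suc n)
    then show ?case unfolding IS[of "Suc n"] IS[of n] by blast
  qed
  obtain k where k: "\<And>n. n \<ge> k \<Longrightarrow> I n = I k"
    using N Ir mono unfolding noetherian_def by (metis (no_types, lifting))
  \<comment> \<open>e n = a^n s is the generator by which I n exceeds its predecessor.\<close>
  define e where "e n = ((\<otimes>) a ^^ n) s" for n
  have e0: "e 0 = s" and eS: "e (Suc n) = a \<otimes> e n" for n by (simp_all add: e_def)
  have ec: "e n \<in> carrier A" for n by (induction n) (use e0 eS a s in auto)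
  have eI: "e n \<in> I n" for n
  proof (induction n)
    case 0
    have "s = s \<otimes> \<one>" using s by simp
    then show ?case unfolding I0 e0 by blast
  next
    case (Suc n)
    have "e (Suc n) = s \<otimes> \<zero> \<oplus> a \<otimes> e n" using s a ec by (simp add: eS)
    then show ?case unfolding IS using Suc by blast
  qed
  have "e (Suc n) \<notin> I n" for n
  proof (induction n)
    case 0
    show ?case
    proof
      assume "e (Suc 0) \<in> I 0"
      then obtain x where "x \<in> carrier A" "a \<otimes> s = s \<otimes> x" by (auto simp: I0 e0 eS)
      then show False using no[of x s] s by simp
    qed
  next
    case (Suc n)
    show ?case
    proof
      assume "e (Suc (Suc n)) \<in> I (Suc n)"
      then obtain x y where xy: "x \<in> carrier A" "y \<in> I n" "a \<otimes> e (Suc n) = s \<otimes> x \<oplus> a \<otimes> y"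
        unfolding IS eS[of "Suc n"] by blast
      have yc: "y \<in> carrier A" using xy(2) D(1) by auto
      have "a \<otimes> (e (Suc n) \<ominus> y) = a \<otimes> e (Suc n) \<ominus> a \<otimes> y"
        using a ec[of "Suc n"] yc by (simp add: a_minus_def r_distr r_minus)
      also have "\<dots> = s \<otimes> x" unfolding xy(3) using a s xy(1) yc by (simp add: a_minus_def a_assoc r_neg)
      finally have "e (Suc n) \<ominus> y = \<zero>" using no[of x "e (Suc n) \<ominus> y"] xy(1) ec[of "Suc n"] yc by simp
      then have "e (Suc n) = y" using ec[of "Suc n"] yc by simp
      then show False using Suc xy(2) by simp
    qed
  qed
  then show False using eI[of "Suc k"] k[of "Suc k"] by simp
qed

locale right_ore_domain = ring A for A :: "'a ring" (structure) +
  assumes one_nonzero: "\<one> \<noteq> \<zero>"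
    and integral: "\<lbrakk>a \<in> carrier A; b \<in> carrier A; a \<otimes> b = \<zero>\<rbrakk> \<Longrightarrow> a = \<zero> \<or> b = \<zero>"
    and ore: "\<lbrakk>a \<in> carrier A; s \<in> carrier A; s \<noteq> \<zero>\<rbrakk> \<Longrightarrow> \<exists>b\<in>carrier A. \<exists>r\<in>carrier A. r \<noteq> \<zero> \<and> a \<otimes> r = s \<otimes> b"
begin

lemma mult_nonzero: "\<lbrakk>a \<in> carrier A; b \<in> carrier A; a \<noteq> \<zero>; b \<noteq> \<zero>\<rbrakk> \<Longrightarrow> a \<otimes> b \<noteq> \<zero>"
  using integral by blast

lemma mult_right_cancel:
  assumes "a \<in> carrier A" "b \<in> carrier A" "r \<in> carrier A" "r \<noteq> \<zero>" "a \<otimes> r = b \<otimes> r"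
  shows "a = b"
proof -
  have "(a \<ominus> b) \<otimes> r = \<zero>" using assms by (simp add: a_minus_def l_distr l_minus r_neg)
  then have "a \<ominus> b = \<zero>" using integral[of "a \<ominus> b" r] assms by auto
  then show ?thesis using assms by simp
qed

lemma mult_left_cancel:
  assumes "a \<in> carrier A" "b \<in> carrier A" "r \<in> carrier A" "r \<noteq> \<zero>" "r \<otimes> a = r \<otimes> b"
  shows "a = b"
proof -
  have "r \<otimes> (a \<ominus> b) = \<zero>" using assms by (simp add: a_minus_def r_distr r_minus r_neg)
  then have "a \<ominus> b = \<zero>" using integral[of r "a \<ominus> b"] assms by auto
  then show ?thesis using assms by simp
qed

text \<open>
  A fraction \<open>q\<close> is encoded as the graph of the map \<open>x \<mapsto> q x\<close> on \<open>{x. q x \<in> A}\<close>: a homomorphism of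
  right modules on a nonzero right ideal which is maximal among such homomorphisms.
\<close>

definition pregraph :: "('a \<times> 'a) set \<Rightarrow> bool" where
  "pregraph G \<longleftrightarrow> G \<subseteq> carrier A \<times> carrier A \<and> (\<exists>x y. (x, y) \<in> G \<and> x \<noteq> \<zero>) \<and>
     (\<forall>x y y'. (x, y) \<in> G \<longrightarrow> (x, y') \<in> G \<longrightarrow> y = y') \<and>
     (\<forall>x y x' y'. (x, y) \<in> G \<longrightarrow> (x', y') \<in> G \<longrightarrow> (x \<oplus> x', y \<oplus> y') \<in> G) \<and>
     (\<forall>x y r. (x, y) \<in> G \<longrightarrow> r \<in> carrier A \<longrightarrow> (x \<otimes> r, y \<otimes> r) \<in> G)"

text \<open>Cancelling a common right factor is how a homomorphism is prolonged to its maximal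
  domain; maximal graphs represent fractions uniquely.\<close>

definition saturated :: "('a \<times> 'a) set \<Rightarrow> bool" where
  "saturated G \<longleftrightarrow> (\<forall>x\<in>carrier A. \<forall>y\<in>carrier A. \<forall>r\<in>carrier A. r \<noteq> \<zero> \<longrightarrow> (x \<otimes> r, y \<otimes> r) \<in> G \<longrightarrow> (x, y) \<in> G)"

definition saturation :: "('a \<times> 'a) set \<Rightarrow> ('a \<times> 'a) set" where
  "saturation G = {(x, y). x \<in> carrier A \<and> y \<in> carrier A \<and>
     (\<exists>r\<in>carrier A. r \<noteq> \<zero> \<and> (x \<otimes> r, y \<otimes> r) \<in> G)}"

definition fraction_graph :: "('a \<times> 'a) set \<Rightarrow> bool" where
  "fraction_graph G \<longleftrightarrow> pregraph G \<and> saturated G"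

lemma pregraphD:
  assumes "pregraph G"
  shows "\<And>x y. (x, y) \<in> G \<Longrightarrow> x \<in> carrier A \<and> y \<in> carrier A" "\<exists>x y. (x, y) \<in> G \<and> x \<noteq> \<zero>"
    "\<And>x y y'. (x, y) \<in> G \<Longrightarrow> (x, y') \<in> G \<Longrightarrow> y = y'"
    "\<And>x y x' y'. (x, y) \<in> G \<Longrightarrow> (x', y') \<in> G \<Longrightarrow> (x \<oplus> x', y \<oplus> y') \<in> G"
    "\<And>x y r. (x, y) \<in> G \<Longrightarrow> r \<in> carrier A \<Longrightarrow> (x \<otimes> r, y \<otimes> r) \<in> G"
  using assms unfolding pregraph_def by blast+

lemma subset_saturation: "pregraph G \<Longrightarrow> G \<subseteq> saturation G"
  using pregraphD(1)[of G] one_nonzero by (auto simp: saturation_def intro!: bexI[of _ \<one>])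

text \<open>Points of the saturation come with denominators r and r'. The Ore condition provides a
  common right multiple ru = r'b, and after multiplication by it both points lie in G.\<close>

lemma fraction_graph_saturation:
  assumes G: "pregraph G" shows "fraction_graph (saturation G)"
proof -
  note D = pregraphD[OF G]
  have single: "y = y'" if xy: "(x, y) \<in> saturation G" "(x, y') \<in> saturation G" for x y y'
  proof -
    obtain r r' where r: "r \<in> carrier A" "r \<noteq> \<zero>" "(x \<otimes> r, y \<otimes> r) \<in> G"
      and r': "r' \<in> carrier A" "r' \<noteq> \<zero>" "(x \<otimes> r', y' \<otimes> r') \<in> G" and c: "x \<in> carrier A" "y \<in> carrier A" "y' \<in> carrier A"
      using xy by (auto simp: saturation_def)
    obtain b u where u: "b \<in> carrier A" "u \<in> carrier A" "u \<noteq> \<zero>" "r \<otimes> u = r' \<otimes> b" using ore[OF r(1) r'(1,2)] by auto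
    have "(x \<otimes> (r \<otimes> u), y \<otimes> (r \<otimes> u)) \<in> G" using D(5)[OF r(3) u(2)] c r u by (simp add: m_assoc)
    moreover have "(x \<otimes> (r \<otimes> u), y' \<otimes> (r \<otimes> u)) \<in> G"
      using D(5)[OF r'(3) u(1)] c r'(1) u(1) unfolding u(4) by (simp add: m_assoc)
    ultimately have "y \<otimes> (r \<otimes> u) = y' \<otimes> (r \<otimes> u)" by (rule D(3))
    then show ?thesis using mult_right_cancel[of y y' "r \<otimes> u"] mult_nonzero[of r u] c r(1,2) u(2,3) by simp
  qed
  have add: "(x \<oplus> x', y \<oplus> y') \<in> saturation G" if xy: "(x, y) \<in> saturation G" "(x', y') \<in> saturation G" for x y x' y'
  proof -
    obtain r r' where r: "r \<in> carrier A" "r \<noteq> \<zero>" "(x \<otimes> r, y \<otimes> r) \<in> G"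
      and r': "r' \<in> carrier A" "r' \<noteq> \<zero>" "(x' \<otimes> r', y' \<otimes> r') \<in> G"
      and c: "x \<in> carrier A" "y \<in> carrier A" "x' \<in> carrier A" "y' \<in> carrier A"
      using xy by (auto simp: saturation_def)
    obtain b u where u: "b \<in> carrier A" "u \<in> carrier A" "u \<noteq> \<zero>" "r \<otimes> u = r' \<otimes> b" using ore[OF r(1) r'(1,2)] by auto
    have "(x \<otimes> (r \<otimes> u), y \<otimes> (r \<otimes> u)) \<in> G" using D(5)[OF r(3) u(2)] c r u by (simp add: m_assoc)
    moreover have "(x' \<otimes> (r \<otimes> u), y' \<otimes> (r \<otimes> u)) \<in> G"
      using D(5)[OF r'(3) u(1)] c r'(1) u(1) unfolding u(4) by (simp add: m_assoc)
    ultimately have "(x \<otimes> (r \<otimes> u) \<oplus> x' \<otimes> (r \<otimes> u), y \<otimes> (r \<otimes> u) \<oplus> y' \<otimes> (r \<otimes> u)) \<in> G"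
      by (rule D(4))
    then have "((x \<oplus> x') \<otimes> (r \<otimes> u), (y \<oplus> y') \<otimes> (r \<otimes> u)) \<in> G"
      using c r(1) u(2) by (simp add: l_distr)
    then show ?thesis using c r(1,2) u(2,3) mult_nonzero[of r u]
      by (auto simp: saturation_def intro!: bexI[of _ "r \<otimes> u"])
  qed
  have mult: "(x \<otimes> z, y \<otimes> z) \<in> saturation G" if xy: "(x, y) \<in> saturation G" and z: "z \<in> carrier A" for x y z
  proof -
    obtain r where r: "r \<in> carrier A" "r \<noteq> \<zero>" "(x \<otimes> r, y \<otimes> r) \<in> G" and c: "x \<in> carrier A" "y \<in> carrier A"
      using xy by (auto simp: saturation_def)
    obtain b u where u: "b \<in> carrier A" "u \<in> carrier A" "u \<noteq> \<zero>" "z \<otimes> u = r \<otimes> b" using ore[OF z r(1,2)] by auto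
    have "(x \<otimes> (z \<otimes> u), y \<otimes> (z \<otimes> u)) \<in> G"
      using D(5)[OF r(3) u(1)] c r(1) u(1) unfolding u(4) by (simp add: m_assoc)
    then show ?thesis using c z u by (auto simp: saturation_def m_assoc intro!: bexI[of _ u])
  qed
  have "saturated (saturation G)"
    unfolding saturated_def
  proof (intro ballI impI)
    fix x y r assume c: "x \<in> carrier A" "y \<in> carrier A" "r \<in> carrier A" "r \<noteq> \<zero>" and "(x \<otimes> r, y \<otimes> r) \<in> saturation G"
    then obtain r' where r': "r' \<in> carrier A" "r' \<noteq> \<zero>" "(x \<otimes> r \<otimes> r', y \<otimes> r \<otimes> r') \<in> G" by (auto simp: saturation_def)
    then show "(x, y) \<in> saturation G" using c mult_nonzero[of r r']
      by (auto simp: saturation_def m_assoc intro!: bexI[of _ "r \<otimes> r'"])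
  qed
  moreover have "pregraph (saturation G)"
    unfolding pregraph_def
  proof (intro conjI allI impI)
    show "saturation G \<subseteq> carrier A \<times> carrier A" by (auto simp: saturation_def)
    show "\<exists>x y. (x, y) \<in> saturation G \<and> x \<noteq> \<zero>" using D(2) subset_saturation[OF G] by blast
  qed (use single add mult in blast)+
  ultimately show ?thesis by (simp add: fraction_graph_def)
qed

lemma fraction_graphD:
  assumes "fraction_graph G"
  shows "\<And>x y. (x, y) \<in> G \<Longrightarrow> x \<in> carrier A \<and> y \<in> carrier A" "\<exists>x y. (x, y) \<in> G \<and> x \<noteq> \<zero>"
    "\<And>x y y'. (x, y) \<in> G \<Longrightarrow> (x, y') \<in> G \<Longrightarrow> y = y'"
    "\<And>x y x' y'. (x, y) \<in> G \<Longrightarrow> (x', y') \<in> G \<Longrightarrow> (x \<oplus> x', y \<oplus> y') \<in> G"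
    "\<And>x y r. (x, y) \<in> G \<Longrightarrow> r \<in> carrier A \<Longrightarrow> (x \<otimes> r, y \<otimes> r) \<in> G"
    "\<And>x y r. x \<in> carrier A \<Longrightarrow> y \<in> carrier A \<Longrightarrow> r \<in> carrier A \<Longrightarrow> r \<noteq> \<zero> \<Longrightarrow> (x \<otimes> r, y \<otimes> r) \<in> G \<Longrightarrow> (x, y) \<in> G"
  using assms pregraphD[of G] unfolding fraction_graph_def saturated_def by blast+

text \<open>One common point with nonzero x decides everything: for (u, v) in G the Ore condition
  gives ur = xb, hence vr = yb, so (ur, vr) is in H, and saturation returns (u, v). Through
  \<open>graph_eqI\<close>, an identity of fractions needs to be checked at one point only.\<close>

lemma graph_subset:
  assumes G: "fraction_graph G" and H: "fraction_graph H" and xy: "(x, y) \<in> G" "(x, y) \<in> H" "x \<noteq> \<zero>"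
  shows "G \<subseteq> H"
proof
  fix p assume "p \<in> G"
  then obtain u v where p: "p = (u, v)" "(u, v) \<in> G" by (cases p) auto
  note DG = fraction_graphD[OF G] and DH = fraction_graphD[OF H]
  have c: "x \<in> carrier A" "y \<in> carrier A" "u \<in> carrier A" "v \<in> carrier A" using DG(1) p(2) xy by auto
  obtain b r where b: "b \<in> carrier A" "r \<in> carrier A" "r \<noteq> \<zero>" "u \<otimes> r = x \<otimes> b" using ore[OF c(3,1) xy(3)] by auto
  have "(u \<otimes> r, v \<otimes> r) \<in> G" "(u \<otimes> r, y \<otimes> b) \<in> G" using DG(5)[OF p(2) b(2)] DG(5)[OF xy(1) b(1)] b(4) by auto
  then have "v \<otimes> r = y \<otimes> b" by (rule DG(3))
  then have "(u \<otimes> r, v \<otimes> r) \<in> H" using DH(5)[OF xy(2) b(1)] b(4) by simp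
  then show "p \<in> H" using DH(6)[of u v r] c b p by simp
qed

lemma graph_eqI:
  assumes "fraction_graph G" "fraction_graph H" "(x, y) \<in> G" "(x, y) \<in> H" "x \<noteq> \<zero>"
  shows "G = H"
  using graph_subset[of G H x y] graph_subset[of H G x y] assms by auto

lemma graph_defined:
  assumes G: "fraction_graph G" and z: "z \<in> carrier A"
  obtains r y where "r \<in> carrier A" "r \<noteq> \<zero>" "(z \<otimes> r, y) \<in> G" "y \<in> carrier A"
proof -
  note D = fraction_graphD[OF G]
  obtain u v where uv: "(u, v) \<in> G" "u \<noteq> \<zero>" using D(2) by auto
  obtain b r where b: "b \<in> carrier A" "r \<in> carrier A" "r \<noteq> \<zero>" "z \<otimes> r = u \<otimes> b" using ore[of z u] z uv D(1) by blast
  have "(z \<otimes> r, v \<otimes> b) \<in> G" using D(5)[OF uv(1) b(1)] b(4) by simp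
  then show ?thesis using that[of r "v \<otimes> b"] b D(1) by blast
qed

text \<open>Composition of partial homomorphisms. The composite need not have maximal domain, so it
  is saturated.\<close>

definition graph_mult where
  "graph_mult G H = saturation {(x, y). \<exists>z. (x, z) \<in> H \<and> (z, y) \<in> G}"

definition graph_add where
  "graph_add G H = saturation {(x, y). \<exists>u v. (x, u) \<in> G \<and> (x, v) \<in> H \<and> y = u \<oplus> v}"

definition graph_of where
  "graph_of a = {(x, a \<otimes> x) |x. x \<in> carrier A}"

lemma graph_mult:
  assumes G: "fraction_graph G" and H: "fraction_graph H"
  shows "fraction_graph (graph_mult G H)"
    and "\<And>x z y. (x, z) \<in> H \<Longrightarrow> (z, y) \<in> G \<Longrightarrow> (x, y) \<in> graph_mult G H"
proof -
  note DG = fraction_graphD[OF G] and DH = fraction_graphD[OF H]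
  let ?N = "{(x, y). \<exists>z. (x, z) \<in> H \<and> (z, y) \<in> G}"
  have N: "pregraph ?N" unfolding pregraph_def
  proof (intro conjI allI impI)
    show "?N \<subseteq> carrier A \<times> carrier A" using DG(1) DH(1) by blast
    obtain x z where xz: "(x, z) \<in> H" "x \<noteq> \<zero>" using DH(2) by auto
    then obtain r y where r: "r \<in> carrier A" "r \<noteq> \<zero>" "(z \<otimes> r, y) \<in> G" using graph_defined[OF G] DH(1) by metis
    have "(x \<otimes> r, z \<otimes> r) \<in> H" using DH(5) xz r by blast
    then show "\<exists>x y. (x, y) \<in> ?N \<and> x \<noteq> \<zero>" using r xz mult_nonzero[of x r] DH(1)[OF xz(1)] by auto
  next
    fix x y y' assume "(x, y) \<in> ?N" "(x, y') \<in> ?N"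
    then obtain z z' where "(x, z) \<in> H" "(z, y) \<in> G" "(x, z') \<in> H" "(z', y') \<in> G" by auto
    then show "y = y'" using DH(3)[of x z z'] DG(3)[of z y y'] by simp
  next
    fix x y x' y' assume "(x, y) \<in> ?N" "(x', y') \<in> ?N"
    then obtain z z' where "(x, z) \<in> H" "(z, y) \<in> G" "(x', z') \<in> H" "(z', y') \<in> G" by auto
    then show "(x \<oplus> x', y \<oplus> y') \<in> ?N" using DH(4)[of x z x' z'] DG(4)[of z y z' y'] by auto
  next
    fix x y r assume "(x, y) \<in> ?N" and r: "r \<in> carrier A"
    then obtain z where "(x, z) \<in> H" "(z, y) \<in> G" by auto
    then show "(x \<otimes> r, y \<otimes> r) \<in> ?N" using DH(5)[OF _ r, of x z] DG(5)[OF _ r, of z y] by auto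
  qed
  show "fraction_graph (graph_mult G H)" unfolding graph_mult_def by (rule fraction_graph_saturation[OF N])
  show "(x, y) \<in> graph_mult G H" if "(x, z) \<in> H" "(z, y) \<in> G" for x z y
    unfolding graph_mult_def using subset_saturation[OF N] that by blast
qed

lemma graph_add:
  assumes G: "fraction_graph G" and H: "fraction_graph H"
  shows "fraction_graph (graph_add G H)"
    and "\<And>x u v. (x, u) \<in> G \<Longrightarrow> (x, v) \<in> H \<Longrightarrow> (x, u \<oplus> v) \<in> graph_add G H"
proof -
  note DG = fraction_graphD[OF G] and DH = fraction_graphD[OF H]
  let ?N = "{(x, y). \<exists>u v. (x, u) \<in> G \<and> (x, v) \<in> H \<and> y = u \<oplus> v}"
  have N: "pregraph ?N" unfolding pregraph_def
  proof (intro conjI allI impI)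
    show "?N \<subseteq> carrier A \<times> carrier A" using DG(1) DH(1) by auto
    obtain x z where xz: "(x, z) \<in> H" "x \<noteq> \<zero>" using DH(2) by auto
    then obtain r y where r: "r \<in> carrier A" "r \<noteq> \<zero>" "(x \<otimes> r, y) \<in> G" using graph_defined[OF G] DH(1) by metis
    have "(x \<otimes> r, z \<otimes> r) \<in> H" using DH(5) xz r by blast
    then show "\<exists>x y. (x, y) \<in> ?N \<and> x \<noteq> \<zero>" using r xz mult_nonzero[of x r] DH(1)[OF xz(1)] by auto
  next
    fix x y x' y' assume "(x, y) \<in> ?N" "(x', y') \<in> ?N"
    then obtain u v u' v' where *: "(x, u) \<in> G" "(x, v) \<in> H" "y = u \<oplus> v" "(x', u') \<in> G" "(x', v') \<in> H" "y' = u' \<oplus> v'"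
      by auto
    have "u \<in> carrier A" "u' \<in> carrier A" "v \<in> carrier A" "v' \<in> carrier A"
      using DG(1)[OF *(1)] DG(1)[OF *(4)] DH(1)[OF *(2)] DH(1)[OF *(5)] by auto
    then have "y \<oplus> y' = (u \<oplus> u') \<oplus> (v \<oplus> v')" unfolding *(3,6) by (simp add: a_ac)
    then show "(x \<oplus> x', y \<oplus> y') \<in> ?N" using DG(4)[OF *(1,4)] DH(4)[OF *(2,5)] by blast
  next
    fix x y r assume "(x, y) \<in> ?N" and r: "r \<in> carrier A"
    then obtain u v where *: "(x, u) \<in> G" "(x, v) \<in> H" "y = u \<oplus> v" by auto
    have "y \<otimes> r = u \<otimes> r \<oplus> v \<otimes> r" unfolding *(3)
      using DG(1)[OF *(1)] DH(1)[OF *(2)] r by (simp add: l_distr)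
    then show "(x \<otimes> r, y \<otimes> r) \<in> ?N" using DG(5)[OF *(1) r] DH(5)[OF *(2) r] by blast
  next
    fix x y y' assume "(x, y) \<in> ?N" "(x, y') \<in> ?N"
    then show "y = y'" using DG(3) DH(3) by blast
  qed
  show "fraction_graph (graph_add G H)" unfolding graph_add_def by (rule fraction_graph_saturation[OF N])
  show "(x, u \<oplus> v) \<in> graph_add G H" if "(x, u) \<in> G" "(x, v) \<in> H" for x u v
    unfolding graph_add_def using subset_saturation[OF N] that by blast
qed

lemma graph_of:
  assumes a: "a \<in> carrier A" shows "fraction_graph (graph_of a)"
  unfolding fraction_graph_def pregraph_def saturated_def
proof (intro conjI allI ballI impI)
  show "\<exists>x y. (x, y) \<in> graph_of a \<and> x \<noteq> \<zero>" using one_nonzero by (auto simp: graph_of_def)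
  fix x y r assume *: "x \<in> carrier A" "y \<in> carrier A" "r \<in> carrier A" "r \<noteq> \<zero>" "(x \<otimes> r, y \<otimes> r) \<in> graph_of a"
  then have "y \<otimes> r = a \<otimes> x \<otimes> r" using a by (auto simp: graph_of_def m_assoc)
  then have "y = a \<otimes> x" using mult_right_cancel[of y "a \<otimes> x" r] * a by simp
  then show "(x, y) \<in> graph_of a" using * by (auto simp: graph_of_def)
qed (use a in \<open>auto simp: graph_of_def r_distr m_assoc\<close>)

definition fraction_ring :: "('a \<times> 'a) set ring" where
  "fraction_ring = \<lparr>carrier = Collect fraction_graph, monoid.mult = graph_mult, one = graph_of \<one>,
     ring.zero = graph_of \<zero>, add = graph_add\<rparr>"

lemma common_domain:
  assumes G: "fraction_graph G" and H: "fraction_graph H" and z: "z \<in> carrier A" "z \<noteq> \<zero>"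
  obtains r u v where "r \<in> carrier A" "r \<noteq> \<zero>" "(z \<otimes> r, u) \<in> G" "(z \<otimes> r, v) \<in> H"
proof -
  obtain r u where r: "r \<in> carrier A" "r \<noteq> \<zero>" "(z \<otimes> r, u) \<in> G" using graph_defined[OF G z(1)] by metis
  obtain r' v where r': "r' \<in> carrier A" "r' \<noteq> \<zero>" "(z \<otimes> r \<otimes> r', v) \<in> H"
    using graph_defined[OF H, of "z \<otimes> r"] z r by (metis m_closed)
  have "(z \<otimes> r \<otimes> r', u \<otimes> r') \<in> G" using fraction_graphD(5)[OF G r(3) r'(1)] .
  then show ?thesis using that[of "r \<otimes> r'"] r r' z mult_nonzero[of r r'] by (simp add: m_assoc)
qed

text \<open>Each ring identity is verified at one nonzero argument where all fractions involved are
  defined. The facts \<open>triple\<close>, \<open>triple'\<close> and \<open>pair\<close> supply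
  such arguments, and \<open>graph_eqI\<close> concludes.\<close>

lemma ring_fraction_ring: "ring fraction_ring"
proof -
  have Da: "(x, u) \<in> G \<Longrightarrow> r \<in> carrier A \<Longrightarrow> (x \<otimes> r, u \<otimes> r) \<in> G" and Dc: "(x, u) \<in> G \<Longrightarrow> x \<in> carrier A \<and> u \<in> carrier A"
    if "fraction_graph G" for G x u r using fraction_graphD[OF that] by blast+
  have triple: "\<exists>x u v w. x \<noteq> \<zero> \<and> x \<in> carrier A \<and> (x, u) \<in> G \<and> (x, v) \<in> H \<and> (x, w) \<in> K"
    if G: "fraction_graph G" and H: "fraction_graph H" and K: "fraction_graph K" for G H K
  proof -
    obtain r u v where r: "r \<in> carrier A" "r \<noteq> \<zero>" "(\<one> \<otimes> r, u) \<in> G" "(\<one> \<otimes> r, v) \<in> H"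
      using common_domain[OF G H one_closed one_nonzero] by metis
    then obtain s w where s: "s \<in> carrier A" "s \<noteq> \<zero>" "(r \<otimes> s, w) \<in> K" using graph_defined[OF K r(1)] by metis
    have "(r \<otimes> s, u \<otimes> s) \<in> G" "(r \<otimes> s, v \<otimes> s) \<in> H" using Da[OF G _ s(1)] Da[OF H _ s(1)] r by auto
    then show ?thesis using s r mult_nonzero[of r s] by (metis m_closed)
  qed
  have triple': "\<exists>x z u v. x \<noteq> \<zero> \<and> (x, z) \<in> K \<and> (z, u) \<in> G \<and> (z, v) \<in> H"
    if G: "fraction_graph G" and H: "fraction_graph H" and K: "fraction_graph K" for G H K
  proof -
    obtain x z where xz: "(x, z) \<in> K" "x \<noteq> \<zero>" using fraction_graphD(2)[OF K] by auto
    then have c: "x \<in> carrier A" "z \<in> carrier A" using Dc[OF K] by auto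
    obtain r u where r: "r \<in> carrier A" "r \<noteq> \<zero>" "(z \<otimes> r, u) \<in> G" using graph_defined[OF G c(2)] by metis
    obtain s v where s: "s \<in> carrier A" "s \<noteq> \<zero>" "(z \<otimes> r \<otimes> s, v) \<in> H"
      using graph_defined[OF H, of "z \<otimes> r"] c r by (metis m_closed)
    have "(z \<otimes> r \<otimes> s, u \<otimes> s) \<in> G" using Da[OF G r(3) s(1)] .
    moreover have "(x \<otimes> r \<otimes> s, z \<otimes> r \<otimes> s) \<in> K" using Da[OF K Da[OF K xz(1) r(1)] s(1)] .
    moreover have "x \<otimes> r \<otimes> s \<noteq> \<zero>" using mult_nonzero c r s xz by simp
    ultimately show ?thesis using s by blast
  qed
  have pair: "\<exists>x u v. x \<noteq> \<zero> \<and> x \<in> carrier A \<and> (x, u) \<in> G \<and> (x, v) \<in> H"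
    if "fraction_graph G" "fraction_graph H" for G H using triple[OF that that(2)] by blast
  have go: "(x, a \<otimes> x) \<in> graph_of a" if "x \<in> carrier A" for x a using that by (auto simp: graph_of_def)
  note g0 = graph_of[OF zero_closed] and g1 = graph_of[OF one_closed]
  have neg: "\<exists>H. fraction_graph H \<and> graph_add H G = graph_of \<zero>" if G: "fraction_graph G" for G
  proof -
    note D = fraction_graphD[OF G]
    let ?H = "graph_mult (graph_of (\<ominus> \<one>)) G"
    have gm: "fraction_graph (graph_of (\<ominus> \<one>))" by (rule graph_of) simp
    note H = graph_mult[OF gm G]
    obtain x y where xy: "(x, y) \<in> G" "x \<noteq> \<zero>" using D(2) by auto
    have c: "x \<in> carrier A" "y \<in> carrier A" using D(1)[OF xy(1)] by auto
    have "(x, (\<ominus> \<one>) \<otimes> y) \<in> ?H" using H(2)[OF xy(1) go[OF c(2)]] .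
    then have "(x, (\<ominus> \<one>) \<otimes> y \<oplus> y) \<in> graph_add ?H G" using graph_add(2)[OF H(1) G] xy by blast
    then have "(x, \<zero> \<otimes> x) \<in> graph_add ?H G" using c by (simp add: l_minus l_neg)
    then have "graph_add ?H G = graph_of \<zero>"
      using graph_eqI[OF graph_add(1)[OF H(1) G] g0 _ go[OF c(1)] xy(2)] by blast
    then show ?thesis using H(1) by blast
  qed
  have assoc: "graph_mult (graph_mult G H) K = graph_mult G (graph_mult H K)"
    if G: "fraction_graph G" and H: "fraction_graph H" and K: "fraction_graph K" for G H K
  proof -
    note GH = graph_mult[OF G H] and HK = graph_mult[OF H K]
    obtain x y where xy: "(x, y) \<in> graph_mult H K" "x \<noteq> \<zero>" using fraction_graphD(2)[OF HK(1)] by auto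
    obtain x k h where *: "(x, k) \<in> K" "(k, h) \<in> H" "x \<noteq> \<zero>" using triple'[OF H H K] by blast
    have c: "x \<in> carrier A" "h \<in> carrier A" using * Dc[OF K] Dc[OF H] by auto
    obtain r g where r: "r \<in> carrier A" "r \<noteq> \<zero>" "(h \<otimes> r, g) \<in> G" using graph_defined[OF G c(2)] by metis
    have 1: "(x \<otimes> r, k \<otimes> r) \<in> K" "(k \<otimes> r, h \<otimes> r) \<in> H" using Da[OF K *(1) r(1)] Da[OF H *(2) r(1)] by auto
    show ?thesis
      by (rule graph_eqI[OF graph_mult(1)[OF GH(1) K] graph_mult(1)[OF G HK(1)], of "x \<otimes> r" g])
        (use graph_mult(2)[OF GH(1) K 1(1) GH(2)[OF 1(2) r(3)]] graph_mult(2)[OF G HK(1) HK(2)[OF 1] r(3)]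
          mult_nonzero[of x r] c r * in auto)
  qed
  have distl: "graph_mult (graph_add G H) K = graph_add (graph_mult G K) (graph_mult H K)"
    if G: "fraction_graph G" and H: "fraction_graph H" and K: "fraction_graph K" for G H K
  proof -
    obtain x z u v where *: "x \<noteq> \<zero>" "(x, z) \<in> K" "(z, u) \<in> G" "(z, v) \<in> H" using triple'[OF G H K] by blast
    show ?thesis
      by (rule graph_eqI[OF graph_mult(1)[OF graph_add(1)[OF G H] K]
            graph_add(1)[OF graph_mult(1)[OF G K] graph_mult(1)[OF H K]]
            graph_mult(2)[OF graph_add(1)[OF G H] K *(2) graph_add(2)[OF G H *(3,4)]]
            graph_add(2)[OF graph_mult(1)[OF G K] graph_mult(1)[OF H K] graph_mult(2)[OF G K *(2,3)] graph_mult(2)[OF H K *(2,4)]] *(1)])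
  qed
  have distr: "graph_mult K (graph_add G H) = graph_add (graph_mult K G) (graph_mult K H)"
    if G: "fraction_graph G" and H: "fraction_graph H" and K: "fraction_graph K" for G H K
  proof -
    obtain x u v where *: "x \<noteq> \<zero>" "x \<in> carrier A" "(x, u) \<in> G" "(x, v) \<in> H" using pair[OF G H] by blast
    have c: "u \<in> carrier A" "v \<in> carrier A" using * Dc[OF G] Dc[OF H] by auto
    obtain r a where r: "r \<in> carrier A" "r \<noteq> \<zero>" "(u \<otimes> r, a) \<in> K" using graph_defined[OF K c(1)] by metis
    obtain s b where s: "s \<in> carrier A" "s \<noteq> \<zero>" "(v \<otimes> r \<otimes> s, b) \<in> K"
      using graph_defined[OF K, of "v \<otimes> r"] c r by (metis m_closed)
    have 1: "(x \<otimes> r \<otimes> s, u \<otimes> r \<otimes> s) \<in> G" "(x \<otimes> r \<otimes> s, v \<otimes> r \<otimes> s) \<in> H" "(u \<otimes> r \<otimes> s, a \<otimes> s) \<in> K"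
      using Da[OF G Da[OF G *(3) r(1)] s(1)] Da[OF H Da[OF H *(4) r(1)] s(1)] Da[OF K r(3) s(1)] by auto
    have nz: "x \<otimes> r \<otimes> s \<noteq> \<zero>" using mult_nonzero * r s by simp
    have 2: "(u \<otimes> r \<otimes> s \<oplus> v \<otimes> r \<otimes> s, a \<otimes> s \<oplus> b) \<in> K" using fraction_graphD(4)[OF K 1(3) s(3)] .
    show ?thesis
      by (rule graph_eqI[OF graph_mult(1)[OF K graph_add(1)[OF G H]]
            graph_add(1)[OF graph_mult(1)[OF K G] graph_mult(1)[OF K H]]
            graph_mult(2)[OF K graph_add(1)[OF G H] graph_add(2)[OF G H 1(1,2)] 2]
            graph_add(2)[OF graph_mult(1)[OF K G] graph_mult(1)[OF K H] graph_mult(2)[OF K G 1(1,3)] graph_mult(2)[OF K H 1(2) s(3)]] nz])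
  qed
  have aassoc: "graph_add (graph_add G H) K = graph_add G (graph_add H K)"
    if G: "fraction_graph G" and H: "fraction_graph H" and K: "fraction_graph K" for G H K
  proof -
    obtain x u v w where *: "x \<noteq> \<zero>" "(x, u) \<in> G" "(x, v) \<in> H" "(x, w) \<in> K" using triple[OF G H K] by blast
    have c: "u \<in> carrier A" "v \<in> carrier A" "w \<in> carrier A" using Dc[OF G *(2)] Dc[OF H *(3)] Dc[OF K *(4)] by auto
    have "(x, u \<oplus> v \<oplus> w) \<in> graph_add G (graph_add H K)"
      using graph_add(2)[OF G graph_add(1)[OF H K] *(2) graph_add(2)[OF H K *(3,4)]] c by (simp add: a_assoc)
    then show ?thesis
      using graph_eqI[OF graph_add(1)[OF graph_add(1)[OF G H] K] graph_add(1)[OF G graph_add(1)[OF H K]]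
            graph_add(2)[OF graph_add(1)[OF G H] K graph_add(2)[OF G H *(2,3)] *(4)] _ *(1)] by blast
  qed
  have acomm: "graph_add G H = graph_add H G" if G: "fraction_graph G" and H: "fraction_graph H" for G H
  proof -
    obtain x u v where *: "x \<noteq> \<zero>" "(x, u) \<in> G" "(x, v) \<in> H" using pair[OF G H] by blast
    have "u \<oplus> v = v \<oplus> u" using Dc[OF G *(2)] Dc[OF H *(3)] a_comm by auto
    then have "(x, u \<oplus> v) \<in> graph_add H G" using graph_add(2)[OF H G *(3,2)] by simp
    then show ?thesis using graph_eqI[OF graph_add(1)[OF G H] graph_add(1)[OF H G] graph_add(2)[OF G H *(2,3)] _ *(1)] by blast
  qed
  have azero: "graph_add (graph_of \<zero>) G = G" and lone: "graph_mult (graph_of \<one>) G = G" and rone: "graph_mult G (graph_of \<one>) = G"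
    if G: "fraction_graph G" for G
  proof -
    obtain x u where *: "(x, u) \<in> G" "x \<noteq> \<zero>" using fraction_graphD(2)[OF G] by auto
    have c: "x \<in> carrier A" "u \<in> carrier A" using Dc[OF G *(1)] by auto
    have "(x, u) \<in> graph_add (graph_of \<zero>) G" using graph_add(2)[OF g0 G go[OF c(1)] *(1)] c by simp
    then show "graph_add (graph_of \<zero>) G = G" using graph_eqI[OF graph_add(1)[OF g0 G] G _ *] by blast
    have "(x, u) \<in> graph_mult (graph_of \<one>) G" using graph_mult(2)[OF g1 G *(1) go[OF c(2)]] c by simp
    then show "graph_mult (graph_of \<one>) G = G" using graph_eqI[OF graph_mult(1)[OF g1 G] G _ *] by blast
    have "(x, u) \<in> graph_mult G (graph_of \<one>)" using graph_mult(2)[OF G g1 go[OF c(1)]] c * by simp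
    then show "graph_mult G (graph_of \<one>) = G" using graph_eqI[OF graph_mult(1)[OF G g1] G _ *] by blast
  qed
  show ?thesis
  proof (intro ringI abelian_groupI monoidI)
    show "\<exists>y\<in>carrier fraction_ring. y \<oplus>\<^bsub>fraction_ring\<^esub> x = \<zero>\<^bsub>fraction_ring\<^esub>" if "x \<in> carrier fraction_ring" for x
      using that neg by (simp add: fraction_ring_def)
  qed (simp_all add: fraction_ring_def graph_mult(1) graph_add(1) g0 g1 assoc distl distr azero lone rone,
      (rule aassoc acomm; assumption)+)
qed

text \<open>A point (s, a) of a graph with s nonzero presents the fraction as a s^-1; a left Ore
  relation ra = bs presents it as r^-1 b.\<close>

theorem goldie_quotient_fraction_ring:
  assumes left_ore: "\<And>a s. \<lbrakk>a \<in> carrier A; s \<in> carrier A; s \<noteq> \<zero>\<rbrakk> \<Longrightarrow>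
    \<exists>b\<in>carrier A. \<exists>r\<in>carrier A. r \<noteq> \<zero> \<and> r \<otimes> a = b \<otimes> s"
  shows "goldie_quotient_ring A fraction_ring graph_of"
proof -
  interpret Q: ring fraction_ring by (rule ring_fraction_ring)
  have go: "(x, a \<otimes> x) \<in> graph_of a" if "x \<in> carrier A" for x a using that by (auto simp: graph_of_def)
  have go1: "(\<one>, a) \<in> graph_of a" if "a \<in> carrier A" for a using go[of \<one> a] that by simp
  have cl: "carrier fraction_ring = Collect fraction_graph" by (simp add: fraction_ring_def)
  have hom: "graph_of \<in> ring_hom A fraction_ring"
  proof (rule ring_hom_memI)
    fix a b assume ab: "a \<in> carrier A" "b \<in> carrier A"
    note ga = graph_of[OF ab(1)] and gb = graph_of[OF ab(2)]
    have "graph_of (a \<otimes> b) = graph_mult (graph_of a) (graph_of b)"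
      by (rule graph_eqI[OF graph_of graph_mult(1)[OF ga gb] go1 graph_mult(2)[OF ga gb go1[OF ab(2)] go[OF ab(2)]] one_nonzero])
        (use ab in auto)
    then show "graph_of (a \<otimes> b) = graph_of a \<otimes>\<^bsub>fraction_ring\<^esub> graph_of b" by (simp add: fraction_ring_def)
    have "graph_of (a \<oplus> b) = graph_add (graph_of a) (graph_of b)"
      by (rule graph_eqI[OF graph_of graph_add(1)[OF ga gb] go1 graph_add(2)[OF ga gb go1[OF ab(1)] go1[OF ab(2)]] one_nonzero])
        (use ab in auto)
    then show "graph_of (a \<oplus> b) = graph_of a \<oplus>\<^bsub>fraction_ring\<^esub> graph_of b" by (simp add: fraction_ring_def)
  qed (simp_all add: fraction_ring_def graph_of)
  have "inj_on graph_of (carrier A)"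
  proof (rule inj_onI)
    fix a b assume ab: "a \<in> carrier A" "b \<in> carrier A" "graph_of a = graph_of b"
    then show "a = b" using go1[OF ab(1)] go1[OF ab(2)] fraction_graphD(3)[OF graph_of[OF ab(1)]] by auto
  qed
  have reg: "regular_elements A = carrier A - {\<zero>}"
  proof -
    have "s \<in> regular_elements A \<longleftrightarrow> s \<in> carrier A - {\<zero>}" for s
      unfolding regular_elements_def using integral one_nonzero r_null[of \<one>] l_null[of \<one>] by auto
    then show ?thesis by blast
  qed
  \<comment> \<open>The converse of \<open>graph_of s\<close>, that is, the graph of s^-1.\<close>
  define cv where "cv s = {(s \<otimes> x, x) |x. x \<in> carrier A}" for s
  have cv: "fraction_graph (cv s)" if s: "s \<in> carrier A" "s \<noteq> \<zero>" for s
    unfolding fraction_graph_def pregraph_def saturated_def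
  proof (intro conjI allI ballI impI)
    show "\<exists>x y. (x, y) \<in> cv s \<and> x \<noteq> \<zero>" using s by (auto simp: cv_def intro!: exI[of _ s] exI[of _ \<one>])
    show "y = y'" if "(x, y) \<in> cv s" "(x, y') \<in> cv s" for x y y'
      using that s mult_left_cancel[of y y' s] by (auto simp: cv_def)
    fix x y r assume *: "x \<in> carrier A" "y \<in> carrier A" "r \<in> carrier A" "r \<noteq> \<zero>" "(x \<otimes> r, y \<otimes> r) \<in> cv s"
    then have "x \<otimes> r = s \<otimes> y \<otimes> r" using s by (auto simp: cv_def m_assoc)
    then have "x = s \<otimes> y" using mult_right_cancel[of x "s \<otimes> y" r] * s by simp
    then show "(x, y) \<in> cv s" using * by (auto simp: cv_def)
  next
    show "(x \<oplus> x', y \<oplus> y') \<in> cv s" if "(x, y) \<in> cv s" "(x', y') \<in> cv s" for x y x' y'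
      using that s by (auto simp: cv_def r_distr)
    show "(x \<otimes> r, y \<otimes> r) \<in> cv s" if "(x, y) \<in> cv s" "r \<in> carrier A" for x y r
      using that s by (auto simp: cv_def m_assoc)
  qed (use s in \<open>auto simp: cv_def\<close>)
  have cvm: "(s \<otimes> x, x) \<in> cv s" if "x \<in> carrier A" for s x using that by (auto simp: cv_def)
  have unit: "graph_of s \<in> Units fraction_ring \<and> inv\<^bsub>fraction_ring\<^esub> (graph_of s) = cv s" if s: "s \<in> carrier A" "s \<noteq> \<zero>" for s
  proof -
    note gs = graph_of[OF s(1)] and c = cv[OF s]
    have s1: "(s, \<one>) \<in> cv s" using cvm[of \<one> s] s by simp
    have ss: "(s, s) \<in> graph_of \<one>" using go[OF s(1), of \<one>] s by simp
    have "graph_mult (graph_of s) (cv s) = graph_of \<one>"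
      using graph_eqI[OF graph_mult(1)[OF gs c] graph_of[OF one_closed] graph_mult(2)[OF gs c s1 go1[OF s(1)]] ss s(2)] .
    moreover have "graph_mult (cv s) (graph_of s) = graph_of \<one>"
      using graph_eqI[OF graph_mult(1)[OF c gs] graph_of[OF one_closed] graph_mult(2)[OF c gs go1[OF s(1)] s1] go1[OF one_closed] one_nonzero] .
    ultimately have *: "graph_of s \<otimes>\<^bsub>fraction_ring\<^esub> cv s = \<one>\<^bsub>fraction_ring\<^esub>"
      "cv s \<otimes>\<^bsub>fraction_ring\<^esub> graph_of s = \<one>\<^bsub>fraction_ring\<^esub>" by (simp_all add: fraction_ring_def)
    have cc: "graph_of s \<in> carrier fraction_ring" "cv s \<in> carrier fraction_ring" using gs c by (auto simp: cl)
    have u: "graph_of s \<in> Units fraction_ring" unfolding Units_def using * cc by blast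
    have "cv s = inv\<^bsub>fraction_ring\<^esub> (graph_of s)"
      using Q.inv_char[OF cc *] by simp
    then show ?thesis using u by simp
  qed
  have right: "\<exists>a\<in>carrier A. \<exists>s\<in>regular_elements A. G = graph_of a \<otimes>\<^bsub>fraction_ring\<^esub> inv\<^bsub>fraction_ring\<^esub> (graph_of s)"
    if G: "fraction_graph G" for G
  proof -
    obtain s a where sa: "(s, a) \<in> G" "s \<noteq> \<zero>" using fraction_graphD(2)[OF G] by auto
    have c: "s \<in> carrier A" "a \<in> carrier A" using fraction_graphD(1)[OF G sa(1)] by auto
    have s1: "(s, \<one>) \<in> cv s" using cvm[of \<one> s] c by simp
    have "graph_mult (graph_of a) (cv s) = G"
      using graph_eqI[OF graph_mult(1)[OF graph_of[OF c(2)] cv[OF c(1) sa(2)]] G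
          graph_mult(2)[OF graph_of[OF c(2)] cv[OF c(1) sa(2)] s1 go1[OF c(2)]] sa] .
    then have "G = graph_of a \<otimes>\<^bsub>fraction_ring\<^esub> inv\<^bsub>fraction_ring\<^esub> (graph_of s)"
      using unit[OF c(1) sa(2)] by (simp add: fraction_ring_def)
    then show ?thesis using c sa reg by blast
  qed
  have left: "\<exists>b\<in>carrier A. \<exists>r\<in>regular_elements A. G = inv\<^bsub>fraction_ring\<^esub> (graph_of r) \<otimes>\<^bsub>fraction_ring\<^esub> graph_of b"
    if G: "fraction_graph G" for G
  proof -
    obtain s a where sa: "(s, a) \<in> G" "s \<noteq> \<zero>" using fraction_graphD(2)[OF G] by auto
    have c: "s \<in> carrier A" "a \<in> carrier A" using fraction_graphD(1)[OF G sa(1)] by auto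
    obtain b r where b: "b \<in> carrier A" "r \<in> carrier A" "r \<noteq> \<zero>" "r \<otimes> a = b \<otimes> s" using left_ore[OF c(2,1) sa(2)] by blast
    have s1: "(b \<otimes> s, a) \<in> cv r" using cvm[OF c(2), of r] b(4) by simp
    have "graph_mult (cv r) (graph_of b) = G"
      using graph_eqI[OF graph_mult(1)[OF cv[OF b(2,3)] graph_of[OF b(1)]] G
          graph_mult(2)[OF cv[OF b(2,3)] graph_of[OF b(1)] go[OF c(1)] s1] sa] .
    then have "G = inv\<^bsub>fraction_ring\<^esub> (graph_of r) \<otimes>\<^bsub>fraction_ring\<^esub> graph_of b"
      using unit[OF b(2,3)] by (simp add: fraction_ring_def)
    then show ?thesis using b reg by blast
  qed
  show ?thesis
    unfolding goldie_quotient_ring_def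
    using hom \<open>inj_on graph_of (carrier A)\<close> unit reg right left
    by (intro conjI ring_axioms Q.ring_axioms ballI) (auto simp: cl)
qed

end

text \<open>For a ring A of cosets, the type of Q is the one over which
  \<open>rational_prime\<close> and \<open>rat_deg\<close> range. The left Ore condition is the
  right one for \<open>opp A\<close>.\<close>

theorem noetherian_domain_goldie:
  fixes A :: "'a ring" (structure)
  assumes A: "ring_without_zero_divisors A" and N: "noetherian A"
  shows "\<exists>(Q :: ('a \<times> 'a) set ring) \<iota>. goldie_quotient_ring A Q \<iota>"
proof -
  interpret ring A using A by (simp add: ring_without_zero_divisors_def)
  interpret right_ore_domain A
    using A noetherian_right_ore[OF A N]
    by unfold_locales (auto simp: ring_without_zero_divisors_def)
  have "ring_without_zero_divisors (opp A)"
    using A ring_opp[OF ring_axioms] by (auto simp: ring_without_zero_divisors_def)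
  from noetherian_right_ore[OF this noetherian_opp[OF ring_axioms N]]
  have "\<And>a s. \<lbrakk>a \<in> carrier A; s \<in> carrier A; s \<noteq> \<zero>\<rbrakk> \<Longrightarrow> \<exists>b\<in>carrier A. \<exists>r\<in>carrier A. r \<noteq> \<zero> \<and> r \<otimes> a = b \<otimes> s"
    by simp
  then show ?thesis using goldie_quotient_fraction_ring by blast
qed

section \<open>The free algebra\<close>

lemma free_algebra_simps [simp]:
  "f \<in> carrier (free_algebra S) \<longleftrightarrow> finite {w. f w \<noteq> 0} \<and> (\<forall>w. f w \<noteq> 0 \<longrightarrow> set w \<subseteq> S)"
  "f \<otimes>\<^bsub>free_algebra S\<^esub> g = (\<lambda>w. \<Sum>i\<le>length w. f (take i w) * g (drop i w))"
  "\<one>\<^bsub>free_algebra S\<^esub> = (\<lambda>w. if w = [] then 1 else 0)"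
  "\<zero>\<^bsub>free_algebra S\<^esub> = (\<lambda>w. 0)"
  "f \<oplus>\<^bsub>free_algebra S\<^esub> g = (\<lambda>w. f w + g w)"
  by (auto simp: free_algebra_def)

lemma concat_product_support:
  fixes f g :: "'x list \<Rightarrow> 'k::Fields.field"
  shows "{w. (\<Sum>i\<le>length w. f (take i w) * g (drop i w)) \<noteq> 0} \<subseteq> (\<lambda>(u, v). u @ v) ` ({u. f u \<noteq> 0} \<times> {v. g v \<noteq> 0})"
proof
  fix w assume "w \<in> {w. (\<Sum>i\<le>length w. f (take i w) * g (drop i w)) \<noteq> 0}"
  then obtain i where "f (take i w) * g (drop i w) \<noteq> 0" by (metis (mono_tags, lifting) mem_Collect_eq sum.neutral)
  then show "w \<in> (\<lambda>(u, v). u @ v) ` ({u. f u \<noteq> 0} \<times> {v. g v \<noteq> 0})"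
    by (intro image_eqI[of _ _ "(take i w, drop i w)"]) auto
qed

text \<open>A word w with a cut position i is the same as a pair (u, v) with w = u @ v. The map h
  carries coefficients into the ring where x takes its values; with \<open>cc\<close> for h this
  makes \<open>ev\<close> multiplicative.\<close>

lemma sum_concat_product:
  fixes f g :: "'x list \<Rightarrow> 'k::Fields.field" and x :: "'x list \<Rightarrow> 'b::comm_ring_1"
  assumes f: "finite {u. f u \<noteq> 0}" and g: "finite {u. g u \<noteq> 0}"
    and h: "h 0 = 0" "\<And>a b. h (a + b) = h a + h b" "\<And>a b. h (a * b) = h a * h b"
  defines "p \<equiv> \<lambda>w. \<Sum>i\<le>length w. f (take i w) * g (drop i w)"
  shows "(\<Sum>w | p w \<noteq> 0. h (p w) * x w) = (\<Sum>u | f u \<noteq> 0. \<Sum>v | g v \<noteq> 0. h (f u) * h (g v) * x (u @ v))"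
proof -
  let ?B = "(\<lambda>(u, v). u @ v) ` ({u. f u \<noteq> 0} \<times> {v. g v \<noteq> 0})"
  have hs: "h (\<Sum>i\<in>A. a i) = (\<Sum>i\<in>A. h (a i))" for A :: "nat set" and a
    by (induction A rule: infinite_finite_induct) (auto simp: h)
  have fB: "finite ?B" using f g by auto
  have "(\<Sum>w | p w \<noteq> 0. h (p w) * x w) = (\<Sum>w\<in>?B. h (p w) * x w)"
    unfolding p_def using concat_product_support[of f g] fB by (intro sum.mono_neutral_left) (auto simp: h)
  also have "\<dots> = (\<Sum>w\<in>?B. \<Sum>i\<le>length w. h (f (take i w)) * h (g (drop i w)) * x w)"
    by (simp add: p_def hs h sum_distrib_right)
  also have "\<dots> = (\<Sum>(w, i)\<in>Sigma ?B (\<lambda>w. {..length w}). h (f (take i w)) * h (g (drop i w)) * x w)"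
    using fB by (subst sum.Sigma) auto
  also have "\<dots> = (\<Sum>(u, v)\<in>{u. f u \<noteq> 0} \<times> {v. g v \<noteq> 0}. h (f u) * h (g v) * x (u @ v))"
  \<comment> \<open>Cuts with a vanishing factor must be set aside as neutral, since the bijection
    reaches only pairs from the two supports.\<close>
  proof (rule sum.reindex_bij_witness_not_neutral[where
        i = "\<lambda>(u, v). (u @ v, length u)" and j = "\<lambda>(w, i). (take i w, drop i w)"
        and S' = "{(w, i) \<in> Sigma ?B (\<lambda>w. {..length w}). f (take i w) = 0 \<or> g (drop i w) = 0}" and T' = "{}"])
    show "finite {(w, i) \<in> Sigma ?B (\<lambda>w. {..length w}). f (take i w) = 0 \<or> g (drop i w) = 0}"
      using fB by (intro finite_subset[OF _ finite_SigmaI[of ?B "\<lambda>w. {..length w}"]]) auto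
  qed (use h in \<open>auto split: prod.splits\<close>)
  also have "\<dots> = (\<Sum>u | f u \<noteq> 0. \<Sum>v | g v \<noteq> 0. h (f u) * h (g v) * x (u @ v))"
    using f g by (subst sum.Sigma) auto
  finally show ?thesis .
qed

text \<open>Both sides sum over the cuts of w into three pieces: (i, j) marks the ends of the second
  and the first piece, (j, k) the lengths of the first and the second.\<close>

lemma concat_product_assoc:
  fixes f g h :: "'x list \<Rightarrow> 'k::Fields.field"
  shows "(\<Sum>i\<le>length w. (\<Sum>j\<le>length (take i w). f (take j (take i w)) * g (drop j (take i w))) * h (drop i w))
    = (\<Sum>j\<le>length w. f (take j w) * (\<Sum>k\<le>length (drop j w). g (take k (drop j w)) * h (drop k (drop j w))))"
proof -
  let ?n = "length w"
  have "(\<Sum>i\<le>?n. (\<Sum>j\<le>length (take i w). f (take j (take i w)) * g (drop j (take i w))) * h (drop i w))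
    = (\<Sum>i\<le>?n. \<Sum>j\<le>i. f (take j w) * g (drop j (take i w)) * h (drop i w))"
    by (intro sum.cong refl) (auto simp: sum_distrib_right min_def)
  also have "\<dots> = (\<Sum>(i, j)\<in>Sigma {..?n} (\<lambda>i. {..i}). f (take j w) * g (drop j (take i w)) * h (drop i w))"
    by (subst sum.Sigma) auto
  also have "\<dots> = (\<Sum>(j, k)\<in>Sigma {..?n} (\<lambda>j. {..?n - j}). f (take j w) * g (take k (drop j w)) * h (drop k (drop j w)))"
    by (rule sum.reindex_bij_witness[where i = "\<lambda>(j, k). (j + k, j)" and j = "\<lambda>(i, j). (j, i - j)"])
      (auto simp: drop_take)
  also have "\<dots> = (\<Sum>j\<le>?n. \<Sum>k\<le>?n - j. f (take j w) * g (take k (drop j w)) * h (drop k (drop j w)))"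
    by (subst sum.Sigma) auto
  also have "\<dots> = (\<Sum>j\<le>?n. f (take j w) * (\<Sum>k\<le>length (drop j w). g (take k (drop j w)) * h (drop k (drop j w))))"
    by (auto simp: sum_distrib_left mult.assoc)
  finally show ?thesis .
qed

lemma concat_product_one:
  fixes f :: "'x list \<Rightarrow> 'k::Fields.field"
  shows "(\<Sum>i\<le>length w. (if take i w = [] then c else 0) * f (drop i w)) = c * f w"
    and "(\<Sum>i\<le>length w. f (take i w) * (if drop i w = [] then c else 0)) = f w * c"
proof -
  have "(\<Sum>i\<le>length w. (if take i w = [] then c else 0) * f (drop i w)) = (\<Sum>i\<le>length w. if i = 0 then c * f w else 0)"
    by (intro sum.cong) auto
  then show "(\<Sum>i\<le>length w. (if take i w = [] then c else 0) * f (drop i w)) = c * f w" by simp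
  have "(\<Sum>i\<le>length w. f (take i w) * (if drop i w = [] then c else 0)) = (\<Sum>i\<le>length w. if i = length w then f w * c else 0)"
    by (intro sum.cong) auto
  then show "(\<Sum>i\<le>length w. f (take i w) * (if drop i w = [] then c else 0)) = f w * c" by simp
qed

lemma free_algebra_mult_closed:
  fixes f g :: "'x list \<Rightarrow> 'k::Fields.field"
  assumes "f \<in> carrier (free_algebra S)" "g \<in> carrier (free_algebra S)"
  shows "f \<otimes>\<^bsub>free_algebra S\<^esub> g \<in> carrier (free_algebra S)"
proof -
  have "finite ((\<lambda>(u, v). u @ v) ` ({u. f u \<noteq> 0} \<times> {v. g v \<noteq> 0}))" using assms by auto
  then have "finite {w. (\<Sum>i\<le>length w. f (take i w) * g (drop i w)) \<noteq> 0}"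
    by (rule finite_subset[OF concat_product_support])
  moreover have "set w \<subseteq> S" if "(\<Sum>i\<le>length w. f (take i w) * g (drop i w)) \<noteq> 0" for w
  proof -
    have "w \<in> (\<lambda>(u, v). u @ v) ` ({u. f u \<noteq> 0} \<times> {v. g v \<noteq> 0})" using concat_product_support that by blast
    then obtain u v where "w = u @ v" "f u \<noteq> 0" "g v \<noteq> 0" by auto
    then show ?thesis using assms by auto
  qed
  ultimately show ?thesis by simp
qed

lemma free_algebra_add_closed:
  fixes f g :: "'x list \<Rightarrow> 'k::Fields.field"
  assumes "f \<in> carrier (free_algebra S)" "g \<in> carrier (free_algebra S)"
  shows "f \<oplus>\<^bsub>free_algebra S\<^esub> g \<in> carrier (free_algebra S)"
proof -
  have "finite {w. f w + g w \<noteq> 0}"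
    by (rule finite_subset[of _ "{w. f w \<noteq> 0} \<union> {w. g w \<noteq> 0}"]) (use assms in auto)
  moreover have "set w \<subseteq> S" if "f w + g w \<noteq> 0" for w
    using assms that by (metis (no_types, lifting) add.right_neutral free_algebra_simps(1))
  ultimately show ?thesis by simp
qed

lemma free_algebra_scale_closed:
  fixes f :: "'x list \<Rightarrow> 'k::Fields.field"
  assumes "f \<in> carrier (free_algebra S)"
  shows "(\<lambda>w. c * f w) \<in> carrier (free_algebra S)"
proof -
  have "finite {w. c * f w \<noteq> 0}" by (rule finite_subset[of _ "{w. f w \<noteq> 0}"]) (use assms in auto)
  then show ?thesis using assms by auto
qed

lemma word_mult: "word u \<otimes>\<^bsub>free_algebra S\<^esub> word v = (word (u @ v) :: 'x list \<Rightarrow> 'k::Fields.field)"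
proof
  fix w
  have iff: "take i w = u \<and> drop i w = v \<longleftrightarrow> i = length u \<and> w = u @ v" if "i \<le> length w" for i
    using that by (auto simp: min_def)
  have "(\<Sum>i\<le>length w. word u (take i w) * word v (drop i w)) = (\<Sum>i\<le>length w. if i = length u \<and> w = u @ v then 1 else (0::'k))"
  proof (intro sum.cong refl)
    fix i assume "i \<in> {..length w}"
    then have "take i w = u \<and> drop i w = v \<longleftrightarrow> i = length u \<and> w = u @ v" using iff by simp
    then show "word u (take i w) * word v (drop i w) = (if i = length u \<and> w = u @ v then 1 else (0::'k))"
      unfolding word_def by (cases "take i w = u"; cases "drop i w = v") simp_all
  qed
  also have "\<dots> = word (u @ v) w"
  proof (cases "w = u @ v")
    case True
    then have "(\<Sum>i\<le>length w. if i = length u \<and> w = u @ v then 1 else (0::'k)) = (\<Sum>i\<le>length w. if i = length u then 1 else 0)" by simp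
    also have "\<dots> = 1" using True by simp
    finally show ?thesis using True by (simp add: word_def)
  qed (simp add: word_def)
  finally show "(word u \<otimes>\<^bsub>free_algebra S\<^esub> word v) w = (word (u @ v) w :: 'k)" by simp
qed

lemma word_closed: "set u \<subseteq> S \<Longrightarrow> word u \<in> carrier (free_algebra S)"
  by (auto simp: word_def)

lemma ring_free_algebra: "ring (free_algebra S :: ('x list \<Rightarrow> 'k::Fields.field) ring)"
proof (intro ringI abelian_groupI monoidI)
  fix f g h :: "'x list \<Rightarrow> 'k"
  assume c: "f \<in> carrier (free_algebra S)" "g \<in> carrier (free_algebra S)" "h \<in> carrier (free_algebra S)"
  show "f \<otimes>\<^bsub>free_algebra S\<^esub> g \<otimes>\<^bsub>free_algebra S\<^esub> h = f \<otimes>\<^bsub>free_algebra S\<^esub> (g \<otimes>\<^bsub>free_algebra S\<^esub> h)"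
    unfolding free_algebra_simps(2) by (rule ext) (rule concat_product_assoc)
next
  fix f :: "'x list \<Rightarrow> 'k" assume c: "f \<in> carrier (free_algebra S)"
  show "\<one>\<^bsub>free_algebra S\<^esub> \<otimes>\<^bsub>free_algebra S\<^esub> f = f" "f \<otimes>\<^bsub>free_algebra S\<^esub> \<one>\<^bsub>free_algebra S\<^esub> = f"
    by (simp_all add: concat_product_one del: take_eq_Nil drop_eq_Nil)
  show "\<exists>g\<in>carrier (free_algebra S). g \<oplus>\<^bsub>free_algebra S\<^esub> f = \<zero>\<^bsub>free_algebra S\<^esub>"
    using free_algebra_scale_closed[OF c, of "-1"] by (intro bexI[of _ "\<lambda>w. -1 * f w"]) (simp, simp only:)
next
  fix f g :: "'x list \<Rightarrow> 'k" assume "f \<in> carrier (free_algebra S)" "g \<in> carrier (free_algebra S)"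
  then show "f \<oplus>\<^bsub>free_algebra S\<^esub> g \<in> carrier (free_algebra S)" "f \<otimes>\<^bsub>free_algebra S\<^esub> g \<in> carrier (free_algebra S)"
    by (rule free_algebra_add_closed, rule free_algebra_mult_closed)
qed (auto simp: algebra_simps sum.distrib)

lemma free_algebra_minus:
  fixes f g :: "'x list \<Rightarrow> 'k::Fields.field"
  assumes "f \<in> carrier (free_algebra S)" "g \<in> carrier (free_algebra S)"
  shows "f \<ominus>\<^bsub>free_algebra S\<^esub> g = (\<lambda>w. f w - g w)"
proof -
  interpret ring "free_algebra S :: ('x list \<Rightarrow> 'k) ring" by (rule ring_free_algebra)
  have c: "(\<lambda>w. -1 * g w) \<in> carrier (free_algebra S)" using assms(2) by (rule free_algebra_scale_closed)
  have "(\<lambda>w. -1 * g w) \<oplus>\<^bsub>free_algebra S\<^esub> g = \<zero>\<^bsub>free_algebra S\<^esub>" by simp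
  then have "\<ominus>\<^bsub>free_algebra S\<^esub> g = (\<lambda>w. -1 * g w)" using minus_equality[OF _ assms(2) c] by simp
  then show ?thesis by (simp add: a_minus_def)
qed

lemma enveloping_relations_closed:
  fixes L :: "'v::ab_group_add set" and smul :: "'k::Fields.field \<Rightarrow> 'v \<Rightarrow> 'v"
  assumes "\<And>x y. x \<in> L \<Longrightarrow> y \<in> L \<Longrightarrow> x + y \<in> L" "\<And>c x. x \<in> L \<Longrightarrow> smul c x \<in> L"
    "\<And>x y. x \<in> L \<Longrightarrow> y \<in> L \<Longrightarrow> br x y \<in> L"
  shows "enveloping_relations L smul br \<subseteq> carrier (free_algebra L)"
proof -
  have sub: "(\<lambda>w. f w - g w) \<in> carrier (free_algebra L)"
    if "f \<in> carrier (free_algebra L)" "g \<in> carrier (free_algebra L)" for f g :: "'v list \<Rightarrow> 'k"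
    using free_algebra_add_closed[OF that(1) free_algebra_scale_closed[OF that(2), of "-1"]] by simp
  show ?thesis
    unfolding enveloping_relations_def
  proof (intro subsetI, elim UnE)
    fix f :: "'v list \<Rightarrow> 'k" assume "f \<in> {\<lambda>w. word [x + y] w - word [x] w - word [y] w |x y. x \<in> L \<and> y \<in> L}"
    then obtain x y where *: "x \<in> L" "y \<in> L" "f = (\<lambda>w. word [x + y] w - word [x] w - word [y] w)" by blast
    show "f \<in> carrier (free_algebra L)" unfolding *(3)
      by (intro sub word_closed) (use * assms in simp_all)
  next
    fix f :: "'v list \<Rightarrow> 'k" assume "f \<in> {\<lambda>w. word [smul c x] w - c * word [x] w |c x. x \<in> L}"
    then obtain x c where *: "x \<in> L" "f = (\<lambda>w. word [smul c x] w - c * word [x] w)" by blast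
    show "f \<in> carrier (free_algebra L)" unfolding *(2)
      by (intro sub word_closed free_algebra_scale_closed) (use * assms in simp_all)
  next
    fix f :: "'v list \<Rightarrow> 'k" assume "f \<in> {\<lambda>w. word [x, y] w - word [y, x] w - word [br x y] w |x y. x \<in> L \<and> y \<in> L}"
    then obtain x y where *: "x \<in> L" "y \<in> L" "f = (\<lambda>w. word [x, y] w - word [y, x] w - word [br x y] w)" by blast
    show "f \<in> carrier (free_algebra L)" unfolding *(3)
      by (intro sub word_closed) (use * assms in simp_all)
  qed
qed

section \<open>The enveloping algebra as a type\<close>

abbreviation ent :: "complex^2^2 \<Rightarrow> 2 \<Rightarrow> 2 \<Rightarrow> complex" where "ent A i j \<equiv> vec_nth (vec_nth A i) j"

abbreviation FA :: "((complex^2^2) list \<Rightarrow> complex) ring" where "FA \<equiv> free_algebra sl2"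
abbreviation EI :: "((complex^2^2) list \<Rightarrow> complex) set" where "EI \<equiv> enveloping_ideal sl2 sl2_scale sl2_bracket"
abbreviation ER :: "((complex^2^2) list \<Rightarrow> complex) set" where "ER \<equiv> enveloping_relations sl2 sl2_scale sl2_bracket"

lemma sl2_iff: "A \<in> sl2 \<longleftrightarrow> ent A 2 2 = - (ent A 1 1)"
  by (auto simp: sl2_def trace_def sum_2 eq_neg_iff_add_eq_0 add.commute)

lemma sl2_bracket_entries:
  "ent (sl2_bracket A B) i j = ent A i 1 * ent B 1 j + ent A i 2 * ent B 2 j - ent B i 1 * ent A 1 j - ent B i 2 * ent A 2 j"
  by (simp add: sl2_bracket_def matrix_matrix_mult_def sum_2)

lemma sl2_closed:
  "A \<in> sl2 \<Longrightarrow> B \<in> sl2 \<Longrightarrow> A + B \<in> sl2" "A \<in> sl2 \<Longrightarrow> sl2_scale c A \<in> sl2" "sl2_bracket A B \<in> sl2"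
  by (auto simp: sl2_iff sl2_scale_def sl2_bracket_entries algebra_simps)

lemma ER_closed: "ER \<subseteq> carrier FA"
  by (rule enveloping_relations_closed) (auto intro: sl2_closed)

lemma ideal_EI: "ideal EI FA"
  unfolding enveloping_ideal_def by (rule ring.genideal_ideal[OF ring_free_algebra ER_closed])

lemma EI_minimal: "ideal J FA \<Longrightarrow> ER \<subseteq> J \<Longrightarrow> EI \<subseteq> J"
  unfolding enveloping_ideal_def by (rule ring.genideal_minimal[OF ring_free_algebra])

lemma ER_EI: "ER \<subseteq> EI"
  unfolding enveloping_ideal_def by (rule ring.genideal_self[OF ring_free_algebra ER_closed])

lemma U_sl2_eq: "U_sl2 = FA Quot EI"
  by (simp add: U_sl2_def enveloping_algebra_def)

lemma ring_U_sl2: "ring U_sl2"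
  unfolding U_sl2_eq by (rule ideal.quotient_is_ring[OF ideal_EI])

text \<open>The relations have no constant term, so they generate an ideal inside the augmentation
  ideal.\<close>

lemma one_notin_EI: "\<one>\<^bsub>FA\<^esub> \<notin> EI"
proof -
  let ?J = "{f \<in> carrier FA. f [] = 0}"
  have "ideal ?J FA"
  proof (rule idealI')
    show "r \<otimes>\<^bsub>FA\<^esub> x \<in> ?J" "x \<otimes>\<^bsub>FA\<^esub> r \<in> ?J" if "r \<in> carrier FA" "x \<in> ?J" for r x
    proof -
      have "x \<in> carrier FA" using that(2) by blast
      note c = free_algebra_mult_closed[OF that(1) this] free_algebra_mult_closed[OF this that(1)]
      have "(r \<otimes>\<^bsub>FA\<^esub> x) [] = 0" "(x \<otimes>\<^bsub>FA\<^esub> r) [] = 0" using that by simp_all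
      then show "r \<otimes>\<^bsub>FA\<^esub> x \<in> ?J" "x \<otimes>\<^bsub>FA\<^esub> r \<in> ?J" using c by blast+
    qed
    show "x \<oplus>\<^bsub>FA\<^esub> y \<in> ?J" if "x \<in> ?J" "y \<in> ?J" for x y
    proof -
      have "x \<oplus>\<^bsub>FA\<^esub> y \<in> carrier FA" by (rule free_algebra_add_closed) (use that in blast)+
      moreover have "(x \<oplus>\<^bsub>FA\<^esub> y) [] = 0" using that by simp
      ultimately show ?thesis by blast
    qed
  qed (rule ring_free_algebra, blast, simp)
  moreover have "f [] = 0" if "f \<in> ER" for f
    using that unfolding enveloping_relations_def by (elim UnE CollectE exE conjE) (simp_all add: word_def)
  then have "ER \<subseteq> ?J" using ER_closed by blast
  ultimately have "EI \<subseteq> ?J" by (rule EI_minimal)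
  then show ?thesis by auto
qed

text \<open>As a type of class \<open>ring_1\<close>, the algebra can be computed with by the
  simplifier, free of carrier conditions; \<open>Rep_ut\<close> leads back to
  \<open>U_sl2\<close>.\<close>

typedef ut = "carrier U_sl2"
  using ring.ring_simprules(2)[OF ring_U_sl2] by blast

instantiation ut :: ring_1
begin
definition "0 = Abs_ut \<zero>\<^bsub>U_sl2\<^esub>"
definition "1 = Abs_ut \<one>\<^bsub>U_sl2\<^esub>"
definition "x + y = Abs_ut (Rep_ut x \<oplus>\<^bsub>U_sl2\<^esub> Rep_ut y)"
definition "x * y = Abs_ut (Rep_ut x \<otimes>\<^bsub>U_sl2\<^esub> Rep_ut y)"
definition "- x = Abs_ut (\<ominus>\<^bsub>U_sl2\<^esub> Rep_ut x)"
definition "x - y = Abs_ut (Rep_ut x \<ominus>\<^bsub>U_sl2\<^esub> Rep_ut y)" for x y :: ut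
instance
proof -
  interpret ring U_sl2 by (rule ring_U_sl2)
  have R: "Rep_ut x \<in> carrier U_sl2" for x by (rule Rep_ut)
  note defs = zero_ut_def one_ut_def plus_ut_def times_ut_def uminus_ut_def minus_ut_def
  have ne: "\<zero>\<^bsub>U_sl2\<^esub> \<noteq> \<one>\<^bsub>U_sl2\<^esub>"
  proof
    assume "\<zero>\<^bsub>U_sl2\<^esub> = \<one>\<^bsub>U_sl2\<^esub>"
    then have "EI +>\<^bsub>FA\<^esub> \<one>\<^bsub>FA\<^esub> = EI" by (simp add: U_sl2_eq FactRing_def)
    moreover have "\<one>\<^bsub>FA\<^esub> \<in> carrier FA" by (rule ring.ring_simprules(6)[OF ring_free_algebra])
    ultimately show False using ideal.rcos_eq_self_iff[OF ideal_EI] one_notin_EI by blast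
  qed
  show "OFCLASS(ut, ring_1_class)"
  proof
    fix a b c :: ut
    show "(0::ut) \<noteq> 1" unfolding defs using ne Abs_ut_inject[of "\<zero>\<^bsub>U_sl2\<^esub>" "\<one>\<^bsub>U_sl2\<^esub>"] by simp
    show "a - b = a + - b" unfolding defs by (simp add: Abs_ut_inverse R a_minus_def)
  qed (simp_all add: defs Abs_ut_inverse Rep_ut_inverse R a_ac m_assoc l_distr r_distr l_neg r_neg)
qed
end

lemma Rep_ut_hom:
  "Rep_ut 0 = \<zero>\<^bsub>U_sl2\<^esub>" "Rep_ut 1 = \<one>\<^bsub>U_sl2\<^esub>" "Rep_ut (x + y) = Rep_ut x \<oplus>\<^bsub>U_sl2\<^esub> Rep_ut y"
  "Rep_ut (x * y) = Rep_ut x \<otimes>\<^bsub>U_sl2\<^esub> Rep_ut y" "Rep_ut (- x) = \<ominus>\<^bsub>U_sl2\<^esub> Rep_ut x"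
proof -
  interpret ring U_sl2 by (rule ring_U_sl2)
  have R: "Rep_ut x \<in> carrier U_sl2" for x by (rule Rep_ut)
  show "Rep_ut 0 = \<zero>\<^bsub>U_sl2\<^esub>" "Rep_ut 1 = \<one>\<^bsub>U_sl2\<^esub>" "Rep_ut (x + y) = Rep_ut x \<oplus>\<^bsub>U_sl2\<^esub> Rep_ut y"
    "Rep_ut (x * y) = Rep_ut x \<otimes>\<^bsub>U_sl2\<^esub> Rep_ut y" "Rep_ut (- x) = \<ominus>\<^bsub>U_sl2\<^esub> Rep_ut x"
    by (simp_all add: zero_ut_def one_ut_def plus_ut_def times_ut_def uminus_ut_def Abs_ut_inverse R)
qed

definition cls :: "((complex^2^2) list \<Rightarrow> complex) \<Rightarrow> ut" where "cls f = Abs_ut (EI +>\<^bsub>FA\<^esub> f)"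

lemma Rep_cls: "f \<in> carrier FA \<Longrightarrow> Rep_ut (cls f) = EI +>\<^bsub>FA\<^esub> f"
  unfolding cls_def by (rule Abs_ut_inverse) (auto simp: U_sl2_eq FactRing_def A_RCOSETS_def' simp del: free_algebra_simps)

lemma cls_hom:
  assumes "f \<in> carrier FA" "g \<in> carrier FA"
  shows "cls (f \<oplus>\<^bsub>FA\<^esub> g) = cls f + cls g" "cls (f \<otimes>\<^bsub>FA\<^esub> g) = cls f * cls g" "cls \<one>\<^bsub>FA\<^esub> = 1"
    "cls f = cls g \<longleftrightarrow> f \<ominus>\<^bsub>FA\<^esub> g \<in> EI"
proof -
  interpret F: ring FA by (rule ring_free_algebra)
  interpret surj_ring_hom FA U_sl2 "a_r_coset FA EI" unfolding U_sl2_eq by (rule surj_ring_hom_quot[OF ideal_EI])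
  note c = F.add.m_closed[OF assms] F.m_closed[OF assms] F.one_closed
  have "Rep_ut (cls (f \<oplus>\<^bsub>FA\<^esub> g)) = Rep_ut (cls f + cls g)" "Rep_ut (cls (f \<otimes>\<^bsub>FA\<^esub> g)) = Rep_ut (cls f * cls g)"
    "Rep_ut (cls \<one>\<^bsub>FA\<^esub>) = Rep_ut 1"
    using hom_add[OF assms] hom_mult[OF assms] hom_one
    by (simp_all only: Rep_ut_hom Rep_cls[OF assms(1)] Rep_cls[OF assms(2)] Rep_cls[OF c(1)] Rep_cls[OF c(2)] Rep_cls[OF c(3)])
  then show "cls (f \<oplus>\<^bsub>FA\<^esub> g) = cls f + cls g" "cls (f \<otimes>\<^bsub>FA\<^esub> g) = cls f * cls g" "cls \<one>\<^bsub>FA\<^esub> = 1"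
    by (simp_all only: Rep_ut_inject)
  interpret I: ideal EI FA by (rule ideal_EI)
  have "cls f = cls g \<longleftrightarrow> EI +>\<^bsub>FA\<^esub> f = EI +>\<^bsub>FA\<^esub> g"
    unfolding Rep_ut_inject[symmetric] Rep_cls[OF assms(1)] Rep_cls[OF assms(2)] ..
  also have "\<dots> \<longleftrightarrow> f \<ominus>\<^bsub>FA\<^esub> g \<in> EI"
    using I.a_rcos_module_minus[OF F.ring_axioms assms(2,1)] I.a_rcos_self[OF assms(1)]
      I.a_repr_independence'[of f g] assms(2) by (metis (no_types, lifting))
  finally show "cls f = cls g \<longleftrightarrow> f \<ominus>\<^bsub>FA\<^esub> g \<in> EI" .
qed

lemma cls_surj: "\<exists>f\<in>carrier FA. u = cls f"
proof -
  have "Rep_ut u \<in> carrier U_sl2" by (rule Rep_ut)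
  then obtain f where f: "f \<in> carrier FA" "Rep_ut u = EI +>\<^bsub>FA\<^esub> f"
    unfolding U_sl2_eq FactRing_def A_RCOSETS_def' by (auto simp del: free_algebra_simps)
  then show ?thesis unfolding cls_def by (metis Rep_ut_inverse)
qed

definition sc :: "complex \<Rightarrow> ut" where "sc c = cls (\<lambda>w. c * word [] w)"
definition gen :: "complex^2^2 \<Rightarrow> ut" where "gen A = cls (word [A])"

lemma scalar_closed: "(\<lambda>w. c * word [] w) \<in> carrier FA"
  by (rule free_algebra_scale_closed, rule word_closed) simp

lemma scalar_mult:
  "(\<lambda>w. c * word [] w) \<otimes>\<^bsub>FA\<^esub> f = (\<lambda>w. c * f w)" "f \<otimes>\<^bsub>FA\<^esub> (\<lambda>w. c * word [] w) = (\<lambda>w. c * f w)"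
proof -
  have *: "(\<lambda>w. c * word [] w) = (\<lambda>w. if w = [] then c else 0)" by (auto simp: word_def)
  show "(\<lambda>w. c * word [] w) \<otimes>\<^bsub>FA\<^esub> f = (\<lambda>w. c * f w)" "f \<otimes>\<^bsub>FA\<^esub> (\<lambda>w. c * word [] w) = (\<lambda>w. c * f w)"
    unfolding * free_algebra_simps concat_product_one by (simp_all add: mult.commute)
qed

lemma cls_scale: "f \<in> carrier FA \<Longrightarrow> cls (\<lambda>w. c * f w) = sc c * cls f"
  using cls_hom(2)[OF scalar_closed[of c], of f] unfolding sc_def scalar_mult(1) by blast

lemma sc_central: "sc c * u = u * sc c"
proof -
  obtain f where f: "f \<in> carrier FA" "u = cls f" using cls_surj by blast
  show ?thesis unfolding f(2) sc_def
    using cls_hom(2)[OF scalar_closed[of c] f(1)] cls_hom(2)[OF f(1) scalar_closed[of c]]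
    by (simp add: scalar_mult del: free_algebra_simps)
qed

lemma sc_hom [simp]: "sc 1 = 1" "sc (c + d) = sc c + sc d" "sc (c * d) = sc c * sc d"
proof -
  have "(\<lambda>w. 1 * word [] w) = \<one>\<^bsub>FA\<^esub>" by (auto simp: word_def)
  then show "sc 1 = 1" unfolding sc_def using cls_hom(3)[OF scalar_closed scalar_closed] by simp
  have "(\<lambda>w. (c + d) * word [] w) = (\<lambda>w. c * word [] w) \<oplus>\<^bsub>FA\<^esub> (\<lambda>w. d * word [] w)" by (simp add: distrib_right)
  then show "sc (c + d) = sc c + sc d" unfolding sc_def using cls_hom(1)[OF scalar_closed scalar_closed] by simp
  have "(\<lambda>w. (c * d) * word [] w) = (\<lambda>w. c * word [] w) \<otimes>\<^bsub>FA\<^esub> (\<lambda>w. d * word [] w)"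
    unfolding scalar_mult by (simp add: mult.assoc)
  then show "sc (c * d) = sc c * sc d" unfolding sc_def using cls_hom(2)[OF scalar_closed scalar_closed] by simp
qed

lemma sc_0 [simp]: "sc 0 = 0"
  using sc_hom(2)[of 0 0] by simp

lemma sc_minus [simp]: "sc (- c) = - sc c" "sc (c - d) = sc c - sc d"
proof -
  show "sc (- c) = - sc c" using sc_hom(2)[of c "- c"] by (simp add: eq_neg_iff_add_eq_0 add.commute)
  show "sc (c - d) = sc c - sc d" using sc_hom(2)[of "c - d" d] by (simp add: eq_diff_eq)
qed

lemma gen_rel:
  assumes "A \<in> sl2" "B \<in> sl2"
  shows "gen (A + B) = gen A + gen B" "gen (sl2_scale c A) = sc c * gen A"
    "gen A * gen B - gen B * gen A = gen (sl2_bracket A B)"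
proof -
  interpret F: ring FA by (rule ring_free_algebra)
  note m = free_algebra_minus
  have wc: "word [A] \<in> carrier FA" "word [B] \<in> carrier FA" "word [A, B] \<in> carrier FA" "word [B, A] \<in> carrier FA"
    "word [A + B] \<in> carrier FA" "word [sl2_scale c A] \<in> carrier FA" "word [sl2_bracket A B] \<in> carrier FA"
    using assms sl2_closed by (auto intro!: word_closed simp del: free_algebra_simps)
  note wm = word_mult[where 'k = complex and S = sl2]
  have "word [A + B] \<ominus>\<^bsub>FA\<^esub> (word [A] \<oplus>\<^bsub>FA\<^esub> word [B]) = (\<lambda>w. word [A + B] w - word [A] w - word [B] w)"
    using m[OF wc(5) free_algebra_add_closed[OF wc(1,2)]] by (simp add: diff_diff_eq)
  also have "\<dots> \<in> EI" using ER_EI assms unfolding enveloping_relations_def by blast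
  finally show "gen (A + B) = gen A + gen B"
    unfolding gen_def using cls_hom(4)[OF wc(5) free_algebra_add_closed[OF wc(1,2)]] cls_hom(1)[OF wc(1,2)] by simp
  have "word [sl2_scale c A] \<ominus>\<^bsub>FA\<^esub> (\<lambda>w. c * word [A] w) = (\<lambda>w. word [sl2_scale c A] w - c * word [A] w)"
    using m[OF wc(6) free_algebra_scale_closed[OF wc(1)]] by simp
  also have "\<dots> \<in> EI" using ER_EI assms unfolding enveloping_relations_def by blast
  finally show "gen (sl2_scale c A) = sc c * gen A"
    unfolding gen_def using cls_hom(4)[OF wc(6) free_algebra_scale_closed[OF wc(1)]] cls_scale[OF wc(1)] by simp
  have "word [A, B] \<ominus>\<^bsub>FA\<^esub> (word [B, A] \<oplus>\<^bsub>FA\<^esub> word [sl2_bracket A B]) = (\<lambda>w. word [A, B] w - word [B, A] w - word [sl2_bracket A B] w)"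
    using m[OF wc(3) free_algebra_add_closed[OF wc(4,7)]] by (simp add: diff_diff_eq)
  also have "\<dots> \<in> EI" using ER_EI assms unfolding enveloping_relations_def by blast
  finally have "cls (word [A, B]) = cls (word [B, A]) + cls (word [sl2_bracket A B])"
    using cls_hom(4)[OF wc(3) free_algebra_add_closed[OF wc(4,7)]] cls_hom(1)[OF wc(4,7)] by simp
  moreover have "cls (word [A, B]) = gen A * gen B" "cls (word [B, A]) = gen B * gen A"
    unfolding gen_def using cls_hom(2)[OF wc(1,2)] cls_hom(2)[OF wc(2,1)] unfolding wm by simp_all
  ultimately show "gen A * gen B - gen B * gen A = gen (sl2_bracket A B)" by (simp add: gen_def)
qed

lemma gen_mult_word: "A \<in> sl2 \<Longrightarrow> set w \<subseteq> sl2 \<Longrightarrow> cls (word (A # w)) = gen A * cls (word w)"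
proof -
  assume a: "A \<in> sl2" "set w \<subseteq> sl2"
  have wm: "word [A] \<otimes>\<^bsub>FA\<^esub> word w = (word (A # w) :: _ \<Rightarrow> complex)" using word_mult[where u = "[A]" and v = w and S = sl2] by simp
  have "word [A] \<in> carrier FA" "word w \<in> carrier FA" using a by (auto intro!: word_closed simp del: free_algebra_simps)
  from cls_hom(2)[OF this] show ?thesis unfolding wm gen_def .
qed

text \<open>Words are built up letter by letter on the left, and \<open>cls f\<close> is a sum of
  scaled words over the support of f.\<close>

lemma ut_gen_induct:
  assumes sc: "\<And>c. P (sc c)" and add: "\<And>u v. P u \<Longrightarrow> P v \<Longrightarrow> P (u + v)"
    and scale: "\<And>c u. P u \<Longrightarrow> P (sc c * u)" and gen: "\<And>A u. A \<in> sl2 \<Longrightarrow> P u \<Longrightarrow> P (gen A * u)"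
  shows "P u"
proof -
  have word: "P (cls (word w))" if "set w \<subseteq> sl2" for w
    using that
  proof (induction w)
    case Nil
    have "cls (word []) = sc 1" by (simp add: sc_def)
    then show ?case using sc[of 1] by simp
  next
    case (Cons A w)
    then show ?case using gen[of A "cls (word w)"] gen_mult_word[of A w] by simp
  qed
  have "P (cls f)" if "f \<in> carrier FA" for f
  proof -
    have "finite {w. f w \<noteq> 0}" using that by simp
    then show ?thesis using that
    proof (induction "{w. f w \<noteq> 0}" arbitrary: f rule: finite_induct)
      case empty
      then have "f = (\<lambda>w. 0 * word [] w)" by auto
      then show ?case using sc[of 0] by (simp add: sc_def)
    next
      case (insert w S)
      define g where "g = (\<lambda>v. if v = w then 0 else f v)"
      have w: "set w \<subseteq> sl2" using insert by auto
      have S: "S = {v. g v \<noteq> 0}" using insert(2,4) by (auto simp: g_def)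
      have g: "g \<in> carrier FA" using insert.prems S insert.hyps(1) by (auto simp: g_def)
      have wc: "word w \<in> carrier FA" using w by (rule word_closed)
      have "f = (\<lambda>v. f w * word w v) \<oplus>\<^bsub>FA\<^esub> g" by (auto simp: g_def word_def)
      then have "cls f = sc (f w) * cls (word w) + cls g"
        using cls_hom(1)[OF free_algebra_scale_closed[OF wc, of "f w"] g] cls_scale[OF wc] by simp
      then show ?case using add[OF scale[OF word[OF w]] insert(3)[OF S g]] by simp
    qed
  qed
  then show ?thesis using cls_surj[of u] by auto
qed

section \<open>A faithful representation by shift operators\<close>

text \<open>The outer variable is t and the inner one w, so a degree is a degree in t, and
  coefficients are polynomials in w.\<close>

type_synonym tw_poly = "complex poly poly"

definition cc :: "complex \<Rightarrow> tw_poly" where "cc c = [:[:c:]:]"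
definition tt :: tw_poly where "tt = [:0, 1:]"
definition ww :: tw_poly where "ww = [:[:0, 1:]:]"
text \<open>W = FE + T^2 + T is to act as w and T as t + i; this forces FE to act as w - (t + i)(t +
  i + 1), the weight attached to F.\<close>

definition fq :: "int \<Rightarrow> tw_poly" where "fq i = ww - (tt + of_int i) * (tt + of_int i + 1)"

lemma cc_simps [simp]: "cc 0 = 0" "cc 1 = 1" "cc (a + b) = cc a + cc b" "cc (a * b) = cc a * cc b"
  "cc (- a) = - cc a" "cc (a - b) = cc a - cc b"
  by (simp_all add: cc_def one_pCons)

lemma cc_numeral [simp]: "cc (numeral n) = numeral n"
  by (simp add: cc_def numeral_poly)

text \<open>The matrix is decomposed along E, F and H. The factor 2 at the diagonal entry is due to
  H = 2T.\<close>

definition opr :: "complex^2^2 \<Rightarrow> (int \<Rightarrow> tw_poly) \<Rightarrow> int \<Rightarrow> tw_poly" where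
  "opr A \<phi> i = cc (ent A 1 2) * \<phi> (i - 1) + cc (ent A 2 1) * (fq i * \<phi> (i + 1)) +
     cc (2 * ent A 1 1) * ((tt + of_int i) * \<phi> i)"

definition word_op :: "(complex^2^2) list \<Rightarrow> (int \<Rightarrow> tw_poly) \<Rightarrow> int \<Rightarrow> tw_poly" where
  "word_op w \<phi> = foldr opr w \<phi>"

definition ev :: "((complex^2^2) list \<Rightarrow> complex) \<Rightarrow> (int \<Rightarrow> tw_poly) \<Rightarrow> int \<Rightarrow> tw_poly" where
  "ev f \<phi> i = (\<Sum>w | f w \<noteq> 0. cc (f w) * word_op w \<phi> i)"

lemma opr_sum: "opr A (\<lambda>i. \<Sum>v\<in>S. a v * \<psi> v i) i = (\<Sum>v\<in>S. a v * opr A (\<psi> v) i)"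
  by (simp add: opr_def sum_distrib_left sum.distrib algebra_simps)

lemma word_op_sum: "word_op w (\<lambda>i. \<Sum>v\<in>S. a v * \<psi> v i) = (\<lambda>i. \<Sum>v\<in>S. a v * word_op w (\<psi> v) i)"
proof (induction w)
  case (Cons A w)
  have "word_op (A # w) (\<lambda>i. \<Sum>v\<in>S. a v * \<psi> v i) = opr A (word_op w (\<lambda>i. \<Sum>v\<in>S. a v * \<psi> v i))"
    by (simp add: word_op_def)
  also have "\<dots> = (\<lambda>i. \<Sum>v\<in>S. a v * opr A (word_op w (\<psi> v)) i)" unfolding Cons by (rule ext) (rule opr_sum)
  finally show ?case by (simp add: word_op_def)
qed (simp add: word_op_def)

lemma word_op_append: "word_op (u @ v) \<phi> = word_op u (word_op v \<phi>)"
  by (simp add: word_op_def)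

lemma ev_superset:
  assumes "finite S" "\<And>w. f w \<noteq> 0 \<Longrightarrow> w \<in> S"
  shows "ev f \<phi> i = (\<Sum>w\<in>S. cc (f w) * word_op w \<phi> i)"
  unfolding ev_def using assms by (intro sum.mono_neutral_left) auto

lemma ev_mult:
  assumes "f \<in> carrier FA" "g \<in> carrier FA"
  shows "ev (f \<otimes>\<^bsub>FA\<^esub> g) \<phi> = ev f (ev g \<phi>)"
proof
  fix i
  have fin: "finite {w. f w \<noteq> 0}" "finite {w. g w \<noteq> 0}" using assms by auto
  have "ev (f \<otimes>\<^bsub>FA\<^esub> g) \<phi> i = (\<Sum>u | f u \<noteq> 0. \<Sum>v | g v \<noteq> 0. cc (f u) * cc (g v) * word_op (u @ v) \<phi> i)"
    unfolding ev_def free_algebra_simps(2) by (rule sum_concat_product[OF fin]) simp_all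
  also have "\<dots> = (\<Sum>u | f u \<noteq> 0. cc (f u) * (\<Sum>v | g v \<noteq> 0. cc (g v) * word_op u (word_op v \<phi>) i))"
    by (simp add: sum_distrib_left mult.assoc word_op_append)
  also have "\<dots> = ev f (ev g \<phi>) i"
  proof -
    have "ev g \<phi> = (\<lambda>i. \<Sum>v | g v \<noteq> 0. cc (g v) * word_op v \<phi> i)" by (rule ext) (rule ev_def)
    then show ?thesis unfolding ev_def[of f] by (simp add: word_op_sum)
  qed
  finally show "ev (f \<otimes>\<^bsub>FA\<^esub> g) \<phi> i = ev f (ev g \<phi>) i" .
qed

lemma ev_linear:
  assumes "finite {w. f w \<noteq> 0}" "finite {w. g w \<noteq> 0}"
  shows "ev (\<lambda>w. a * f w + b * g w) \<phi> i = cc a * ev f \<phi> i + cc b * ev g \<phi> i"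
proof -
  let ?S = "{w. f w \<noteq> 0} \<union> {w. g w \<noteq> 0}"
  have S: "finite ?S" using assms by simp
  have "ev (\<lambda>w. a * f w + b * g w) \<phi> i = (\<Sum>w\<in>?S. cc (a * f w + b * g w) * word_op w \<phi> i)"
    by (rule ev_superset[OF S]) auto
  also have "\<dots> = cc a * (\<Sum>w\<in>?S. cc (f w) * word_op w \<phi> i) + cc b * (\<Sum>w\<in>?S. cc (g w) * word_op w \<phi> i)"
    by (simp add: sum_distrib_left sum.distrib algebra_simps)
  also have "\<dots> = cc a * ev f \<phi> i + cc b * ev g \<phi> i"
    by (subst (1 2) ev_superset[OF S]) auto
  finally show ?thesis .
qed

lemma finite_word: "finite {w. word u w \<noteq> (0::complex)}"
  by (simp add: word_def)

lemma ev_word: "ev (word u) \<phi> i = word_op u \<phi> i"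
proof -
  have "ev (word u) \<phi> i = (\<Sum>w\<in>{u}. cc (word u w) * word_op w \<phi> i)"
    by (rule ev_superset) (auto simp: word_def split: if_splits)
  then show ?thesis by (simp add: word_def)
qed

lemma word_op_Nil [simp]: "word_op [] \<phi> = \<phi>" and word_op_Cons [simp]: "word_op (A # w) \<phi> = opr A (word_op w \<phi>)"
  by (simp_all add: word_op_def)

text \<open>The reason is f(i - 1) - f(i) = 2(t + i), which is [E, F] = 2T, together with the change
  of t + i by 1 under the two shifts.\<close>

lemma opr_bracket:
  assumes "A \<in> sl2" "B \<in> sl2"
  shows "opr A (opr B \<phi>) i - opr B (opr A \<phi>) i = opr (sl2_bracket A B) \<phi> i"
proof -
  have 1: "ent A 2 2 = - ent A 1 1" "ent B 2 2 = - ent B 1 1" using assms by (auto simp: sl2_iff)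
  have f: "fq (i - 1) = fq i + 2 * (tt + of_int i)" "fq (i + 1) = fq i - 2 * (tt + of_int i) - 2"
    by (simp_all add: fq_def algebra_simps)
  define x where "x = tt + of_int i"
  have x: "tt + of_int (i - 1) = x - 1" "tt + of_int (i + 1) = x + 1" "tt + of_int i = x" by (simp_all add: x_def)
  show ?thesis
    unfolding opr_def sl2_bracket_entries 1 f x cc_simps cc_numeral
    by (simp add: x algebra_simps)
qed

lemma ev_relation:
  assumes "f \<in> ER" shows "ev f \<phi> i = 0"
proof -
  have two: "ev (\<lambda>w. word u w - a * word v w) \<phi> i = word_op u \<phi> i - cc a * word_op v \<phi> i" for u v a
    using ev_linear[OF finite_word finite_word, of 1 u "- a" v \<phi> i] by (simp add: ev_word)
  have fin: "finite {w. word u w - 1 * word v w \<noteq> (0::complex)}" for u v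
    by (rule finite_subset[of _ "{u, v}"]) (auto simp: word_def split: if_splits)
  have three: "ev (\<lambda>w. word u w - word v w - word z w) \<phi> i = word_op u \<phi> i - word_op v \<phi> i - word_op z \<phi> i" for u v z
    using ev_linear[OF fin finite_word, of 1 u v "-1" z \<phi> i] two[of u 1 v] by (simp add: ev_word)
  show ?thesis
    using assms unfolding enveloping_relations_def
  proof (elim UnE CollectE exE conjE)
    fix x y assume *: "f = (\<lambda>w. word [x + y] w - word [x] w - word [y] w)"
    show ?thesis unfolding * three by (simp add: opr_def algebra_simps)
  next
    fix c x assume "f = (\<lambda>w. word [sl2_scale c x] w - c * word [x] w)"
    then show ?thesis by (simp add: two opr_def sl2_scale_def algebra_simps)
  next
    fix x y assume "x \<in> sl2" "y \<in> sl2" "f = (\<lambda>w. word [x, y] w - word [y, x] w - word [sl2_bracket x y] w)"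
    then show ?thesis using opr_bracket[of x y \<phi> i] by (simp add: three)
  qed
qed

text \<open>The elements acting as zero form an ideal that contains the relations. Hence the action
  of a class is independent of the representative, which \<open>rep\<close> selects
  arbitrarily.\<close>

lemma ev_EI:
  assumes "f \<in> EI" shows "ev f \<phi> = (\<lambda>i. 0)"
proof -
  let ?J = "{f \<in> carrier FA. \<forall>\<phi> i. ev f \<phi> i = 0}"
  have z: "ev f (\<lambda>i. 0) i = 0" for f i
  proof -
    have "word_op w (\<lambda>i. 0) = (\<lambda>i. 0)" for w using word_op_sum[of w "\<lambda>v. 0" _ "{}"] by simp
    then show ?thesis by (simp add: ev_def)
  qed
  have "ideal ?J FA"
  proof (rule idealI')
    show "?J \<subseteq> carrier FA" by blast
    show "\<zero>\<^bsub>FA\<^esub> \<in> ?J" by (simp add: ev_def)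
    show "f \<oplus>\<^bsub>FA\<^esub> g \<in> ?J" if "f \<in> ?J" "g \<in> ?J" for f g
    proof -
      have c: "f \<in> carrier FA" "g \<in> carrier FA" using that by blast+
      have "f \<oplus>\<^bsub>FA\<^esub> g = (\<lambda>w. 1 * f w + 1 * g w)" by simp
      then have "ev (f \<oplus>\<^bsub>FA\<^esub> g) \<phi> i = 0" for \<phi> i using ev_linear[of f g 1 1 \<phi> i] that by simp
      then show ?thesis using free_algebra_add_closed[OF c] by blast
    qed
    show "r \<otimes>\<^bsub>FA\<^esub> x \<in> ?J" "x \<otimes>\<^bsub>FA\<^esub> r \<in> ?J" if r: "r \<in> carrier FA" and xJ: "x \<in> ?J" for r x
    proof -
      have x: "x \<in> carrier FA" "ev x \<phi> = (\<lambda>i. 0)" for \<phi> using xJ by (blast, auto)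
      have "ev (r \<otimes>\<^bsub>FA\<^esub> x) \<phi> i = 0" "ev (x \<otimes>\<^bsub>FA\<^esub> r) \<phi> i = 0" for \<phi> i
        using ev_mult[OF r x(1)] ev_mult[OF x(1) r] x(2) z by simp_all
      then show "r \<otimes>\<^bsub>FA\<^esub> x \<in> ?J" "x \<otimes>\<^bsub>FA\<^esub> r \<in> ?J"
        using free_algebra_mult_closed[OF r x(1)] free_algebra_mult_closed[OF x(1) r] by blast+
    qed
  qed (rule ring_free_algebra)
  moreover have "ER \<subseteq> ?J" using ER_closed ev_relation by blast
  ultimately have "EI \<subseteq> ?J" by (rule EI_minimal)
  then show ?thesis using assms by (auto intro!: ext)
qed

definition rep :: "ut \<Rightarrow> (int \<Rightarrow> tw_poly) \<Rightarrow> int \<Rightarrow> tw_poly" where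
  "rep u = ev (SOME f. f \<in> carrier FA \<and> u = cls f)"

lemma rep_cls:
  assumes f: "f \<in> carrier FA" shows "rep (cls f) \<phi> i = ev f \<phi> i"
proof -
  define g where "g = (SOME g. g \<in> carrier FA \<and> cls f = cls g)"
  have g: "g \<in> carrier FA \<and> cls f = cls g" unfolding g_def by (rule someI[of _ f]) (use f in blast)
  then have "f \<ominus>\<^bsub>FA\<^esub> g \<in> EI" using cls_hom(4)[OF f] by blast
  then have "ev (\<lambda>w. 1 * f w + (-1) * g w) \<phi> i = 0"
    using ev_EI[of "f \<ominus>\<^bsub>FA\<^esub> g" \<phi>] free_algebra_minus[OF f] g by simp
  then have "ev f \<phi> i = ev g \<phi> i" using ev_linear[of f g 1 "-1" \<phi> i] f g by simp
  then show ?thesis by (simp add: rep_def g_def)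
qed

lemma rep_add: "rep (u + v) \<phi> i = rep u \<phi> i + rep v \<phi> i"
proof -
  obtain f g where f: "f \<in> carrier FA" "u = cls f" and g: "g \<in> carrier FA" "v = cls g" using cls_surj by metis
  have "f \<oplus>\<^bsub>FA\<^esub> g = (\<lambda>w. 1 * f w + 1 * g w)" by simp
  then show ?thesis unfolding f(2) g(2) cls_hom(1)[OF f(1) g(1), symmetric]
    using rep_cls[OF free_algebra_add_closed[OF f(1) g(1)]] rep_cls[OF f(1)] rep_cls[OF g(1)]
      ev_linear[of f g 1 1 \<phi> i] f(1) g(1) by simp
qed

lemma rep_mult: "rep (u * v) \<phi> = rep u (rep v \<phi>)"
proof -
  obtain f g where f: "f \<in> carrier FA" "u = cls f" and g: "g \<in> carrier FA" "v = cls g" using cls_surj by metis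
  have "rep (cls f) = ev f" "rep (cls g) = ev g" using rep_cls[OF f(1)] rep_cls[OF g(1)] by (auto intro!: ext)
  then show ?thesis unfolding f(2) g(2) cls_hom(2)[OF f(1) g(1), symmetric]
    using rep_cls[OF free_algebra_mult_closed[OF f(1) g(1)]] ev_mult[OF f(1) g(1)] by (auto intro!: ext)
qed

lemma rep_sc: "rep (sc c) \<phi> i = cc c * \<phi> i"
  unfolding sc_def rep_cls[OF scalar_closed] using ev_linear[OF finite_word finite_word, of c "[]" 0 "[]" \<phi> i] by (simp add: ev_word)

lemma rep_gen: "A \<in> sl2 \<Longrightarrow> rep (gen A) \<phi> = opr A \<phi>"
  unfolding gen_def by (rule ext, subst rep_cls) (auto intro!: word_closed simp: ev_word simp del: free_algebra_simps)

section \<open>Generators and relations\<close>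

definition mk :: "complex \<Rightarrow> complex \<Rightarrow> complex \<Rightarrow> complex^2^2" where
  "mk h b c = (\<chi> i j. if i = 1 then if j = 1 then h else b else if j = 1 then c else - h)"

lemma ent_mk [simp]: "ent (mk h b c) 1 1 = h" "ent (mk h b c) 1 2 = b" "ent (mk h b c) 2 1 = c" "ent (mk h b c) 2 2 = - h"
  by (simp_all add: mk_def)

lemma mk_sl2 [simp]: "mk h b c \<in> sl2"
  by (simp add: sl2_iff)

lemma matrix2_eqI: "(\<And>i j. ent A i j = ent B i j) \<Longrightarrow> A = B"
  by (simp add: vec_eq_iff)

lemma sl2_eq_mk: "A \<in> sl2 \<Longrightarrow> A = mk (ent A 1 1) (ent A 1 2) (ent A 2 1)"
proof (rule matrix2_eqI)
  fix i j :: 2 assume "A \<in> sl2"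
  then show "ent A i j = ent (mk (ent A 1 1) (ent A 1 2) (ent A 2 1)) i j"
    using exhaust_2[of i] exhaust_2[of j] by (auto simp: sl2_iff)
qed

definition gE :: ut where "gE = gen (mk 0 1 0)"
definition gF :: ut where "gF = gen (mk 0 0 1)"
text \<open>Half of H, normalized so that E and F change the eigenvalue of T by 1 and integers index
  the weights.\<close>

definition gT :: ut where "gT = sc (1/2) * gen (mk 1 0 0)"
definition gW :: ut where "gW = gF * gE + gT * gT + gT"

lemma mk_scale: "sl2_scale r (mk h b c) = mk (r * h) (r * b) (r * c)"
  by (rule matrix2_eqI) (auto simp: sl2_scale_def mk_def)

lemma mk_add: "mk h b c + mk h' b' c' = mk (h + h') (b + b') (c + c')"
  by (rule matrix2_eqI) (auto simp: mk_def)

lemma gen_mk: "gen (mk h b c) = sc (2 * h) * gT + sc b * gE + sc c * gF"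
proof -
  have "mk h b c = sl2_scale h (mk 1 0 0) + sl2_scale b (mk 0 1 0) + sl2_scale c (mk 0 0 1)"
    by (simp add: mk_scale mk_add)
  then have "gen (mk h b c) = sc h * gen (mk 1 0 0) + sc b * gE + sc c * gF"
    by (simp only: gen_rel(1) gen_rel(2)[OF _ mk_sl2] sl2_closed mk_sl2 gE_def gF_def)
  moreover have "sc h * gen (mk 1 0 0) = sc (2 * h) * gT"
    unfolding gT_def by (simp only: mult.assoc[symmetric] sc_hom(3)[symmetric]) simp
  ultimately show ?thesis by simp
qed

lemma sc_assoc_comm: "u * (sc c * v) = sc c * (u * v)"
  by (metis mult.assoc sc_central)

lemma bracket_mk: "sl2_bracket (mk h b c) (mk h' b' c') = mk (b * c' - b' * c) (2 * h * b' - 2 * h' * b) (2 * h' * c - 2 * h * c')"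
proof (rule matrix2_eqI)
  fix i j :: 2
  show "ent (sl2_bracket (mk h b c) (mk h' b' c')) i j = ent (mk (b * c' - b' * c) (2 * h * b' - 2 * h' * b) (2 * h' * c - 2 * h * c')) i j"
    using exhaust_2[of i] exhaust_2[of j] by (auto simp: sl2_bracket_entries algebra_simps)
qed

lemma TE: "gT * gE = gE * gT + gE" and TF: "gT * gF = gF * gT - gF" and EF: "gE * gF = gF * gE + gT + gT"
proof -
  let ?H = "gen (mk 1 0 0)"
  have "?H * gE - gE * ?H = sc 2 * gE" "?H * gF - gF * ?H = - (sc 2 * gF)" "gE * gF - gF * gE = sc 2 * gT"
    unfolding gE_def gF_def using gen_rel(3)[of "mk 1 0 0" "mk 0 1 0"] gen_rel(3)[of "mk 1 0 0" "mk 0 0 1"]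
      gen_rel(3)[of "mk 0 1 0" "mk 0 0 1"] gen_mk[of 0 2 0] gen_mk[of 0 0 "-2"] gen_mk[of 1 0 0]
    by (simp_all add: bracket_mk gE_def[symmetric] gF_def[symmetric])
  note 1 = this
  have h: "sc (1/2) * (sc 2 * u) = u" for u by (simp only: mult.assoc[symmetric] sc_hom(3)[symmetric]) simp
  have "gT * gE - gE * gT = sc (1/2) * (?H * gE - gE * ?H)"
    by (simp add: gT_def mult.assoc sc_assoc_comm right_diff_distrib)
  then show "gT * gE = gE * gT + gE" unfolding 1 h by (simp add: algebra_simps)
  have "gT * gF - gF * gT = sc (1/2) * (?H * gF - gF * ?H)"
    by (simp add: gT_def mult.assoc sc_assoc_comm right_diff_distrib)
  then have "gT * gF - gF * gT = - gF" unfolding 1 using h by simp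
  then show "gT * gF = gF * gT - gF" by (simp add: algebra_simps)
  have "sc 2 * gT = gT + gT" using sc_hom(2)[of 1 1] by (simp add: mult_2)
  then show "gE * gF = gF * gE + gT + gT" using 1(3) by (simp add: algebra_simps)
qed

lemma ut_induct [case_names sc add scale E F T]:
  assumes "\<And>c. P (sc c)" "\<And>u v. P u \<Longrightarrow> P v \<Longrightarrow> P (u + v)" "\<And>c u. P u \<Longrightarrow> P (sc c * u)"
    "\<And>u. P u \<Longrightarrow> P (gE * u)" "\<And>u. P u \<Longrightarrow> P (gF * u)" "\<And>u. P u \<Longrightarrow> P (gT * u)"
  shows "P u"
proof (induction u rule: ut_gen_induct)
  case (4 A u)
  have "gen A = sc (2 * ent A 1 1) * gT + sc (ent A 1 2) * gE + sc (ent A 2 1) * gF"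
    using sl2_eq_mk[OF 4(1)] gen_mk by metis
  then have "gen A * u = sc (2 * ent A 1 1) * (gT * u) + sc (ent A 1 2) * (gE * u) + sc (ent A 2 1) * (gF * u)"
    by (simp add: distrib_right mult.assoc)
  then show ?case using assms(2-6) 4(2) by metis
qed (use assms in auto)

lemma rep_gE: "rep gE \<phi> i = \<phi> (i - 1)" and rep_gF: "rep gF \<phi> i = fq i * \<phi> (i + 1)"
  and rep_gT: "rep gT \<phi> i = (tt + of_int i) * \<phi> i"
proof -
  show "rep gE \<phi> i = \<phi> (i - 1)" "rep gF \<phi> i = fq i * \<phi> (i + 1)"
    by (simp_all add: gE_def gF_def rep_gen opr_def del: cc_numeral)
  have "cc (1/2) * (2 * x) = x" for x :: tw_poly
    using cc_simps(4)[of "1/2" 2] by (simp add: mult.assoc[symmetric] del: cc_simps(4))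
  then show "rep gT \<phi> i = (tt + of_int i) * \<phi> i"
    by (simp add: gT_def rep_mult rep_sc rep_gen opr_def)
qed

lemma rep_gW: "rep gW \<phi> i = ww * \<phi> i"
  by (simp add: gW_def rep_add rep_mult rep_gE rep_gF rep_gT fq_def algebra_simps)

lemma gW_central: "gW * u = u * gW"
proof -
  have e: "gE * gT = gT * gE - gE" "gF * gT = gT * gF + gF" unfolding TE TF by simp_all
  have "gE * gT * x = gT * (gE * x) - gE * x" "gF * gT * x = gT * (gF * x) + gF * x"
    "gE * gF * x = gF * (gE * x) + gT * x + gT * x" for x
    unfolding e EF by (simp_all add: left_diff_distrib distrib_right mult.assoc)
  note r = e EF this[unfolded mult.assoc]
  have W: "gW * gE = gE * gW" "gW * gF = gF * gW" "gW * gT = gT * gW"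
    by (simp_all add: gW_def distrib_left distrib_right mult.assoc r left_diff_distrib right_diff_distrib)
  have step: "gW * (g * u) = g * u * gW" if "gW * g = g * gW" "gW * u = u * gW" for g u
    by (metis mult.assoc that)
  show ?thesis
  proof (induction u rule: ut_induct)
    case (sc c) show ?case by (simp add: sc_central)
  next
    case (add u v) then show ?case by (simp add: algebra_simps)
  qed (use step W sc_central in metis)+
qed

section \<open>Polynomials in the central and the weight variable\<close>

text \<open>Evaluation in a possibly noncommutative ring: the sum of x^i h(a_i), powers on the left.
  It is multiplicative if x commutes with the values of h.\<close>

definition hev :: "('c::comm_ring_1 \<Rightarrow> 'r::ring_1) \<Rightarrow> 'r \<Rightarrow> 'c poly \<Rightarrow> 'r" where
  "hev h x p = fold_coeffs (\<lambda>a s. h a + x * s) p 0"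

lemma hev_0 [simp]: "hev h x 0 = 0"
  by (simp add: hev_def)

lemma hev_pCons: "h 0 = 0 \<Longrightarrow> hev h x (pCons a p) = h a + x * hev h x p"
  unfolding hev_def by (cases "p = 0 \<and> a = 0"; cases "p = 0") (auto simp: fold_coeffs_pCons_coeff_not_0_eq fold_coeffs_pCons_not_0_0_eq)

lemma hev_const: "h 0 = 0 \<Longrightarrow> hev h x [:a:] = h a"
  by (simp add: hev_pCons)

lemma hev_add:
  assumes "h 0 = 0" "\<And>a b. h (a + b) = h a + h b"
  shows "hev h x (p + q) = hev h x p + hev h x q"
  by (induction p q rule: poly_induct2) (simp_all add: hev_pCons assms algebra_simps)

lemma hev_mult:
  assumes h: "h 0 = 0" "\<And>a b. h (a + b) = h a + h b" "\<And>a b. h (a * b) = h a * h b"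
    and x: "\<And>a. h a * x = x * h a"
  shows "hev h x (p * q) = hev h x p * hev h x q"
proof -
  have s: "hev h x (Polynomial.smult a q) = h a * hev h x q" for a q
    by (induction q) (simp_all add: hev_pCons h distrib_left x mult.assoc[symmetric])
  show ?thesis
    by (induction p) (simp_all add: hev_pCons h s hev_add[OF h(1,2)] distrib_right mult.assoc)
qed

lemma hev_comm:
  assumes "h 0 = 0" "\<And>a. y * h a = h a * y" "y * x = x * y"
  shows "y * hev h x p = hev h x p * y"
proof (induction p)
  case (pCons a p)
  have "y * (x * hev h x p) = x * hev h x p * y" by (metis assms(3) mult.assoc pCons.IH)
  then show ?case by (simp add: hev_pCons assms(1,2) distrib_left distrib_right)
qed simp

definition pw :: "complex poly \<Rightarrow> ut" where "pw = hev sc gW"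
definition pm :: "tw_poly \<Rightarrow> ut" where "pm = hev pw gT"

lemma pw_simps [simp]: "pw 0 = 0" "pw 1 = 1" "pw (p + q) = pw p + pw q" "pw (p * q) = pw p * pw q"
  "pw [:c:] = sc c"
proof -
  show "pw 0 = 0" "pw (p + q) = pw p + pw q" "pw [:c:] = sc c" "pw 1 = 1"
    by (simp_all add: pw_def hev_add hev_const one_pCons)
  show "pw (p * q) = pw p * pw q" unfolding pw_def by (rule hev_mult) (simp, simp, simp, rule sc_central)
qed

lemma pw_W: "pw [:0, 1:] = gW"
  by (simp add: pw_def hev_pCons)

lemma pw_central: "pw p * u = u * pw p"
  unfolding pw_def
  by (rule hev_comm[symmetric]) (simp, rule sc_central[symmetric], rule gW_central[symmetric])

lemma pm_simps [simp]: "pm 0 = 0" "pm 1 = 1" "pm (p + q) = pm p + pm q" "pm (p * q) = pm p * pm q"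
  "pm [:a:] = pw a"
proof -
  show "pm 0 = 0" "pm (p + q) = pm p + pm q" "pm [:a:] = pw a" "pm 1 = 1"
    by (simp_all add: pm_def hev_add hev_const one_pCons)
  show "pm (p * q) = pm p * pm q" unfolding pm_def by (rule hev_mult) (simp, simp, simp, rule pw_central)
qed

lemma pm_pCons: "pm (pCons a p) = pw a + gT * pm p"
  by (simp add: pm_def hev_pCons)

lemma pm_minus [simp]: "pm (- p) = - pm p" "pm (p - q) = pm p - pm q"
proof -
  show *: "pm (- p) = - pm p" for p using pm_simps(3)[of p "- p"] by (simp add: eq_neg_iff_add_eq_0 add.commute)
  show "pm (p - q) = pm p - pm q" using pm_simps(3)[of p "- q"] * by simp
qed

lemma pm_basic [simp]: "pm tt = gT" "pm ww = gW" "pm (cc c) = sc c" "pm (of_int i) = of_int i" "pm (of_nat n) = of_nat n"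
proof -
  show "pm tt = gT" "pm ww = gW" "pm (cc c) = sc c"
    by (simp_all add: tt_def ww_def cc_def pm_pCons pw_W)
  show n: "pm (of_nat n) = of_nat n" for n by (induction n) simp_all
  show "pm (of_int i) = of_int i" by (cases i) (simp_all add: n del: of_nat_Suc)
qed

lemma pm_comm: "pm p * pm q = pm q * pm p"
  by (metis pm_simps(4) mult.commute)

text \<open>The substitution t \<mapsto> t + j, by which p(T, W) changes when it passes a term of
  weight j.\<close>

definition sh :: "int \<Rightarrow> tw_poly \<Rightarrow> tw_poly" where "sh j p = pcompose p [:of_int j, 1:]"

lemma sh_simps [simp]: "sh j 0 = 0" "sh j 1 = 1" "sh j (p + q) = sh j p + sh j q" "sh j (p * q) = sh j p * sh j q"
  "sh j (p - q) = sh j p - sh j q" "sh j [:a:] = [:a:]" "sh j tt = tt + of_int j" "sh j ww = ww" "sh j (cc c) = cc c"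
  by (simp_all add: sh_def pcompose_add pcompose_mult pcompose_diff pcompose_pCons tt_def ww_def cc_def one_pCons of_int_poly)

lemma sh_of_int [simp]: "sh j (of_int i) = of_int i"
  by (simp add: of_int_poly)

lemma sh_numeral [simp]: "sh j (numeral n) = numeral n"
  using sh_of_int[of j "numeral n"] by simp

lemma sh_sh: "sh i (sh j p) = sh (i + j) p"
  by (simp add: sh_def pcompose_assoc[symmetric] pcompose_pCons add.commute)

lemma sh_0 [simp]: "sh 0 p = p"
  by (simp add: sh_def pcompose_idR)

lemma sh_fq [simp]: "sh j (fq i) = fq (i + j)"
  by (simp add: fq_def algebra_simps)

lemma pm_E: "pm p * gE = gE * pm (sh 1 p)" and pm_F: "pm p * gF = gF * pm (sh (-1) p)"
proof -
  show "pm p * gE = gE * pm (sh 1 p)"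
  proof (induction p)
    case (pCons a p)
    have "sh 1 (pCons a p) = [:a:] + (tt + 1) * sh 1 p"
      by (simp add: sh_def pcompose_pCons tt_def one_pCons)
    then have "gE * pm (sh 1 (pCons a p)) = gE * pw a + (gE * gT + gE) * pm (sh 1 p)"
      by (simp add: distrib_left distrib_right mult.assoc)
    also have "\<dots> = pw a * gE + gT * (gE * pm (sh 1 p))" by (simp add: TE[symmetric] pw_central mult.assoc)
    also have "\<dots> = pm (pCons a p) * gE" by (simp add: pm_pCons distrib_right mult.assoc pCons.IH)
    finally show ?case by simp
  qed simp
  show "pm p * gF = gF * pm (sh (-1) p)"
  proof (induction p)
    case (pCons a p)
    have "sh (-1) (pCons a p) = [:a:] + (tt - 1) * sh (-1) p"
      by (simp add: sh_def pcompose_pCons tt_def one_pCons)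
    then have "gF * pm (sh (-1) (pCons a p)) = gF * pw a + (gF * gT - gF) * pm (sh (-1) p)"
      by (simp add: distrib_left left_diff_distrib right_diff_distrib mult.assoc)
    also have "\<dots> = pw a * gF + gT * (gF * pm (sh (-1) p))" by (simp add: TF[symmetric] pw_central mult.assoc)
    also have "\<dots> = pm (pCons a p) * gF" by (simp add: pm_pCons distrib_right mult.assoc pCons.IH)
    finally show ?case by simp
  qed simp
qed

lemma FE_pm: "gF * gE = pm (fq 0)" and EF_pm: "gE * gF = pm (fq (-1))"
proof -
  show "gF * gE = pm (fq 0)" by (simp add: fq_def gW_def algebra_simps)
  show "gE * gF = pm (fq (-1))" by (simp add: fq_def gW_def EF algebra_simps)
qed

definition wt :: "int \<Rightarrow> ut" where "wt k = (if 0 \<le> k then gE ^ nat k else gF ^ nat (- k))"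

lemma pm_E_power: "pm p * gE ^ n = gE ^ n * pm (sh (int n) p)"
proof (induction n arbitrary: p)
  case (Suc n)
  have "pm p * gE ^ Suc n = gE * (pm (sh 1 p) * gE ^ n)" by (simp add: pm_E mult.assoc[symmetric])
  then show ?case by (simp add: Suc sh_sh mult.assoc add.commute)
qed simp

lemma pm_F_power: "pm p * gF ^ n = gF ^ n * pm (sh (- int n) p)"
proof (induction n arbitrary: p)
  case (Suc n)
  have "pm p * gF ^ Suc n = gF * (pm (sh (-1) p) * gF ^ n)" by (simp add: pm_F mult.assoc[symmetric])
  then show ?case by (simp add: Suc sh_sh mult.assoc add.commute)
qed simp

lemma pm_wt: "pm p * wt k = wt k * pm (sh k p)"
  using pm_E_power[of p "nat k"] pm_F_power[of p "nat (- k)"] by (auto simp: wt_def)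

text \<open>For negative k the first two letters form EF, a polynomial in T and W, which is moved to
  the right past the remaining F.\<close>

lemma E_wt: "\<exists>g. gE * wt k = wt (k + 1) * pm g"
proof (cases "0 \<le> k")
  case True
  then have "gE * wt k = wt (k + 1) * pm 1" by (simp add: wt_def nat_add_distrib)
  then show ?thesis by blast
next
  case False
  define n where "n = nat (- k) - 1"
  have n: "k = - int (Suc n)" using False by (simp add: n_def)
  have "gE * wt k = pm (fq (-1)) * gF ^ n" using n by (simp add: wt_def EF_pm[symmetric] mult.assoc nat_add_distrib)
  also have "\<dots> = wt (k + 1) * pm (sh (- int n) (fq (-1)))" using n by (simp only: pm_F_power) (simp add: wt_def)
  finally show ?thesis by blast
qed

lemma F_wt: "\<exists>g. gF * wt k = wt (k - 1) * pm g"
proof (cases "0 < k")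
  case True
  define n where "n = nat k - 1"
  have n: "k = int (Suc n)" using True by (simp add: n_def)
  have "gF * wt k = pm (fq 0) * gE ^ n" using n by (simp add: wt_def FE_pm[symmetric] mult.assoc nat_add_distrib)
  also have "\<dots> = wt (k - 1) * pm (sh (int n) (fq 0))" using n by (simp only: pm_E_power) (simp add: wt_def)
  finally show ?thesis by blast
next
  case False
  define n where "n = nat (- k)"
  have n: "k = - int n" using False by (simp add: n_def)
  have "gF * wt k = wt (k - 1) * pm 1"
    using n by (cases n) (simp_all add: wt_def nat_add_distrib)
  then show ?thesis by blast
qed

definition normal_form :: "ut \<Rightarrow> bool" where
  "normal_form u \<longleftrightarrow> (\<exists>S p. finite S \<and> u = (\<Sum>k\<in>S. wt k * pm (p k)))"

lemma normal_form_add: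
  assumes "normal_form u" "normal_form v" shows "normal_form (u + v)"
proof -
  obtain S p S' p' where *: "finite S" "u = (\<Sum>k\<in>S. wt k * pm (p k))" "finite S'" "v = (\<Sum>k\<in>S'. wt k * pm (p' k))"
    using assms by (auto simp: normal_form_def)
  have "u = (\<Sum>k\<in>S \<union> S'. wt k * pm (if k \<in> S then p k else 0))" unfolding *(2)
    using *(1,3) by (intro sum.mono_neutral_cong_left) auto
  moreover have "v = (\<Sum>k\<in>S \<union> S'. wt k * pm (if k \<in> S' then p' k else 0))" unfolding *(4)
    using *(1,3) by (intro sum.mono_neutral_cong_left) auto
  ultimately have "u + v = (\<Sum>k\<in>S \<union> S'. wt k * pm ((if k \<in> S then p k else 0) + (if k \<in> S' then p' k else 0)))"
    by (simp only: sum.distrib[symmetric] pm_simps(3) distrib_left)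
  then show ?thesis unfolding normal_form_def using *(1,3) by (intro exI[of _ "S \<union> S'"]
      exI[of _ "\<lambda>k. (if k \<in> S then p k else 0) + (if k \<in> S' then p' k else 0)"]) simp
qed

lemma normal_form_single: "normal_form (wt k * pm p)"
  unfolding normal_form_def by (intro exI[of _ "{k}"] exI[of _ "\<lambda>_. p"]) simp

lemma normal_form_sum: "finite S \<Longrightarrow> (\<And>k. k \<in> S \<Longrightarrow> normal_form (f k)) \<Longrightarrow> normal_form (\<Sum>k\<in>S. f k)"
proof (induction S rule: finite_induct)
  case empty
  show ?case using normal_form_single[of 0 0] by simp
qed (simp add: normal_form_add)

lemma normal_form: "normal_form u"
proof (induction u rule: ut_induct)
  case (sc c)
  show ?case using normal_form_single[of 0 "cc c"] by (simp add: wt_def)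
next
  case (add u v) then show ?case by (rule normal_form_add)
next
  case (scale c u)
  then obtain S p where *: "finite S" "u = (\<Sum>k\<in>S. wt k * pm (p k))" by (auto simp: normal_form_def)
  have "normal_form (sc c * (wt k * pm (p k)))" for k
    using normal_form_single[of k "cc c * p k"] by (simp add: sc_assoc_comm)
  then show ?case unfolding *(2) sum_distrib_left using *(1) by (intro normal_form_sum)
next
  case (E u)
  then obtain S p where *: "finite S" "u = (\<Sum>k\<in>S. wt k * pm (p k))" by (auto simp: normal_form_def)
  have "normal_form (gE * (wt k * pm (p k)))" for k
  proof -
    obtain g where "gE * wt k = wt (k + 1) * pm g" using E_wt by blast
    then have "gE * (wt k * pm (p k)) = wt (k + 1) * pm (g * p k)" by (simp add: mult.assoc[symmetric])
    then show ?thesis using normal_form_single[of "k + 1" "g * p k"] by simp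
  qed
  then show ?case unfolding *(2) sum_distrib_left using *(1) by (intro normal_form_sum)
next
  case (F u)
  then obtain S p where *: "finite S" "u = (\<Sum>k\<in>S. wt k * pm (p k))" by (auto simp: normal_form_def)
  have "normal_form (gF * (wt k * pm (p k)))" for k
  proof -
    obtain g where "gF * wt k = wt (k - 1) * pm g" using F_wt by blast
    then have "gF * (wt k * pm (p k)) = wt (k - 1) * pm (g * p k)" by (simp add: mult.assoc[symmetric])
    then show ?thesis using normal_form_single[of "k - 1" "g * p k"] by simp
  qed
  then show ?case unfolding *(2) sum_distrib_left using *(1) by (intro normal_form_sum)
next
  case (T u)
  then obtain S p where *: "finite S" "u = (\<Sum>k\<in>S. wt k * pm (p k))" by (auto simp: normal_form_def)
  have "normal_form (gT * (wt k * pm (p k)))" for k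
  proof -
    have "gT * (wt k * pm (p k)) = wt k * pm (sh k tt * p k)"
      using pm_wt[of tt k] by (simp only: pm_basic(1) pm_simps(4) mult.assoc[symmetric])
    then show ?thesis using normal_form_single[of k "sh k tt * p k"] by simp
  qed
  then show ?case unfolding *(2) sum_distrib_left using *(1) by (intro normal_form_sum)
qed

section \<open>Coefficients\<close>

definition dl :: "int \<Rightarrow> tw_poly" where "dl i = (if i = 0 then 1 else 0)"
text \<open>The column of u at index 0. By \<open>co_wt_pm\<close> a term \<open>wt k * pm p\<close>
  contributes x_k p at k and nothing elsewhere; as x_k is nonzero, \<open>co\<close> separates the
  elements of U.\<close>

definition co :: "ut \<Rightarrow> int \<Rightarrow> tw_poly" where "co u k = rep u dl k"
text \<open>The factor that F^(-k) collects on its way from index 0 to a negative index k; it is the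
  empty product for k \<ge> 0.\<close>

definition xk :: "int \<Rightarrow> tw_poly" where "xk k = (\<Prod>j<nat (- k). fq (k + int j))"

lemma co_add [simp]: "co (u + v) k = co u k + co v k"
  by (simp add: co_def rep_add)

lemma co_scale: "co (sc c * u) k = cc c * co u k"
  by (simp add: co_def rep_mult rep_sc)

lemma co_sc: "co (sc c) k = (if k = 0 then cc c else 0)"
  by (simp add: co_def rep_sc dl_def)

lemma co_0 [simp]: "co 0 k = 0"
  using co_sc[of 0 k] by simp

lemma co_1: "co 1 k = (if k = 0 then 1 else 0)"
  using co_sc[of 1 k] by simp

lemma co_minus [simp]: "co (- u) k = - co u k" "co (u - v) k = co u k - co v k"
proof -
  show *: "co (- u) k = - co u k" for u using co_add[of u "- u" k] by (simp add: eq_neg_iff_add_eq_0 add.commute)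
  show "co (u - v) k = co u k - co v k" using co_add[of u "- v" k] * by simp
qed

lemma co_sum: "co (\<Sum>x\<in>A. f x) k = (\<Sum>x\<in>A. co (f x) k)"
  by (induction A rule: infinite_finite_induct) simp_all

lemma co_E: "co (gE * u) k = co u (k - 1)" and co_F: "co (gF * u) k = fq k * co u (k + 1)"
  and co_T: "co (gT * u) k = (tt + of_int k) * co u k" and co_W: "co (gW * u) k = ww * co u k"
  by (simp_all add: co_def rep_mult rep_gE rep_gF rep_gT rep_gW)

lemma rep_pm: "rep (pm p) \<phi> i = sh i p * \<phi> i"
proof (induction p arbitrary: \<phi>)
  case 0
  show ?case using rep_sc[of 0 \<phi> i] by simp
next
  case (pCons a p)
  have w: "rep (pw q) \<phi> i = [:q:] * \<phi> i" for q \<phi>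
  proof (induction q arbitrary: \<phi>)
    case 0
    show ?case using rep_sc[of 0 \<phi> i] by simp
  next
    case (pCons c q)
    have "pw (pCons c q) = sc c + gW * pw q" by (simp add: pw_def hev_pCons)
    moreover have "[:pCons c q:] = cc c + ww * [:q:]" by (simp add: cc_def ww_def)
    ultimately show ?case by (simp only: rep_add rep_mult rep_sc rep_gW pCons.IH) (simp add: algebra_simps)
  qed
  have "sh i (pCons a p) = [:a:] + (tt + of_int i) * sh i p"
    by (simp add: sh_def pcompose_pCons tt_def of_int_poly)
  then show ?case by (simp only: pm_pCons rep_add rep_mult w rep_gT pCons.IH) (simp add: algebra_simps)
qed

lemma rep_E_power: "rep (gE ^ n) \<phi> i = \<phi> (i - int n)"
proof (induction n arbitrary: i)
  case 0 show ?case using rep_sc[of 1 \<phi> i] by simp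
qed (simp add: rep_mult rep_gE algebra_simps)

lemma rep_F_power: "rep (gF ^ n) \<phi> i = (\<Prod>j<n. fq (i + int j)) * \<phi> (i + int n)"
proof (induction n arbitrary: i)
  case 0 show ?case using rep_sc[of 1 \<phi> i] by simp
next
  case (Suc n)
  have "rep (gF ^ Suc n) \<phi> i = fq i * ((\<Prod>j<n. fq (i + 1 + int j)) * \<phi> (i + 1 + int n))"
    by (simp add: rep_mult rep_gF Suc)
  also have "\<dots> = (fq (i + int 0) * (\<Prod>j<n. fq (i + int (Suc j)))) * \<phi> (i + int (Suc n))" by (simp add: algebra_simps)
  also have "fq (i + int 0) * (\<Prod>j<n. fq (i + int (Suc j))) = (\<Prod>j<Suc n. fq (i + int j))"
    by (rule prod.lessThan_Suc_shift[symmetric])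
  finally show ?case .
qed

lemma co_wt_pm: "co (wt k * pm p) m = (if m = k then xk k * p else 0)"
proof -
  have p: "rep (pm p) dl = (\<lambda>i. if i = 0 then p else 0)" by (rule ext) (simp add: rep_pm dl_def)
  show ?thesis
  proof (cases "0 \<le> k")
    case True
    then show ?thesis by (simp add: co_def rep_mult p wt_def rep_E_power xk_def)
  next
    case False
    then show ?thesis by (auto simp: co_def rep_mult p wt_def rep_F_power xk_def)
  qed
qed

definition evc :: "complex \<Rightarrow> complex \<Rightarrow> tw_poly \<Rightarrow> complex" where "evc a c p = poly (poly p [:a:]) c"

lemma evc_simps [simp]: "evc a c 0 = 0" "evc a c 1 = 1" "evc a c (p + q) = evc a c p + evc a c q"
  "evc a c (p * q) = evc a c p * evc a c q" "evc a c (p - q) = evc a c p - evc a c q" "evc a c (- p) = - evc a c p"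
  "evc a c tt = a" "evc a c ww = c" "evc a c (cc d) = d" "evc a c (of_int i) = of_int i"
  by (simp_all add: evc_def tt_def ww_def cc_def of_int_poly)

lemma evc_sum: "evc a c (\<Sum>x\<in>A. f x) = (\<Sum>x\<in>A. evc a c (f x))"
  by (induction A rule: infinite_finite_induct) simp_all

lemma evc_prod: "evc a c (\<Prod>x\<in>A. f x) = (\<Prod>x\<in>A. evc a c (f x))"
  by (induction A rule: infinite_finite_induct) simp_all

lemma evc_sh [simp]: "evc a c (sh j p) = evc (a + of_int j) c p"
  by (simp add: evc_def sh_def poly_pcompose of_int_poly add.commute)

lemma evc_fq [simp]: "evc a c (fq i) = c - (a + of_int i) * (a + of_int i + 1)"
  by (simp add: fq_def)

lemma fq_nonzero: "fq i \<noteq> 0"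
proof
  assume "fq i = 0"
  then have "evc 0 (of_int i * (of_int i + 1) + 1) (fq i) = 0" by simp
  then show False by simp
qed

lemma xk_nonzero: "xk k \<noteq> 0"
  by (simp add: xk_def fq_nonzero)

text \<open>The coefficients of a normal form can be read off from \<open>co u\<close>, because each
  x_k is a nonzero element of a domain. Setting p k = 0 off the summation set makes the formula
  valid for all k.\<close>

lemma co_normal_form:
  "\<exists>p. finite {k. co u k \<noteq> 0} \<and> (\<forall>k. co u k = xk k * p k) \<and> u = (\<Sum>k | co u k \<noteq> 0. wt k * pm (p k))"
proof -
  obtain S p where *: "finite S" "u = (\<Sum>k\<in>S. wt k * pm (p k))" using normal_form[of u] by (auto simp: normal_form_def)
  define q where "q k = (if k \<in> S then p k else 0)" for k
  have c: "co u k = xk k * q k" for k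
    using *(1) by (simp add: *(2) co_sum co_wt_pm q_def)
  then have s: "{k. co u k \<noteq> 0} \<subseteq> S" by (auto simp: q_def)
  have "(\<Sum>k | co u k \<noteq> 0. wt k * pm (q k)) = (\<Sum>k\<in>S. wt k * pm (p k))"
    using s *(1) c xk_nonzero by (intro sum.mono_neutral_cong_left) (auto simp: q_def)
  then show ?thesis using c finite_subset[OF s *(1)] *(2) by (intro exI[of _ q]) simp
qed

lemma co_finite: "finite {k. co u k \<noteq> 0}"
  using co_normal_form by blast

lemma co_eq_0_imp: "(\<And>k. co u k = 0) \<Longrightarrow> u = 0"
  using co_normal_form[of u] by auto

text \<open>A twisted convolution: v leads from index 0 to j, and at j the element u acts as it does
  at 0 with t replaced by t + j.\<close>

lemma co_mult: "co (u * v) k = (\<Sum>j | co v j \<noteq> 0. sh j (co u (k - j)) * co v j)"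
proof (induction u arbitrary: k rule: ut_induct)
  case (sc c)
  have "(\<Sum>j | co v j \<noteq> 0. sh j (co (sc c) (k - j)) * co v j) = (\<Sum>j | co v j \<noteq> 0. if j = k then cc c * co v k else 0)"
    by (intro sum.cong) (auto simp: co_sc)
  also have "\<dots> = cc c * co v k" using co_finite by simp
  finally show ?case by (simp add: co_scale)
next
  case (add u1 u2) then show ?case by (simp add: distrib_right sum.distrib)
next
  case (scale c u) then show ?case by (simp add: co_scale mult.assoc sum_distrib_left)
next
  case (E u)
  then show ?case by (simp add: co_E mult.assoc algebra_simps)
next
  case (F u)
  have "sh j (fq (k - j) * co u (k - j + 1)) * co v j = fq k * (sh j (co u (k + 1 - j)) * co v j)" for j
    by (simp add: algebra_simps)
  then show ?case by (simp only: co_F mult.assoc F sum_distrib_left)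
next
  case (T u)
  have "sh j ((tt + of_int (k - j)) * co u (k - j)) * co v j = (tt + of_int k) * (sh j (co u (k - j)) * co v j)" for j
    by (simp add: algebra_simps)
  then show ?case by (simp only: co_T mult.assoc T sum_distrib_left)
qed

text \<open>The matrix coefficient of u in a weight module where W acts by c, from the vector of
  T-eigenvalue a to that of a + k.\<close>

definition ma :: "complex \<Rightarrow> complex \<Rightarrow> ut \<Rightarrow> int \<Rightarrow> complex" where "ma a c u k = evc a c (co u k)"

lemma ma_mult:
  assumes "finite S" "\<And>j. j \<notin> S \<Longrightarrow> ma a c v j = 0 \<or> ma (a + of_int j) c u (k - j) = 0"
  shows "ma a c (u * v) k = (\<Sum>j\<in>S. ma (a + of_int j) c u (k - j) * ma a c v j)"
proof -
  have "ma a c (u * v) k = (\<Sum>j | co v j \<noteq> 0. ma (a + of_int j) c u (k - j) * ma a c v j)"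
    by (simp add: ma_def co_mult evc_sum)
  also have "\<dots> = (\<Sum>j\<in>{j. co v j \<noteq> 0} \<union> S. ma (a + of_int j) c u (k - j) * ma a c v j)"
    using assms(1) co_finite by (intro sum.mono_neutral_left) (auto simp: ma_def)
  also have "\<dots> = (\<Sum>j\<in>S. ma (a + of_int j) c u (k - j) * ma a c v j)"
    using assms co_finite by (intro sum.mono_neutral_right) auto
  finally show ?thesis .
qed

section \<open>Leading terms and the noetherian property\<close>

text \<open>
  The associated graded ring with respect to the degree in the weight variable embeds into a
  Laurent polynomial ring, so leading terms are multiplicative.
\<close>

definition has_lead :: "ut \<Rightarrow> nat \<Rightarrow> int \<Rightarrow> complex poly \<Rightarrow> bool" where
  "has_lead u J K q \<longleftrightarrow> q \<noteq> 0 \<and> (\<forall>k. Polynomial.degree (co u k) \<le> J) \<and> Polynomial.coeff (co u K) J = q \<and> (\<forall>k>K. Polynomial.coeff (co u k) J = 0)"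

lemma coeff_mult_le:
  fixes p q :: "'c::idom poly"
  assumes "Polynomial.degree p \<le> m" "Polynomial.degree q \<le> n"
  shows "Polynomial.coeff (p * q) (m + n) = Polynomial.coeff p m * Polynomial.coeff q n"
proof (cases "Polynomial.degree p = m \<and> Polynomial.degree q = n")
  case True
  then show ?thesis using coeff_mult_degree_sum[of p q] by auto
next
  case False
  then have "Polynomial.degree (p * q) < m + n" using assms degree_mult_le[of p q] by linarith
  moreover have "Polynomial.coeff p m = 0 \<or> Polynomial.coeff q n = 0" using False assms by (auto simp: coeff_eq_0 le_less)
  ultimately show ?thesis by (auto simp: coeff_eq_0)
qed

lemma degree_sh [simp]: "Polynomial.degree (sh j p) = Polynomial.degree p"
  by (simp add: sh_def degree_pcompose)

lemma coeff_sh: "Polynomial.degree p \<le> J \<Longrightarrow> Polynomial.coeff (sh j p) J = Polynomial.coeff p J"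
proof (cases "Polynomial.degree p = J")
  case True
  then show ?thesis using lead_coeff_comp[of "[:of_int j, 1:]" p] by (simp add: sh_def degree_pcompose)
next
  case False
  moreover assume "Polynomial.degree p \<le> J"
  ultimately show ?thesis by (simp add: coeff_eq_0)
qed

text \<open>The substitution t \<mapsto> t + j does not affect top coefficients, so in degree J + J'
  the twisted convolution becomes an ordinary one, and there only the pair (K, K') contributes at
  index K + K'.\<close>

lemma has_lead_mult:
  assumes u: "has_lead u J K q" and v: "has_lead v J' K' q'"
  shows "has_lead (u * v) (J + J') (K + K') (q * q')"
proof -
  have du: "Polynomial.degree (co u k) \<le> J" and dv: "Polynomial.degree (co v k) \<le> J'" for k using u v by (auto simp: has_lead_def)
  have co: "co (u * v) k = (\<Sum>j | co v j \<noteq> 0. sh j (co u (k - j)) * co v j)" for k by (rule co_mult)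
  have d: "Polynomial.degree (co (u * v) k) \<le> J + J'" for k
    unfolding co
  proof (rule degree_sum_le)
    show "Polynomial.degree (sh j (co u (k - j)) * co v j) \<le> J + J'" for j
      using degree_mult_le[of "sh j (co u (k - j))" "co v j"] du[of "k - j"] dv[of j] by simp
  qed (rule co_finite)
  have c: "Polynomial.coeff (co (u * v) k) (J + J') = (\<Sum>j | co v j \<noteq> 0. Polynomial.coeff (co u (k - j)) J * Polynomial.coeff (co v j) J')" for k
    unfolding co coeff_sum using du dv by (intro sum.cong refl) (simp add: coeff_mult_le coeff_sh)
  have zero: "Polynomial.coeff (co u (k - j)) J * Polynomial.coeff (co v j) J' = 0" if "k > K + K' \<or> k = K + K' \<and> j \<noteq> K'" for k j
  proof -
    have "k - j > K \<or> j > K'" using that by linarith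
    then show ?thesis using u v by (auto simp: has_lead_def)
  qed
  have "Polynomial.coeff (co (u * v) k) (J + J') = 0" if "k > K + K'" for k
    unfolding c using that zero by (intro sum.neutral) blast
  moreover have "Polynomial.coeff (co (u * v) (K + K')) (J + J') = q * q'"
  proof -
    have K': "co v K' \<noteq> 0" using v by (auto simp: has_lead_def)
    have "Polynomial.coeff (co (u * v) (K + K')) (J + J') = (\<Sum>j\<in>{K'}. Polynomial.coeff (co u (K + K' - j)) J * Polynomial.coeff (co v j) J')"
      unfolding c using zero[of "K + K'"] co_finite K' by (intro sum.mono_neutral_right) auto
    then show ?thesis using u v by (simp add: has_lead_def)
  qed
  ultimately show ?thesis using u v d by (simp add: has_lead_def)
qed

lemma has_lead_unique:
  assumes "has_lead u J K q" "has_lead u J' K' q'"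
  shows "J = J' \<and> K = K' \<and> q = q'"
proof -
  have *: "J' \<le> J" if "has_lead u J K q" "has_lead u J' K' q'" for J K q J' K' q'
    using that le_degree[of "co u K'" J'] unfolding has_lead_def by (metis order_trans)
  have J: "J = J'" using *[OF assms] *[OF assms(2,1)] by simp
  have "K = K'" using assms unfolding J has_lead_def by (metis linorder_neqE)
  then show ?thesis using assms J by (simp add: has_lead_def)
qed

lemma has_lead_exists:
  assumes "u \<noteq> 0" shows "\<exists>J K q. has_lead u J K q"
proof -
  let ?S = "{k. co u k \<noteq> 0}"
  have S: "finite ?S" "?S \<noteq> {}" using co_finite co_eq_0_imp[of u] assms by auto
  define J where "J = Max ((\<lambda>k. Polynomial.degree (co u k)) ` ?S)"
  have d: "Polynomial.degree (co u k) \<le> J" for k using S by (cases "co u k = 0") (auto simp: J_def)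
  have "J \<in> (\<lambda>k. Polynomial.degree (co u k)) ` ?S" unfolding J_def using S by (intro Max_in) auto
  then obtain k0 where k0: "co u k0 \<noteq> 0" "Polynomial.degree (co u k0) = J" by auto
  let ?T = "{k. Polynomial.coeff (co u k) J \<noteq> 0}"
  have T: "finite ?T" by (rule finite_subset[OF _ S(1)]) auto
  have "k0 \<in> ?T" using k0 leading_coeff_0_iff[of "co u k0"] by simp
  then have T0: "?T \<noteq> {}" by blast
  define M where "M = Max ?T"
  have "M \<in> ?T" unfolding M_def by (rule Max_in[OF T T0])
  moreover have "k \<notin> ?T" if "k > M" for k using Max_ge[OF T, of k] that unfolding M_def by (rule_tac notI) simp
  ultimately have "has_lead u J M (Polynomial.coeff (co u M) J)" using d by (simp add: has_lead_def)
  then show ?thesis by blast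
qed

lemma degree_fq: "Polynomial.degree (fq i) = 2"
proof -
  have "fq i = [:[:0, 1:] - of_int i * (of_int i + 1), - 2 * of_int i - 1, -1:]"
    by (simp add: fq_def ww_def tt_def of_int_poly one_pCons numeral_poly algebra_simps)
  then show ?thesis by simp
qed

lemma degree_xk: "Polynomial.degree (xk k) = 2 * nat (- k)"
  unfolding xk_def by (subst degree_prod_eq_sum_degree) (simp_all add: fq_nonzero degree_fq)

text \<open>Index -n carries the factor \<open>xk (- n)\<close> of degree 2n in t. So K + J is
  nonnegative, and \<open>lead_exp\<close>, which records K + J as a natural number, loses
  nothing.\<close>

lemma has_lead_bound: "has_lead u J K q \<Longrightarrow> 2 * nat (- K) \<le> J"
proof -
  assume u: "has_lead u J K q"
  obtain p where p: "co u K = xk K * p" using co_normal_form[of u] by blast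
  have "co u K \<noteq> 0" using u by (auto simp: has_lead_def)
  then have "2 * nat (- K) \<le> Polynomial.degree (co u K)" using p degree_mult_eq[of "xk K" p] by (auto simp: degree_xk)
  also have "\<dots> \<le> J" using u by (simp add: has_lead_def)
  finally show ?thesis .
qed

lemma has_lead_1: "has_lead 1 0 0 1"
  by (simp add: has_lead_def co_1)

lemma has_lead_power: "has_lead u J K q \<Longrightarrow> has_lead (u ^ n) (n * J) (int n * K) (q ^ n)"
proof (induction n)
  case (Suc n)
  have "has_lead (u * u ^ n) (J + n * J) (K + int n * K) (q * q ^ n)" using has_lead_mult Suc by blast
  then show ?case by (simp add: algebra_simps)
qed (simp add: has_lead_1)

lemma has_lead_gens: "has_lead gE 0 1 1" "has_lead gF 2 (-1) (-1)" "has_lead gT 1 0 1" "has_lead gW 0 0 [:0, 1:]"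
proof -
  have 1: "co gE k = (if k = 1 then 1 else 0)" "co gF k = (if k = -1 then fq (-1) else 0)"
    "co gT k = (if k = 0 then tt else 0)" "co gW k = (if k = 0 then ww else 0)" for k
    using co_E[of 1 k] co_F[of 1 k] co_T[of 1 k] co_W[of 1 k] by (auto simp: co_1)
  have "fq (-1) = [:[:0, 1:], 1, -1:]" by (simp add: fq_def ww_def tt_def one_pCons)
  then show "has_lead gF 2 (-1) (-1)" by (simp add: has_lead_def 1 numeral_2_eq_2)
  show "has_lead gE 0 1 1" "has_lead gT 1 0 1" "has_lead gW 0 0 [:0, 1:]"
    by (auto simp: has_lead_def 1 tt_def ww_def)
qed

definition lead_exp :: "ut \<Rightarrow> nat \<times> nat \<times> nat" where
  "lead_exp u = (THE e. \<exists>J K q. has_lead u J K q \<and> e = (J, nat (K + int J), Polynomial.degree q))"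

lemma lead_exp_eq: "has_lead u J K q \<Longrightarrow> lead_exp u = (J, nat (K + int J), Polynomial.degree q)"
  unfolding lead_exp_def by (rule the_equality) (use has_lead_unique in blast)+

text \<open>\<alpha> is the ratio of the leading coefficients of q and q'. The subtraction removes
  the leading term, after which J drops, or K at equal J, or else the degree of q.\<close>

lemma lead_cancel:
  assumes u: "has_lead u J K q" and v: "has_lead v J K q'" and d: "Polynomial.degree q = Polynomial.degree q'"
  shows "\<exists>\<alpha>. u - sc \<alpha> * v = 0 \<or>
    (lead_exp (u - sc \<alpha> * v), lead_exp u) \<in> less_than <*lex*> less_than <*lex*> less_than"
proof -
  define \<alpha> where "\<alpha> = Polynomial.lead_coeff q / Polynomial.lead_coeff q'"
  define w where "w = u - sc \<alpha> * v"
  have q0: "q \<noteq> 0" "q' \<noteq> 0" using u v by (auto simp: has_lead_def)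
  have cw: "co w k = co u k - cc \<alpha> * co v k" for k by (simp add: w_def co_scale)
  have ccs: "cc \<alpha> * p = Polynomial.smult [:\<alpha>:] p" for p by (simp add: cc_def)
  have dw: "Polynomial.degree (co w k) \<le> J" for k
    unfolding cw ccs using u v by (intro degree_diff_le) (auto simp: has_lead_def intro: order_trans[OF degree_smult_le])
  have sym: "Polynomial.coeff (co w k) J = Polynomial.coeff (co u k) J - Polynomial.smult \<alpha> (Polynomial.coeff (co v k) J)" for k
    by (simp add: cw ccs)
  have symK: "Polynomial.coeff (co w K) J = q - Polynomial.smult \<alpha> q'" using u v by (simp add: sym has_lead_def)
  have sym0: "Polynomial.coeff (co w k) J = 0" if "k > K" for k using u v that by (simp add: sym has_lead_def)
  show ?thesis
  proof (intro exI[of _ \<alpha>], fold w_def, rule disjCI)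
    assume "(lead_exp w, lead_exp u) \<notin> less_than <*lex*> less_than <*lex*> less_than"
    note no = this[unfolded lead_exp_eq[OF u]]
    show "w = 0"
    proof (rule ccontr)
      assume "w \<noteq> 0"
      then obtain J2 K2 q2 where w: "has_lead w J2 K2 q2" using has_lead_exists by blast
      have J2: "J2 \<le> J" using w dw[of K2] le_degree[of "co w K2" J2] by (auto simp: has_lead_def)
      have "J2 = J" using no J2 unfolding lead_exp_eq[OF w] by auto
      then have wJ: "has_lead w J K2 q2" using w by simp
      have K2: "K2 \<le> K" using sym0[of K2] wJ by (force simp: has_lead_def)
      have b: "K2 + int J \<ge> 0" using has_lead_bound[OF wJ] by linarith
      have "K2 = K" using no K2 b unfolding lead_exp_eq[OF wJ] by (auto simp: nat_less_eq_zless)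
      then have q2: "q2 = q - Polynomial.smult \<alpha> q'" "q2 \<noteq> 0" using wJ symK by (auto simp: has_lead_def)
      have "Polynomial.degree q2 \<le> Polynomial.degree q" unfolding q2(1) using d degree_smult_le[of \<alpha> q'] by (intro degree_diff_le) auto
      moreover have "Polynomial.coeff q2 (Polynomial.degree q) = 0" using q0 d by (simp add: q2(1) \<alpha>_def)
      then have "Polynomial.degree q2 \<noteq> Polynomial.degree q" using q2(2) by (metis leading_coeff_0_iff)
      ultimately show False using no \<open>K2 = K\<close> unfolding lead_exp_eq[OF wJ] by auto
    qed
  qed
qed

section \<open>Dickson's lemma and the ascending chain condition\<close>

lemma nat_incseq_subseq: "\<exists>r::nat \<Rightarrow> nat. strict_mono r \<and> incseq (\<lambda>n. f (r n) :: nat)"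
proof -
  obtain r :: "nat \<Rightarrow> nat" where r: "strict_mono r" "monoseq (\<lambda>n. f (r n))" using seq_monosub by blast
  show ?thesis
  proof (cases "incseq (\<lambda>n. f (r n))")
    case False
    then have dec: "decseq (\<lambda>n. f (r n))" using r(2) by (simp add: monoseq_iff)
    define m where "m = (LEAST x. x \<in> range (\<lambda>n. f (r n)))"
    have "m \<in> range (\<lambda>n. f (r n))" unfolding m_def by (rule LeastI) blast
    then obtain N where N: "f (r N) = m" by auto
    have "f (r (N + n)) = m" for n
    proof (rule antisym)
      show "f (r (N + n)) \<le> m" using decseqD[OF dec, of N "N + n"] N by simp
      show "m \<le> f (r (N + n))" unfolding m_def by (rule Least_le) blast
    qed
    moreover have "strict_mono (\<lambda>n. r (N + n))" using r(1) by (simp add: strict_mono_def)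
    ultimately show ?thesis by (intro exI[of _ "\<lambda>n. r (N + n)"]) simp
  qed (use r in blast)
qed

lemma dickson4:
  fixes f g h k :: "nat \<Rightarrow> nat"
  shows "\<exists>p q. p < q \<and> f p \<le> f q \<and> g p \<le> g q \<and> h p \<le> h q \<and> k p \<le> k q"
proof -
  obtain r1 where r1: "strict_mono r1" "incseq (\<lambda>n. f (r1 n))" using nat_incseq_subseq by blast
  obtain r2 where r2: "strict_mono r2" "incseq (\<lambda>n. g (r1 (r2 n)))" using nat_incseq_subseq[of "\<lambda>n. g (r1 n)"] by blast
  obtain r3 where r3: "strict_mono r3" "incseq (\<lambda>n. h (r1 (r2 (r3 n))))" using nat_incseq_subseq[of "\<lambda>n. h (r1 (r2 n))"] by blast
  obtain r4 where r4: "strict_mono r4" "incseq (\<lambda>n. k (r1 (r2 (r3 (r4 n)))))" using nat_incseq_subseq[of "\<lambda>n. k (r1 (r2 (r3 n)))"] by blast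
  have l4: "r4 0 < r4 1" using r4(1) by (simp add: strict_mono_def)
  have l3: "r3 (r4 0) < r3 (r4 1)" using r3(1) l4 by (simp add: strict_mono_def)
  have l2: "r2 (r3 (r4 0)) < r2 (r3 (r4 1))" using r2(1) l3 by (simp add: strict_mono_def)
  have l1: "r1 (r2 (r3 (r4 0))) < r1 (r2 (r3 (r4 1)))" using r1(1) l2 by (simp add: strict_mono_def)
  show ?thesis
    using l1 incseqD[OF r1(2), OF less_imp_le[OF l2]] incseqD[OF r2(2), OF less_imp_le[OF l3]]
      incseqD[OF r3(2), OF less_imp_le[OF l4]] incseqD[OF r4(2), of 0 1] by blast
qed

text \<open>The monomial E^a F^b T^j W^i has these data. Such monomials realize every difference of
  exponents that Dickson's lemma yields in \<open>chain_stabilizes\<close>.\<close>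

lemma lead_monomial:
  "\<exists>m q. has_lead m (2 * b + j) (int a - int b) q \<and> Polynomial.degree q = i"
proof -
  have "has_lead (gE ^ a * gF ^ b * gT ^ j * gW ^ i)
    (a * 0 + b * 2 + j * 1 + i * 0) (int a * 1 + int b * (-1) + int j * 0 + int i * 0)
    (1 ^ a * (-1) ^ b * 1 ^ j * [:0, 1:] ^ i)"
    by (intro has_lead_mult has_lead_power has_lead_gens)
  moreover have "Polynomial.degree (1 ^ a * (-1) ^ b * 1 ^ j * [:0, 1:] ^ i :: complex poly) = i"
    by (simp add: degree_mult_eq degree_power_eq)
  moreover have "a * 0 + b * 2 + j * 1 + i * 0 = 2 * b + j"
    "int a * 1 + int b * (-1) + int j * 0 + int i * 0 = int a - int b" by simp_all
  ultimately show ?thesis by (simp only:) blast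
qed

text \<open>A Groebner basis argument. Along a chain that never stabilizes, let u N have least
  leading exponent in the union minus I N. Dickson's lemma gives x < y for which the exponent of u
  (s x) divides that of u (s y); subtracting a multiple of the former leaves an element outside I (s
  y) of smaller exponent. The parameter \<open>act\<close> stands for left or for right
  multiplication.\<close>

lemma chain_stabilizes:
  fixes I :: "nat \<Rightarrow> ut set"
  assumes act: "\<And>m u J K q J' K' q'. has_lead m J K q \<Longrightarrow> has_lead u J' K' q' \<Longrightarrow> has_lead (act m u) (J + J') (K + K') (q * q')"
    and I: "\<And>n. 0 \<in> I n" "\<And>n u v. u \<in> I n \<Longrightarrow> v \<in> I n \<Longrightarrow> u + v \<in> I n" "\<And>n c u. u \<in> I n \<Longrightarrow> sc c * u \<in> I n"
      "\<And>n m u. u \<in> I n \<Longrightarrow> act m u \<in> I n" and mono: "\<And>n. I n \<subseteq> I (Suc n)"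
  shows "\<exists>N. \<forall>n\<ge>N. I n = I N"
proof (rule ccontr)
  assume no: "\<not> ?thesis"
  have mono': "I m \<subseteq> I n" if "m \<le> n" for m n using lift_Suc_mono_le[of I, OF mono that] .
  let ?r = "less_than <*lex*> less_than <*lex*> less_than"
  let ?U = "\<Union>n. I n"
  have diff: "u - sc c * v \<in> I n" if "u \<in> I n" "v \<in> I n" for u v c n
    using I(2)[OF that(1) I(3)[OF that(2), of "- c"]] by simp
  have ex: "\<exists>u. u \<in> ?U - I N" for N
  proof (rule ccontr)
    assume "\<nexists>u. u \<in> ?U - I N"
    then have "I n = I N" if "n \<ge> N" for n using mono'[OF that] by blast
    then show False using no by blast
  qed
  have wf: "wf (inv_image ?r lead_exp)" by (intro wf_inv_image wf_lex_prod wf_less_than)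
  have "\<exists>u. u \<in> ?U - I N \<and> (\<forall>v. (lead_exp v, lead_exp u) \<in> ?r \<longrightarrow> v \<notin> ?U - I N)" for N
  proof -
    obtain u0 where "u0 \<in> ?U - I N" using ex by blast
    then obtain u where "u \<in> ?U - I N" "\<And>v. (v, u) \<in> inv_image ?r lead_exp \<Longrightarrow> v \<notin> ?U - I N"
      using wfE_min[OF wf] by metis
    then show ?thesis by (auto simp: inv_image_def)
  qed
  then obtain u where u: "\<And>N. u N \<in> ?U - I N" "\<And>N v. (lead_exp v, lead_exp (u N)) \<in> ?r \<Longrightarrow> v \<notin> ?U - I N" by metis
  have u0: "u N \<noteq> 0" for N using u(1)[of N] I(1)[of N] by auto
  have "\<forall>N. \<exists>t. has_lead (u N) (fst t) (fst (snd t)) (snd (snd t))" using has_lead_exists[OF u0] by simp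
  from choice[OF this] obtain t where t: "\<And>N. has_lead (u N) (fst (t N)) (fst (snd (t N))) (snd (snd (t N)))" by blast
  define J K q where "J N = fst (t N)" and "K N = fst (snd (t N))" and "q N = snd (snd (t N))" for N
  have l: "has_lead (u N) (J N) (K N) (q N)" for N using t by (simp add: J_def K_def q_def)
  obtain g where g: "\<And>N. u N \<in> I (g N)" 
  proof -
    have "\<exists>n. u N \<in> I n" for N using u(1)[of N] by blast
    then show thesis using that by metis
  qed
  \<comment> \<open>The indices are thinned out so that u (s x) already lies in I (s (Suc
    x)).\<close>
  define s where "s = rec_nat 0 (\<lambda>_ x. max (g x) (Suc x))"
  have s: "s (Suc n) = max (g (s n)) (Suc (s n))" for n by (simp add: s_def)
  have ss: "strict_mono s" by (rule strict_monoI_Suc) (simp add: s)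
  \<comment> \<open>K is split into positive and negative parts, the exponents of E and F, and each
    F accounts for 2 in J. By \<open>has_lead_bound\<close> the subtraction in \<open>jf\<close> is
    not truncated.\<close>
  define jf kp km df where "jf n = J (s n) - 2 * nat (- K (s n))" and "kp n = nat (K (s n))"
    and "km n = nat (- K (s n))" and "df n = Polynomial.degree (q (s n))" for n
  obtain x y where xy: "x < y" "jf x \<le> jf y" "kp x \<le> kp y" "km x \<le> km y" "df x \<le> df y"
    using dickson4[of jf kp km df] by blast
  obtain m qm where m: "has_lead m (2 * (km y - km x) + (jf y - jf x)) (int (kp y - kp x) - int (km y - km x)) qm"
    "Polynomial.degree qm = df y - df x" using lead_monomial by blast
  have bd: "2 * nat (- K (s n)) \<le> J (s n)" for n using has_lead_bound[OF l] .
  have eqJ: "2 * (km y - km x) + (jf y - jf x) + J (s x) = J (s y)"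
  proof -
    have *: "2 * (b - a) + (jy - 2 * b - (jx - 2 * a)) + jx = jy"
      if "a \<le> b" "jx - 2 * a \<le> jy - 2 * b" "2 * a \<le> jx" "2 * b \<le> jy" for a b jx jy :: nat
      using that by arith
    show ?thesis unfolding jf_def km_def
      by (rule *[OF xy(4)[unfolded km_def] xy(2)[unfolded jf_def] bd bd])
  qed
  have eqK: "int (kp y - kp x) - int (km y - km x) + K (s x) = K (s y)"
  proof -
    have *: "int (nat k) - int (nat (- k)) = k" for k by simp
    show ?thesis
      using of_nat_diff[OF xy(3), where 'a = int] of_nat_diff[OF xy(4), where 'a = int] *[of "K (s x)"] *[of "K (s y)"]
      unfolding kp_def km_def by linarith
  qed
  define v where "v = act m (u (s x))"
  have lv: "has_lead v (J (s y)) (K (s y)) (qm * q (s x))" using act[OF m(1) l[of "s x"]] unfolding v_def eqJ eqK .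
  have "Polynomial.degree (q (s y)) = Polynomial.degree (qm * q (s x))"
    using m(2) xy(5) l[of "s x"] m(1) by (simp add: has_lead_def degree_mult_eq df_def)
  then obtain \<alpha> where \<alpha>: "u (s y) - sc \<alpha> * v = 0 \<or> (lead_exp (u (s y) - sc \<alpha> * v), lead_exp (u (s y))) \<in> ?r"
    using lead_cancel[OF l lv] by blast
  have "u (s x) \<in> I (s (Suc x))" using g[of "s x"] mono'[of "g (s x)" "s (Suc x)"] by (auto simp: s)
  then have "u (s x) \<in> I (s y)" using mono'[of "s (Suc x)" "s y"] xy(1) ss by (auto simp: strict_mono_less_eq)
  then have v: "v \<in> I (s y)" unfolding v_def by (rule I(4))
  define w where "w = u (s y) - sc \<alpha> * v"
  have "w \<notin> I (s y)"
  proof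
    assume "w \<in> I (s y)"
    then have "w + sc \<alpha> * v \<in> I (s y)" using I(2,3) v by blast
    then show False using u(1)[of "s y"] by (simp add: w_def)
  qed
  moreover have "w \<in> ?U"
  proof -
    obtain n where n: "u (s y) \<in> I n" using u(1)[of "s y"] by blast
    have "u (s y) \<in> I (max n (s y))" "v \<in> I (max n (s y))" using n v mono'[of n "max n (s y)"] mono'[of "s y" "max n (s y)"] by auto
    then show ?thesis unfolding w_def using diff by blast
  qed
  ultimately have "w \<in> ?U - I (s y)" by blast
  moreover have "w \<noteq> 0" using calculation I(1) by auto
  ultimately show False using \<alpha> u(2)[of w "s y"] by (auto simp: w_def[symmetric])
qed

lemma range_Rep_ut: "range Rep_ut = carrier U_sl2"
  using type_definition.Rep_range[OF type_definition_ut] .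

lemma image_vimage_Rep_ut: "L \<subseteq> carrier U_sl2 \<Longrightarrow> Rep_ut ` {u. Rep_ut u \<in> L} = L"
  unfolding range_Rep_ut[symmetric] by auto

theorem noetherian_U_sl2: "noetherian U_sl2"
  unfolding noetherian_def
proof (intro conjI allI impI)
  fix L :: "nat \<Rightarrow> ((complex^2^2) list \<Rightarrow> complex) set set"
  define I where "I n = {u. Rep_ut u \<in> L n}" for n
  {
    assume L: "\<forall>n. left_ideal U_sl2 (L n) \<and> L n \<subseteq> L (Suc n)"
    note D = left_idealD[OF L[rule_format, THEN conjunct1]]
    have "\<exists>N. \<forall>n\<ge>N. I n = I N"
      by (rule chain_stabilizes[where act = "\<lambda>m u. m * u"])
        (use D L Rep_ut in \<open>auto simp: I_def Rep_ut_hom has_lead_mult\<close>)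
    then obtain N where N: "\<And>n. n \<ge> N \<Longrightarrow> I n = I N" by blast
    have "L n = Rep_ut ` I n" for n unfolding I_def by (rule image_vimage_Rep_ut[OF D(1), symmetric])
    then show "\<exists>N. \<forall>n\<ge>N. L n = L N" using N by metis
  next
    assume L: "\<forall>n. right_ideal U_sl2 (L n) \<and> L n \<subseteq> L (Suc n)"
    note D = right_idealD[OF L[rule_format, THEN conjunct1]]
    have "\<exists>N. \<forall>n\<ge>N. I n = I N"
    proof (rule chain_stabilizes[where act = "\<lambda>m u. u * m"])
      show "has_lead (u * m) (J + J') (K + K') (q * q')" if "has_lead m J K q" "has_lead u J' K' q'" for m u J K q J' K' q'
        using has_lead_mult[OF that(2,1)] by (simp add: ac_simps)
      show "sc c * u \<in> I n" if "u \<in> I n" for n c u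
        using that D(4)[of "Rep_ut (sc c)" "Rep_ut u" n] Rep_ut by (simp add: I_def Rep_ut_hom sc_central)
    qed (use D L Rep_ut in \<open>auto simp: I_def Rep_ut_hom\<close>)
    then obtain N where N: "\<And>n. n \<ge> N \<Longrightarrow> I n = I N" by blast
    have "L n = Rep_ut ` I n" for n unfolding I_def by (rule image_vimage_Rep_ut[OF D(1), symmetric])
    then show "\<exists>N. \<forall>n\<ge>N. L n = L N" using N by metis
  }
qed

section \<open>Two-sided ideals of the enveloping algebra\<close>

definition tideal :: "ut set \<Rightarrow> bool" where
  "tideal I \<longleftrightarrow> 0 \<in> I \<and> (\<forall>x\<in>I. \<forall>y\<in>I. x + y \<in> I) \<and> (\<forall>u. \<forall>x\<in>I. u * x \<in> I \<and> x * u \<in> I)"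

definition tprime :: "ut set \<Rightarrow> bool" where
  "tprime P \<longleftrightarrow> tideal P \<and> 1 \<notin> P \<and> (\<forall>a b. (\<forall>x. a * x * b \<in> P) \<longrightarrow> a \<in> P \<or> b \<in> P)"

lemma tidealD:
  assumes "tideal I"
  shows "0 \<in> I" "x \<in> I \<Longrightarrow> y \<in> I \<Longrightarrow> x + y \<in> I" "x \<in> I \<Longrightarrow> u * x \<in> I" "x \<in> I \<Longrightarrow> x * u \<in> I"
    "x \<in> I \<Longrightarrow> - x \<in> I" "x \<in> I \<Longrightarrow> y \<in> I \<Longrightarrow> x - y \<in> I"
proof -
  show a: "0 \<in> I" "x \<in> I \<Longrightarrow> y \<in> I \<Longrightarrow> x + y \<in> I" "x \<in> I \<Longrightarrow> u * x \<in> I" "x \<in> I \<Longrightarrow> x * u \<in> I" for x y u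
    using assms by (auto simp: tideal_def)
  show b: "- x \<in> I" if "x \<in> I" for x using a(3)[of x "- 1"] that by simp
  show "x - y \<in> I" if "x \<in> I" "y \<in> I" using a(2)[of x "- y"] b that by simp
qed

lemma tideal_sum: "tideal I \<Longrightarrow> (\<And>k. k \<in> S \<Longrightarrow> f k \<in> I) \<Longrightarrow> (\<Sum>k\<in>S. f k) \<in> I"
  by (induction S rule: infinite_finite_induct) (auto simp: tidealD)

lemma tideal_unscale:
  assumes "tideal I" "c \<noteq> 0" "sc c * u \<in> I" shows "u \<in> I"
proof -
  have "sc (inverse c) * (sc c * u) = sc (inverse c * c) * u" by (simp add: mult.assoc)
  then have "sc (inverse c) * (sc c * u) = u" using assms(2) by simp
  then show ?thesis using tidealD(3)[OF assms(1,3), of "sc (inverse c)"] by simp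
qed

lemma tprime_central:
  assumes P: "tprime P" and c: "\<And>x. z * x = x * z" and u: "u * z \<in> P"
  shows "z \<in> P \<or> u \<in> P"
proof -
  have "z * x * u \<in> P" for x
  proof -
    have "z * x * u = x * (u * z)" by (metis c mult.assoc)
    then show ?thesis using P u tidealD(3)[of P] by (simp add: tprime_def)
  qed
  then show ?thesis using P by (auto simp: tprime_def)
qed

lemma of_int_sc: "of_int i = sc (of_int i)"
  using pm_basic(4)[of i] pm_simps(5)[of "[:of_int i:]"] by (simp add: of_int_poly)

text \<open>The commutator with T multiplies the term of weight k by k. Subtracting l times the sum
  removes the term of weight l and scales the others by the nonzero numbers k - l, so induction
  applies.\<close>

lemma tideal_homogeneous:
  assumes I: "tideal I" and S: "finite S" and "(\<Sum>k\<in>S. wt k * pm (p k)) \<in> I" "k \<in> S"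
  shows "wt k * pm (p k) \<in> I"
  using S assms(3,4)
proof (induction S arbitrary: p k rule: finite_induct)
  case (insert l S)
  let ?u = "\<Sum>k\<in>insert l S. wt k * pm (p k)"
  have comm: "gT * (wt k * pm (p k)) - wt k * pm (p k) * gT = sc (of_int k) * (wt k * pm (p k))" for k
  proof -
    have "gT * (wt k * pm (p k)) = wt k * (pm (tt + of_int k) * pm (p k))"
      using pm_wt[of tt k] by (simp add: mult.assoc[symmetric])
    moreover have "wt k * pm (p k) * gT = wt k * (gT * pm (p k))"
      using pm_comm[of "p k" tt] by (simp add: mult.assoc)
    ultimately show ?thesis by (simp add: distrib_right distrib_left sc_assoc_comm of_int_sc)
  qed
  have "gT * ?u - ?u * gT - sc (of_int l) * ?u = (\<Sum>k\<in>insert l S. sc (of_int k) * (wt k * pm (p k)) - sc (of_int l) * (wt k * pm (p k)))"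
    by (simp only: sum_distrib_left sum_distrib_right sum_subtractf[symmetric] comm)
  also have "\<dots> = (\<Sum>k\<in>insert l S. wt k * pm (cc (of_int (k - l)) * p k))"
    by (intro sum.cong refl) (simp add: sc_assoc_comm left_diff_distrib right_diff_distrib)
  also have "\<dots> = (\<Sum>k\<in>S. wt k * pm (cc (of_int (k - l)) * p k))"
    using insert.hyps by simp
  finally have eq: "gT * ?u - ?u * gT - sc (of_int l) * ?u = (\<Sum>k\<in>S. wt k * pm (cc (of_int (k - l)) * p k))" .
  have "gT * ?u - ?u * gT - sc (of_int l) * ?u \<in> I"
    by (intro tidealD(6)[OF I] tidealD(3)[OF I] tidealD(4)[OF I] insert.prems(1))
  then have "(\<Sum>k\<in>S. wt k * pm (cc (of_int (k - l)) * p k)) \<in> I" unfolding eq .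
  from insert.IH[OF this] have h: "sc (of_int (k - l)) * (wt k * pm (p k)) \<in> I" if "k \<in> S" for k
    using that by (simp only: pm_simps(4) pm_basic(3) sc_assoc_comm)
  have *: "wt k * pm (p k) \<in> I" if "k \<in> S" for k
  proof (rule tideal_unscale[OF I])
    show "sc (of_int (k - l)) * (wt k * pm (p k)) \<in> I" using h that .
    show "complex_of_int (k - l) \<noteq> 0" using that insert.hyps by auto
  qed
  have "(\<Sum>k\<in>S. wt k * pm (p k)) \<in> I" by (rule tideal_sum[OF I]) (rule *)
  then have "?u - (\<Sum>k\<in>S. wt k * pm (p k)) \<in> I" by (rule tidealD(6)[OF I insert.prems(1)])
  moreover have "?u - (\<Sum>k\<in>S. wt k * pm (p k)) = wt l * pm (p l)" using insert.hyps by simp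
  ultimately have "wt l * pm (p l) \<in> I" by (rule back_subst)
  then show ?case using * insert.prems(2) by (cases "k = l") auto
qed simp

text \<open>Differencing lowers the degree by one and multiplies the leading coefficient by the
  degree. Here n is only an upper bound of the degree, as the induction over \<open>pCons\<close>
  requires.\<close>

lemma shift_difference_coeffs:
  "Polynomial.degree p \<le> n \<Longrightarrow> (\<forall>m\<ge>n. Polynomial.coeff (sh 1 p - p) m = 0) \<and>
     Polynomial.coeff (sh 1 p - p) (n - 1) = of_nat n * Polynomial.coeff p n"
proof (induction p arbitrary: n)
  case (pCons a p)
  show ?case
  proof (cases n)
    case 0
    then have "p = 0" using pCons.prems by (metis degree_pCons_eq le_zero_eq nat.distinct(1))
    then show ?thesis using 0 by simp
  next
    case (Suc m)
    have d: "Polynomial.degree p \<le> m" using pCons.prems Suc by (cases "p = 0") auto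
    note IH = pCons.IH[OF d]
    have "sh 1 (pCons a p) = [:a:] + [:1, 1:] * sh 1 p" by (simp add: sh_def pcompose_pCons)
    then have e: "sh 1 (pCons a p) - pCons a p = pCons 0 (sh 1 p - p) + (sh 1 p - p) + p"
      by (simp add: algebra_simps)
    have "Polynomial.coeff (sh 1 (pCons a p) - pCons a p) j = 0" if jn: "j \<ge> n" for j
    proof -
      obtain i where i: "j = Suc i" "i \<ge> m" using jn Suc by (cases j) auto
      show ?thesis unfolding e coeff_add i(1) coeff_pCons_Suc using IH i d by (simp add: coeff_eq_0)
    qed
    moreover have "Polynomial.coeff (sh 1 (pCons a p) - pCons a p) m = of_nat n * Polynomial.coeff p m"
      unfolding e coeff_add using IH Suc by (cases m) (simp_all add: algebra_simps)
    ultimately show ?thesis using Suc by simp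
  qed
qed simp

lemma sc_of_nat: "sc (of_nat n) = of_nat n"
  by (induction n) simp_all

lemma pw_of_nat [simp]: "pw (of_nat n) = of_nat n"
  by (induction n) simp_all

text \<open>Since E^n p(T) E - E E^n p(T) = E^(n+1) (p(T + 1) - p(T)), each commutator trades one
  degree in T for one factor E. The positive integers that accumulate in the leading coefficient are
  invertible scalars.\<close>

lemma tideal_lower_degree:
  assumes I: "tideal I" and "gE ^ n * pm p \<in> I"
  shows "gE ^ (n + Polynomial.degree p) * pw (Polynomial.lead_coeff p) \<in> I"
  using assms(2)
proof (induction "Polynomial.degree p" arbitrary: n p)
  case 0
  then obtain a where "p = [:a:]" by (metis degree_eq_zeroE)
  then show ?case using 0 by simp
next
  case (Suc d)
  let ?r = "sh 1 p - p"
  note r = shift_difference_coeffs[of p "Suc d", OF eq_refl[OF Suc.hyps(2)[symmetric]]]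
  have c: "Polynomial.coeff ?r m = 0" if "m \<ge> Suc d" for m using r that by blast
  have cd: "Polynomial.coeff ?r d = of_nat (Suc d) * Polynomial.lead_coeff p"
    using r[THEN conjunct2] unfolding Suc.hyps(2)[symmetric] diff_Suc_1 .
  have p0: "Polynomial.lead_coeff p \<noteq> 0" using Suc.hyps(2) by auto
  have "Polynomial.coeff ?r d \<noteq> 0" unfolding cd using p0 by (simp del: of_nat_Suc)
  then have dr: "Polynomial.degree ?r = d" using c by (intro antisym degree_le le_degree) auto
  have "gE ^ n * pm p * gE - gE * (gE ^ n * pm p) = gE ^ Suc n * pm ?r"
    by (simp add: mult.assoc pm_E right_diff_distrib) (simp add: mult.assoc[symmetric] power_commutes)
  then have "gE ^ Suc n * pm ?r \<in> I" using tidealD(3,4,6)[OF I] Suc.prems by metis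
  from Suc.hyps(1)[OF dr[symmetric] this]
  have "gE ^ (Suc n + d) * pw (of_nat (Suc d) * Polynomial.lead_coeff p) \<in> I" unfolding dr cd .
  then have "sc (of_nat (Suc d)) * (gE ^ (Suc n + d) * pw (Polynomial.lead_coeff p)) \<in> I"
    by (simp only: pw_simps(4) pw_of_nat sc_of_nat[symmetric] sc_assoc_comm)
  then have "gE ^ (Suc n + d) * pw (Polynomial.lead_coeff p) \<in> I"
    by (rule tideal_unscale[OF I, rotated]) (simp del: of_nat_Suc)
  then show ?case using Suc.hyps(2) by (metis add_Suc_shift)
qed

lemma EnFn: "gE ^ n * gF ^ n = pm (\<Prod>i<n. fq (- 1 - int i))"
proof (induction n)
  case (Suc n)
  have "gE ^ Suc n * gF ^ Suc n = gE ^ n * (gE * gF) * gF ^ n"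
    by (simp only: power_Suc2[of gE] power_Suc[of gF] mult.assoc)
  also have "\<dots> = gE ^ n * gF ^ n * pm (sh (- int n) (fq (- 1)))" unfolding EF_pm by (simp only: mult.assoc pm_F_power)
  also have "\<dots> = pm (\<Prod>i<Suc n. fq (- 1 - int i))" unfolding Suc by (simp add: add.commute)
  finally show ?case .
qed simp

lemma FnEn: "gF ^ n * gE ^ n = pm (\<Prod>i<n. fq (int i))"
proof (induction n)
  case (Suc n)
  have "gF ^ Suc n * gE ^ Suc n = gF ^ n * (gF * gE) * gE ^ n"
    by (simp only: power_Suc2[of gF] power_Suc[of gE] mult.assoc)
  also have "\<dots> = gF ^ n * gE ^ n * pm (sh (int n) (fq 0))" unfolding FE_pm by (simp only: mult.assoc pm_E_power)
  also have "\<dots> = pm (\<Prod>i<Suc n. fq (int i))" unfolding Suc by simp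
  finally show ?case .
qed simp

text \<open>A power of F is absorbed by the same power of E on its left, at the cost of the
  polynomial g. The shape of g is recorded because \<open>tideal_E_power\<close> needs g to remain
  nonzero at w = c.\<close>

lemma wt_to_E:
  assumes I: "tideal I" "wt k * pm p \<in> I"
  shows "\<exists>n g. g \<noteq> 0 \<and> gE ^ n * pm (g * p) \<in> I \<and> (g = 1 \<or> (\<exists>m. g = (\<Prod>i<m. fq (- 1 - int i))))"
proof (cases "0 \<le> k")
  case True
  then show ?thesis using I(2) by (intro exI[of _ "nat k"] exI[of _ 1]) (simp add: wt_def)
next
  case False
  define n where "n = nat (- k)"
  let ?g = "\<Prod>i<n. fq (- 1 - int i)"
  have "gE ^ n * (wt k * pm p) = gE ^ 0 * pm (?g * p)"
    using False EnFn[of n] by (simp add: wt_def n_def mult.assoc[symmetric])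
  then have "gE ^ 0 * pm (?g * p) \<in> I" using tidealD(3)[OF I] by metis
  then show ?thesis using fq_nonzero by (intro exI[of _ 0] exI[of _ ?g]) auto
qed

lemma tideal_nonzero:
  assumes I: "tideal I" and u: "u \<in> I" "u \<noteq> 0"
  shows "\<exists>m q. q \<noteq> 0 \<and> gE ^ m * pw q \<in> I"
proof -
  obtain p where "finite {k. co u k \<noteq> 0}" and p': "\<forall>k. co u k = xk k * p k" and "u = (\<Sum>k | co u k \<noteq> 0. wt k * pm (p k))"
    using co_normal_form[of u] by (elim exE conjE)
  note p = this(1) p'[rule_format] this(3)
  obtain k where k: "co u k \<noteq> 0" using co_eq_0_imp u(2) by blast
  have "wt k * pm (p k) \<in> I" using tideal_homogeneous[OF I p(1)] p(3) u(1) k by simp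
  then obtain n g where g: "g \<noteq> 0" "gE ^ n * pm (g * p k) \<in> I" using wt_to_E[OF I] by blast
  have "g * p k \<noteq> 0" using g(1) k p(2) by auto
  then show ?thesis using tideal_lower_degree[OF I g(2)] by (metis leading_coeff_0_iff)
qed

section \<open>Specializing the Casimir element\<close>

text \<open>\<open>pc c\<close> sets w = c, \<open>emb\<close> lifts back with coefficients constant
  in w, and \<open>pt\<close> substitutes T for t.\<close>

definition pc :: "complex \<Rightarrow> tw_poly \<Rightarrow> complex poly" where "pc c p = map_poly (\<lambda>q. poly q c) p"
definition emb :: "complex poly \<Rightarrow> tw_poly" where "emb p = map_poly (\<lambda>x. [:x:]) p"
definition pt :: "complex poly \<Rightarrow> ut" where "pt = hev sc gT"

lemma poly_pc: "poly (pc c p) a = evc a c p"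
  by (induction p) (simp_all add: pc_def evc_def map_poly_pCons)

lemma pc_eqI: "(\<And>a. evc a c p = poly r a) \<Longrightarrow> pc c p = r"
  using poly_eq_poly_eq_iff[of "pc c p" r] by (auto simp: poly_pc)

lemma pc_simps [simp]: "pc c 0 = 0" "pc c 1 = 1" "pc c (p + q) = pc c p + pc c q" "pc c (p * q) = pc c p * pc c q"
  by (intro pc_eqI; simp add: poly_pc)+

lemma pc_prod: "pc c (\<Prod>i\<in>S. f i) = (\<Prod>i\<in>S. pc c (f i))"
  by (induction S rule: infinite_finite_induct) simp_all

text \<open>At t = -i and t = 1 - i the values are c and c - 2, which are not both zero.\<close>

lemma pc_fq_nonzero: "pc c (fq i) \<noteq> 0"
proof
  assume "pc c (fq i) = 0"
  then have *: "evc a c (fq i) = 0" for a by (metis poly_0 poly_pc)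
  have "c = 0" using *[of "- of_int i"] by simp
  then show False using *[of "1 - of_int i"] by simp
qed

lemma pc_xk_nonzero: "pc c (xk k) \<noteq> 0"
  by (simp add: xk_def pc_prod pc_fq_nonzero)

lemma pt_simps [simp]: "pt 0 = 0" "pt 1 = 1" "pt (p + q) = pt p + pt q" "pt (p * q) = pt p * pt q" "pt [:c:] = sc c"
proof -
  show "pt 0 = 0" "pt (p + q) = pt p + pt q" "pt [:c:] = sc c" "pt 1 = 1"
    by (simp_all add: pt_def hev_add hev_const one_pCons)
  show "pt (p * q) = pt p * pt q" unfolding pt_def by (rule hev_mult) (simp, simp, simp, rule sc_central)
qed

lemma pm_emb: "pm (emb p) = pt p"
  by (induction p) (simp_all add: emb_def pt_def pm_def map_poly_pCons hev_pCons)

lemma emb_lead: "Polynomial.degree (emb p) = Polynomial.degree p" "Polynomial.lead_coeff (emb p) = [:Polynomial.lead_coeff p:]"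
  by (simp_all add: emb_def degree_map_poly coeff_map_poly)

lemma evc_emb [simp]: "evc a c (emb p) = poly p a"
  by (induction p) (simp_all add: emb_def evc_def map_poly_pCons)

lemma tideal_reduce:
  assumes I: "tideal I" and W: "gW - sc c \<in> I"
  shows "pm p - pt (pc c p) \<in> I"
proof -
  have w: "pw q - sc (poly q c) \<in> I" for q
  proof (induction q)
    case (pCons a q)
    have "pw (pCons a q) - sc (poly (pCons a q) c) = gW * (pw q - sc (poly q c)) + (gW - sc c) * sc (poly q c)"
      by (simp add: pw_def hev_pCons right_diff_distrib left_diff_distrib)
    then show ?case using tidealD[OF I] pCons.IH W by simp
  qed (simp add: tidealD(1)[OF I])
  show ?thesis
  proof (induction p)
    case (pCons a p)
    have "pm (pCons a p) - pt (pc c (pCons a p)) = (pw a - sc (poly a c)) + gT * (pm p - pt (pc c p))"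
      by (simp add: pm_pCons pc_def map_poly_pCons pt_def hev_pCons right_diff_distrib)
    then show ?case using tidealD[OF I] pCons.IH w by simp
  qed (simp add: tidealD(1)[OF I])
qed

lemma tideal_reduce_iff:
  assumes I: "tideal I" and W: "gW - sc c \<in> I"
  shows "u * pm p \<in> I \<longleftrightarrow> u * pt (pc c p) \<in> I"
proof -
  have d: "u * (pm p - pt (pc c p)) \<in> I" using tidealD(3)[OF I tideal_reduce[OF I W]] .
  have "u * pm p = u * (pm p - pt (pc c p)) + u * pt (pc c p)"
    "u * pt (pc c p) = u * pm p - u * (pm p - pt (pc c p))" by (simp_all add: right_diff_distrib)
  then show ?thesis using d tidealD(2,6)[OF I] by metis
qed

text \<open>This is (W - c)U: by \<open>cas_ideal_least\<close> it is the smallest ideal containing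
  W - c. Defining it by vanishing at w = c turns membership and primeness into questions about
  polynomials.\<close>

definition cas_ideal :: "complex \<Rightarrow> ut set" where "cas_ideal c = {u. \<forall>k. pc c (co u k) = 0}"

lemma cas_ideal_iff: "u \<in> cas_ideal c \<longleftrightarrow> (\<forall>a k. ma a c u k = 0)"
proof -
  have "pc c p = 0 \<longleftrightarrow> (\<forall>a. evc a c p = 0)" for p
    using pc_eqI[of c p 0] by (metis poly_0 poly_pc)
  then show ?thesis by (auto simp: cas_ideal_def ma_def)
qed

lemma ma_simps [simp]: "ma a c 0 k = 0" "ma a c (u + v) k = ma a c u k + ma a c v k"
  "ma a c (u - v) k = ma a c u k - ma a c v k" "ma a c (sc d) k = (if k = 0 then d else 0)"
  "ma a c gW k = (if k = 0 then c else 0)" "ma a c 1 k = (if k = 0 then 1 else 0)"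
  "ma a c (sc d * u) k = d * ma a c u k"
  using co_W[of 1 k] by (auto simp: ma_def co_sc co_1 co_scale)

lemma ma_mult_supp:
  "ma a c (u * v) k = (\<Sum>j | co v j \<noteq> 0. ma (a + of_int j) c u (k - j) * ma a c v j)"
  by (rule ma_mult[OF co_finite]) (simp add: ma_def)

lemma tideal_cas_ideal: "tideal (cas_ideal c)"
  unfolding tideal_def by (intro conjI ballI allI; simp add: cas_ideal_iff ma_mult_supp)

lemma W_cas_ideal: "gW - sc d \<in> cas_ideal c \<longleftrightarrow> c = d"
  by (auto simp: cas_ideal_iff)

lemma one_notin_cas: "1 \<notin> cas_ideal c"
  by (auto simp: cas_ideal_iff)

lemma co_E_power: "co (gE ^ m) k = (if k = int m then 1 else 0)"
  using co_wt_pm[of "int m" 1 k] by (simp add: wt_def xk_def)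

lemma E_notin_cas: "gE ^ m \<notin> cas_ideal c"
  by (auto simp: cas_ideal_def co_E_power)

text \<open>As x_k does not vanish identically at w = c, the polynomials p k of the normal form do,
  and modulo W - c only their specialization matters.\<close>

lemma cas_ideal_least:
  assumes I: "tideal I" and W: "gW - sc c \<in> I"
  shows "cas_ideal c \<subseteq> I"
proof
  fix u assume u: "u \<in> cas_ideal c"
  obtain p where "finite {k. co u k \<noteq> 0}" and p': "\<forall>k. co u k = xk k * p k" and "u = (\<Sum>k | co u k \<noteq> 0. wt k * pm (p k))"
    using co_normal_form[of u] by (elim exE conjE)
  note p = this(1) p'[rule_format] this(3)
  have "pc c (p k) = 0" for k
  proof -
    have "pc c (co u k) = 0" using u by (simp add: cas_ideal_def)
    then have "pc c (xk k) * pc c (p k) = 0" unfolding p(2) pc_simps(4) .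
    then show ?thesis using pc_xk_nonzero by simp
  qed
  then have "wt k * pm (p k) \<in> I" for k using tideal_reduce_iff[OF I W, of "wt k" "p k"] tidealD(1)[OF I] by simp
  then show "u \<in> I" by (subst p(3)) (rule tideal_sum[OF I])
qed

text \<open>Modulo W - c the coefficients become polynomials in T alone, so lowering the degree
  leaves a nonzero scalar beside the power of E.\<close>

lemma tideal_E_power:
  assumes I: "tideal I" and W: "gW - sc c \<in> I" and u: "u \<in> I" "u \<notin> cas_ideal c"
  shows "\<exists>m. gE ^ m \<in> I"
proof -
  obtain p where "finite {k. co u k \<noteq> 0}" and p': "\<forall>k. co u k = xk k * p k" and "u = (\<Sum>k | co u k \<noteq> 0. wt k * pm (p k))"
    using co_normal_form[of u] by (elim exE conjE)
  note p = this(1) p'[rule_format] this(3)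
  obtain k where k: "pc c (co u k) \<noteq> 0" using u(2) by (auto simp: cas_ideal_def)
  then have k0: "co u k \<noteq> 0" by auto
  have "wt k * pm (p k) \<in> I" using tideal_homogeneous[OF I p(1)] p(3) u(1) k0 by simp
  then obtain n g where g: "gE ^ n * pm (g * p k) \<in> I" "g = 1 \<or> (\<exists>m. g = (\<Prod>i<m. fq (- 1 - int i)))"
    using wt_to_E[OF I] by blast
  have "pc c g \<noteq> 0" using g(2) pc_fq_nonzero by (auto simp: pc_prod)
  moreover have "pc c (p k) \<noteq> 0" using k p(2)[of k] by auto
  ultimately have r: "pc c (g * p k) \<noteq> 0" by simp
  let ?r = "pc c (g * p k)"
  have "gE ^ n * pm (emb ?r) \<in> I"
    unfolding pm_emb by (rule tideal_reduce_iff[OF I W, THEN iffD1, OF g(1)])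
  from tideal_lower_degree[OF I this]
  have "gE ^ (n + Polynomial.degree ?r) * sc (Polynomial.lead_coeff ?r) \<in> I"
    unfolding emb_lead(2) unfolding emb_lead(1) pw_simps(5) .
  then have "sc (Polynomial.lead_coeff ?r) * gE ^ (n + Polynomial.degree ?r) \<in> I" by (metis sc_central)
  then show ?thesis using tideal_unscale[OF I] r by (metis leading_coeff_0_iff)
qed

lemma cc_of_nat: "cc (of_nat n) = of_nat n"
  by (induction n) simp_all

text \<open>On the highest weight vector of the irreducible module of dimension m + 1, T = m/2 and
  FE = 0, hence W = T^2 + T = m(m + 2)/4.\<close>

definition cn :: "nat \<Rightarrow> complex" where "cn m = of_nat (m * (m + 2)) / 4"

lemma cn_inj: "cn m = cn n \<Longrightarrow> m = n"
proof -
  assume "cn m = cn n"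
  then have "complex_of_nat (m * (m + 2)) = of_nat (n * (n + 2))"
    unfolding cn_def by (simp del: of_nat_mult of_nat_add)
  then have "m * (m + 2) = n * (n + 2)" by (rule of_nat_eq_iff[THEN iffD1])
  moreover have "m * (m + 2) < n * (n + 2)" if "m < n" for m n :: nat using that by (intro mult_strict_mono) auto
  ultimately show "m = n" by (metis linorder_neqE_nat nat_neq_iff)
qed

text \<open>Both F E^(m+1) = E^m f(m) and E^(m+1) F = E^m f(-1) lie in I. Here f(-1) - f(m) = (m +
  1)(2T + m), and the remainder of f(-1) on division by 2T + m is W - m(m + 2)/4.\<close>

lemma E_lowering:
  assumes I: "tideal I" and E: "gE ^ Suc m \<in> I"
  shows "gE ^ m * (gW - sc (cn m)) \<in> I"
proof -
  have "gF * gE ^ Suc m = pm (fq 0) * gE ^ m" by (simp add: FE_pm[symmetric] mult.assoc)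
  also have "\<dots> = gE ^ m * pm (fq (int m))" by (simp add: pm_E_power)
  finally have 1: "gF * gE ^ Suc m = gE ^ m * pm (fq (int m))" .
  have 2: "gE ^ Suc m * gF = gE ^ m * pm (fq (- 1))" by (simp only: power_Suc2 mult.assoc EF_pm)
  have i: "gE ^ m * pm (fq (int m)) \<in> I" "gE ^ m * pm (fq (- 1)) \<in> I"
    using tidealD(3,4)[OF I E] 1 2 by metis+
  \<comment> \<open>\<open>?x\<close> cancels the factor m + 1, and \<open>?y\<close> is minus the
    quotient of f(-1) by 2t + m.\<close>
  let ?x = "cc (1 / (of_nat m + 1))" let ?y = "tt * cc (1/2) - cc ((of_nat m + 2) / 4)"
  have ne: "of_nat m + 1 \<noteq> (0 :: complex)" by (metis of_nat_Suc of_nat_neq_0 add.commute)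
  have key: "ww - cc (cn m) = fq (- 1) + (fq (- 1) - fq (int m)) * ?x * ?y"
  proof -
    have "fq (- 1) - fq (int m) = cc (of_nat m + 1) * (cc 2 * tt + cc (of_nat m))"
      by (simp add: fq_def cc_of_nat algebra_simps)
    then have "(fq (- 1) - fq (int m)) * ?x = (cc (of_nat m + 1) * ?x) * (cc 2 * tt + cc (of_nat m))"
      by (simp only: ac_simps)
    also have "cc (of_nat m + 1) * ?x = 1" using ne by (simp only: cc_simps(4)[symmetric]) simp
    finally have "(fq (- 1) - fq (int m)) * ?x * ?y = (cc 2 * tt + cc (of_nat m)) * ?y" by simp
    also have "\<dots> = tt * tt * cc (2 * (1/2)) + tt * cc (of_nat m * (1/2) - 2 * ((of_nat m + 2) / 4)) - cc (of_nat m * ((of_nat m + 2) / 4))"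
      by (simp only: cc_simps) (simp add: algebra_simps)
    also have "\<dots> = tt * tt - tt - cc (cn m)"
    proof -
      have "of_nat m * (1/2) - 2 * ((of_nat m + 2) / 4) = (- 1 :: complex)" "2 * (1/2) = (1::complex)"
        "of_nat m * ((of_nat m + 2) / 4) = cn m" by (simp_all add: field_simps cn_def)
      then show ?thesis by simp
    qed
    finally show ?thesis by (simp add: fq_def algebra_simps)
  qed
  have "gE ^ m * pm (fq (- 1) + (fq (- 1) - fq (int m)) * ?x * ?y)
      = gE ^ m * pm (fq (- 1)) + (gE ^ m * pm (fq (- 1)) - gE ^ m * pm (fq (int m))) * pm ?x * pm ?y"
    by (simp only: pm_simps pm_minus distrib_left left_diff_distrib right_diff_distrib mult.assoc)
  also have "\<dots> \<in> I" using i tidealD(2,4,6)[OF I] by simp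
  finally show ?thesis unfolding key[symmetric] by simp
qed

text \<open>P contains some E^m q(W), and q(W) is central, so one of the factors is in P. A power of
  E is reduced by \<open>E_lowering\<close> until some W - c appears, since 1 is not in P; q(W)
  splits into central linear factors over C.\<close>

lemma tprime_contains_casimir:
  assumes P: "tprime P" and u: "u \<in> P" "u \<noteq> 0"
  shows "\<exists>c. gW - sc c \<in> P"
proof -
  have I: "tideal P" "1 \<notin> P" using P by (auto simp: tprime_def)
  have Wc: "(gW - sc c) * x = x * (gW - sc c)" for x c
    by (simp add: left_diff_distrib right_diff_distrib gW_central sc_central)
  obtain m q where q: "q \<noteq> 0" "gE ^ m * pw q \<in> P" using tideal_nonzero[OF I(1) u] by blast
  have E: "\<exists>c. gW - sc c \<in> P" if "gE ^ m \<in> P" for m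
    using that
  proof (induction m)
    case (Suc m)
    then show ?case using tprime_central[OF P Wc E_lowering[OF I(1) Suc.prems]] by blast
  qed (use I in simp)
  have Q: "\<exists>c. gW - sc c \<in> P" if "pw q \<in> P" "q \<noteq> 0" for q
    using that
  proof (induction "Polynomial.degree q" arbitrary: q)
    case 0
    then obtain a where a: "q = [:a:]" "a \<noteq> 0" by (metis degree_eq_zeroE pCons_0_0)
    then have "sc a * 1 \<in> P" using 0 by simp
    then have "1 \<in> P" using tideal_unscale[OF I(1) a(2)] by blast
    then show ?case using I by simp
  next
    case (Suc d)
    then have "\<not> constant (poly q)" by (simp add: constant_degree)
    then obtain z where "poly q z = 0" using fundamental_theorem_of_algebra by blast
    then obtain r where r: "q = [:- z, 1:] * r" by (metis poly_eq_0_iff_dvd dvdE)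
    have r0: "r \<noteq> 0" using r Suc.prems by auto
    have "Polynomial.degree q = Suc (Polynomial.degree r)" unfolding r using r0 by (subst degree_mult_eq) auto
    then have d: "d = Polynomial.degree r" using Suc.hyps(2) by simp
    have "pw [:- z, 1:] = gW - sc z" by (simp add: pw_def hev_pCons)
    then have "pw q = (gW - sc z) * pw r" unfolding r pw_simps(4) by simp
    then have "pw r * (gW - sc z) \<in> P" using Suc.prems Wc by simp
    then have "gW - sc z \<in> P \<or> pw r \<in> P" using tprime_central[OF P Wc] by blast
    then show ?case using Suc.hyps(1)[OF d] r0 by blast
  qed
  have "pw q \<in> P \<or> gE ^ m \<in> P" using tprime_central[OF P pw_central q(2)] .
  then show ?thesis using E Q q(1) by blast
qed

text \<open>If n + 1 is the least exponent of a power of E in I, then \<open>E_lowering\<close> and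
  W - c put (c - c_n) E^n into I, which forces c = c_n.\<close>

lemma ideal_over_cas:
  assumes I: "tideal I" "1 \<notin> I" and W: "gW - sc c \<in> I" and E: "gE ^ m \<in> I"
  shows "\<exists>n. c = cn n \<and> gE ^ Suc n \<in> I \<and> gE ^ n \<notin> I"
proof -
  define M where "M = (LEAST m. gE ^ m \<in> I)"
  have M: "gE ^ M \<in> I" unfolding M_def using E by (rule LeastI)
  obtain n where n: "M = Suc n" using M I by (cases M) auto
  have nn: "gE ^ n \<notin> I" using not_less_Least[of n "\<lambda>m. gE ^ m \<in> I"] n by (simp add: M_def)
  have "gE ^ n * (gW - sc (cn n)) - gE ^ n * (gW - sc c) \<in> I"
    using E_lowering[OF I(1), of n] M n tidealD(3)[OF I(1) W] tidealD(6)[OF I(1)] by metis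
  moreover have "gE ^ n * (gW - sc (cn n)) - gE ^ n * (gW - sc c) = sc (c - cn n) * gE ^ n"
    by (simp add: right_diff_distrib left_diff_distrib sc_central)
  ultimately have "c = cn n" using tideal_unscale[OF I(1), of "c - cn n" "gE ^ n"] nn by fastforce
  then show ?thesis using M n nn by auto
qed

text \<open>The highest indices K and K' at which u and v survive w = c contribute a single term at
  K + K': a shifted nonzero polynomial times a nonzero polynomial.\<close>

lemma cas_ideal_completely_prime:
  assumes "u * v \<in> cas_ideal c" shows "u \<in> cas_ideal c \<or> v \<in> cas_ideal c"
proof (rule ccontr)
  assume no: "\<not> (u \<in> cas_ideal c \<or> v \<in> cas_ideal c)"
  have top: "\<exists>K. pc c (co w K) \<noteq> 0 \<and> (\<forall>k>K. pc c (co w k) = 0)" if "w \<notin> cas_ideal c" for w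
  proof -
    let ?T = "{k. pc c (co w k) \<noteq> 0}"
    have T: "finite ?T" by (rule finite_subset[OF _ co_finite[of w]]) auto
    have T0: "?T \<noteq> {}" using that by (auto simp: cas_ideal_def)
    define M where "M = Max ?T"
    have "M \<in> ?T" unfolding M_def by (rule Max_in[OF T T0])
    moreover have "k \<notin> ?T" if "k > M" for k using Max_ge[OF T, of k] that unfolding M_def by (rule_tac notI) simp
    ultimately show ?thesis by blast
  qed
  obtain K where K: "pc c (co u K) \<noteq> 0" "\<And>k. k > K \<Longrightarrow> pc c (co u k) = 0" using top no by blast
  obtain K' where K': "pc c (co v K') \<noteq> 0" "\<And>k. k > K' \<Longrightarrow> pc c (co v k) = 0" using top no by blast
  have "pcompose (pc c (co u K)) [:of_int K', 1:] \<noteq> 0"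
  proof
    assume "pcompose (pc c (co u K)) [:of_int K', 1:] = 0"
    then have "poly (pcompose (pc c (co u K)) [:of_int K', 1:]) (x - of_int K') = 0" for x by simp
    then have "poly (pc c (co u K)) x = 0" for x by (simp add: poly_pcompose)
    then show False using K(1) poly_all_0_iff_0 by blast
  qed
  then have "pcompose (pc c (co u K)) [:of_int K', 1:] * pc c (co v K') \<noteq> 0" using K'(1) by simp
  then obtain a where a: "poly (pcompose (pc c (co u K)) [:of_int K', 1:] * pc c (co v K')) a \<noteq> 0"
    using poly_all_0_iff_0 by blast
  have "ma a c (u * v) (K + K') = (\<Sum>j\<in>{K'}. ma (a + of_int j) c u (K + K' - j) * ma a c v j)"
  proof (rule ma_mult)
    fix j assume "j \<notin> {K'}"
    then have "j > K' \<or> K + K' - j > K" by auto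
    then show "ma a c v j = 0 \<or> ma (a + of_int j) c u (K + K' - j) = 0"
      using K(2) K'(2) by (metis ma_def poly_0 poly_pc)
  qed simp
  moreover have "ma a c (u * v) (K + K') = 0" using assms by (simp add: cas_ideal_iff)
  ultimately show False using a by (simp add: ma_def poly_pc poly_pcompose add.commute)
qed

lemma tprime_cas_ideal: "tprime (cas_ideal c)"
  unfolding tprime_def
proof (intro conjI allI impI tideal_cas_ideal one_notin_cas)
  fix a b assume "\<forall>x. a * x * b \<in> cas_ideal c"
  then have "a * 1 * b \<in> cas_ideal c" by blast
  then show "a \<in> cas_ideal c \<or> b \<in> cas_ideal c" using cas_ideal_completely_prime by simp
qed

lemma pw_cas_ideal: "pw q \<in> cas_ideal c \<longleftrightarrow> poly q c = 0"
proof -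
  have "co (pw q) k = (if k = 0 then [:q:] else 0)" for k
    using co_wt_pm[of 0 "[:q:]" k] by (simp add: wt_def xk_def)
  then have "ma a c (pw q) k = (if k = 0 then poly q c else 0)" for a k by (simp add: ma_def evc_def)
  then show ?thesis by (auto simp: cas_ideal_iff)
qed

lemma pw_eq_0_iff: "pw q = 0 \<longleftrightarrow> q = 0"
proof
  assume "pw q = 0"
  then have "poly q c = 0" for c using pw_cas_ideal[of q c] tidealD(1)[OF tideal_cas_ideal] by simp
  then show "q = 0" using poly_all_0_iff_0 by blast
qed simp

section \<open>Finite-dimensional quotients\<close>

text \<open>Gaussian elimination: a pivot at (l, b) clears the coordinate b from the other vectors,
  and both counts drop by one.\<close>

lemma linear_dependence:
  fixes \<alpha> :: "'i \<Rightarrow> 'b \<Rightarrow> complex"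
  assumes "finite B" "finite I" "card B < card I"
  shows "\<exists>a. (\<exists>i\<in>I. a i \<noteq> 0) \<and> (\<forall>b\<in>B. (\<Sum>i\<in>I. a i * \<alpha> i b) = 0)"
  using assms
proof (induction B arbitrary: I \<alpha> rule: finite_induct)
  case empty
  then have "I \<noteq> {}" by auto
  then show ?case by (intro exI[of _ "\<lambda>_. 1"]) auto
next
  case (insert b B)
  show ?case
  proof (cases "\<forall>i\<in>I. \<alpha> i b = 0")
    case True
    have "card B < card I" using insert by simp
    then obtain a where "\<exists>i\<in>I. a i \<noteq> 0" "\<forall>b\<in>B. (\<Sum>i\<in>I. a i * \<alpha> i b) = 0" using insert.IH[of I \<alpha>] insert.prems by blast
    then show ?thesis using True by (intro exI[of _ a]) auto
  next
    case False
    then obtain l where l: "l \<in> I" "\<alpha> l b \<noteq> 0" by blast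
    define \<beta> where "\<beta> i b' = \<alpha> i b' - \<alpha> i b / \<alpha> l b * \<alpha> l b'" for i b'
    have "card B < card (I - {l})" using insert l by simp
    then obtain a where a: "\<exists>i\<in>I - {l}. a i \<noteq> 0" "\<forall>b\<in>B. (\<Sum>i\<in>I - {l}. a i * \<beta> i b) = 0"
      using insert.IH[of "I - {l}" \<beta>] insert.prems by blast
    define a' where "a' i = (if i = l then - (\<Sum>i\<in>I - {l}. a i * \<alpha> i b / \<alpha> l b) else a i)" for i
    have s: "(\<Sum>i\<in>I. a' i * \<alpha> i b') = (\<Sum>i\<in>I - {l}. a i * \<beta> i b')" for b'
    proof -
      have "(\<Sum>i\<in>I. a' i * \<alpha> i b') = a' l * \<alpha> l b' + (\<Sum>i\<in>I - {l}. a' i * \<alpha> i b')"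
        using insert.prems l by (intro sum.remove) auto
      also have "(\<Sum>i\<in>I - {l}. a' i * \<alpha> i b') = (\<Sum>i\<in>I - {l}. a i * \<alpha> i b')" by (intro sum.cong) (auto simp: a'_def)
      finally show ?thesis by (simp add: a'_def \<beta>_def sum_distrib_right sum_subtractf right_diff_distrib mult.assoc)
    qed
    have "\<beta> i b = 0" for i using l by (simp add: \<beta>_def)
    then have "\<forall>b'\<in>insert b B. (\<Sum>i\<in>I. a' i * \<alpha> i b') = 0" using a(2) by (simp add: s)
    moreover have "\<exists>i\<in>I. a' i \<noteq> 0" using a(1) by (auto simp: a'_def)
    ultimately show ?thesis by blast
  qed
qed

text \<open>Row i and column j of u in a module where index j has T-eigenvalue j - n/2. The indices
  0, ..., n form the irreducible module of dimension n + 1 as a subquotient, because the action of F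
  vanishes on the steps from 0 to -1 and from n + 1 to n.\<close>

definition mn :: "nat \<Rightarrow> ut \<Rightarrow> int \<Rightarrow> int \<Rightarrow> complex" where
  "mn n u i j = ma (of_int j - of_nat n / 2) (cn n) u (i - j)"

lemma cn_factor: "cn n - (of_int z - of_nat n / 2) * (of_int z - of_nat n / 2 + 1) = of_int ((int n - z) * (z + 1))"
proof -
  define h :: complex where "h = of_nat n / 2"
  have n: "of_nat n = 2 * h" by (simp add: h_def)
  have c: "cn n = h * (h + 1)" by (simp add: cn_def n algebra_simps)
  show ?thesis unfolding c h_def[symmetric] by (simp add: n algebra_simps)
qed

lemma evc_xk: "evc (of_int j - of_nat n / 2) (cn n) (xk (i - j)) = (\<Prod>l<nat (j - i). of_int ((int n - (i + int l)) * (i + int l + 1)))"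
proof -
  have "evc (of_int j - of_nat n / 2) (cn n) (fq (i - j + int l)) = of_int ((int n - (i + int l)) * (i + int l + 1))" for l
    using cn_factor[of n "i + int l"] by (simp add: algebra_simps)
  then show ?thesis by (simp add: xk_def evc_prod)
qed

text \<open>The indices at least 0 span a submodule, and so do those above n: a descent from j to i
  must pass the step to -1 or the step to n, where a factor of x_(i-j) is zero.\<close>

lemma mn_vanish:
  assumes "i < 0 \<and> 0 \<le> j \<or> i \<le> int n \<and> int n < j" shows "mn n u i j = 0"
proof -
  obtain p where p: "\<forall>k. co u k = xk k * p k" using co_normal_form[of u] by (elim exE conjE)
  obtain l where l: "l < nat (j - i)" "i + int l = - 1 \<or> i + int l = int n"
  proof (cases "i < 0 \<and> 0 \<le> j")
    case True
    then show ?thesis by (intro that[of "nat (- 1 - i)"]) simp_all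
  next
    case False
    then have "i \<le> int n" "int n < j" using assms by linarith+
    then show ?thesis by (intro that[of "nat (int n - i)"]) simp_all
  qed
  have "(int n - (i + int l)) * (i + int l + 1) = 0" using l(2) by (elim disjE) simp_all
  then have "of_int ((int n - (i + int l)) * (i + int l + 1)) = (0::complex)" by (simp only: of_int_0)
  then have "evc (of_int j - of_nat n / 2) (cn n) (xk (i - j)) = 0"
    unfolding evc_xk using l(1) by (intro prod_zero bexI[of _ l]) simp_all
  then show ?thesis using p by (simp add: mn_def ma_def)
qed

lemma mn_mult:
  assumes "i \<le> int n" "0 \<le> k"
  shows "mn n (u * v) i k = (\<Sum>j\<in>{0..int n}. mn n u i j * mn n v j k)"
proof -
  let ?a = "of_int k - of_nat n / 2 :: complex"
  have "mn n (u * v) i k = (\<Sum>j\<in>(\<lambda>j. j - k) ` {0..int n}. ma (?a + of_int j) (cn n) u (i - k - j) * ma ?a (cn n) v j)"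
    unfolding mn_def
  proof (rule ma_mult)
    fix j assume "j \<notin> (\<lambda>j. j - k) ` {0..int n}"
    then have "j + k \<notin> {0..int n}" by (metis add_diff_cancel_right' image_eqI)
    then have "j + k < 0 \<or> j + k > int n" unfolding atLeastAtMost_iff by linarith
    then have "mn n v (j + k) k = 0 \<or> mn n u i (j + k) = 0"
    proof
      assume "j + k < 0"
      then have "mn n v (j + k) k = 0" using assms(2) by (intro mn_vanish) simp
      then show ?thesis by simp
    next
      assume "j + k > int n"
      then have "mn n u i (j + k) = 0" using assms(1) by (intro mn_vanish) simp
      then show ?thesis by simp
    qed
    then show "ma ?a (cn n) v j = 0 \<or> ma (?a + of_int j) (cn n) u (i - k - j) = 0"
      by (simp add: mn_def algebra_simps)
  qed simp
  also have "\<dots> = (\<Sum>j\<in>{0..int n}. mn n u i j * mn n v j k)"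
    by (subst sum.reindex) (auto simp: inj_on_def mn_def algebra_simps)
  finally show ?thesis .
qed

lemma mn_simps [simp]: "mn n 0 i j = 0" "mn n (u + v) i j = mn n u i j + mn n v i j" "mn n (u - v) i j = mn n u i j - mn n v i j"
  "mn n (sc d * u) i j = d * mn n u i j" "mn n (sc d) i j = (if i = j then d else 0)" "mn n 1 i j = (if i = j then 1 else 0)"
  by (simp_all add: mn_def)

lemma mn_sum: "mn n (\<Sum>x\<in>A. f x) i j = (\<Sum>x\<in>A. mn n (f x) i j)"
  by (induction A rule: infinite_finite_induct) simp_all

lemma mn_wt_pm: "mn n (wt k * pm p) i j = (if i - j = k then evc (of_int j - of_nat n / 2) (cn n) (xk k * p) else 0)"
  by (simp add: mn_def ma_def co_wt_pm)

lemma mn_E_power: "mn n (gE ^ m) i j = (if i - j = int m then 1 else 0)"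
  by (simp add: mn_def ma_def co_E_power)

definition fin_ideal :: "nat \<Rightarrow> ut set" where
  "fin_ideal n = {u. \<forall>i\<in>{0..int n}. \<forall>j\<in>{0..int n}. mn n u i j = 0}"

lemma tideal_fin_ideal: "tideal (fin_ideal n)"
  unfolding tideal_def fin_ideal_def by (auto simp: mn_mult)

lemma one_notin_fin: "1 \<notin> fin_ideal n"
  by (auto simp: fin_ideal_def intro!: bexI[of _ 0])

lemma W_fin_ideal: "gW - sc (cn n) \<in> fin_ideal n"
  by (auto simp: fin_ideal_def mn_def)

lemma E_fin_ideal: "gE ^ m \<in> fin_ideal n \<longleftrightarrow> n < m"
proof
  assume "gE ^ m \<in> fin_ideal n"
  then have "mn n (gE ^ m) (int m) 0 = 0" if "\<not> n < m" using that by (auto simp: fin_ideal_def)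
  moreover have "mn n (gE ^ m) (int m) 0 = 1" by (simp add: mn_E_power)
  ultimately show "n < m" by fastforce
qed (auto simp: fin_ideal_def mn_E_power)

text \<open>The linear polynomial whose root is the T-eigenvalue of index b.\<close>

definition lf :: "nat \<Rightarrow> int \<Rightarrow> complex poly" where "lf n b = [:of_nat n / 2 - of_int b, 1:]"

lemma poly_lf: "poly (lf n b) (of_int j - of_nat n / 2) = of_int (j - b)"
  by (simp add: lf_def)

text \<open>Up to a nonzero scalar the matrix unit at (r, s): the polynomial in T kills every column
  except s, and \<open>wt (r - s)\<close> moves s to r.\<close>

definition mu :: "nat \<Rightarrow> int \<Rightarrow> int \<Rightarrow> ut" where
  "mu n r s = wt (r - s) * pm (emb (\<Prod>b\<in>{0..int n} - {s}. lf n b))"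

lemma mn_mu:
  assumes "r \<in> {0..int n}" "s \<in> {0..int n}"
  shows "\<exists>v. v \<noteq> 0 \<and> (\<forall>i\<in>{0..int n}. \<forall>j\<in>{0..int n}. mn n (mu n r s) i j = (if i = r \<and> j = s then v else 0))"
proof -
  let ?p = "\<Prod>b\<in>{0..int n} - {s}. lf n b"
  define v where "v = evc (of_int s - of_nat n / 2) (cn n) (xk (r - s)) * poly ?p (of_int s - of_nat n / 2)"
  have "(int n - (r + int l)) * (r + int l + 1) \<noteq> 0" if "l < nat (s - r)" for l using that assms by auto
  then have "(\<Prod>l<nat (s - r). of_int ((int n - (r + int l)) * (r + int l + 1)) :: complex) \<noteq> 0"
    by (simp only: prod_zero_iff finite_lessThan of_int_eq_0_iff lessThan_iff) blast
  moreover have "poly ?p (of_int s - of_nat n / 2) \<noteq> 0" by (simp add: poly_prod poly_lf)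
  ultimately have "v \<noteq> 0" by (simp add: v_def evc_xk)
  moreover have "mn n (mu n r s) i j = (if i = r \<and> j = s then v else 0)" if "i \<in> {0..int n}" "j \<in> {0..int n}" for i j
  proof (cases "j = s")
    case True
    then show ?thesis by (simp add: mu_def mn_wt_pm v_def)
  next
    case False
    then have "poly ?p (of_int j - of_nat n / 2) = 0" using that(2) by (auto simp: poly_prod poly_lf)
    then show ?thesis using False by (simp add: mu_def mn_wt_pm)
  qed
  ultimately show ?thesis by blast
qed

lemma mn_mult3:
  assumes r: "r \<in> {0..int n}" and s: "s \<in> {0..int n}" and a: "a \<in> {0..int n}" and b: "b \<in> {0..int n}"
  shows "\<exists>v. v \<noteq> 0 \<and> (\<forall>i\<in>{0..int n}. \<forall>j\<in>{0..int n}. mn n (mu n r a * u * mu n b s) i j = (if i = r \<and> j = s then v * mn n u a b else 0))"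
proof -
  obtain v where v: "v \<noteq> 0" "\<forall>i\<in>{0..int n}. \<forall>j\<in>{0..int n}. mn n (mu n r a) i j = (if i = r \<and> j = a then v else 0)"
    using mn_mu[OF r a] by blast
  obtain w where w: "w \<noteq> 0" "\<forall>i\<in>{0..int n}. \<forall>j\<in>{0..int n}. mn n (mu n b s) i j = (if i = b \<and> j = s then w else 0)"
    using mn_mu[OF b s] by blast
  have "mn n (mu n r a * u * mu n b s) i j = (if i = r \<and> j = s then v * w * mn n u a b else 0)"
    if i: "i \<in> {0..int n}" and j: "j \<in> {0..int n}" for i j
  proof -
    have 1: "mn n (mu n r a * u) i k = (if i = r then v * mn n u a k else 0)" if k: "k \<in> {0..int n}" for k
    proof -
      have "mn n (mu n r a * u) i k = (\<Sum>l\<in>{0..int n}. if l = a then (if i = r then v * mn n u a k else 0) else 0)"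
        using i k v(2) by (subst mn_mult) (auto intro!: sum.cong simp del: sum.delta sum.delta')
      then show ?thesis using a by simp
    qed
    have "mn n (mu n r a * u * mu n b s) i j = (\<Sum>k\<in>{0..int n}. mn n (mu n r a * u) i k * mn n (mu n b s) k j)"
      using i j by (intro mn_mult) auto
    also have "\<dots> = (\<Sum>k\<in>{0..int n}. if k = b then (if i = r \<and> j = s then v * w * mn n u a b else 0) else 0)"
      using 1 w(2) j by (intro sum.cong refl) auto
    also have "\<dots> = (if i = r \<and> j = s then v * w * mn n u a b else 0)" using b by simp
    finally show ?thesis .
  qed
  then show ?thesis using v(1) w(1) by (intro exI[of _ "v * w"]) simp
qed

text \<open>U acts by all matrices of size n + 1, and these form a simple algebra: matrix units on
  both sides of u carry a nonzero entry to each diagonal place, and the sum of the results is 1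
  modulo \<open>fin_ideal n\<close>.\<close>

lemma fin_ideal_maximal:
  assumes I: "tideal I" "fin_ideal n \<subseteq> I" and u: "u \<in> I" "u \<notin> fin_ideal n"
  shows "1 \<in> I"
proof -
  obtain a b where ab: "a \<in> {0..int n}" "b \<in> {0..int n}" "mn n u a b \<noteq> 0" using u(2) by (auto simp: fin_ideal_def)
  have "\<forall>s\<in>{0..int n}. \<exists>y\<in>I. \<forall>i\<in>{0..int n}. \<forall>j\<in>{0..int n}. mn n y i j = (if i = s \<and> j = s then 1 else 0)"
  proof
    fix s assume s: "s \<in> {0..int n}"
    obtain v where v: "v \<noteq> 0" "\<forall>i\<in>{0..int n}. \<forall>j\<in>{0..int n}. mn n (mu n s a * u * mu n b s) i j = (if i = s \<and> j = s then v * mn n u a b else 0)"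
      using mn_mult3[OF s s ab(1,2)] by blast
    let ?y = "sc (1 / (v * mn n u a b)) * (mu n s a * u * mu n b s)"
    have "?y \<in> I" by (intro tidealD(3,4)[OF I(1)] u(1))
    moreover have "\<forall>i\<in>{0..int n}. \<forall>j\<in>{0..int n}. mn n ?y i j = (if i = s \<and> j = s then 1 else 0)"
      using v ab(3) by simp
    ultimately show "\<exists>y\<in>I. \<forall>i\<in>{0..int n}. \<forall>j\<in>{0..int n}. mn n y i j = (if i = s \<and> j = s then 1 else 0)" by blast
  qed
  then obtain y where y: "\<And>s. s \<in> {0..int n} \<Longrightarrow> y s \<in> I"
    "\<And>s i j. s \<in> {0..int n} \<Longrightarrow> i \<in> {0..int n} \<Longrightarrow> j \<in> {0..int n} \<Longrightarrow> mn n (y s) i j = (if i = s \<and> j = s then 1 else 0)"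
    by (metis (no_types, lifting))
  let ?s = "\<Sum>s\<in>{0..int n}. y s"
  have "mn n (1 - ?s) i j = 0" if "i \<in> {0..int n}" "j \<in> {0..int n}" for i j
  proof -
    have "(\<Sum>s\<in>{0..int n}. mn n (y s) i j) = (\<Sum>s\<in>{0..int n}. if s = i then (if i = j then 1 else 0) else 0)"
      using that y(2) by (intro sum.cong refl) auto
    then show ?thesis using that by (simp add: mn_sum)
  qed
  then have "1 - ?s \<in> I" using I(2) by (auto simp: fin_ideal_def)
  moreover have "?s \<in> I" using y(1) by (rule tideal_sum[OF I(1)])
  ultimately have "(1 - ?s) + ?s \<in> I" by (rule tidealD(2)[OF I(1)])
  then show ?thesis by simp
qed

text \<open>The powers of u with exponents 0, ..., (n + 1)^2 outnumber the matrix entries.\<close>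

lemma fin_ideal_algebraic:
  "\<exists>I :: nat set. \<exists>a. finite I \<and> (\<exists>i\<in>I. a i \<noteq> 0) \<and> (\<Sum>i\<in>I. sc (a i) * u ^ i) \<in> fin_ideal n"
proof -
  let ?B = "{0..int n} \<times> {0..int n}"
  obtain a where a: "\<exists>i\<in>{..card ?B}. a i \<noteq> 0" "\<forall>b\<in>?B. (\<Sum>i\<in>{..card ?B}. a i * mn n (u ^ i) (fst b) (snd b)) = 0"
    using linear_dependence[of ?B "{..card ?B}" "\<lambda>i b. mn n (u ^ i) (fst b) (snd b)"] by auto
  have "(\<Sum>i\<in>{..card ?B}. sc (a i) * u ^ i) \<in> fin_ideal n" using a(2) by (auto simp: fin_ideal_def mn_sum)
  then show ?thesis using a(1) by blast
qed

section \<open>The ideal generated by W - c_n and E^(n+1)\<close>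

lemma lf_coprime: "b \<noteq> b' \<Longrightarrow> coprime (lf n b) (lf n b')"
proof (rule coprimeI)
  fix d assume b: "b \<noteq> b'" and d: "d dvd lf n b" "d dvd lf n b'"
  have "d dvd lf n b - lf n b'" using d by (rule dvd_diff)
  also have "lf n b - lf n b' = [:of_int (b' - b):]" by (simp add: lf_def)
  also have "\<dots> dvd 1" using b unfolding is_unit_const_poly_iff by (simp add: dvd_field_iff)
  finally show "is_unit d" .
qed

lemma lf_prod_coprime:
  assumes "S \<inter> T = {}" shows "coprime (\<Prod>b\<in>S. lf n b) (\<Prod>b\<in>T. lf n b)"
  using assms by (intro prod_coprime_left prod_coprime_right lf_coprime) auto

lemma lf_prod_dvd:
  assumes "finite S" "\<And>b. b \<in> S \<Longrightarrow> poly r (of_int b - of_nat n / 2) = 0"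
  shows "(\<Prod>b\<in>S. lf n b) dvd r"
  using assms
proof (induction S rule: finite_induct)
  case (insert b S)
  have b: "lf n b = [:- (of_int b - of_nat n / 2), 1:]" by (simp add: lf_def)
  have "lf n b dvd r" unfolding b by (rule poly_eq_0_iff_dvd[THEN iffD1]) (simp add: insert.prems)
  moreover have "coprime (lf n b) (\<Prod>b\<in>S. lf n b)" using insert.hyps by (intro prod_coprime_right lf_coprime) auto
  ultimately show ?case using insert by (simp add: divides_mult)
qed simp

text \<open>By Bezout, an ideal of C[t] containing two products of distinct linear factors contains
  the product over their common roots.\<close>

lemma ideal_common_roots:
  assumes add: "\<And>p q. p \<in> N \<Longrightarrow> q \<in> N \<Longrightarrow> p + q \<in> N" and mult: "\<And>p r. p \<in> N \<Longrightarrow> r * p \<in> N"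
    and fin: "finite S" "finite T" and S: "(\<Prod>b\<in>S. lf n b) \<in> N" and T: "(\<Prod>b\<in>T. lf n b) \<in> N"
  shows "(\<Prod>b\<in>S \<inter> T. lf n b) \<in> N"
proof -
  let ?p = "\<Prod>b\<in>S - T. lf n b" let ?q = "\<Prod>b\<in>T - S. lf n b" let ?g = "\<Prod>b\<in>S \<inter> T. lf n b"
  have "coprime ?p ?q" by (rule lf_prod_coprime) auto
  then have g1: "gcd ?p ?q = 1" by simp
  obtain x y where xy: "x * ?p + y * ?q = 1"
    using bezout_coefficients_fst_snd[of ?p ?q] unfolding g1 by blast
  have "(\<Prod>b\<in>S. lf n b) = ?g * ?p" using fin(1) by (rule prod.Int_Diff)
  moreover have "(\<Prod>b\<in>T. lf n b) = ?g * ?q" using prod.Int_Diff[OF fin(2), of "lf n" S] by (simp add: Int_commute)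
  ultimately have "x * (?g * ?p) + y * (?g * ?q) \<in> N" using S T add mult by simp
  moreover have "x * (?g * ?p) + y * (?g * ?q) = ?g * (x * ?p + y * ?q)" by (simp add: algebra_simps)
  ultimately show ?thesis unfolding xy by simp
qed

lemma pc_fq_factor: "pc (cn n) (fq i) = - (lf n (int n - i) * lf n (- 1 - i))"
proof (rule pc_eqI)
  fix a
  define h :: complex where "h = of_nat n / 2"
  have n: "of_nat n = 2 * h" by (simp add: h_def)
  have c: "cn n = h * (h + 1)" by (simp add: cn_def n algebra_simps)
  show "evc a (cn n) (fq i) = poly (- (lf n (int n - i) * lf n (- 1 - i))) a"
    unfolding c lf_def h_def[symmetric] by (simp add: n algebra_simps)
qed

text \<open>For each weight k, the r(t) with \<open>wt k * pt r\<close> in I form an ideal N k of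
  C[t]. Two elements of N 0, from F^(n+1) E^(n+1) and E^(n+1) F^(n+1), have the indices 0, ..., n as
  common roots, so the product G over these is in N 0. Multiplication by \<open>wt k\<close> on
  either side puts G and its shift by k into N k. This leaves as roots the b with b and b + k both
  in 0, ..., n, and there the coefficients of an element of \<open>fin_ideal n\<close>
  vanish.\<close>

lemma fin_ideal_least:
  assumes I: "tideal I" and W: "gW - sc (cn n) \<in> I" and E: "gE ^ Suc n \<in> I"
  shows "fin_ideal n \<subseteq> I"
proof
  fix u assume u: "u \<in> fin_ideal n"
  define N where "N k = {r. wt k * pt r \<in> I}" for k
  have Nadd: "p + q \<in> N k" if "p \<in> N k" "q \<in> N k" for p q k
    using that tidealD(2)[OF I] by (auto simp: N_def distrib_left)
  have Nmult: "r * p \<in> N k" if "p \<in> N k" for p r k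
  proof -
    have "wt k * pt p * pt r \<in> I" using that tidealD(4)[OF I] by (simp add: N_def)
    then show ?thesis by (simp add: N_def mult.assoc pt_simps(4)[symmetric] mult.commute del: pt_simps(4))
  qed
  have unsign: "p \<in> N k" if "(- 1) ^ m * p \<in> N k" for p k m
    using Nmult[OF that, of "(- 1) ^ m"] by (simp add: mult.assoc[symmetric] power_add[symmetric] flip: mult_2)
  have w0: "wt 0 = 1" by (simp add: wt_def)
  have red: "pc (cn n) p \<in> N 0" if "pm p \<in> I" for p
    using tideal_reduce_iff[OF I W, of 1 p] that by (simp add: N_def w0)
  \<comment> \<open>The factors f(0), ..., f(n) have their roots at the indices n, ..., 0 and -1,
    ..., -(n + 1).\<close>
  have P1: "(\<Prod>b\<in>{- int (Suc n)..int n}. lf n b) \<in> N 0"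
  proof -
    have "gF ^ Suc n * gE ^ Suc n \<in> I" using E by (rule tidealD(3)[OF I])
    then have "pc (cn n) (\<Prod>i<Suc n. fq (int i)) \<in> N 0" unfolding FnEn by (rule red)
    also have "pc (cn n) (\<Prod>i<Suc n. fq (int i)) = (- 1) ^ Suc n * ((\<Prod>i<Suc n. lf n (int n - int i)) * (\<Prod>i<Suc n. lf n (- 1 - int i)))"
      unfolding pc_prod pc_fq_factor prod.distrib[symmetric] by (simp only: prod_uminus card_lessThan)
    also have "(\<Prod>i<Suc n. lf n (int n - int i)) = (\<Prod>b\<in>{0..int n}. lf n b)"
      by (rule prod.reindex_bij_witness[of _ "\<lambda>b. nat (int n - b)" "\<lambda>i. int n - int i"]) auto
    also have "(\<Prod>i<Suc n. lf n (- 1 - int i)) = (\<Prod>b\<in>{- int (Suc n)..-1}. lf n b)"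
      by (rule prod.reindex_bij_witness[of _ "\<lambda>b. nat (- 1 - b)" "\<lambda>i. - 1 - int i"]) auto
    also have "(\<Prod>b\<in>{0..int n}. lf n b) * (\<Prod>b\<in>{- int (Suc n)..-1}. lf n b) = (\<Prod>b\<in>{- int (Suc n)..int n}. lf n b)"
    proof -
      have "{- int (Suc n)..int n} = {0..int n} \<union> {- int (Suc n)..-1}" by auto
      then show ?thesis by (simp only:) (subst prod.union_disjoint, auto)
    qed
    finally show ?thesis by (rule unsign)
  qed
  \<comment> \<open>The factors f(-1), ..., f(-(n + 1)) have their roots at the indices n + 1, ...,
    2n + 1 and 0, ..., n.\<close>
  have P2: "(\<Prod>b\<in>{0..2 * int n + 1}. lf n b) \<in> N 0"
  proof -
    have "gE ^ Suc n * gF ^ Suc n \<in> I" using E by (rule tidealD(4)[OF I])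
    then have "pc (cn n) (\<Prod>i<Suc n. fq (- 1 - int i)) \<in> N 0" unfolding EnFn by (rule red)
    also have "pc (cn n) (\<Prod>i<Suc n. fq (- 1 - int i)) = (- 1) ^ Suc n * ((\<Prod>i<Suc n. lf n (int n - (- 1 - int i))) * (\<Prod>i<Suc n. lf n (- 1 - (- 1 - int i))))"
      unfolding pc_prod pc_fq_factor prod.distrib[symmetric] by (simp only: prod_uminus card_lessThan)
    also have "(\<Prod>i<Suc n. lf n (int n - (- 1 - int i))) = (\<Prod>b\<in>{int n + 1..2 * int n + 1}. lf n b)"
      by (rule prod.reindex_bij_witness[of _ "\<lambda>b. nat (b - int n - 1)" "\<lambda>i. int n - (- 1 - int i)"]) auto
    also have "(\<Prod>i<Suc n. lf n (- 1 - (- 1 - int i))) = (\<Prod>b\<in>{0..int n}. lf n b)"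
      by (rule prod.reindex_bij_witness[of _ nat "\<lambda>i. - 1 - (- 1 - int i)"]) auto
    also have "(\<Prod>b\<in>{int n + 1..2 * int n + 1}. lf n b) * (\<Prod>b\<in>{0..int n}. lf n b) = (\<Prod>b\<in>{0..2 * int n + 1}. lf n b)"
    proof -
      have "{0..2 * int n + 1} = {int n + 1..2 * int n + 1} \<union> {0..int n}" by auto
      then show ?thesis by (simp only:) (subst prod.union_disjoint, auto)
    qed
    finally show ?thesis by (rule unsign)
  qed
  have "{- int (Suc n)..int n} \<inter> {0..2 * int n + 1} = {0..int n}" by auto
  then have G: "(\<Prod>b\<in>{0..int n}. lf n b) \<in> N 0"
    using ideal_common_roots[OF Nadd Nmult _ _ P1 P2] by simp
  let ?G = "\<Prod>b\<in>{0..int n}. lf n b"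
  have Gk: "(\<Prod>b\<in>{0..int n} \<inter> {- k..int n - k}. lf n b) \<in> N k" for k
  proof (rule ideal_common_roots[OF Nadd Nmult])
    have GI: "pt ?G \<in> I" using G by (simp add: N_def w0)
    show "?G \<in> N k" using tidealD(3)[OF I GI] by (simp add: N_def)
    have "pm (emb ?G) * wt k \<in> I" using tidealD(4)[OF I GI] by (simp add: pm_emb)
    then have "wt k * pt (pc (cn n) (sh k (emb ?G))) \<in> I"
      unfolding pm_wt by (rule tideal_reduce_iff[OF I W, THEN iffD1])
    moreover have "pc (cn n) (sh k (emb ?G)) = (\<Prod>b\<in>{- k..int n - k}. lf n b)"
    proof (rule pc_eqI)
      fix a
      have "evc a (cn n) (sh k (emb ?G)) = (\<Prod>b\<in>{0..int n}. poly (lf n b) (a + of_int k))" by (simp add: poly_prod)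
      also have "\<dots> = (\<Prod>b\<in>{- k..int n - k}. poly (lf n b) a)"
        by (rule prod.reindex_bij_witness[of _ "\<lambda>b. b + k" "\<lambda>b. b - k"]) (auto simp: lf_def)
      finally show "evc a (cn n) (sh k (emb ?G)) = poly (\<Prod>b\<in>{- k..int n - k}. lf n b) a" by (simp add: poly_prod)
    qed
    ultimately show "(\<Prod>b\<in>{- k..int n - k}. lf n b) \<in> N k" by (simp add: N_def)
  qed simp_all
  obtain p where "finite {k. co u k \<noteq> 0}" and p': "\<forall>k. co u k = xk k * p k" and "u = (\<Sum>k | co u k \<noteq> 0. wt k * pm (p k))"
    using co_normal_form[of u] by (elim exE conjE)
  note p = this(1) p'[rule_format] this(3)
  have "wt k * pm (p k) \<in> I" for k
  proof -
    let ?r = "pc (cn n) (p k)"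
    have "(\<Prod>b\<in>{0..int n} \<inter> {- k..int n - k}. lf n b) dvd ?r"
    proof (rule lf_prod_dvd)
      fix j assume "j \<in> {0..int n} \<inter> {- k..int n - k}"
      then have j: "j \<in> {0..int n}" "j + k \<in> {0..int n}" by auto
      have "mn n u (j + k) j = 0" using u j by (simp add: fin_ideal_def)
      then have "evc (of_int j - of_nat n / 2) (cn n) (xk (j + k - j)) * evc (of_int j - of_nat n / 2) (cn n) (p k) = 0"
        by (simp add: mn_def ma_def p(2))
      moreover have "evc (of_int j - of_nat n / 2) (cn n) (xk (j + k - j)) \<noteq> 0"
      proof -
        have "(int n - (j + k + int l)) * (j + k + int l + 1) \<noteq> 0" if "l < nat (j - (j + k))" for l using that j by auto
        then show ?thesis unfolding evc_xk
          by (simp only: prod_zero_iff finite_lessThan of_int_eq_0_iff lessThan_iff) blast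
      qed
      ultimately show "poly ?r (of_int j - of_nat n / 2) = 0" by (simp add: poly_pc)
    qed simp
    then obtain s where "?r = s * (\<Prod>b\<in>{0..int n} \<inter> {- k..int n - k}. lf n b)" by (metis dvd_def mult.commute)
    then have "?r \<in> N k" using Nmult[OF Gk] by simp
    then show ?thesis using tideal_reduce_iff[OF I W, of "wt k" "p k"] by (simp add: N_def)
  qed
  then show "u \<in> I" by (subst p(3)) (rule tideal_sum[OF I])
qed

text \<open>A nonzero intersection would contain some E^m q(W) with q nonzero. Its entry at (m, 0)
  is q(c_n) for n \<ge> m, yet infinitely many numbers c_n cannot all be roots of q.\<close>

lemma fin_ideal_inter:
  assumes "\<And>n. u \<in> fin_ideal n" shows "u = 0"
proof (rule ccontr)
  assume u: "u \<noteq> 0"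
  have "tideal (\<Inter>n. fin_ideal n)"
    unfolding tideal_def INT_iff using tidealD[OF tideal_fin_ideal] by (intro conjI ballI allI) (simp_all only: INT_iff simp_thms)
  moreover have "u \<in> (\<Inter>n. fin_ideal n)" using assms by blast
  ultimately have "\<exists>m q. q \<noteq> 0 \<and> gE ^ m * pw q \<in> (\<Inter>n. fin_ideal n)" using u by (rule tideal_nonzero)
  then obtain m q where q: "q \<noteq> 0" "gE ^ m * pw q \<in> (\<Inter>n. fin_ideal n)" by (elim exE conjE)
  have "finite {z. poly q z = 0}" using q(1) by (rule poly_roots_finite)
  moreover have "infinite (cn ` {m..})"
    using finite_imageD[of cn "{m..}"] cn_inj infinite_Ici[of m] by (auto simp: inj_on_def)
  ultimately have "\<not> cn ` {m..} \<subseteq> {z. poly q z = 0}" using finite_subset by blast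
  then obtain n where n: "n \<ge> m" "poly q (cn n) \<noteq> 0" by auto
  have "mn n (gE ^ m * pw q) (int m) 0 = poly q (cn n)"
    using mn_wt_pm[of n "int m" "[:q:]" "int m" 0] by (simp add: wt_def xk_def evc_def)
  moreover have "mn n (gE ^ m * pw q) (int m) 0 = 0" using q(2) n(1) by (auto simp: fin_ideal_def)
  ultimately show False using n(2) by simp
qed

section \<open>Maximal left ideals\<close>

definition tleft :: "ut set \<Rightarrow> bool" where
  "tleft L \<longleftrightarrow> 0 \<in> L \<and> (\<forall>x\<in>L. \<forall>y\<in>L. x + y \<in> L) \<and> (\<forall>u. \<forall>x\<in>L. u * x \<in> L)"

text \<open>Maximality is put in the form in which simplicity of a module is checked: an element
  outside L is left invertible modulo L.\<close>

definition tmaxleft :: "ut set \<Rightarrow> bool" where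
  "tmaxleft L \<longleftrightarrow> tleft L \<and> 1 \<notin> L \<and> (\<forall>u. u \<notin> L \<longrightarrow> (\<exists>v. v * u - 1 \<in> L))"

definition tbound :: "ut set \<Rightarrow> ut set" where
  "tbound L = {r. \<forall>x. r * x \<in> L}"

lemma tideal_tbound: "tleft L \<Longrightarrow> tideal (tbound L)"
  unfolding tideal_def tbound_def tleft_def by (auto simp: mult.assoc distrib_right)

text \<open>L is the annihilator of the vector of index 0. It is maximal because a matrix unit takes
  any nonzero vector to a multiple of that one.\<close>

lemma fin_ideal_primitive: "\<exists>L. tmaxleft L \<and> tbound L = fin_ideal n"
proof -
  define L where "L = {u. \<forall>i\<in>{0..int n}. mn n u i 0 = 0}"
  have L: "tleft L" unfolding tleft_def L_def by (auto simp: mn_mult)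
  have one: "1 \<notin> L" by (auto simp: L_def intro!: bexI[of _ 0])
  have "\<exists>v. v * u - 1 \<in> L" if u: "u \<notin> L" for u
  proof -
    obtain a where a: "a \<in> {0..int n}" "mn n u a 0 \<noteq> 0" using u by (auto simp: L_def)
    obtain v where v: "v \<noteq> 0" "\<forall>i\<in>{0..int n}. \<forall>j\<in>{0..int n}. mn n (mu n 0 a) i j = (if i = 0 \<and> j = a then v else 0)"
      using mn_mu[of 0 n a] a by auto
    have "mn n (mu n 0 a * u) i 0 = (if i = 0 then v * mn n u a 0 else 0)" if i: "i \<in> {0..int n}" for i
    proof -
      have "mn n (mu n 0 a * u) i 0 = (\<Sum>l\<in>{0..int n}. if l = a then (if i = 0 then v * mn n u a 0 else 0) else 0)"
        using i v(2) by (subst mn_mult) (auto intro!: sum.cong simp del: sum.delta sum.delta')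
      then show ?thesis using a by simp
    qed
    then have "sc (1 / (v * mn n u a 0)) * mu n 0 a * u - 1 \<in> L" using v(1) a(2) by (auto simp: L_def mult.assoc)
    then show ?thesis by blast
  qed
  then have m: "tmaxleft L" using L one by (simp add: tmaxleft_def)
  have sub: "fin_ideal n \<subseteq> tbound L"
    using tidealD(4)[OF tideal_fin_ideal, of _ n] by (auto simp: tbound_def L_def fin_ideal_def)
  have "1 \<notin> tbound L" using one by (auto simp: tbound_def dest: spec[of _ 1])
  then have "tbound L \<subseteq> fin_ideal n" using fin_ideal_maximal[OF tideal_tbound[OF L] sub] by blast
  then show ?thesis using m sub by blast
qed

lemma ma_T: "ma a c (gT * u) k = (a + of_int k) * ma a c u k" and ma_E: "ma a c (gE * u) k = ma a c u (k - 1)"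
  by (simp_all add: ma_def co_T co_E)

text \<open>The T-eigenvalues of the simple module are a + Z, with a such that no f(i) vanishes on
  them, and L annihilates the vector of index 0. An element that kills all basis vectors has
  coefficients with infinitely many roots a + j at w = c.\<close>

lemma cas_ideal_primitive: "\<exists>L. tmaxleft L \<and> tbound L = cas_ideal c"
proof -
  \<comment> \<open>Every element of a + Z has imaginary part |c| + 1, so (a + i)(a + i + 1) has
    modulus at least (|c| + 1)^2 and never equals c.\<close>
  define a where "a = \<i> * of_real (norm c + 1)"
  have nz: "c - (a + of_int i) * (a + of_int i + 1) \<noteq> 0" for i
  proof
    assume "c - (a + of_int i) * (a + of_int i + 1) = 0"
    then have "norm c = norm (a + of_int i) * norm (a + of_int i + 1)" by (simp add: norm_mult[symmetric])
    moreover have "norm c + 1 \<le> norm (a + of_int i)" "norm c + 1 \<le> norm (a + of_int i + 1)"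
      using abs_Im_le_cmod[of "a + of_int i"] abs_Im_le_cmod[of "a + of_int i + 1"] by (simp_all add: a_def)
    then have "(norm c + 1) * (norm c + 1) \<le> norm (a + of_int i) * norm (a + of_int i + 1)"
      by (intro mult_mono) auto
    ultimately have "(norm c + 1) * (norm c + 1) \<le> norm c" by simp
    moreover have "(norm c + 1) * (norm c + 1) = norm c * norm c + (norm c + norm c + 1)" by (simp add: algebra_simps)
    moreover have "0 \<le> norm c * norm c" "0 \<le> norm c" by simp_all
    ultimately show False by linarith
  qed
  have fq: "evc (a + of_int j) c (fq i) \<noteq> 0" for i j
    using nz[of "j + i"] by (simp add: add.assoc)
  have xk: "evc (a + of_int j) c (xk k) \<noteq> 0" for j k
    unfolding xk_def evc_prod using fq by (simp only: prod_zero_iff finite_lessThan) blast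
  have wt1: "ma (a + of_int j) c (wt k) m = (if m = k then evc (a + of_int j) c (xk k) else 0)" for j k m
    using co_wt_pm[of k 1 m] by (simp add: ma_def)
  define L where "L = {u. \<forall>k. ma a c u k = 0}"
  have L: "tleft L" unfolding tleft_def L_def by (auto simp: ma_mult_supp)
  have one: "1 \<notin> L" by (auto simp: L_def)
  have "\<exists>v. v * u - 1 \<in> L" if u: "u \<notin> L" for u
  proof -
    let ?S = "{k. ma a c u k \<noteq> 0}"
    have S: "finite ?S" by (rule finite_subset[OF _ co_finite[of u]]) (auto simp: ma_def)
    obtain k where k: "k \<in> ?S" using u by (auto simp: L_def)
    \<comment> \<open>A product of factors T - a - l retains a single index k of the vector, up to a
      scalar; \<open>wt (- k)\<close> then leads from index k to index 0.\<close>
    have proj: "\<exists>w. \<forall>m. ma a c (w * u) m = (\<Prod>j\<in>T. of_int (m - j)) * ma a c u m" if "finite T" for T :: "int set"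
      using that
    proof (induction T rule: finite_induct)
      case empty show ?case by (intro exI[of _ 1]) simp
    next
      case (insert l T)
      then obtain w where w: "\<forall>m. ma a c (w * u) m = (\<Prod>j\<in>T. of_int (m - j)) * ma a c u m" by blast
      have "ma a c ((gT - sc (a + of_int l)) * w * u) m = (\<Prod>j\<in>insert l T. of_int (m - j)) * ma a c u m" for m
        using insert.hyps w by (simp add: left_diff_distrib mult.assoc ma_T) (simp add: algebra_simps)
      then show ?case by blast
    qed
    obtain w where w: "\<forall>m. ma a c (w * u) m = (\<Prod>j\<in>?S - {k}. of_int (m - j)) * ma a c u m" using proj[of "?S - {k}"] S by blast
    define d where "d = (\<Prod>j\<in>?S - {k}. of_int (k - j)) * ma a c u k"
    have d: "d \<noteq> 0" using S k by (auto simp: d_def)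
    have w': "ma a c (w * u) m = (if m = k then d else 0)" for m
    proof (cases "m = k")
      case False
      then show ?thesis using w S by (cases "m \<in> ?S") auto
    qed (simp add: w d_def)
    let ?e = "evc (a + of_int k) c (xk (- k))"
    have "ma a c (wt (- k) * (w * u)) m = (if m = 0 then ?e * d else 0)" for m
    proof -
      have "ma a c (wt (- k) * (w * u)) m = (\<Sum>j\<in>{k}. ma (a + of_int j) c (wt (- k)) (m - j) * ma a c (w * u) j)"
        by (rule ma_mult) (auto simp: w')
      then show ?thesis using w' wt1[of k "- k" "m - k"] by simp
    qed
    then have "sc (1 / (?e * d)) * (wt (- k) * w) * u - 1 \<in> L" using d xk[of k "- k"] by (simp add: L_def mult.assoc)
    then show ?thesis by blast
  qed
  then have m: "tmaxleft L" using L one by (simp add: tmaxleft_def)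
  have "r \<in> cas_ideal c" if r: "r \<in> tbound L" for r
  proof -
    have "ma (a + of_int j) c r k = 0" for j k
    proof -
      have "ma a c (r * wt j) (k + j) = (\<Sum>i\<in>{j}. ma (a + of_int i) c r (k + j - i) * ma a c (wt j) i)"
        by (rule ma_mult) (use wt1[of 0] in auto)
      moreover have "ma a c (r * wt j) (k + j) = 0" using r by (auto simp: tbound_def L_def)
      ultimately show ?thesis using wt1[of 0 j j] xk[of 0 j] by simp
    qed
    then have z: "poly (pc c (co r k)) (a + of_int j) = 0" for j k by (simp add: poly_pc ma_def)
    have "pc c (co r k) = 0" for k
    proof (rule ccontr)
      assume "pc c (co r k) \<noteq> 0"
      then have "finite {x. poly (pc c (co r k)) x = 0}" by (rule poly_roots_finite)
      moreover have "range (\<lambda>j. a + of_int j) \<subseteq> {x. poly (pc c (co r k)) x = 0}" using z by blast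
      ultimately have "finite (range (\<lambda>j::int. a + of_int j))" using finite_subset by blast
      then have "finite (UNIV :: int set)" by (rule finite_imageD) (auto simp: inj_on_def)
      then show False by simp
    qed
    then show ?thesis by (simp add: cas_ideal_def)
  qed
  moreover have "cas_ideal c \<subseteq> tbound L"
    using tidealD(4)[OF tideal_cas_ideal, of _ c] by (auto simp: tbound_def L_def cas_ideal_iff)
  ultimately show ?thesis using m by blast
qed

text \<open>
  The elements \<open>(gW - c)\<^sup>-\<^sup>1\<close> would act on a faithful simple module; these are uncountably many, while the
  module has countable dimension.
\<close>

lemma tbound_nonzero:
  assumes L: "tmaxleft L" shows "tbound L \<noteq> {0}"
proof
  assume b: "tbound L = {0}"
  have l: "tleft L" and one: "1 \<notin> L" using L by (auto simp: tmaxleft_def)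
  have add: "x + y \<in> L" if "x \<in> L" "y \<in> L" for x y using l that by (auto simp: tleft_def)
  have mult: "u * x \<in> L" if "x \<in> L" for u x using l that by (auto simp: tleft_def)
  have zero: "0 \<in> L" using l by (auto simp: tleft_def)
  \<comment> \<open>A central element of L belongs to the bound of L.\<close>
  have cent: "pw q \<notin> L" if "q \<noteq> 0" for q
  proof
    assume "pw q \<in> L"
    then have "pw q \<in> tbound L" using mult by (auto simp: tbound_def pw_central)
    then show False using b that by (simp add: pw_eq_0_iff)
  qed
  have "\<exists>v. v * pw [:- c, 1:] - 1 \<in> L" for c using L cent[of "[:- c, 1:]"] by (auto simp: tmaxleft_def)
  then obtain v where v: "\<And>c. v c * pw [:- c, 1:] - 1 \<in> L" by metis
  \<comment> \<open>The coefficient supports of the v c fit into countably many finite boxes.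
    Uncountably many c share one box, and more than its size of them give linearly dependent v
    c.\<close>
  define B where "B M = {- int M..int M} \<times> {..M} \<times> {..M}" for M
  define Bd where "Bd M = {c. \<forall>k i j. (k, i, j) \<notin> B M \<longrightarrow> Polynomial.coeff (Polynomial.coeff (co (v c) k) i) j = 0}" for M
  have "\<exists>M. c \<in> Bd M" for c
  proof -
    let ?K = "{k. co (v c) k \<noteq> 0}"
    have K: "finite ?K" by (rule co_finite)
    let ?D = "\<lambda>k. insert (nat \<bar>k\<bar>) (insert (Polynomial.degree (co (v c) k)) ((\<lambda>i. Polynomial.degree (Polynomial.coeff (co (v c) k) i)) ` {..Polynomial.degree (co (v c) k)}))"
    define M where "M = Max (insert 0 (\<Union>k\<in>?K. ?D k))"
    have fin: "finite (insert 0 (\<Union>k\<in>?K. ?D k))" using K by simp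
    have bound: "x \<le> M" if "k \<in> ?K" "x \<in> ?D k" for k x unfolding M_def using fin that by (intro Max_ge) blast+
    have "(k, i, j) \<in> B M" if ne: "Polynomial.coeff (Polynomial.coeff (co (v c) k) i) j \<noteq> 0" for k i j
    proof -
      have k: "k \<in> ?K" using ne by auto
      have i: "i \<le> Polynomial.degree (co (v c) k)" using ne by (intro le_degree) auto
      have j: "j \<le> Polynomial.degree (Polynomial.coeff (co (v c) k) i)" using ne by (intro le_degree)
      have "nat \<bar>k\<bar> \<le> M" "Polynomial.degree (co (v c) k) \<le> M" "Polynomial.degree (Polynomial.coeff (co (v c) k) i) \<le> M"
        using bound[OF k] i by auto
      then show ?thesis using i j by (auto simp: B_def)
    qed
    then show ?thesis by (auto simp: Bd_def)
  qed
  then have "(\<Union>M. Bd M) = (UNIV :: complex set)" by blast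
  moreover have "uncountable (UNIV :: complex set)" by (rule uncountable_UNIV_complex)
  ultimately obtain M where "uncountable (Bd M)" by (metis countable_UN countableI_type)
  then have "infinite (Bd M)" using countable_finite by blast
  then obtain Y where Y: "Y \<subseteq> Bd M" "finite Y" "card Y = Suc (card (B M))" using infinite_arbitrarily_large by blast
  have "finite (B M)" by (simp add: B_def)
  then obtain \<alpha> where \<alpha>: "\<exists>c\<in>Y. \<alpha> c \<noteq> 0"
    "\<forall>b\<in>B M. (\<Sum>c\<in>Y. \<alpha> c * (case b of (k, i, j) \<Rightarrow> Polynomial.coeff (Polynomial.coeff (co (v c) k) i) j)) = 0"
    using linear_dependence[of "B M" Y "\<lambda>c b. case b of (k, i, j) \<Rightarrow> Polynomial.coeff (Polynomial.coeff (co (v c) k) i) j"] Y by auto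
  have "(\<Sum>c\<in>Y. sc (\<alpha> c) * v c) = 0"
  proof (rule co_eq_0_imp, rule poly_eqI, rule poly_eqI)
    fix k i j
    have "Polynomial.coeff (Polynomial.coeff (co (\<Sum>c\<in>Y. sc (\<alpha> c) * v c) k) i) j = (\<Sum>c\<in>Y. \<alpha> c * Polynomial.coeff (Polynomial.coeff (co (v c) k) i) j)"
      by (simp add: co_sum co_scale coeff_sum cc_def)
    also have "\<dots> = 0"
    proof (cases "(k, i, j) \<in> B M")
      case True then show ?thesis using \<alpha>(2) by fastforce
    next
      case False
      then have "Polynomial.coeff (Polynomial.coeff (co (v c) k) i) j = 0" if "c \<in> Y" for c using Y(1) that by (auto simp: Bd_def)
      then show ?thesis by simp
    qed
    finally show "Polynomial.coeff (Polynomial.coeff (co (\<Sum>c\<in>Y. sc (\<alpha> c) * v c) k) i) j = Polynomial.coeff (Polynomial.coeff 0 i) j" by simp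
  qed
  note rel = this
  \<comment> \<open>Multiplying the relation by the product of all W - d, d in Y, turns it into
    \<open>pw Q\<close> in L. As in Lagrange interpolation, Q is nonzero because its value at c is
    \<alpha> c times a nonzero number.\<close>
  define q where "q c = (\<Prod>d\<in>Y - {c}. [:- d, 1:])" for c
  define Q where "Q = (\<Sum>c\<in>Y. Polynomial.smult (\<alpha> c) (q c))"
  have full: "[:- c, 1:] * q c = (\<Prod>d\<in>Y. [:- d, 1:])" if "c \<in> Y" for c
    unfolding q_def using Y(2) that by (simp add: prod.remove)
  have psm: "pw (Polynomial.smult r p) = sc r * pw p" for r p
    using pw_simps(4)[of "[:r:]" p] by simp
  have psum: "pw (\<Sum>c\<in>A. f c) = (\<Sum>c\<in>A. pw (f c))" for A :: "complex set" and f
    by (induction A rule: infinite_finite_induct) simp_all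
  have lsum: "(\<Sum>c\<in>A. f c) \<in> L" if "\<And>c. c \<in> A \<Longrightarrow> f c \<in> L" for A :: "complex set" and f
    using that by (induction A rule: infinite_finite_induct) (auto intro: add zero)
  have "(\<Sum>c\<in>Y. sc (\<alpha> c) * pw (q c) * (v c * pw [:- c, 1:] - 1)) \<in> L" by (intro lsum mult v)
  also have "(\<Sum>c\<in>Y. sc (\<alpha> c) * pw (q c) * (v c * pw [:- c, 1:] - 1)) = (\<Sum>c\<in>Y. sc (\<alpha> c) * v c) * pw (\<Prod>d\<in>Y. [:- d, 1:]) - pw Q"
  proof -
    have "sc (\<alpha> c) * pw (q c) * (v c * pw [:- c, 1:] - 1) = sc (\<alpha> c) * v c * pw (\<Prod>d\<in>Y. [:- d, 1:]) - pw (Polynomial.smult (\<alpha> c) (q c))"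
      if "c \<in> Y" for c
    proof -
      have "pw (q c) * (v c * pw [:- c, 1:]) = v c * pw ([:- c, 1:] * q c)"
        by (simp only: pw_simps(4) mult.assoc pw_central[of "q c"])
      then show ?thesis unfolding full[OF that] by (simp add: right_diff_distrib mult.assoc psm)
    qed
    then show ?thesis by (simp add: Q_def psum sum_subtractf sum_distrib_right)
  qed
  also have "\<dots> = - 1 * pw Q" by (simp add: rel)
  finally have "- 1 * (- 1 * pw Q) \<in> L" by (rule mult)
  then have "pw Q \<in> L" by simp
  moreover have "Q \<noteq> 0"
  proof
    assume Q0: "Q = 0"
    obtain c where c: "c \<in> Y" "\<alpha> c \<noteq> 0" using \<alpha>(1) by blast
    have "poly (q d) c = 0" if "d \<in> Y" "d \<noteq> c" for d
      unfolding q_def poly_prod using Y(2) c that by (intro prod_zero) auto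
    then have "poly Q c = (\<Sum>d\<in>Y. if d = c then \<alpha> c * poly (q c) c else 0)"
      unfolding Q_def poly_sum by (intro sum.cong refl) auto
    also have "\<dots> = \<alpha> c * poly (q c) c" using Y(2) c by simp
    finally show False using Q0 c Y(2) by (auto simp: q_def poly_prod)
  qed
  ultimately show False using cent by blast
qed

text \<open>The condition on T confines y to the index m; the one on E makes the polynomial there
  invariant under t \<mapsto> t + 1, hence constant. In \<open>cas_rational\<close>, y stands for
  zE^m with z central.\<close>

lemma cas_ideal_centralizer:
  assumes T: "gT * y - y * (gT + of_nat m) \<in> cas_ideal c" and E: "gE * y - y * gE \<in> cas_ideal c"
  shows "\<exists>r. y - sc r * gE ^ m \<in> cas_ideal c"
proof -
  have T1: "ma a c (y * gT) k = a * ma a c y k" for a k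
    using ma_mult[of "{0}" a c gT y k] co_T[of 1] by (simp add: ma_def co_1)
  have E1: "ma a c (y * gE) k = ma (a + 1) c y (k - 1)" for a k
    using ma_mult[of "{1}" a c gE y k] co_E[of 1] by (simp add: ma_def co_1)
  have N1: "ma a c (y * of_nat m) k = of_nat m * ma a c y k" for a k
  proof -
    have "y * of_nat m = sc (of_nat m) * y" unfolding sc_of_nat[symmetric] by (rule sc_central[symmetric])
    then show ?thesis by simp
  qed
  have "(of_int k - of_nat m) * ma a c y k = 0" for a k
    using T unfolding cas_ideal_iff by (simp add: ma_T distrib_left T1 N1 algebra_simps)
  then have off: "ma a c y k = 0" if "k \<noteq> int m" for a k
    using that by (metis eq_iff_diff_eq_0 mult_eq_0_iff of_int_eq_iff of_int_of_nat_eq)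
  have "ma a c y (int m) = ma (a + 1) c y (int m)" for a
    using E unfolding cas_ideal_iff by (simp add: ma_E E1) (metis add_diff_cancel_right')
  then have per: "poly (pc c (co y (int m))) (a + 1) = poly (pc c (co y (int m))) a" for a by (simp add: poly_pc ma_def)
  let ?p = "pc c (co y (int m))"
  have nat: "poly ?p (of_nat n) = poly ?p 0" for n
  proof (induction n)
    case (Suc n) then show ?case using per[of "of_nat n"] by (simp add: add.commute)
  qed simp
  have "?p = [:poly ?p 0:]"
  proof (rule ccontr)
    assume "?p \<noteq> [:poly ?p 0:]"
    then have "finite {x. poly (?p - [:poly ?p 0:]) x = 0}" by (intro poly_roots_finite) simp
    moreover have "range of_nat \<subseteq> {x. poly (?p - [:poly ?p 0:]) x = 0}" using nat by auto
    ultimately have "finite (range (of_nat :: nat \<Rightarrow> complex))" using finite_subset by blast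
    then have "finite (UNIV :: nat set)" by (rule finite_imageD) (auto simp: inj_on_def)
    then show False by simp
  qed
  then have "ma a c y (int m) = poly ?p 0" for a by (metis ma_def poly_0 poly_pCons mult_zero_right add.right_neutral poly_pc)
  then have "y - sc (poly ?p 0) * gE ^ m \<in> cas_ideal c"
    using off by (auto simp: cas_ideal_iff ma_def[of _ _ "gE ^ m"] co_E_power)
  then show ?thesis by blast
qed

section \<open>The spectrum of the enveloping algebra\<close>

lemma ideal_image_iff: "ideal (Rep_ut ` I) U_sl2 \<longleftrightarrow> tideal I"
proof
  assume "ideal (Rep_ut ` I) U_sl2"
  then have i: "left_ideal U_sl2 (Rep_ut ` I)" "right_ideal U_sl2 (Rep_ut ` I)"
    using ideal_iff_left_right[OF ring_U_sl2] by auto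
  note l = left_idealD[OF i(1)] and r = right_idealD[OF i(2)]
  have mem: "Rep_ut u \<in> Rep_ut ` I \<longleftrightarrow> u \<in> I" for u by (auto simp: Rep_ut_inject)
  show "tideal I"
    unfolding tideal_def
  proof (intro conjI ballI allI)
    show "0 \<in> I" using l(2) unfolding Rep_ut_hom(1)[symmetric] mem .
    show "x + y \<in> I" if "x \<in> I" "y \<in> I" for x y
      using l(3)[of "Rep_ut x" "Rep_ut y"] that unfolding Rep_ut_hom(3)[symmetric] mem by simp
    show "u * x \<in> I" if "x \<in> I" for u x
      using l(4)[of "Rep_ut u" "Rep_ut x"] that Rep_ut unfolding Rep_ut_hom(4)[symmetric] mem by simp
    show "x * u \<in> I" if "x \<in> I" for u x
      using r(4)[of "Rep_ut u" "Rep_ut x"] that Rep_ut unfolding Rep_ut_hom(4)[symmetric] mem by simp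
  qed
next
  assume I: "tideal I"
  show "ideal (Rep_ut ` I) U_sl2"
  proof (rule idealI'[OF ring_U_sl2])
    show "Rep_ut ` I \<subseteq> carrier U_sl2" using Rep_ut by auto
    show "\<zero>\<^bsub>U_sl2\<^esub> \<in> Rep_ut ` I" using tidealD(1)[OF I] unfolding Rep_ut_hom(1)[symmetric] by (rule imageI)
    show "x \<oplus>\<^bsub>U_sl2\<^esub> y \<in> Rep_ut ` I" if "x \<in> Rep_ut ` I" "y \<in> Rep_ut ` I" for x y
      using that tidealD(2)[OF I] by (elim imageE) (simp flip: Rep_ut_hom)
    show "r \<otimes>\<^bsub>U_sl2\<^esub> x \<in> Rep_ut ` I" if "r \<in> carrier U_sl2" "x \<in> Rep_ut ` I" for r x
      using that(1)[folded range_Rep_ut] that(2) tidealD(3)[OF I] by (elim imageE) (simp flip: Rep_ut_hom)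
    show "x \<otimes>\<^bsub>U_sl2\<^esub> r \<in> Rep_ut ` I" if "r \<in> carrier U_sl2" "x \<in> Rep_ut ` I" for r x
      using that(1)[folded range_Rep_ut] that(2) tidealD(4)[OF I] by (elim imageE) (simp flip: Rep_ut_hom)
  qed
qed

lemma Rep_ut_mem_iff: "Rep_ut u \<in> Rep_ut ` I \<longleftrightarrow> u \<in> I"
  by (auto simp: Rep_ut_inject)

lemma image_subset_image_iff: "Rep_ut ` I \<subseteq> Rep_ut ` J \<longleftrightarrow> I \<subseteq> J"
  by (auto simp: Rep_ut_inject)

lemma image_psubset_iff: "Rep_ut ` I \<subset> Rep_ut ` J \<longleftrightarrow> I \<subset> J"
  by (simp add: psubset_eq image_subset_image_iff inj_image_eq_iff inj_def Rep_ut_inject)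

lemma ball_U_sl2: "(\<forall>x\<in>carrier U_sl2. F x) \<longleftrightarrow> (\<forall>u. F (Rep_ut u))"
  unfolding range_Rep_ut[symmetric] by simp

lemma image_eq_carrier_iff: "Rep_ut ` I = carrier U_sl2 \<longleftrightarrow> I = UNIV"
  unfolding range_Rep_ut[symmetric] by (simp add: inj_image_eq_iff inj_def Rep_ut_inject)

lemma tideal_one: "tideal I \<Longrightarrow> 1 \<in> I \<longleftrightarrow> I = UNIV"
  using tidealD(3)[of I 1] by (auto simp del: mult_1_right) (metis mult_1_right)

lemma spec_image_iff: "Rep_ut ` P \<in> spec U_sl2 \<longleftrightarrow> tprime P"
  unfolding spec_def mem_Collect_eq prime_ideal_iff[OF ring_U_sl2] ideal_image_iff image_eq_carrier_iff ball_U_sl2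
    Rep_ut_hom[symmetric] Rep_ut_mem_iff tprime_def
  using tideal_one[of P] by blast

lemma spec_cases:
  assumes "Q \<in> spec U_sl2"
  obtains P where "tprime P" "Q = Rep_ut ` P"
proof
  have "Q = Rep_ut ` {u. Rep_ut u \<in> Q}" using image_vimage_Rep_ut specD(4)[OF assms] by simp
  then show "Q = Rep_ut ` {u. Rep_ut u \<in> Q}" "tprime {u. Rep_ut u \<in> Q}" using assms spec_image_iff by metis+
qed

lemma left_ideal_image_iff: "left_ideal U_sl2 (Rep_ut ` L) \<longleftrightarrow> tleft L"
proof
  assume l: "left_ideal U_sl2 (Rep_ut ` L)"
  note l = left_idealD[OF l]
  show "tleft L"
    unfolding tleft_def
  proof (intro conjI ballI allI)
    show "0 \<in> L" using l(2) unfolding Rep_ut_hom(1)[symmetric] Rep_ut_mem_iff .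
    show "x + y \<in> L" if "x \<in> L" "y \<in> L" for x y
      using l(3)[of "Rep_ut x" "Rep_ut y"] that unfolding Rep_ut_hom(3)[symmetric] Rep_ut_mem_iff by simp
    show "u * x \<in> L" if "x \<in> L" for u x
      using l(4)[of "Rep_ut u" "Rep_ut x"] that Rep_ut unfolding Rep_ut_hom(4)[symmetric] Rep_ut_mem_iff by simp
  qed
next
  assume L: "tleft L"
  show "left_ideal U_sl2 (Rep_ut ` L)"
  proof (rule left_idealI[OF ring_U_sl2])
    show "Rep_ut ` L \<subseteq> carrier U_sl2" using Rep_ut by auto
    show "\<zero>\<^bsub>U_sl2\<^esub> \<in> Rep_ut ` L" using L unfolding tleft_def Rep_ut_hom(1)[symmetric] Rep_ut_mem_iff by simp
    show "x \<oplus>\<^bsub>U_sl2\<^esub> y \<in> Rep_ut ` L" if "x \<in> Rep_ut ` L" "y \<in> Rep_ut ` L" for x y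
      using that L unfolding tleft_def by (elim imageE) (simp flip: Rep_ut_hom)
    show "r \<otimes>\<^bsub>U_sl2\<^esub> x \<in> Rep_ut ` L" if "r \<in> carrier U_sl2" "x \<in> Rep_ut ` L" for r x
      using that(1)[folded range_Rep_ut] that(2) L unfolding tleft_def by (elim imageE) (simp flip: Rep_ut_hom)
  qed
qed

lemma maximal_left_image_iff: "maximal_left_ideal U_sl2 (Rep_ut ` L) \<longleftrightarrow> tmaxleft L"
proof
  assume m: "maximal_left_ideal U_sl2 (Rep_ut ` L)"
  then have L: "tleft L" and U: "L \<noteq> UNIV"
    by (auto simp: maximal_left_ideal_def left_ideal_image_iff image_eq_carrier_iff)
  have "1 \<notin> L" using L U unfolding tleft_def by (metis UNIV_eq_I mult.right_neutral)
  moreover have "\<exists>v. v * u - 1 \<in> L" if u: "u \<notin> L" for u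
  proof -
    define M where "M = {v * u + x |v x. x \<in> L}"
    have "tleft M"
      unfolding tleft_def
    proof (intro conjI ballI allI)
      show "0 \<in> M" using L unfolding M_def tleft_def by (intro CollectI exI[of _ 0]) simp
      show "a + b \<in> M" if ab: "a \<in> M" "b \<in> M" for a b
      proof -
        obtain v x w y where *: "a = v * u + x" "b = w * u + y" "x \<in> L" "y \<in> L" using ab unfolding M_def by blast
        have "a + b = (v + w) * u + (x + y)" by (simp add: * algebra_simps)
        moreover have "x + y \<in> L" using * L by (simp add: tleft_def)
        ultimately show ?thesis unfolding M_def by blast
      qed
      show "r * a \<in> M" if a: "a \<in> M" for r a
      proof -
        obtain v x where *: "a = v * u + x" "x \<in> L" using a unfolding M_def by blast
        have "r * a = (r * v) * u + r * x" by (simp add: * algebra_simps)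
        moreover have "r * x \<in> L" using * L by (simp add: tleft_def)
        ultimately show ?thesis unfolding M_def by blast
      qed
    qed
    moreover have "L \<subseteq> M"
    proof
      fix x assume "x \<in> L"
      moreover have "x = 0 * u + x" by simp
      ultimately show "x \<in> M" unfolding M_def by blast
    qed
    moreover have "u \<in> M"
    proof -
      have "u = 1 * u + 0" "0 \<in> L" using L by (simp_all add: tleft_def)
      then show ?thesis unfolding M_def by blast
    qed
    ultimately have "Rep_ut ` M = Rep_ut ` L \<or> Rep_ut ` M = carrier U_sl2"
      using m unfolding maximal_left_ideal_def by (simp add: left_ideal_image_iff image_mono)
    then have "M = UNIV" using u \<open>u \<in> M\<close> Rep_ut_mem_iff image_eq_carrier_iff by metis
    then have "1 \<in> M" by simp
    then obtain v x where "1 = v * u + x" "x \<in> L" unfolding M_def by blast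
    moreover from this have "v * u - 1 = - 1 * x" by (simp add: algebra_simps)
    ultimately show ?thesis using L unfolding tleft_def by metis
  qed
  ultimately show "tmaxleft L" using L by (simp add: tmaxleft_def)
next
  assume m: "tmaxleft L"
  then have L: "tleft L" "1 \<notin> L" by (auto simp: tmaxleft_def)
  show "maximal_left_ideal U_sl2 (Rep_ut ` L)"
    unfolding maximal_left_ideal_def left_ideal_image_iff image_eq_carrier_iff
  proof (intro conjI allI impI)
    show "L \<noteq> UNIV" using L by blast
    fix L' assume "left_ideal U_sl2 L' \<and> Rep_ut ` L \<subseteq> L'"
    then have L': "left_ideal U_sl2 L'" "Rep_ut ` L \<subseteq> L'" by auto
    define M where "M = {u. Rep_ut u \<in> L'}"
    have L'M: "L' = Rep_ut ` M" unfolding M_def using image_vimage_Rep_ut left_idealD(1)[OF L'(1)] by simp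
    have M: "tleft M" "L \<subseteq> M" using L' unfolding L'M left_ideal_image_iff image_subset_image_iff by auto
    show "L' = Rep_ut ` L \<or> L' = carrier U_sl2"
    proof (cases "M = L")
      case False
      then obtain u where u: "u \<in> M" "u \<notin> L" using M(2) by blast
      obtain v where "v * u - 1 \<in> M" using m u(2) M(2) unfolding tmaxleft_def by blast
      moreover have "v * u \<in> M" using M(1) u(1) by (simp add: tleft_def)
      ultimately have "v * u + - 1 * (v * u - 1) \<in> M" using M(1) unfolding tleft_def by blast
      then have one: "1 \<in> M" by simp
      have "M = UNIV"
      proof (rule UNIV_eq_I[symmetric])
        show "x \<in> M" for x using M(1) one unfolding tleft_def by (metis mult_1_right)
      qed
      then show ?thesis unfolding L'M image_eq_carrier_iff by simp
    qed (simp add: L'M)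
  qed (use L in simp)
qed

lemma bound_of_image: "bound_of U_sl2 (Rep_ut ` L) = Rep_ut ` tbound L"
proof -
  have "bound_of U_sl2 (Rep_ut ` L) = {r \<in> range Rep_ut. \<forall>u. r \<otimes>\<^bsub>U_sl2\<^esub> Rep_ut u \<in> Rep_ut ` L}"
    unfolding bound_of_def ball_U_sl2 range_Rep_ut ..
  also have "\<dots> = Rep_ut ` tbound L" unfolding tbound_def by (auto simp: Rep_ut_hom(4)[symmetric] Rep_ut_mem_iff)
  finally show ?thesis .
qed

lemma primitive_image_iff: "primitive_ideal U_sl2 (Rep_ut ` P) \<longleftrightarrow> (\<exists>L. tmaxleft L \<and> tbound L = P)"
proof -
  have inj: "Rep_ut ` P = Rep_ut ` tbound L \<longleftrightarrow> tbound L = P" for L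
    by (auto simp: inj_image_eq_iff inj_def Rep_ut_inject)
  show ?thesis
    unfolding primitive_ideal_iff[OF ring_U_sl2]
  proof
    assume "\<exists>L. maximal_left_ideal U_sl2 L \<and> Rep_ut ` P = bound_of U_sl2 L"
    then obtain L where L: "maximal_left_ideal U_sl2 L" "Rep_ut ` P = bound_of U_sl2 L" by blast
    then have "L = Rep_ut ` {u. Rep_ut u \<in> L}"
      using image_vimage_Rep_ut left_idealD(1) unfolding maximal_left_ideal_def by metis
    then show "\<exists>L. tmaxleft L \<and> tbound L = P" using L maximal_left_image_iff bound_of_image inj by metis
  next
    assume "\<exists>L. tmaxleft L \<and> tbound L = P"
    then show "\<exists>L. maximal_left_ideal U_sl2 L \<and> Rep_ut ` P = bound_of U_sl2 L"
      using maximal_left_image_iff bound_of_image inj by metis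
  qed
qed

lemma locally_closed_image_iff:
  assumes P: "tprime P"
  shows "locally_closed_prime U_sl2 (Rep_ut ` P) \<longleftrightarrow> (\<exists>x. x \<notin> P \<and> (\<forall>Q. tprime Q \<longrightarrow> P \<subset> Q \<longrightarrow> x \<in> Q))"
proof -
  have S: "Rep_ut ` P \<in> spec U_sl2" using P by (simp add: spec_image_iff)
  have all: "(\<forall>Q\<in>spec U_sl2. F Q) \<longleftrightarrow> (\<forall>Q. tprime Q \<longrightarrow> F (Rep_ut ` Q))" for F
    by (metis spec_image_iff spec_cases)
  show ?thesis
    unfolding locally_closed_prime_iff[OF ring_U_sl2 S] all image_psubset_iff range_Rep_ut[symmetric]
    by (simp add: Rep_ut_mem_iff)
qed

section \<open>Classification of the prime ideals\<close>

text \<open>Suppose aUb = 0 with a, b nonzero. The u with uUb = 0 form an ideal, which contains some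
  E^m q(W); the elements annihilated by E^m q(W) U form an ideal, which contains some E^m' q'(W).
  But the product E^(m+m') (qq')(W) is nonzero.\<close>

lemma tprime_zero: "tprime {0}"
  unfolding tprime_def
proof (intro conjI allI impI)
  show "tideal {0}" by (simp add: tideal_def)
  show "1 \<notin> ({0} :: ut set)" by simp
  fix a b :: ut assume ab: "\<forall>x. a * x * b \<in> {0}"
  show "a \<in> {0} \<or> b \<in> {0}"
  proof (rule ccontr)
    assume "\<not> (a \<in> {0} \<or> b \<in> {0})"
    then have ne: "a \<noteq> 0" "b \<noteq> 0" by auto
    define I where "I = {u. \<forall>x. u * x * b = 0}"
    have I: "tideal I"
      unfolding tideal_def
    proof (intro conjI ballI allI)
      show "x * u \<in> I" if x: "x \<in> I" for u x
      proof -
        have "x * (u * y) * b = 0" for y using x unfolding I_def by blast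
        then show ?thesis by (simp add: I_def mult.assoc)
      qed
      show "u * x \<in> I" if "x \<in> I" for u x using that unfolding I_def by (simp add: mult.assoc)
    qed (simp_all add: I_def distrib_right)
    have "a \<in> I" using ab by (simp add: I_def)
    then have "\<exists>m q. q \<noteq> 0 \<and> gE ^ m * pw q \<in> I" using ne(1) by (rule tideal_nonzero[OF I])
    then obtain m q where q: "q \<noteq> 0" "gE ^ m * pw q \<in> I" by (elim exE conjE)
    define J where "J = {u. \<forall>x. gE ^ m * pw q * x * u = 0}"
    have J: "tideal J"
      unfolding tideal_def
    proof (intro conjI ballI allI)
      show "u * x \<in> J" if x: "x \<in> J" for u x
      proof -
        have "gE ^ m * pw q * (y * u) * x = 0" for y using x unfolding J_def by blast
        then show ?thesis by (simp add: J_def mult.assoc)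
      qed
      show "x * u \<in> J" if "x \<in> J" for u x using that unfolding J_def by (simp add: mult.assoc[symmetric])
    qed (simp_all add: J_def distrib_left)
    have "b \<in> J" using q(2) by (simp add: I_def J_def)
    then have "\<exists>m q. q \<noteq> 0 \<and> gE ^ m * pw q \<in> J" using ne(2) by (rule tideal_nonzero[OF J])
    then obtain m' q' where q': "q' \<noteq> 0" "gE ^ m' * pw q' \<in> J" by (elim exE conjE)
    have "gE ^ m * pw q * 1 * (gE ^ m' * pw q') = 0" using q'(2) unfolding J_def by blast
    moreover have "gE ^ m * pw q * 1 * (gE ^ m' * pw q') = gE ^ (m + m') * pw (q * q')"
    proof -
      have "gE ^ m * pw q * 1 * (gE ^ m' * pw q') = gE ^ m * (pw q * gE ^ m') * pw q'" by (simp add: mult.assoc)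
      also have "\<dots> = gE ^ m * (gE ^ m' * pw q) * pw q'" by (simp only: pw_central)
      finally show ?thesis by (simp add: power_add mult.assoc)
    qed
    ultimately have "wt (int (m + m')) * pm [:q * q':] = 0" by (simp add: wt_def del: of_nat_add)
    then have "co (wt (int (m + m')) * pm [:q * q':]) (int (m + m')) = 0" by (simp only: co_0)
    then show False unfolding co_wt_pm using q(1) q'(1) xk_nonzero by simp
  qed
qed

text \<open>Unless P is \<open>cas_ideal c\<close>, it contains a power of E. The least exponent n +
  1 determines c = c_n and makes P contain \<open>fin_ideal n\<close>, which is maximal.\<close>

lemma tideal_casimir_cases:
  assumes P: "tideal P" "1 \<notin> P" and W: "gW - sc c \<in> P"
  obtains "P = cas_ideal c" | n where "c = cn n" "P = fin_ideal n" "gE ^ Suc n \<in> P"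
proof (cases "P \<subseteq> cas_ideal c")
  case True
  then show ?thesis using cas_ideal_least[OF P(1) W] that(1) by blast
next
  case False
  then obtain u where u: "u \<in> P" "u \<notin> cas_ideal c" by blast
  have "\<exists>m. gE ^ m \<in> P" by (rule tideal_E_power[OF P(1) W u])
  then obtain m where m: "gE ^ m \<in> P" by (elim exE)
  have "\<exists>n. c = cn n \<and> gE ^ Suc n \<in> P \<and> gE ^ n \<notin> P" by (rule ideal_over_cas[OF P W m])
  then obtain n where n: "c = cn n" "gE ^ Suc n \<in> P" by (elim exE conjE)
  have f: "fin_ideal n \<subseteq> P" by (rule fin_ideal_least[OF P(1) W[unfolded n(1)] n(2)])
  have "P \<subseteq> fin_ideal n"
  proof
    fix u assume "u \<in> P"
    then show "u \<in> fin_ideal n" using fin_ideal_maximal[OF P(1) f] P(2) by blast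
  qed
  then show ?thesis using n f that(2) by blast
qed

lemma tprime_cases:
  assumes "tprime P"
  obtains "P = {0}" | c where "P = cas_ideal c" | n where "P = fin_ideal n"
proof (cases "P = {0}")
  case False
  have P: "tideal P" "1 \<notin> P" using assms by (auto simp: tprime_def)
  then obtain u where "u \<in> P" "u \<noteq> 0" using False tidealD(1)[OF P(1)] by blast
  then have "\<exists>c. gW - sc c \<in> P" by (rule tprime_contains_casimir[OF assms])
  then obtain c where "gW - sc c \<in> P" by (elim exE)
  then show ?thesis using tideal_casimir_cases[OF P] that by metis
qed (use that in blast)

lemma tprime_fin_ideal: "tprime (fin_ideal n)"
proof -
  obtain L where L: "tmaxleft L" "tbound L = fin_ideal n" using fin_ideal_primitive by blast
  then have "primitive_ideal U_sl2 (Rep_ut ` fin_ideal n)" using primitive_image_iff by blast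
  then show ?thesis
    using primitive_imp_prime[OF ring_U_sl2] spec_image_iff unfolding spec_def by blast
qed

lemma cas_subset_fin: "cas_ideal (cn n) \<subset> fin_ideal n"
proof -
  have "cas_ideal (cn n) \<subseteq> fin_ideal n" by (rule cas_ideal_least[OF tideal_fin_ideal W_fin_ideal])
  moreover have "gE ^ Suc n \<in> fin_ideal n" "gE ^ Suc n \<notin> cas_ideal (cn n)"
    by (rule E_fin_ideal[THEN iffD2]) (simp, rule E_notin_cas)
  ultimately show ?thesis by blast
qed

lemma gW_sc_nonzero: "gW - sc c \<noteq> 0"
proof
  assume "gW - sc c = 0"
  then have "gW - sc c \<in> cas_ideal (c + 1)" using tidealD(1)[OF tideal_cas_ideal] by simp
  then show False unfolding W_cas_ideal by simp
qed

lemma zero_psubset_cas: "{0} \<subset> cas_ideal c"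
proof -
  have "gW - sc c \<in> cas_ideal c" using W_cas_ideal by simp
  then show ?thesis using gW_sc_nonzero[of c] tidealD(1)[OF tideal_cas_ideal, of c] by blast
qed

lemma zero_not_locally_closed: "\<not> locally_closed_prime U_sl2 (Rep_ut ` {0})"
proof
  assume "locally_closed_prime U_sl2 (Rep_ut ` {0})"
  then obtain x where x: "x \<notin> {0}" "\<And>Q. tprime Q \<Longrightarrow> {0} \<subset> Q \<Longrightarrow> x \<in> Q"
    unfolding locally_closed_image_iff[OF tprime_zero] by (elim exE conjE) blast
  have "x \<in> fin_ideal n" for n using zero_psubset_cas cas_subset_fin by (intro x(2) tprime_fin_ideal) blast
  then have "x = 0" by (rule fin_ideal_inter)
  then show False using x(1) by simp
qed

text \<open>Since \<open>cn\<close> is injective, at most one \<open>fin_ideal n\<close> lies above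
  \<open>cas_ideal c\<close>. The witness is E^(n+1) if c = c_n, and 1 if no prime lies strictly
  above.\<close>

lemma cas_locally_closed: "locally_closed_prime U_sl2 (Rep_ut ` cas_ideal c)"
proof -
  have *: "\<exists>n. c = cn n \<and> gE ^ Suc n \<in> Q" if Q: "tprime Q" "cas_ideal c \<subset> Q" for Q
  proof -
    have "gW - sc c \<in> Q" using Q(2) W_cas_ideal[of c c] by blast
    moreover have "tideal Q" "1 \<notin> Q" using Q(1) by (auto simp: tprime_def)
    ultimately show ?thesis using tideal_casimir_cases[of Q c] Q(2) by (metis psubsetE order_refl)
  qed
  show ?thesis unfolding locally_closed_image_iff[OF tprime_cas_ideal]
  proof (cases "\<exists>n. c = cn n")
    case True
    then obtain n where n: "c = cn n" by blast
    have "gE ^ Suc n \<in> Q" if "tprime Q" "cas_ideal c \<subset> Q" for Q using *[OF that] n cn_inj by metis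
    then show "\<exists>x. x \<notin> cas_ideal c \<and> (\<forall>Q. tprime Q \<longrightarrow> cas_ideal c \<subset> Q \<longrightarrow> x \<in> Q)" using E_notin_cas by blast
  next
    case False
    then show "\<exists>x. x \<notin> cas_ideal c \<and> (\<forall>Q. tprime Q \<longrightarrow> cas_ideal c \<subset> Q \<longrightarrow> x \<in> Q)"
      using * one_notin_cas by blast
  qed
qed

lemma fin_locally_closed: "locally_closed_prime U_sl2 (Rep_ut ` fin_ideal n)"
  unfolding locally_closed_image_iff[OF tprime_fin_ideal]
proof (intro exI[of _ 1] conjI allI impI)
  show "1 \<notin> fin_ideal n" by (rule one_notin_fin)
  fix Q assume Q: "tprime Q" "fin_ideal n \<subset> Q"
  then obtain u where "u \<in> Q" "u \<notin> fin_ideal n" by blast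
  then show "1 \<in> Q" using fin_ideal_maximal[of Q n u] Q by (auto simp: tprime_def)
qed

section \<open>Quotients of the enveloping algebra\<close>

lemma U_sl2_scalar_eq: "U_sl2_scalar c = Rep_ut (sc c)"
  by (simp add: U_sl2_scalar_def enveloping_scalar_def sc_def Rep_cls[OF scalar_closed])

lemma complex_field_simps [simp]:
  "carrier complex_field = UNIV" "\<one>\<^bsub>complex_field\<^esub> = 1" "a \<otimes>\<^bsub>complex_field\<^esub> b = a * b" "a \<oplus>\<^bsub>complex_field\<^esub> b = a + b"
  by (simp_all add: ring_of_type_algebra_def)

lemma k_algebra_U_sl2: "k_algebra complex_field U_sl2 U_sl2_scalar"
  unfolding k_algebra_def
proof (intro conjI)
  show "field complex_field" by (rule field_from_type_algebra)
  show "ring U_sl2" by (rule ring_U_sl2)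
  show "U_sl2_scalar \<in> ring_hom complex_field U_sl2"
    using Rep_ut by (intro ring_hom_memI) (simp_all add: U_sl2_scalar_eq Rep_ut_hom)
  show "U_sl2_scalar ` carrier complex_field \<subseteq> center U_sl2"
    using Rep_ut by (auto simp: center_def U_sl2_scalar_eq ball_U_sl2 Rep_ut_hom(4)[symmetric] sc_central)
qed

definition qm :: "ut set \<Rightarrow> ut \<Rightarrow> ((complex^2^2) list \<Rightarrow> complex) set set" where
  "qm I u = Rep_ut ` I +>\<^bsub>U_sl2\<^esub> Rep_ut u"

lemma qm:
  assumes I: "tideal I"
  defines "A \<equiv> U_sl2 Quot (Rep_ut ` I)"
  shows "ring A" "carrier A = range (qm I)" "qm I 0 = \<zero>\<^bsub>A\<^esub>" "qm I 1 = \<one>\<^bsub>A\<^esub>" "qm I (u + v) = qm I u \<oplus>\<^bsub>A\<^esub> qm I v"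
    "qm I (u * v) = qm I u \<otimes>\<^bsub>A\<^esub> qm I v" "qm I u = \<zero>\<^bsub>A\<^esub> \<longleftrightarrow> u \<in> I" "qm I u = qm I v \<longleftrightarrow> u - v \<in> I"
proof -
  have i: "ideal (Rep_ut ` I) U_sl2" using I by (simp add: ideal_image_iff)
  interpret surj_ring_hom U_sl2 A "a_r_coset U_sl2 (Rep_ut ` I)" unfolding A_def by (rule surj_ring_hom_quot) fact
  note c = Rep_ut
  show "ring A" by (rule S.ring_axioms)
  show "carrier A = range (qm I)" unfolding surj[symmetric] range_Rep_ut[symmetric] qm_def by (simp add: image_image)
  show z: "qm I 0 = \<zero>\<^bsub>A\<^esub>" by (simp add: qm_def Rep_ut_hom)
  show "qm I 1 = \<one>\<^bsub>A\<^esub>" by (simp add: qm_def Rep_ut_hom)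
  show add: "qm I (u + v) = qm I u \<oplus>\<^bsub>A\<^esub> qm I v" for u v by (simp add: qm_def Rep_ut_hom c)
  show "qm I (u * v) = qm I u \<otimes>\<^bsub>A\<^esub> qm I v" by (simp add: qm_def Rep_ut_hom c)
  have "Rep_ut u \<in> pre {\<zero>\<^bsub>A\<^esub>} \<longleftrightarrow> u \<in> I" for u
    unfolding A_def by (simp only: pre_zero_quot[OF i] Rep_ut_mem_iff)
  then show zero: "qm I u = \<zero>\<^bsub>A\<^esub> \<longleftrightarrow> u \<in> I" for u by (simp add: pre_def qm_def c)
  have cl: "qm I u \<in> carrier A" for u by (simp add: qm_def c)
  have "qm I u = qm I (u - v) \<oplus>\<^bsub>A\<^esub> qm I v" using add[of "u - v" v] by simp
  also have "\<dots> = qm I v \<longleftrightarrow> qm I (u - v) = \<zero>\<^bsub>A\<^esub>" using cl by (metis S.add.l_cancel_one S.add.r_cancel_one)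
  finally show "qm I u = qm I v \<longleftrightarrow> u - v \<in> I" by (simp add: zero)
qed

lemma hev_monom: "hev sc u (Polynomial.monom a n) = sc a * u ^ n"
proof (induction n)
  case (Suc n)
  have "u * (sc a * u ^ n) = sc a * u ^ Suc n" using sc_central[of a u] by (simp add: mult.assoc[symmetric])
  then show ?case by (simp add: monom_Suc hev_pCons Suc)
qed (simp add: monom_0 hev_const)

lemma hev_sc_add: "hev sc u (p + q) = hev sc u p + hev sc u q"
  by (rule hev_add) simp_all

lemma hev_sum: "hev sc u (\<Sum>i\<in>S. f i) = (\<Sum>i\<in>S. hev sc u (f i))"
  by (induction S rule: infinite_finite_induct) (simp_all add: hev_sc_add)

lemma algebraic_relation_iff:
  "(\<exists>S :: nat set. \<exists>a. finite S \<and> (\<exists>i\<in>S. a i \<noteq> 0) \<and> (\<Sum>i\<in>S. sc (a i) * u ^ i) \<in> I) \<longleftrightarrow> (\<exists>p. p \<noteq> 0 \<and> hev sc u p \<in> I)"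
proof
  assume "\<exists>S :: nat set. \<exists>a. finite S \<and> (\<exists>i\<in>S. a i \<noteq> 0) \<and> (\<Sum>i\<in>S. sc (a i) * u ^ i) \<in> I"
  then obtain S :: "nat set" and a where *: "finite S" "\<exists>i\<in>S. a i \<noteq> 0" "(\<Sum>i\<in>S. sc (a i) * u ^ i) \<in> I"
    by (elim exE conjE)
  define p where "p = (\<Sum>i\<in>S. Polynomial.monom (a i) i)"
  obtain i where i: "i \<in> S" "a i \<noteq> 0" using *(2) by blast
  have "Polynomial.coeff p i = a i" using *(1) i(1) by (simp add: p_def coeff_sum)
  then have "p \<noteq> 0" using i(2) by auto
  moreover have "hev sc u p \<in> I" using *(3) by (simp add: p_def hev_sum hev_monom)
  ultimately show "\<exists>p. p \<noteq> 0 \<and> hev sc u p \<in> I" by blast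
next
  assume "\<exists>p. p \<noteq> 0 \<and> hev sc u p \<in> I"
  then obtain p where p: "p \<noteq> 0" "hev sc u p \<in> I" by blast
  have "hev sc u p = (\<Sum>i\<in>{..Polynomial.degree p}. sc (Polynomial.coeff p i) * u ^ i)"
    by (subst poly_as_sum_of_monoms[of p, symmetric]) (simp only: hev_sum hev_monom)
  then show "\<exists>S :: nat set. \<exists>a. finite S \<and> (\<exists>i\<in>S. a i \<noteq> 0) \<and> (\<Sum>i\<in>S. sc (a i) * u ^ i) \<in> I"
    using p by (intro exI[of _ "{..Polynomial.degree p}"] exI[of _ "Polynomial.coeff p"] conjI bexI[of _ "Polynomial.degree p"]) auto
qed

section \<open>Goldie quotients of the prime factor rings, and rationality\<close>

locale env_goldie =
  fixes I :: "ut set" and Q :: "'q ring" and \<iota>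
  assumes prime: "tprime I" and goldie: "goldie_quotient_ring (U_sl2 Quot (Rep_ut ` I)) Q \<iota>"
begin

abbreviation "A \<equiv> U_sl2 Quot (Rep_ut ` I)"

definition j :: "ut \<Rightarrow> 'q" where "j u = \<iota> (qm I u)"

lemma ideal: "tideal I" using prime by (simp add: tprime_def)

sublocale ring_hom_ring A Q \<iota> by (rule goldie_hom) (rule goldie)

lemmas quotient = qm[OF ideal]

lemma j_hom: "j u \<in> carrier Q" "j 0 = \<zero>\<^bsub>Q\<^esub>" "j 1 = \<one>\<^bsub>Q\<^esub>" "j (u + v) = j u \<oplus>\<^bsub>Q\<^esub> j v" "j (u * v) = j u \<otimes>\<^bsub>Q\<^esub> j v"
proof -
  have c: "qm I u \<in> carrier A" for u unfolding quotient(2) by simp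
  show "j u \<in> carrier Q" using c by (simp add: j_def)
  show "j 0 = \<zero>\<^bsub>Q\<^esub>" "j 1 = \<one>\<^bsub>Q\<^esub>" unfolding j_def quotient(3,4) by simp_all
  show "j (u + v) = j u \<oplus>\<^bsub>Q\<^esub> j v" unfolding j_def quotient(5) by (rule hom_add[OF c c])
  show "j (u * v) = j u \<otimes>\<^bsub>Q\<^esub> j v" unfolding j_def quotient(6) by (rule hom_mult[OF c c])
qed

lemma j_eq_iff: "j u = j v \<longleftrightarrow> u - v \<in> I"
proof -
  have "inj_on \<iota> (carrier A)" using goldie by (simp add: goldie_quotient_ring_def)
  then have "j u = j v \<longleftrightarrow> qm I u = qm I v" unfolding j_def quotient(2) by (auto simp: inj_on_def)
  then show ?thesis unfolding quotient(8) .
qed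

lemma j_power: "j (u ^ n) = j u [^]\<^bsub>Q\<^esub> n"
proof (induction n)
  case (Suc n)
  then show ?case unfolding power_Suc2 by (simp add: j_hom)
qed (simp add: j_hom)

lemma scalars_eq: "scalars_in_quotient complex_field U_sl2 U_sl2_scalar (Rep_ut ` I) \<iota> = range (\<lambda>c. j (sc c))"
  by (simp add: scalars_in_quotient_def U_sl2_scalar_eq j_def qm_def)

lemma center_powers: "z [^]\<^bsub>center_ring Q\<^esub> (n::nat) = z [^]\<^bsub>Q\<^esub> n"
  by (induction n) (simp_all add: center_ring_def)

lemma j_sc_center: "j (sc c) \<in> center Q"
proof -
  have "subring (range (\<lambda>c. j (sc c))) (center_ring Q)"
    unfolding scalars_eq[symmetric]
    using scalars_subring[OF k_algebra_U_sl2 _ goldie] ideal ideal_image_iff by blast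
  then have "range (\<lambda>c. j (sc c)) \<subseteq> carrier (center_ring Q)" by (rule subringE(1))
  then show ?thesis by (auto simp: center_ring_def)
qed

lemma algebraic_iff:
  assumes z: "j u \<in> center Q"
  shows "ring.algebraic (center_ring Q) (scalars_in_quotient complex_field U_sl2 U_sl2_scalar (Rep_ut ` I) \<iota>) (j u) \<longleftrightarrow>
    (\<exists>p. p \<noteq> 0 \<and> hev sc u p \<in> I)"
proof -
  have spec: "Rep_ut ` I \<in> spec U_sl2" using prime by (simp add: spec_image_iff)
  have dom: "domain (center_ring Q)" by (rule center_ring_domain[OF goldie prime_quot_zero[OF specD(1)[OF spec]]])
  interpret Z: domain "center_ring Q" by (rule dom)
  have sub: "subring (range (\<lambda>c. j (sc c))) (center_ring Q)"
    using scalars_subring[OF k_algebra_U_sl2 specD(2)[OF spec] goldie] unfolding scalars_eq .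
  have sum: "(\<Oplus>\<^bsub>center_ring Q\<^esub>i\<in>S. j (sc (a i)) \<otimes>\<^bsub>center_ring Q\<^esub> j u [^]\<^bsub>center_ring Q\<^esub> i) = j (\<Sum>i\<in>S. sc (a i) * u ^ i)"
    if "finite S" for S :: "nat set" and a
    using that
  proof (induction S rule: finite_induct)
    case empty
    show ?case unfolding Z.finsum_empty sum.empty by (simp add: j_hom center_ring_def)
  next
    case (insert n S)
    have c: "j (sc (a i)) \<otimes>\<^bsub>center_ring Q\<^esub> j u [^]\<^bsub>center_ring Q\<^esub> i \<in> carrier (center_ring Q)" for i
      by (intro Z.m_closed Z.nat_pow_closed) (simp_all add: center_ring_def z j_sc_center)
    then have "(\<Oplus>\<^bsub>center_ring Q\<^esub>i\<in>insert n S. j (sc (a i)) \<otimes>\<^bsub>center_ring Q\<^esub> j u [^]\<^bsub>center_ring Q\<^esub> i) =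
        j (sc (a n)) \<otimes>\<^bsub>center_ring Q\<^esub> j u [^]\<^bsub>center_ring Q\<^esub> n \<oplus>\<^bsub>center_ring Q\<^esub>
          (\<Oplus>\<^bsub>center_ring Q\<^esub>i\<in>S. j (sc (a i)) \<otimes>\<^bsub>center_ring Q\<^esub> j u [^]\<^bsub>center_ring Q\<^esub> i)"
      using insert.hyps by (intro Z.finsum_insert) auto
    then show ?case unfolding insert.IH unfolding center_powers sum.insert[OF insert.hyps]
      by (simp add: j_hom j_power center_ring_def)
  qed
  have jsc: "j (sc c) = \<zero>\<^bsub>Q\<^esub> \<longleftrightarrow> c = 0" for c
  proof
    assume "j (sc c) = \<zero>\<^bsub>Q\<^esub>"
    then have "sc c \<in> I" using j_eq_iff[of "sc c" 0] by (simp add: j_hom)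
    then have "c \<noteq> 0 \<Longrightarrow> 1 \<in> I" using tideal_unscale[OF ideal, of c 1] by simp
    then show "c = 0" using prime by (auto simp: tprime_def)
  qed (simp add: j_hom)
  have "ring.algebraic (center_ring Q) (range (\<lambda>c. j (sc c))) (j u) \<longleftrightarrow>
      (\<exists>S :: nat set. \<exists>c. finite S \<and> c \<in> S \<rightarrow> range (\<lambda>c. j (sc c)) \<and> (\<exists>i\<in>S. c i \<noteq> \<zero>\<^bsub>center_ring Q\<^esub>) \<and>
           (\<Oplus>\<^bsub>center_ring Q\<^esub>i\<in>S. c i \<otimes>\<^bsub>center_ring Q\<^esub> j u [^]\<^bsub>center_ring Q\<^esub> i) = \<zero>\<^bsub>center_ring Q\<^esub>)"
    by (rule Z.algebraic_iff[OF sub]) (simp add: center_ring_def z)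
  also have "\<dots> \<longleftrightarrow> (\<exists>S :: nat set. \<exists>a. finite S \<and> (\<exists>i\<in>S. a i \<noteq> 0) \<and> (\<Sum>i\<in>S. sc (a i) * u ^ i) \<in> I)"
  proof
    assume "\<exists>S :: nat set. \<exists>c. finite S \<and> c \<in> S \<rightarrow> range (\<lambda>c. j (sc c)) \<and> (\<exists>i\<in>S. c i \<noteq> \<zero>\<^bsub>center_ring Q\<^esub>) \<and>
           (\<Oplus>\<^bsub>center_ring Q\<^esub>i\<in>S. c i \<otimes>\<^bsub>center_ring Q\<^esub> j u [^]\<^bsub>center_ring Q\<^esub> i) = \<zero>\<^bsub>center_ring Q\<^esub>"
    then obtain S :: "nat set" and c where *: "finite S" "c \<in> S \<rightarrow> range (\<lambda>c. j (sc c))" "\<exists>i\<in>S. c i \<noteq> \<zero>\<^bsub>center_ring Q\<^esub>"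
      "(\<Oplus>\<^bsub>center_ring Q\<^esub>i\<in>S. c i \<otimes>\<^bsub>center_ring Q\<^esub> j u [^]\<^bsub>center_ring Q\<^esub> i) = \<zero>\<^bsub>center_ring Q\<^esub>"
      by (elim exE conjE)
    have "\<exists>a. \<forall>i\<in>S. c i = j (sc (a i))" using *(2) by (intro bchoice) auto
    then obtain a where a: "\<And>i. i \<in> S \<Longrightarrow> c i = j (sc (a i))" by blast
    have "(\<Oplus>\<^bsub>center_ring Q\<^esub>i\<in>S. c i \<otimes>\<^bsub>center_ring Q\<^esub> j u [^]\<^bsub>center_ring Q\<^esub> i) =
        (\<Oplus>\<^bsub>center_ring Q\<^esub>i\<in>S. j (sc (a i)) \<otimes>\<^bsub>center_ring Q\<^esub> j u [^]\<^bsub>center_ring Q\<^esub> i)"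
    proof (rule Z.finsum_cong', rule refl)
      show "(\<lambda>i. j (sc (a i)) \<otimes>\<^bsub>center_ring Q\<^esub> j u [^]\<^bsub>center_ring Q\<^esub> i) \<in> S \<rightarrow> carrier (center_ring Q)"
        by (intro Pi_I Z.m_closed Z.nat_pow_closed) (simp_all add: center_ring_def z j_sc_center)
    qed (simp add: a)
    then have "j (\<Sum>i\<in>S. sc (a i) * u ^ i) = j 0" using *(4) sum[OF *(1)] by (simp add: center_ring_def j_hom)
    then have "(\<Sum>i\<in>S. sc (a i) * u ^ i) \<in> I" unfolding j_eq_iff by simp
    moreover have "\<exists>i\<in>S. a i \<noteq> 0" using *(3) a jsc by (simp add: center_ring_def)
    ultimately show "\<exists>S :: nat set. \<exists>a. finite S \<and> (\<exists>i\<in>S. a i \<noteq> 0) \<and> (\<Sum>i\<in>S. sc (a i) * u ^ i) \<in> I"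
      using *(1) by blast
  next
    assume "\<exists>S :: nat set. \<exists>a. finite S \<and> (\<exists>i\<in>S. a i \<noteq> 0) \<and> (\<Sum>i\<in>S. sc (a i) * u ^ i) \<in> I"
    then obtain S :: "nat set" and a where *: "finite S" "\<exists>i\<in>S. a i \<noteq> 0" "(\<Sum>i\<in>S. sc (a i) * u ^ i) \<in> I"
      by (elim exE conjE)
    have "j (\<Sum>i\<in>S. sc (a i) * u ^ i) = j 0" using *(3) unfolding j_eq_iff by simp
    then have "(\<Oplus>\<^bsub>center_ring Q\<^esub>i\<in>S. j (sc (a i)) \<otimes>\<^bsub>center_ring Q\<^esub> j u [^]\<^bsub>center_ring Q\<^esub> i) = \<zero>\<^bsub>center_ring Q\<^esub>"
      using sum[OF *(1)] by (simp add: center_ring_def j_hom)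
    moreover have "\<exists>i\<in>S. j (sc (a i)) \<noteq> \<zero>\<^bsub>center_ring Q\<^esub>" using *(2) jsc by (simp add: center_ring_def)
    ultimately show "\<exists>S :: nat set. \<exists>c. finite S \<and> c \<in> S \<rightarrow> range (\<lambda>c. j (sc c)) \<and> (\<exists>i\<in>S. c i \<noteq> \<zero>\<^bsub>center_ring Q\<^esub>) \<and>
           (\<Oplus>\<^bsub>center_ring Q\<^esub>i\<in>S. c i \<otimes>\<^bsub>center_ring Q\<^esub> j u [^]\<^bsub>center_ring Q\<^esub> i) = \<zero>\<^bsub>center_ring Q\<^esub>"
      using *(1) by (intro exI[of _ S] exI[of _ "\<lambda>i. j (sc (a i))"]) auto
  qed
  also have "\<dots> \<longleftrightarrow> (\<exists>p. p \<noteq> 0 \<and> hev sc u p \<in> I)" by (rule algebraic_relation_iff)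
  finally show ?thesis unfolding scalars_eq .
qed

end

text \<open>W is central in U and hence in the quotient ring, and it satisfies no nonzero polynomial
  over C.\<close>

lemma zero_not_rational: "\<not> rational_prime complex_field U_sl2 U_sl2_scalar (Rep_ut ` {0})"
proof
  assume "rational_prime complex_field U_sl2 U_sl2_scalar (Rep_ut ` {0})"
  then obtain Q :: "(((complex^2^2) list \<Rightarrow> complex) set set \<times> ((complex^2^2) list \<Rightarrow> complex) set set) set ring" and \<iota>
    where G: "goldie_quotient_ring (U_sl2 Quot (Rep_ut ` {0})) Q \<iota>"
      and alg: "\<forall>z\<in>center Q. ring.algebraic (center_ring Q) (scalars_in_quotient complex_field U_sl2 U_sl2_scalar (Rep_ut ` {0}) \<iota>) z"
    unfolding rational_prime_def by (elim exE conjE)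
  interpret env_goldie "{0}" Q \<iota> using tprime_zero G by (rule env_goldie.intro)
  have "qm {0} gW \<otimes>\<^bsub>A\<^esub> qm {0} u = qm {0} u \<otimes>\<^bsub>A\<^esub> qm {0} gW" for u
    unfolding quotient(6)[symmetric] gW_central[of u] ..
  then have "qm {0} gW \<in> center A" unfolding center_def quotient(2) by blast
  then have z: "j gW \<in> center Q" unfolding j_def by (rule goldie_center[OF goldie])
  then have "\<exists>p. p \<noteq> 0 \<and> hev sc gW p \<in> {0}" using alg algebraic_iff by blast
  then show False using pw_eq_0_iff unfolding pw_def by blast
qed

lemma cas_rational: "rational_prime complex_field U_sl2 U_sl2_scalar (Rep_ut ` cas_ideal c)"
proof -
  let ?I = "cas_ideal c"
  let ?A = "U_sl2 Quot (Rep_ut ` ?I)"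
  note quot = qm[OF tideal_cas_ideal, of c]
  have nzd: "ring_without_zero_divisors ?A"
    unfolding ring_without_zero_divisors_def quot(2)
  proof (intro conjI ballI impI)
    show "ring ?A" by (rule quot(1))
    show "\<one>\<^bsub>?A\<^esub> \<noteq> \<zero>\<^bsub>?A\<^esub>" unfolding quot(4)[symmetric] quot(7) by (rule one_notin_cas)
    fix a b assume ab: "a \<in> range (qm ?I)" "b \<in> range (qm ?I)" "a \<otimes>\<^bsub>?A\<^esub> b = \<zero>\<^bsub>?A\<^esub>"
    then obtain u v where uv: "a = qm ?I u" "b = qm ?I v" by blast
    then have "u * v \<in> ?I" using ab(3) by (simp add: quot(6)[symmetric] quot(7))
    then have "u \<in> ?I \<or> v \<in> ?I" by (rule cas_ideal_completely_prime)
    then show "a = \<zero>\<^bsub>?A\<^esub> \<or> b = \<zero>\<^bsub>?A\<^esub>" unfolding uv quot(7) .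
  qed
  have "ideal (Rep_ut ` ?I) U_sl2" using tideal_cas_ideal by (simp add: ideal_image_iff)
  then interpret s: surj_ring_hom U_sl2 ?A "a_r_coset U_sl2 (Rep_ut ` ?I)" by (rule surj_ring_hom_quot)
  have "noetherian ?A" by (rule s.noetherian_image) (rule noetherian_U_sl2)
  with nzd have "\<exists>(Q :: (((complex^2^2) list \<Rightarrow> complex) set set \<times> ((complex^2^2) list \<Rightarrow> complex) set set) set ring) \<iota>.
    goldie_quotient_ring ?A Q \<iota>" by (rule noetherian_domain_goldie)
  then obtain Q :: "(((complex^2^2) list \<Rightarrow> complex) set set \<times> ((complex^2^2) list \<Rightarrow> complex) set set) set ring" and \<iota>
    where G: "goldie_quotient_ring ?A Q \<iota>" by (elim exE)
  interpret env_goldie ?I Q \<iota> using tprime_cas_ideal G by (rule env_goldie.intro)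
  have regular: "qm ?I u \<in> regular_elements A" if "u \<notin> ?I" for u
    using that nzd quotient(7)[of u] unfolding regular_elements_def ring_without_zero_divisors_def quotient(2) by blast
  have "ring.algebraic (center_ring Q) (scalars_in_quotient complex_field U_sl2 U_sl2_scalar (Rep_ut ` ?I) \<iota>) z"
    if z: "z \<in> center Q" for z
  proof -
    have zQ: "z \<in> carrier Q" and comm: "\<And>x. x \<in> carrier Q \<Longrightarrow> z \<otimes>\<^bsub>Q\<^esub> x = x \<otimes>\<^bsub>Q\<^esub> z" using z by (auto simp: center_def)
    obtain a s where as: "a \<in> carrier A" "s \<in> regular_elements A" "z \<otimes>\<^bsub>Q\<^esub> \<iota> s = \<iota> a"
      using goldie_right_fraction[OF goldie zQ] by metis
    have "s \<in> range (qm ?I)" using subsetD[OF regular_carrier as(2)] unfolding quotient(2) .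
    then obtain u where u: "s = qm ?I u" by (elim rangeE)
    have unI: "u \<notin> ?I"
    proof
      assume "u \<in> ?I"
      then have "s \<otimes>\<^bsub>A\<^esub> qm ?I 1 = \<zero>\<^bsub>A\<^esub>" unfolding u quotient(6)[symmetric] mult_1_right quotient(7) .
      moreover have "qm ?I 1 \<in> carrier A" unfolding quotient(2) by simp
      ultimately have "qm ?I 1 = \<zero>\<^bsub>A\<^esub>" using as(2) unfolding regular_elements_def by blast
      then show False using one_notin_cas unfolding quotient(7) by blast
    qed
    \<comment> \<open>The denominators of z; they form a two-sided ideal because z is
      central.\<close>
    define J where "J = {x. \<exists>y. z \<otimes>\<^bsub>Q\<^esub> j x = j y}"
    have J: "tideal J"
      unfolding tideal_def
    proof (intro conjI ballI allI)
      have "z \<otimes>\<^bsub>Q\<^esub> j 0 = j 0" using zQ by (simp add: j_hom)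
      then show "0 \<in> J" unfolding J_def by blast
      show "x + y \<in> J" if xy: "x \<in> J" "y \<in> J" for x y
      proof -
        obtain x' y' where "z \<otimes>\<^bsub>Q\<^esub> j x = j x'" "z \<otimes>\<^bsub>Q\<^esub> j y = j y'" using xy unfolding J_def by blast
        then have "z \<otimes>\<^bsub>Q\<^esub> j (x + y) = j (x' + y')" using zQ by (simp add: j_hom S.r_distr)
        then show ?thesis unfolding J_def by blast
      qed
      show "v * x \<in> J" "x * v \<in> J" if x: "x \<in> J" for v x
      proof -
        obtain y where y: "z \<otimes>\<^bsub>Q\<^esub> j x = j y" using x unfolding J_def by blast
        have "z \<otimes>\<^bsub>Q\<^esub> j (v * x) = (z \<otimes>\<^bsub>Q\<^esub> j v) \<otimes>\<^bsub>Q\<^esub> j x" using zQ by (simp add: j_hom S.m_assoc)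
        also have "\<dots> = j v \<otimes>\<^bsub>Q\<^esub> (z \<otimes>\<^bsub>Q\<^esub> j x)" unfolding comm[OF j_hom(1)] using zQ by (simp add: j_hom S.m_assoc comm[OF j_hom(1)])
        also have "\<dots> = j (v * y)" by (simp add: y j_hom)
        finally show "v * x \<in> J" unfolding J_def by blast
        have "z \<otimes>\<^bsub>Q\<^esub> j (x * v) = (z \<otimes>\<^bsub>Q\<^esub> j x) \<otimes>\<^bsub>Q\<^esub> j v" using zQ by (simp add: j_hom S.m_assoc)
        also have "\<dots> = j (y * v)" by (simp add: y j_hom)
        finally show "x * v \<in> J" unfolding J_def by blast
      qed
    qed
    have "j (gW - sc c) = \<zero>\<^bsub>Q\<^esub>" using j_eq_iff[of "gW - sc c" 0] W_cas_ideal by (simp add: j_hom)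
    then have "z \<otimes>\<^bsub>Q\<^esub> j (gW - sc c) = j 0" using zQ by (simp add: j_hom)
    then have W: "gW - sc c \<in> J" unfolding J_def by blast
    obtain v where "a = qm ?I v" using as(1) unfolding quotient(2) by (elim rangeE)
    then have "z \<otimes>\<^bsub>Q\<^esub> j u = j v" using as(3) by (simp add: j_def u)
    then have "u \<in> J" unfolding J_def by blast
    then have "\<exists>m. gE ^ m \<in> J" using unI by (rule tideal_E_power[OF J W])
    then obtain m y where y: "z \<otimes>\<^bsub>Q\<^esub> j (gE ^ m) = j y" unfolding J_def by blast
    \<comment> \<open>As z commutes with v and w, y = zE^m inherits the commutation rules of
      E^m.\<close>
    have slide: "j (v * y) = j (y * w)" if "v * gE ^ m = gE ^ m * w" for v w
    proof -
      have "j (v * y) = j v \<otimes>\<^bsub>Q\<^esub> (z \<otimes>\<^bsub>Q\<^esub> j (gE ^ m))" by (simp add: y j_hom)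
      also have "\<dots> = (z \<otimes>\<^bsub>Q\<^esub> j v) \<otimes>\<^bsub>Q\<^esub> j (gE ^ m)" unfolding comm[OF j_hom(1)] using zQ by (simp add: j_hom S.m_assoc comm[OF j_hom(1)])
      also have "\<dots> = z \<otimes>\<^bsub>Q\<^esub> j (v * gE ^ m)" using zQ by (simp add: j_hom(1,5) S.m_assoc)
      also have "\<dots> = (z \<otimes>\<^bsub>Q\<^esub> j (gE ^ m)) \<otimes>\<^bsub>Q\<^esub> j w" unfolding that using zQ by (simp add: j_hom(1,5) S.m_assoc)
      finally show ?thesis by (simp add: y j_hom)
    qed
    have "gT * gE ^ m = gE ^ m * (gT + of_nat m)" using pm_E_power[of tt m] by simp
    from slide[OF this] have T: "gT * y - y * (gT + of_nat m) \<in> ?I" unfolding j_eq_iff .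
    have "gE * gE ^ m = gE ^ m * gE" by (rule power_commutes[symmetric])
    from slide[OF this] have E: "gE * y - y * gE \<in> ?I" unfolding j_eq_iff .
    have "\<exists>r. y - sc r * gE ^ m \<in> ?I" using T E by (rule cas_ideal_centralizer)
    then obtain r where "y - sc r * gE ^ m \<in> ?I" by (elim exE)
    then have "z \<otimes>\<^bsub>Q\<^esub> j (gE ^ m) = j (sc r) \<otimes>\<^bsub>Q\<^esub> j (gE ^ m)" unfolding y j_eq_iff[symmetric] by (simp add: j_hom)
    moreover have unit: "j (gE ^ m) \<in> Units Q" unfolding j_def by (rule goldie_unit(2)[OF goldie regular[OF E_notin_cas]])
    moreover have "x \<otimes>\<^bsub>Q\<^esub> j (gE ^ m) \<otimes>\<^bsub>Q\<^esub> inv\<^bsub>Q\<^esub> j (gE ^ m) = x" if "x \<in> carrier Q" for x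
      using that unit j_hom(1)[of "gE ^ m"] by (simp add: S.m_assoc)
    ultimately have zr: "z = j (sc r)" using zQ j_hom(1)[of "sc r"] by metis
    have "hev sc (sc r) [:- r, 1:] = 0" by (simp add: hev_pCons)
    then have "hev sc (sc r) [:- r, 1:] \<in> ?I" using tidealD(1)[OF ideal] by simp
    moreover have "[:- r, 1:] \<noteq> 0" by simp
    ultimately show ?thesis unfolding zr algebraic_iff[OF j_sc_center] by blast
  qed
  then show ?thesis unfolding rational_prime_def using G by blast
qed

text \<open>If all regular elements are units, fractions add nothing; f merely produces a copy of A
  in another type.\<close>

lemma goldie_quotient_self:
  fixes A :: "'a ring" (structure)
  assumes A: "ring A" and reg: "regular_elements A \<subseteq> Units A" and f: "inj_on f (carrier A)"
  shows "goldie_quotient_ring A (image_ring f A) f"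
proof -
  interpret ring A by fact
  have Q: "ring (image_ring f A)" by (rule inj_imp_image_ring_is_ring) fact
  have h: "f \<in> ring_hom A (image_ring f A)"
    using inj_imp_image_ring_iso[OF f] by (simp add: ring_iso_def)
  interpret h: ring_hom_ring A "image_ring f A" f by (intro ring_hom_ringI2 A Q h)
  have u: "f ` regular_elements A \<subseteq> Units (image_ring f A)"
  proof
    fix y assume "y \<in> f ` regular_elements A"
    then obtain s where s: "s \<in> Units A" "y = f s" using reg by blast
    then have si: "s \<in> carrier A" "inv s \<in> carrier A" "inv s \<otimes> s = \<one>" "s \<otimes> inv s = \<one>" by auto
    have "f (inv s) \<otimes>\<^bsub>image_ring f A\<^esub> f s = \<one>\<^bsub>image_ring f A\<^esub>" "f s \<otimes>\<^bsub>image_ring f A\<^esub> f (inv s) = \<one>\<^bsub>image_ring f A\<^esub>"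
      using h.hom_mult[OF si(2,1)] h.hom_mult[OF si(1,2)] si by simp_all
    then show "y \<in> Units (image_ring f A)" unfolding s(2) Units_def using h.hom_closed si(1,2) by blast
  qed
  have one: "\<one> \<in> regular_elements A" by (simp add: regular_elements_def)
  have "\<exists>a\<in>carrier A. \<exists>s\<in>regular_elements A. q = f a \<otimes>\<^bsub>image_ring f A\<^esub> inv\<^bsub>image_ring f A\<^esub> (f s)"
    "\<exists>a\<in>carrier A. \<exists>s\<in>regular_elements A. q = inv\<^bsub>image_ring f A\<^esub> (f s) \<otimes>\<^bsub>image_ring f A\<^esub> f a"
    if "q \<in> carrier (image_ring f A)" for q
  proof -
    have "q \<in> f ` carrier A" using that by (simp only: image_ring_carrier)
    then obtain a where a: "a \<in> carrier A" "q = f a" by (elim imageE)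
    then have "q = f a \<otimes>\<^bsub>image_ring f A\<^esub> inv\<^bsub>image_ring f A\<^esub> (f \<one>)" "q = inv\<^bsub>image_ring f A\<^esub> (f \<one>) \<otimes>\<^bsub>image_ring f A\<^esub> f a"
      by simp_all
    then show "\<exists>a\<in>carrier A. \<exists>s\<in>regular_elements A. q = f a \<otimes>\<^bsub>image_ring f A\<^esub> inv\<^bsub>image_ring f A\<^esub> (f s)"
      "\<exists>a\<in>carrier A. \<exists>s\<in>regular_elements A. q = inv\<^bsub>image_ring f A\<^esub> (f s) \<otimes>\<^bsub>image_ring f A\<^esub> f a"
      using one a(1) by blast+
  qed
  then show ?thesis unfolding goldie_quotient_ring_def using A Q h f u by blast
qed

text \<open>Modulo \<open>fin_ideal n\<close> every element satisfies a polynomial over C. If it is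
  regular, the variable can be cancelled until the constant coefficient is nonzero, and the relation
  then exhibits an inverse.\<close>

lemma fin_rational: "rational_prime complex_field U_sl2 U_sl2_scalar (Rep_ut ` fin_ideal n)"
proof -
  let ?I = "fin_ideal n"
  let ?A = "U_sl2 Quot (Rep_ut ` ?I)"
  note quot = qm[OF tideal_fin_ideal, of n]
  have alg: "\<exists>p. p \<noteq> 0 \<and> hev sc u p \<in> ?I" for u
    using fin_ideal_algebraic algebraic_relation_iff by blast
  have "regular_elements ?A \<subseteq> Units ?A"
  proof
    fix s assume s: "s \<in> regular_elements ?A"
    then obtain u where u: "s = qm ?I u" using regular_carrier[of ?A] quot(2) by blast
    have reg: "x \<in> ?I" if "u * x \<in> ?I" for x
    proof -
      have "s \<otimes>\<^bsub>?A\<^esub> qm ?I x = \<zero>\<^bsub>?A\<^esub>" using that unfolding u quot(6)[symmetric] quot(7) .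
      moreover have "qm ?I x \<in> carrier ?A" unfolding quot(2) by simp
      ultimately have "qm ?I x = \<zero>\<^bsub>?A\<^esub>" using s unfolding regular_elements_def by blast
      then show ?thesis unfolding quot(7) .
    qed
    have inverse: "\<exists>w. u * w - 1 \<in> ?I \<and> w * u - 1 \<in> ?I" if "p \<noteq> 0" "hev sc u p \<in> ?I" for p
      using that
    proof (induction p)
      case (pCons a p)
      have e: "sc a + u * hev sc u p \<in> ?I" using pCons.prems(2) by (simp add: hev_pCons)
      show ?case
      proof (cases "a = 0")
        case True
        then have "u * hev sc u p \<in> ?I" using e by simp
        then have "hev sc u p \<in> ?I" by (rule reg)
        moreover have "p \<noteq> 0" using True pCons.prems(1) by simp
        ultimately show ?thesis by (intro pCons.IH)
      next
        case False
        define w where "w = sc (- 1 / a) * hev sc u p"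
        have c: "u * hev sc u p = hev sc u p * u" by (rule hev_comm) (simp, rule sc_central[symmetric], simp)
        have "sc (- 1 / a) * (sc a + u * hev sc u p) = sc (- 1 / a * a) + u * w"
          unfolding w_def distrib_left sc_hom(3) mult.assoc[symmetric] sc_central[of "- 1 / a" u] ..
        also have "\<dots> = u * w - 1" using False by (simp del: sc_hom(3))
        finally have 1: "u * w - 1 \<in> ?I" using tidealD(3)[OF tideal_fin_ideal e] by metis
        have uw: "u * w = w * u" unfolding w_def mult.assoc c[symmetric] by (simp only: mult.assoc[symmetric] sc_central[of "- 1 / a" u])
        show ?thesis using 1 1[unfolded uw] by blast
      qed
    qed simp
    obtain p where "p \<noteq> 0" "hev sc u p \<in> ?I" using alg by blast
    then have "\<exists>w. u * w - 1 \<in> ?I \<and> w * u - 1 \<in> ?I" by (rule inverse)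
    then obtain w where w: "u * w - 1 \<in> ?I" "w * u - 1 \<in> ?I" by blast
    then have "s \<otimes>\<^bsub>?A\<^esub> qm ?I w = \<one>\<^bsub>?A\<^esub>" "qm ?I w \<otimes>\<^bsub>?A\<^esub> s = \<one>\<^bsub>?A\<^esub>"
      unfolding u quot(6)[symmetric] quot(4)[symmetric] quot(8) .
    moreover have "s \<in> carrier ?A" "qm ?I w \<in> carrier ?A" unfolding u quot(2) by simp_all
    ultimately show "s \<in> Units ?A" unfolding Units_def by blast
  qed
  \<comment> \<open>The singletons {(a, a)} place a copy of the factor ring in the type over which
    \<open>rational_prime\<close> quantifies.\<close>
  then have G: "goldie_quotient_ring ?A (image_ring (\<lambda>a. {(a, a)}) ?A) (\<lambda>a. {(a, a)})"
    by (intro goldie_quotient_self quot(1)) (auto simp: inj_on_def)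
  interpret env_goldie ?I "image_ring (\<lambda>a. {(a, a)}) ?A" "\<lambda>a. {(a, a)}" using tprime_fin_ideal G by (rule env_goldie.intro)
  have "ring.algebraic (center_ring (image_ring (\<lambda>a. {(a, a)}) ?A))
      (scalars_in_quotient complex_field U_sl2 U_sl2_scalar (Rep_ut ` ?I) (\<lambda>a. {(a, a)})) z"
    if z: "z \<in> center (image_ring (\<lambda>a. {(a, a)}) ?A)" for z
  proof -
    have "z \<in> (\<lambda>a. {(a, a)}) ` carrier ?A" using z unfolding center_def image_ring_carrier by blast
    then obtain u where u: "z = j u" unfolding j_def quotient(2) by blast
    show ?thesis using alg z unfolding u by (simp only: algebraic_iff)
  qed
  then show ?thesis unfolding rational_prime_def using G by blast
qed

theorem dixmier_moeglin_U_sl2: "dixmier_moeglin complex_field U_sl2 U_sl2_scalar"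
  unfolding dixmier_moeglin_def
proof (intro ballI)
  fix S assume "S \<in> spec U_sl2"
  then obtain P where P: "tprime P" "S = Rep_ut ` P" by (rule spec_cases)
  have cas: "primitive_ideal U_sl2 (Rep_ut ` cas_ideal c)" for c
    using cas_ideal_primitive primitive_image_iff by blast
  have fin: "primitive_ideal U_sl2 (Rep_ut ` fin_ideal n)" for n
    using fin_ideal_primitive primitive_image_iff by blast
  have zero: "\<not> primitive_ideal U_sl2 (Rep_ut ` {0})"
    using tbound_nonzero primitive_image_iff by metis
  from P(1) show "(primitive_ideal U_sl2 S \<longleftrightarrow> locally_closed_prime U_sl2 S) \<and>
      (locally_closed_prime U_sl2 S \<longleftrightarrow> rational_prime complex_field U_sl2 U_sl2_scalar S)"
  proof (cases rule: tprime_cases)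
    case 1
    show ?thesis unfolding P(2) 1 using zero zero_not_locally_closed zero_not_rational by blast
  next
    case (2 c)
    show ?thesis unfolding P(2) 2 using cas cas_locally_closed cas_rational by blast
  next
    case (3 n)
    show ?thesis unfolding P(2) 3 using fin fin_locally_closed fin_rational by blast
  qed
qed

section \<open>Failure of the strong equivalence at the zero ideal\<close>

theorem not_strong_dixmier_moeglin_U_sl2: "\<not> strong_dixmier_moeglin complex_field U_sl2 U_sl2_scalar"
proof
  let ?O = "Rep_ut ` {0}"
  let ?A = "U_sl2 Quot ?O"
  assume "strong_dixmier_moeglin complex_field U_sl2 U_sl2_scalar"
  moreover have "?O \<in> spec U_sl2" using tprime_zero by (rule spec_image_iff[THEN iffD2])
  ultimately have eq: "loc_deg U_sl2 ?O = prim_deg U_sl2 ?O" unfolding strong_dixmier_moeglin_def by blast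
  have z: "tideal {0}" using tprime_zero by (simp add: tprime_def)
  then have i: "ideal ?O U_sl2" by (rule ideal_image_iff[THEN iffD2])
  then interpret surj_ring_hom U_sl2 ?A "a_r_coset U_sl2 ?O" by (rule surj_ring_hom_quot)
  define im where "im P = a_r_coset U_sl2 ?O ` Rep_ut ` P" for P
  have im_carrier: "im P \<subseteq> carrier ?A" for P unfolding im_def surj[symmetric] using Rep_ut by auto
  have pre_im: "pre (im P) = Rep_ut ` P" if "tideal P" for P
  proof -
    have "ideal (Rep_ut ` P) U_sl2" using that by (simp add: ideal_image_iff)
    then have "additive_subgroup (Rep_ut ` P) U_sl2" by (rule ideal.axioms(1))
    moreover have "pre {\<zero>\<^bsub>?A\<^esub>} \<subseteq> Rep_ut ` P" unfolding pre_zero_quot[OF i] using tidealD(1)[OF that] by auto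
    ultimately show ?thesis unfolding im_def by (rule pre_img)
  qed
  have im_spec: "im P \<in> spec ?A" if "tprime P" for P
    using spec_pre_iff[OF im_carrier, of P] pre_im that by (simp add: spec_image_iff tprime_def)
  have im_psubset: "im P \<subset> im P'" if "tprime P" "tprime P'" "P \<subset> P'" for P P'
    using pre_psubset_iff[OF im_carrier im_carrier, of P P'] pre_im that by (simp add: tprime_def image_psubset_iff)
  have spec_im: "\<exists>P. tprime P \<and> S = im P" if S: "S \<in> spec ?A" for S
  proof -
    have "pre S \<in> spec U_sl2" using spec_pre_iff specD(4)[OF S] S by blast
    then obtain P where P: "tprime P" "pre S = Rep_ut ` P" by (rule spec_cases)
    then have "S = im P" using img_pre specD(4)[OF S] unfolding im_def by metis
    then show ?thesis using P(1) by blast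
  qed
  have psubset_im: "P \<subset> P'" if "tprime P" "tprime P'" "im P \<subset> im P'" for P P'
    using pre_psubset_iff[OF im_carrier im_carrier, of P P'] pre_im that by (simp add: tprime_def image_psubset_iff)
  \<comment> \<open>A chain of length 2 ending here would contain a nonzero prime P' strictly below
    \<open>cas_ideal 0\<close>. But P' contains some W - c, where c must be 0, and then all of
    \<open>cas_ideal 0\<close>.\<close>
  have "\<not> enat 1 < height ?A (im (cas_ideal 0))"
  proof
    assume "enat 1 < height ?A (im (cas_ideal 0))"
    then obtain n C where C: "n > 1" "\<forall>i\<le>n. C i \<in> spec ?A" "\<forall>i<n. C i \<subset> C (Suc i)" "C n = im (cas_ideal 0)"
      unfolding enat_less_height_iff by blast
    obtain k where k: "n = Suc (Suc k)" using C(1) by (metis One_nat_def less_imp_Suc_add plus_1_eq_Suc add_Suc)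
    obtain P P' where P: "tprime P" "C k = im P" "tprime P'" "C (Suc k) = im P'"
      using spec_im C(2) k by (metis Suc_leD order_refl)
    have "im P \<subset> im P'" "im P' \<subset> im (cas_ideal 0)" using C(3,4) k P by (metis lessI less_SucI)+
    then have PP: "P \<subset> P'" "P' \<subset> cas_ideal 0" using psubset_im P tprime_cas_ideal by blast+
    have P': "tideal P'" using P(3) by (simp add: tprime_def)
    have "0 \<in> P" using P(1) tidealD(1) by (auto simp: tprime_def)
    then obtain u where "u \<in> P'" "u \<noteq> 0" using PP(1) by blast
    then have "\<exists>c. gW - sc c \<in> P'" by (rule tprime_contains_casimir[OF P(3)])
    then obtain c where c: "gW - sc c \<in> P'" by (elim exE)
    then have "gW - sc c \<in> cas_ideal 0" using PP(2) by blast
    then have "0 = c" unfolding W_cas_ideal .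
    then have "cas_ideal 0 \<subseteq> P'" using cas_ideal_least[OF P' c] by simp
    then show False using PP(2) by blast
  qed
  moreover have "primitive_ideal ?A (im (cas_ideal 0))"
  proof -
    have "primitive_ideal U_sl2 (Rep_ut ` cas_ideal 0)" using cas_ideal_primitive primitive_image_iff by blast
    then show ?thesis using primitive_pre_iff[OF im_carrier, of "cas_ideal 0"] pre_im[OF tideal_cas_ideal] by simp
  qed
  then have "prim_deg U_sl2 ?O \<le> height ?A (im (cas_ideal 0))" unfolding prim_deg_def by (intro Inf_lower) blast
  ultimately have le: "loc_deg U_sl2 ?O \<le> enat 1" unfolding eq by (meson leI order_trans not_le)
  let ?S = "{enat d |d. carrier ?A \<inter> \<Inter>{Q \<in> spec ?A. enat d < height ?A Q} \<noteq> {\<zero>\<^bsub>?A\<^esub>}}"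
  have "loc_deg U_sl2 ?O = Inf ?S" by (simp add: loc_deg_def Let_def)
  \<comment> \<open>Being at most 1, the infimum is not the value \<infinity> of the empty set, so
    it is attained by some d.\<close>
  moreover have "?S \<noteq> {}"
  proof
    assume "?S = {}"
    then have "Inf ?S = \<infinity>" by (simp add: Inf_enat_def)
    then show False using le \<open>loc_deg U_sl2 ?O = Inf ?S\<close> by simp
  qed
  then have "Inf ?S \<in> ?S" by (metis (no_types, lifting) Inf_enat_def LeastI ex_in_conv)
  then obtain d where d': "Inf ?S = enat d" "carrier ?A \<inter> \<Inter>{Q \<in> spec ?A. enat d < height ?A Q} \<noteq> {\<zero>\<^bsub>?A\<^esub>}"
    unfolding mem_Collect_eq by (elim exE conjE)
  ultimately have "enat d \<le> enat 1" using le by metis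
  then have d: "d \<le> 1" "carrier ?A \<inter> \<Inter>{Q \<in> spec ?A. enat d < height ?A Q} \<noteq> {\<zero>\<^bsub>?A\<^esub>}"
    using d'(2) by simp_all
  \<comment> \<open>The chain 0, \<open>cas_ideal (cn n)\<close>, \<open>fin_ideal n\<close> has
    length 2, which exceeds d.\<close>
  have fin: "im (fin_ideal n) \<in> {Q \<in> spec ?A. enat d < height ?A Q}" for n
  proof -
    define C where "C i = (if i = 0 then im {0} else if i = 1 then im (cas_ideal (cn n)) else im (fin_ideal n))" for i :: nat
    have "\<forall>i\<le>2. C i \<in> spec ?A" unfolding C_def using im_spec tprime_zero tprime_cas_ideal tprime_fin_ideal by simp
    moreover have "C i \<subset> C (Suc i)" if "i < 2" for i
    proof -
      have "i = 0 \<or> i = 1" using that by linarith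
      then show ?thesis
      proof
        assume "i = 1"
        then show ?thesis unfolding C_def using im_psubset[OF tprime_cas_ideal tprime_fin_ideal cas_subset_fin] by simp
      next
        assume "i = 0"
        then show ?thesis unfolding C_def using im_psubset[OF tprime_zero tprime_cas_ideal zero_psubset_cas] by simp
      qed
    qed
    moreover have "C 2 = im (fin_ideal n)" by (simp add: C_def)
    ultimately have "enat d < height ?A (im (fin_ideal n))"
      unfolding enat_less_height_iff using d(1) by (intro exI[of _ 2] conjI exI[of _ C]) simp_all
    then show ?thesis using im_spec[OF tprime_fin_ideal] by simp
  qed
  have "\<zero>\<^bsub>?A\<^esub> \<in> carrier ?A \<inter> \<Inter>{Q \<in> spec ?A. enat d < height ?A Q}" using specD(5) S.zero_closed by blast
  then obtain x where x: "x \<in> carrier ?A" "x \<in> \<Inter>{Q \<in> spec ?A. enat d < height ?A Q}" "x \<noteq> \<zero>\<^bsub>?A\<^esub>" using d(2) by blast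
  obtain u where u: "x = qm {0} u" using x(1) unfolding qm(2)[OF z] by blast
  have "u \<in> fin_ideal n" for n
  proof -
    have "?O +>\<^bsub>U_sl2\<^esub> Rep_ut u \<in> im (fin_ideal n)" using x(2) fin[of n] unfolding u qm_def by blast
    then have "Rep_ut u \<in> pre (im (fin_ideal n))" unfolding pre_def using Rep_ut by blast
    then show ?thesis unfolding pre_im[OF tideal_fin_ideal] Rep_ut_mem_iff .
  qed
  then have "u = 0" by (rule fin_ideal_inter)
  then show False using x(3) unfolding u qm(3)[OF z, symmetric] by simp
qed

theorem mainTheorem2:
  shows "(\<forall>(K :: 'k ring) (R :: 'a ring) (\<eta> :: 'k \<Rightarrow> 'a).
            field K \<and> infinite (carrier K) \<and> k_algebra K R \<eta> \<and> noetherian R \<and>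
            strong_dixmier_moeglin K R \<eta> \<longrightarrow> dixmier_moeglin K R \<eta>) \<and>
         k_algebra complex_field U_sl2 U_sl2_scalar \<and> noetherian U_sl2 \<and>
         dixmier_moeglin complex_field U_sl2 U_sl2_scalar \<and>
         \<not> strong_dixmier_moeglin complex_field U_sl2 U_sl2_scalar"
proof (intro conjI allI impI)
  show "dixmier_moeglin K R \<eta>"
    if "field K \<and> infinite (carrier K) \<and> k_algebra K R \<eta> \<and> noetherian R \<and> strong_dixmier_moeglin K R \<eta>"
    for K :: "'k ring" and R :: "'a ring" and \<eta>
    using that by (intro strong_imp_dixmier_moeglin) simp_all
qed (fact k_algebra_U_sl2 noetherian_U_sl2 dixmier_moeglin_U_sl2 not_strong_dixmier_moeglin_U_sl2)+

end
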